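(* Let $1<p<\infty$ and let $\{T_\varepsilon\}_{\varepsilon\in[0,\delta)}$ be a family of maps of $[0,1]$ satisfying assumptions (A1)–(A9) listed in the context. Then there exists $\delta_2>0$ such that for all $\varepsilon\in[0,\delta_2)$, $T_\varepsilon$ admits a unique invariant probability density $h_\varepsilon\in W^{2,p}$. Moreover, the map $\varepsilon\mapsto h_\varepsilon$ is differentiable in $L^p$ at $\varepsilon=0$. Furthermore, $$h_\varepsilon=h_0+\varepsilon\,(I-P_{T_0})^{-1}(q)+o(\varepsilon),$$ where $$q(x)=\begin{cases}P_{T_0}\left[A_0h_0'+B_0h_0\right](x) & \text{for } x\in[0,a_0),\\ 0 & \text{for } x\in[a_0,1],\end{cases}$$ with $$A_\varepsilon=-\left(\frac{\partial_\varepsilon T_\varepsilon}{T_\varepsilon'}\right),\qquad B_\varepsilon=\left(\frac{\partial_\varepsilon T_\varepsilon\cdot T_\varepsilon''}{(T_\varepsilon')^2}-\frac{\partial_\varepsilon T_\varepsilon'}{T_\varepsilon'}\right),$$ and the error term $o(\varepsilon)$ is understood in the $L^p$-topology.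
   Context: Fix $\delta>0$, $1<p<\infty$, $c\in(0,1)$ and $\beta\in\left(-1,\frac{1-2p}{2p}\right)$. All function spaces $L^r$, $W^{i,p}$ ($i=1,2$) are over the unit interval with Lebesgue measure $\mu$; $W^{i,p}$ are the usual Sobolev spaces, and $W_0^{1,p}=\{u\in W^{1,p}:\int_0^1u\,dx=0\}$ (mean-zero functions, not functions vanishing at the boundary). Primes denote derivatives in $x$; $\partial_\varepsilon$ denotes the derivative in $\varepsilon$ (one-sided at $\varepsilon=0$), and the derivatives $\partial_\varepsilon T_\varepsilon$, $\partial_\varepsilon T_\varepsilon'$ are assumed to exist. For each $\varepsilon\in[0,\delta)$, $T_\varepsilon:[0,1]\to[0,1]$ is a map non-singular with respect to $\mu$. Its transfer operator $P_{T_\varepsilon}$ is defined by $$\int_0^1P_{T_\varepsilon}f\cdot g\,d\mu=\int_0^1f\cdot(g\circ T_\varepsilon)\,d\mu\quad\text{for all } f\in L^1,\ g\in L^\infty,$$ and is considered acting on $L^p$ and on Sobolev spaces. An invariant density is a density $h$ with $P_{T_\varepsilon}h=h$. $(I-P_{T_0})^{-1}$ denotes the inverse of $I-P_{T_0}$ on $W_0^{1,p}$. Assumptions: (A1) $T_{0,\varepsilon}:=T_\varepsilon|_{[0,c)}$ and $T_{1,\varepsilon}:=T_\varepsilon|_{(c,1]}$ are one-to-one. (A2) $T_\varepsilon(0)=0$, $T_\varepsilon(1)=0$, $\lim_{x\to c^\pm}T_\varepsilon(x)=a_\varepsilon\in[0,1]$. (A3) $T_\varepsilon|_{[0,1]\setminus\{c\}}\in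 C^3$. (A4) There is $\theta>1$ such that $|T_\varepsilon'(x)|\ge\theta$ for all $\varepsilon\in[0,\delta)$ and all $x\in[0,1]\setminus\{c\}$. (A5) $T_0$ is topologically mixing on $[0,a_0]$. (A6) $\lim_{x\to c^-}T_\varepsilon'(x)=+\infty$, $\lim_{x\to c^+}T_\varepsilon'(x)=-\infty$, and $\lim_{x\to c^\pm}\frac{|T_\varepsilon'(x)|}{|x-c|^\beta}=C_{\varepsilon,1}$ for all $\varepsilon\in[0,\delta)$. (A7) $\lim_{x\to c^\pm}\frac{|T_\varepsilon''(x)|}{|x-c|^{\beta-1}}=C_{\varepsilon,2}$ and $\lim_{x\to c^\pm}\frac{|T_\varepsilon'''(x)|}{|x-c|^{\beta-2}}=C_{\varepsilon,3}$ for all $\varepsilon\in[0,\delta)$. (In (A6) and (A7) the $C_{\varepsilon,j}$ are finite constants.) (A8) $\displaystyle\sup_{\varepsilon\in[0,\delta),\,i\in\{0,1,2\},\,x\in[0,1]\setminus\{c\}}\frac{|T_\varepsilon^{(i+1)}(x)|}{|x-c|^{\beta-i}}<\infty$ and $\displaystyle\inf_{\varepsilon\in[0,\delta),\,x\in[0,1]\setminus\{c\}}\frac{|T_\varepsilon'(x)|}{|x-c|^\beta}>0$. (A9) $\displaystyle\sup_{\|f\|_{W^{1,p}}\le1}\|(P_{T_0}-P_{T_\varepsilon})f\|_{L^{2p}}\to0$ as $\varepsilon\to0$; moreover, for every $f\in W^{2,p}$ there exists $\partial_\varepsilon P_{T_\varepsilon}f|_{\varepsilon=0}\in W^{1,p}$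 such that $$\left\|P_{T_\varepsilon}f-P_{T_0}f-\varepsilon\left(\partial_\varepsilon P_{T_\varepsilon}f|_{\varepsilon=0}\right)\right\|_{W^{1,p}}=o(\varepsilon).$$ *)

theory Defs
  imports "HOL-Analysis.Analysis"
begin

text \<open>Elements of $L^r$ and of the Sobolev spaces are represented by functions on the reals,
  of which only the values on the unit interval, up to null sets, matter.\<close>

abbreviation mu :: "real measure" where
  "mu \<equiv> lebesgue_on {0..1}"

definition Lp_space :: "real \<Rightarrow> (real \<Rightarrow> real) set" where
  "Lp_space r = {f \<in> borel_measurable mu. integrable mu (\<lambda>x. \<bar>f x\<bar> powr r)}"

definition Linf_space :: "(real \<Rightarrow> real) set" where
  "Linf_space = {f \<in> borel_measurable mu. \<exists>C. AE x in mu. \<bar>f x\<bar> \<le> C}"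

text \<open>Norms take the value infinity outside the space, so that a bound on a norm, or the
  convergence of norms to zero, includes membership in the space.\<close>

definition Lp_norm :: "real \<Rightarrow> (real \<Rightarrow> real) \<Rightarrow> ennreal" where
  "Lp_norm r f =
     (if f \<in> Lp_space r then ennreal ((LINT x|mu. \<bar>f x\<bar> powr r) powr (1 / r)) else \<infinity>)"

definition test_function :: "(real \<Rightarrow> real) \<Rightarrow> bool" where
  "test_function \<phi> \<longleftrightarrow>
     (\<forall>k x. (deriv ^^ k) \<phi> field_differentiable (at x)) \<and>
     (\<exists>a b. 0 < a \<and> a < b \<and> b < 1 \<and> (\<forall>x. x \<notin> {a..b} \<longrightarrow> \<phi> x = 0))"

text \<open>On a bounded interval $L^p \subseteq L^1$, so nothing is lost in \<open>sobolev_space\<close> by asking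
  for integrability instead of local integrability.\<close>

definition has_weak_deriv :: "(real \<Rightarrow> real) \<Rightarrow> (real \<Rightarrow> real) \<Rightarrow> bool" where
  "has_weak_deriv f g \<longleftrightarrow>
     integrable mu f \<and> integrable mu g \<and>
     (\<forall>\<phi>. test_function \<phi> \<longrightarrow>
        (LINT x|mu. f x * deriv \<phi> x) = - (LINT x|mu. g x * \<phi> x))"

definition weak_deriv :: "(real \<Rightarrow> real) \<Rightarrow> real \<Rightarrow> real" where
  "weak_deriv f = (SOME g. has_weak_deriv f g)"

primrec sobolev_space :: "nat \<Rightarrow> real \<Rightarrow> (real \<Rightarrow> real) set" where
  "sobolev_space 0 p = Lp_space p"
| "sobolev_space (Suc k) p =
     {f \<in> Lp_space p. \<exists>g \<in> sobolev_space k p. has_weak_deriv f g}"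

definition W1p_norm :: "real \<Rightarrow> (real \<Rightarrow> real) \<Rightarrow> ennreal" where
  "W1p_norm p f =
     (if f \<in> sobolev_space 1 p then Lp_norm p f + Lp_norm p (weak_deriv f) else \<infinity>)"

definition W1p_mean_zero :: "real \<Rightarrow> (real \<Rightarrow> real) set" where
  "W1p_mean_zero p = {u \<in> sobolev_space 1 p. (LINT x|mu. u x) = 0}"

definition nonsingular :: "(real \<Rightarrow> real) \<Rightarrow> bool" where
  "nonsingular T \<longleftrightarrow> T \<in> mu \<rightarrow>\<^sub>M mu \<and> absolutely_continuous mu (distr mu mu T)"

text \<open>For integrable \<open>f\<close> the integrability premise holds for every \<open>\<phi>\<close>, and this is the usual
  duality (see \<open>is_transfer_integrable_iff\<close>). The premise extends the operator to
  measurable functions that may fail to be integrable near the singular point \<open>c\<close>, because the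
  hypotheses on $\partial_\varepsilon T_\varepsilon$ do not by themselves make
  $A_0 h_0' + B_0 h_0$ integrable.\<close>

definition is_transfer :: "(real \<Rightarrow> real) \<Rightarrow> (real \<Rightarrow> real) \<Rightarrow> (real \<Rightarrow> real) \<Rightarrow> bool" where
  "is_transfer T f g \<longleftrightarrow>
     g \<in> borel_measurable mu \<and>
     (\<forall>\<phi> \<in> Linf_space. integrable mu (\<lambda>x. f x * \<phi> (T x)) \<longrightarrow>
        integrable mu (\<lambda>x. g x * \<phi> x) \<and>
        (LINT x|mu. g x * \<phi> x) = (LINT x|mu. f x * \<phi> (T x)))"

lemma integrable_mult_Linf:
  assumes "integrable mu f" "\<phi> \<in> Linf_space"
  shows "integrable mu (\<lambda>x. f x * \<phi> x)"
proof -
  from assms obtain C where C: "AE x in mu. \<bar>\<phi> x\<bar> \<le> C" and m: "\<phi> \<in> borel_measurable mu"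
    by (auto simp: Linf_space_def)
  show ?thesis
  proof (rule Bochner_Integration.integrable_bound)
    show "integrable mu (\<lambda>x. C * f x)" using assms by simp
    show "(\<lambda>x. f x * \<phi> x) \<in> borel_measurable mu"
      using assms m by (intro borel_measurable_times) auto
    show "AE x in mu. norm (f x * \<phi> x) \<le> norm (C * f x)"
      using C
    proof eventually_elim
      case (elim x)
      have "\<bar>f x\<bar> * \<bar>\<phi> x\<bar> \<le> \<bar>f x\<bar> * \<bar>C\<bar>"
        using elim by (intro mult_left_mono) auto
      then show ?case by (simp add: abs_mult mult.commute)
    qed
  qed
qed

lemma Linf_compose:
  assumes "nonsingular T" "\<phi> \<in> Linf_space"
  shows "(\<lambda>x. \<phi> (T x)) \<in> Linf_space"
proof -
  from assms obtain C where C: "AE x in mu. \<bar>\<phi> x\<bar> \<le> C" and m: "\<phi> \<in> borel_measurable mu"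
    by (auto simp: Linf_space_def)
  have T: "T \<in> mu \<rightarrow>\<^sub>M mu" "absolutely_continuous mu (distr mu mu T)"
    using assms by (auto simp: nonsingular_def)
  have "AE x in distr mu mu T. \<bar>\<phi> x\<bar> \<le> C"
    using absolutely_continuous_AE[OF _ T(2) C] by simp
  then have "AE x in mu. \<bar>\<phi> (T x)\<bar> \<le> C"
    using T(1) by (rule AE_distrD[rotated])
  then show ?thesis
    using measurable_compose[OF T(1) m] by (auto simp: Linf_space_def)
qed

lemma is_transfer_integrable_iff:
  assumes "nonsingular T" "integrable mu f"
  shows "is_transfer T f g \<longleftrightarrow>
     integrable mu g \<and>
     (\<forall>\<phi> \<in> Linf_space. (LINT x|mu. g x * \<phi> x) = (LINT x|mu. f x * \<phi> (T x)))"
proof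
  assume L: "is_transfer T f g"
  have "(\<lambda>x. 1) \<in> Linf_space" by (auto simp: Linf_space_def)
  with L assms have "integrable mu g" by (fastforce simp: is_transfer_def)
  with L show "integrable mu g \<and>
     (\<forall>\<phi> \<in> Linf_space. (LINT x|mu. g x * \<phi> x) = (LINT x|mu. f x * \<phi> (T x)))"
    using integrable_mult_Linf[OF assms(2) Linf_compose[OF assms(1)]]
    by (auto simp: is_transfer_def)
next
  assume "integrable mu g \<and>
     (\<forall>\<phi> \<in> Linf_space. (LINT x|mu. g x * \<phi> x) = (LINT x|mu. f x * \<phi> (T x)))"
  then show "is_transfer T f g"
    using integrable_mult_Linf by (auto simp: is_transfer_def)
qed

definition transfer_op :: "(real \<Rightarrow> real) \<Rightarrow> (real \<Rightarrow> real) \<Rightarrow> real \<Rightarrow> real" where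
  "transfer_op T f = (SOME g. is_transfer T f g)"

definition invariant_density :: "(real \<Rightarrow> real) \<Rightarrow> (real \<Rightarrow> real) \<Rightarrow> bool" where
  "invariant_density T h \<longleftrightarrow>
     integrable mu h \<and> (AE x in mu. 0 \<le> h x) \<and> (LINT x|mu. h x) = 1 \<and>
     (AE x in mu. transfer_op T h x = h x)"

text \<open>Bijectivity is meant modulo equality almost everywhere.\<close>

definition I_minus_P_bij :: "real \<Rightarrow> (real \<Rightarrow> real) \<Rightarrow> bool" where
  "I_minus_P_bij p T \<longleftrightarrow>
     (\<forall>v \<in> W1p_mean_zero p. (\<lambda>x. v x - transfer_op T v x) \<in> W1p_mean_zero p) \<and>
     (\<forall>w \<in> W1p_mean_zero p. \<exists>v \<in> W1p_mean_zero p.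
        (AE x in mu. v x - transfer_op T v x = w x) \<and>
        (\<forall>v' \<in> W1p_mean_zero p.
           (AE x in mu. v' x - transfer_op T v' x = w x) \<longrightarrow> (AE x in mu. v' x = v x)))"

definition I_minus_P_inv :: "real \<Rightarrow> (real \<Rightarrow> real) \<Rightarrow> (real \<Rightarrow> real) \<Rightarrow> real \<Rightarrow> real" where
  "I_minus_P_inv p T w =
     (SOME v. v \<in> W1p_mean_zero p \<and> (AE x in mu. v x - transfer_op T v x = w x))"

text \<open>The derivatives at \<open>0\<close> and \<open>1\<close> are one-sided.\<close>

definition deriv_on :: "real set \<Rightarrow> (real \<Rightarrow> real) \<Rightarrow> real \<Rightarrow> real" where
  "deriv_on S f x = vector_derivative f (at x within S)"

definition Ck_on :: "nat \<Rightarrow> real set \<Rightarrow> (real \<Rightarrow> real) \<Rightarrow> bool" where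
  "Ck_on k S f \<longleftrightarrow>
     (\<forall>i<k. (deriv_on S ^^ i) f differentiable_on S) \<and> continuous_on S ((deriv_on S ^^ k) f)"

abbreviation Dx :: "real \<Rightarrow> nat \<Rightarrow> (real \<Rightarrow> real) \<Rightarrow> real \<Rightarrow> real" where
  "Dx c k f \<equiv> (deriv_on ({0..1} - {c}) ^^ k) f"

definition D_eps :: "real \<Rightarrow> (real \<Rightarrow> real \<Rightarrow> real) \<Rightarrow> real \<Rightarrow> real \<Rightarrow> real" where
  "D_eps \<delta> F \<epsilon> x = vector_derivative (\<lambda>e. F e x) (at \<epsilon> within {0..<\<delta>})"

definition topologically_mixing_on :: "real set \<Rightarrow> (real \<Rightarrow> real) \<Rightarrow> bool" where
  "topologically_mixing_on X f \<longleftrightarrow>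
     (\<forall>U V. openin (top_of_set X) U \<and> openin (top_of_set X) V \<and> U \<noteq> {} \<and> V \<noteq> {} \<longrightarrow>
        (\<exists>N. \<forall>n\<ge>N. (f ^^ n) ` U \<inter> V \<noteq> {}))"

definition A_coeff :: "real \<Rightarrow> real \<Rightarrow> (real \<Rightarrow> real \<Rightarrow> real) \<Rightarrow> real \<Rightarrow> real \<Rightarrow> real" where
  "A_coeff \<delta> c T \<epsilon> x = - (D_eps \<delta> T \<epsilon> x / Dx c 1 (T \<epsilon>) x)"

definition B_coeff :: "real \<Rightarrow> real \<Rightarrow> (real \<Rightarrow> real \<Rightarrow> real) \<Rightarrow> real \<Rightarrow> real \<Rightarrow> real" where
  "B_coeff \<delta> c T \<epsilon> x =
     D_eps \<delta> T \<epsilon> x * Dx c 2 (T \<epsilon>) x / (Dx c 1 (T \<epsilon>) x)\<^sup>2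
     - D_eps \<delta> (\<lambda>e. Dx c 1 (T e)) \<epsilon> x / Dx c 1 (T \<epsilon>) x"

definition q_fun ::
  "real \<Rightarrow> real \<Rightarrow> (real \<Rightarrow> real \<Rightarrow> real) \<Rightarrow> real \<Rightarrow> (real \<Rightarrow> real) \<Rightarrow> real \<Rightarrow> real" where
  "q_fun \<delta> c T a0 h0 x =
     (if x \<in> {0..<a0}
      then transfer_op (T 0)
             (\<lambda>y. A_coeff \<delta> c T 0 y * weak_deriv h0 y + B_coeff \<delta> c T 0 y * h0 y) x
      else 0)"

end

theory Submission
  imports Defs "HOL-Complex_Analysis.Great_Picard"
begin

text \<open>Off null sets the transfer operator is the sum over preimages \<open>P f y = (\<Sum>T x = y. f x / \<bar>T' x\<bar>)\<close>,
  and \<open>(P f)' = P (f'/T' + (1/T')' f)\<close>. The singularity of order \<open>\<beta>\<close> makes \<open>1/T'\<close> vanish at the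
  cusp fast enough for the coefficients of this formula, and of the one for \<open>(P f)''\<close>, to lie in $L^p$.
  This gives Lasota--Yorke inequalities with constants that do not depend on \<open>\<epsilon>\<close>.

  Mixing forces \<open>a 0 = 1\<close>: otherwise \<open>[min (T\<^sub>0 (a 0)) c, a 0]\<close> would be invariant
  up to finitely many points. A full cusp map is exact, so \<open>P\<^sub>0\<^sup>n f \<rightarrow> 0\<close> in $L^1$, uniformly for \<open>f\<close> in the unit ball
  of $W_0^{1,p}$ by compactness. One large power of \<open>P\<^sub>0\<close> is thus a contraction in the weak norm; by
  (A9) the same holds for \<open>P\<^sub>\<epsilon>\<close> with small \<open>\<epsilon>\<close>, and together with the Lasota--Yorke inequality the
  Neumann series \<open>(\<Sum>n. P\<^sub>\<epsilon>\<^sup>n)\<close> converges on $W_0^{1,p}$ uniformly in \<open>\<epsilon>\<close>. It produces the invariant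
  density \<open>h\<^sub>\<epsilon> = 1 + (I - P\<^sub>\<epsilon>)\<^sup>-\<^sup>1 (P\<^sub>\<epsilon> 1 - 1)\<close>, and \<open>h\<^sub>\<epsilon> - h\<^sub>0 = (I - P\<^sub>\<epsilon>)\<^sup>-\<^sup>1 (P\<^sub>\<epsilon> - P\<^sub>0) h\<^sub>0\<close> gives the
  expansion with \<open>q\<close> the derivative of \<open>P\<^sub>\<epsilon> h\<^sub>0\<close> supplied by (A9). That \<open>q\<close> is the stated function
  follows by differentiating \<open>P\<^sub>\<epsilon> h\<^sub>0 (y)\<close> at each single \<open>y\<close> along the two preimages of \<open>y\<close>.\<close>

subsection \<open>Smooth functions\<close>

text \<open>The operator is used as a sum defined at every point, so linearity, positivity and
  iteration are exact identities; only the link with the chosen \<open>transfer_op\<close> is almost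
  everywhere. On mean zero functions the derivative controls the sup norm, hence all decay is
  measured on derivatives. Two obstacles shape the estimates. Expansion does not make the operator a
  contraction of L^p, so a norm built from all iterates is used. And (1/T')' has a derivative
  controlled only by a non-integrable power at the cusp; its product with 1/T' is better behaved and
  carries the second derivative. The error is o(\<epsilon>) in L^p because q is merely in W^{1,p}:
  there (A9) compares the operators only in L^{2p}, so the resolvents at q converge in L^p. The
  second derivative of the density at 0 is what allows (A9) to be applied to it. The response
  integrand may fail to be integrable, so q is identified point by point, along a sequence of
  \<epsilon> on which convergence holds almost everywhere.\<close>

primrec diff_times :: "nat \<Rightarrow> (real \<Rightarrow> real) \<Rightarrow> bool" where
  "diff_times 0 f = True"
| "diff_times (Suc n) f = ((\<forall>x. f field_differentiable at x) \<and> diff_times n (deriv f))"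

text \<open>The recursion strips derivatives from the inside, so closure properties go by induction
  on \<open>n\<close> with the functions generalised; this passes back to the form used in
  \<open>test_function\<close>.\<close>

lemma diff_times_iff: "(\<forall>n. diff_times n f) \<longleftrightarrow> (\<forall>k x. (deriv ^^ k) f field_differentiable at x)"
proof -
  have *: "diff_times n f \<longleftrightarrow> (\<forall>k<n. \<forall>x. (deriv ^^ k) f field_differentiable at x)" for n f
  proof (induction n arbitrary: f)
    case (Suc n)
    have "(\<forall>k<Suc n. \<forall>x. (deriv ^^ k) f field_differentiable at x) \<longleftrightarrow>
       (\<forall>x. f field_differentiable at x) \<and> (\<forall>k<n. \<forall>x. (deriv ^^ k) (deriv f) field_differentiable at x)"
      by (subst All_less_Suc2) (simp add: funpow_swap1 del: funpow.simps(2) add: funpow_Suc_right)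
    then show ?case using Suc by simp
  qed simp
  show ?thesis unfolding * by blast
qed

lemma diff_times_Suc_D: "diff_times (Suc n) f \<Longrightarrow> diff_times n f"
  by (induction n arbitrary: f) auto

lemma diff_times_add: "diff_times n f \<Longrightarrow> diff_times n g \<Longrightarrow> diff_times n (\<lambda>x. f x + g x)"
proof (induction n arbitrary: f g)
  case (Suc n)
  have "deriv (\<lambda>x. f x + g x) = (\<lambda>x. deriv f x + deriv g x)"
    using Suc.prems by (intro ext deriv_add) auto
  then show ?case using Suc by (auto intro!: field_differentiable_add)
qed simp

lemma diff_times_mult: "diff_times n f \<Longrightarrow> diff_times n g \<Longrightarrow> diff_times n (\<lambda>x. f x * g x)"
proof (induction n arbitrary: f g)
  case (Suc n)
  have "deriv (\<lambda>x. f x * g x) = (\<lambda>x. f x * deriv g x + deriv f x * g x)"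
    using Suc.prems by (intro ext deriv_mult) auto
  moreover have "diff_times n f" "diff_times n g" using Suc.prems diff_times_Suc_D by blast+
  ultimately show ?case using Suc
    by (auto intro!: field_differentiable_mult diff_times_add)
qed simp

lemma diff_times_const: "diff_times n (\<lambda>x. c)"
proof (induction n arbitrary: c)
  case (Suc n)
  have "deriv (\<lambda>x. c) = (\<lambda>x::real. 0::real)" by (auto intro!: ext)
  then show ?case using Suc by auto
qed simp

lemma diff_times_power: "diff_times n f \<Longrightarrow> diff_times n (\<lambda>x. f x ^ k)"
  by (induction k) (auto intro: diff_times_const diff_times_mult)

lemma diff_times_affine: "diff_times n f \<Longrightarrow> diff_times n (\<lambda>x. f (k * x + d))"
proof (induction n arbitrary: f)
  case (Suc n)
  have D: "((\<lambda>x. f (k * x + d)) has_field_derivative k * deriv f (k * x + d)) (at x)" for x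
  proof -
    have "(f has_field_derivative deriv f (k * x + d)) (at (k * x + d))"
      using Suc.prems by (simp add: DERIV_deriv_iff_field_differentiable)
    moreover have "((\<lambda>x. k * x + d) has_field_derivative k) (at x)"
      by (auto intro!: derivative_eq_intros)
    ultimately have "((\<lambda>x. f (k * x + d)) has_field_derivative deriv f (k * x + d) * k) (at x)"
      by (rule DERIV_chain2)
    then show ?thesis by (simp add: mult.commute)
  qed
  then have "deriv (\<lambda>x. f (k * x + d)) = (\<lambda>x. k * deriv f (k * x + d))"
    by (intro ext DERIV_imp_deriv)
  moreover have "diff_times n (\<lambda>x. k * deriv f (k * x + d))"
    using Suc by (intro diff_times_mult diff_times_const) auto
  ultimately show ?case using D by (auto simp: field_differentiable_def)
qed simp

lemma diff_times_antideriv: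
  assumes "\<And>x. (F has_field_derivative f x) (at x)" "\<And>n. diff_times n f"
  shows "diff_times n F"
proof -
  have "deriv F = f" using assms(1) by (intro ext DERIV_imp_deriv)
  then show ?thesis using assms by (cases n) (auto simp: field_differentiable_def)
qed

lemma diff_times_real_polynomial: "real_polynomial_function q \<Longrightarrow> diff_times n q"
proof (induction n arbitrary: q)
  case (Suc n)
  then obtain q' where q': "real_polynomial_function q'" "\<And>x. (q has_real_derivative q' x) (at x)"
    using has_real_derivative_polynomial_function by blast
  then have "deriv q = q'" by (intro ext DERIV_imp_deriv)
  with Suc q' show ?case by (auto simp: field_differentiable_def)
qed simp

section \<open>Smooth cutoff functions\<close>

definition flat :: "real poly \<Rightarrow> real \<Rightarrow> real" where
  "flat q x = (if x > 0 then poly q (1 / x) * exp (- (1 / x)) else 0)"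

text \<open>The power \<open>t ^ k\<close> strengthens the claim for the induction on
  \<open>q\<close>: passing to the next coefficient multiplies by one more \<open>t\<close>.\<close>

lemma poly_exp_tendsto_0: "((\<lambda>t. t ^ k * poly q t * exp (- t)) \<longlongrightarrow> (0::real)) at_top"
proof (induction q arbitrary: k)
  case (pCons a q)
  have "((\<lambda>t. a * (t ^ k / exp t) + t ^ Suc k * poly q t * exp (- t)) \<longlongrightarrow> a * 0 + 0) at_top"
    by (intro tendsto_intros tendsto_power_div_exp_0 pCons.IH)
  then show ?case by (simp add: field_simps exp_minus)
qed simp

lemma flat_tendsto_0: "(flat q \<longlongrightarrow> 0) (at 0)"
proof -
  have "((\<lambda>x. poly q (1/x) * exp (-(1/x))) \<longlongrightarrow> 0) (at_right 0)"
    using filterlim_compose[OF poly_exp_tendsto_0[of 0 q] filterlim_inverse_at_top_right]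
    by (simp add: inverse_eq_divide)
  moreover have "eventually (\<lambda>x. poly q (1/x) * exp (-(1/x)) = flat q x) (at_right 0)"
    by (auto simp: eventually_at_filter flat_def)
  ultimately have "(flat q \<longlongrightarrow> 0) (at_right 0)"
    by (rule Lim_transform_eventually)
  moreover have "(flat q \<longlongrightarrow> 0) (at_left 0)"
    by (rule tendsto_eventually) (auto simp: eventually_at_filter flat_def)
  ultimately show ?thesis by (simp add: filterlim_at_split)
qed

text \<open>The functions q(1/x) exp(-1/x), extended by 0 to the left, are closed under
  differentiation: the chain rule turns \<open>q\<close> into t^2 (q - q'). Smoothness is then an
  induction.\<close>

lemma flat_DERIV: "(flat q has_real_derivative flat ([:0,0,1:] * (q - pderiv q)) x) (at x)"
proof -
  consider "x > 0" | "x = 0" | "x < 0" by linarith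
  then show ?thesis
  proof cases
    case 1
    have "((\<lambda>x. poly q (1/x) * exp (-(1/x))) has_real_derivative flat ([:0,0,1:] * (q - pderiv q)) x) (at x)"
      using 1 by (auto intro!: derivative_eq_intros simp: flat_def field_simps power2_eq_square)
    moreover have "eventually (\<lambda>x. poly q (1/x) * exp (-(1/x)) = flat q x) (nhds x)"
      using eventually_nhds_in_open[of "{0<..}" x] 1
      by (auto simp: flat_def elim!: eventually_mono)
    ultimately show ?thesis by (subst (asm) DERIV_cong_ev[OF refl _ refl])
  next
    case 2
    have "(flat (pCons 0 q) \<longlongrightarrow> 0) (at 0)" by (rule flat_tendsto_0)
    \<comment> \<open>Division by \<open>h\<close> multiplies the polynomial in 1/h by its variable,
      so the difference quotient at 0 is again some \<open>flat\<close>.\<close>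
    moreover have "flat (pCons 0 q) = (\<lambda>h. (flat q (0 + h) - flat q 0) / h)"
      by (auto simp: flat_def field_simps intro!: ext)
    ultimately have "((\<lambda>h. (flat q (0 + h) - flat q 0) / h) \<longlongrightarrow> 0) (at 0)" by (simp only:)
    then show ?thesis using 2 by (simp add: DERIV_def flat_def)
  next
    case 3
    have "((\<lambda>x. 0) has_real_derivative flat ([:0,0,1:] * (q - pderiv q)) x) (at x)"
      using 3 by (auto simp: flat_def)
    moreover have "eventually (\<lambda>x. 0 = flat q x) (nhds x)"
      using eventually_nhds_in_open[of "{..<0}" x] 3
      by (auto simp: flat_def elim!: eventually_mono)
    ultimately show ?thesis by (subst (asm) DERIV_cong_ev[OF refl _ refl])
  qed
qed

lemma diff_times_flat: "diff_times n (flat q)"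
proof (induction n arbitrary: q)
  case (Suc n)
  have "deriv (flat q) = flat ([:0,0,1:] * (q - pderiv q))"
    by (intro ext DERIV_imp_deriv flat_DERIV)
  then show ?case using Suc flat_DERIV by (auto simp: field_differentiable_def)
qed simp

text \<open>The product of the two \<open>flat\<close> factors is a bump b with values in [0,1],
  positive exactly between 1/(n+3) and 1 - 1/(n+3). Passing to 1 - (1 - b)^n keeps the zeros of b
  and pushes the values inside towards 1. The offset 3 keeps the interval nondegenerate.\<close>

definition cutoff :: "nat \<Rightarrow> real \<Rightarrow> real" where
  "cutoff n x = 1 - (1 - flat 1 (x - 1 / (real n + 3)) * flat 1 (1 - 1 / (real n + 3) - x)) ^ n"

lemma diff_times_cutoff: "diff_times k (cutoff n)"
proof -
  have 1: "diff_times k (\<lambda>x. flat 1 (1 * x + (- (1 / (real n + 3)))))"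
    "diff_times k (\<lambda>x. flat 1 ((-1) * x + (1 - 1 / (real n + 3))))"
    by (intro diff_times_affine diff_times_flat)+
  have 2: "diff_times k (\<lambda>x. 1 + (-1) * (1 + (-1) * (flat 1 (1 * x + (- (1 / (real n + 3)))) *
      flat 1 ((-1) * x + (1 - 1 / (real n + 3))))) ^ n)"
    by (intro diff_times_add diff_times_mult diff_times_const diff_times_power 1)
  show ?thesis
    using 2 unfolding cutoff_def[abs_def] by (simp add: algebra_simps)
qed

lemma flat1_bounds: "0 \<le> flat 1 x" "flat 1 x \<le> 1" "x > 0 \<Longrightarrow> flat 1 x > 0" "x \<le> 0 \<Longrightarrow> flat 1 x = 0"
  by (auto simp: flat_def)

lemma cutoff_bounds: "0 \<le> cutoff n x" "cutoff n x \<le> 1"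
  unfolding cutoff_def using flat1_bounds
  by (auto intro!: power_le_one zero_le_power simp: mult_le_one)

lemma cutoff_support: "x \<notin> {1 / (real n + 3)..1 - 1 / (real n + 3)} \<Longrightarrow> cutoff n x = 0"
  unfolding cutoff_def using flat1_bounds(4)[of "x - 1 / (real n + 3)"] flat1_bounds(4)[of "1 - 1 / (real n + 3) - x"]
  by auto

lemma test_function_iff: "test_function \<phi> \<longleftrightarrow> (\<forall>n. diff_times n \<phi>) \<and>
     (\<exists>a b. 0 < a \<and> a < b \<and> b < 1 \<and> (\<forall>x. x \<notin> {a..b} \<longrightarrow> \<phi> x = 0))"
  by (simp add: test_function_def diff_times_iff)

lemma test_function_cutoff_mult:
  assumes "\<And>n. diff_times n f"
  shows "test_function (\<lambda>x. cutoff n x * f x)"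
  unfolding test_function_iff
proof (intro conjI allI)
  show "\<exists>a b. 0 < a \<and> a < b \<and> b < 1 \<and> (\<forall>x. x \<notin> {a..b} \<longrightarrow> cutoff n x * f x = 0)"
    by (rule exI[of _ "1/(real n+3)"], rule exI[of _ "1-1/(real n+3)"])
       (use cutoff_support[of _ n] in \<open>auto simp: field_simps\<close>)
qed (intro diff_times_mult diff_times_cutoff assms)

lemma cutoff_tendsto:
  assumes "0 < x" "x < 1"
  shows "(\<lambda>n. cutoff n x) \<longlonglongrightarrow> 1"
proof -
  define d where "d = min x (1 - x)"
  have d: "d > 0" "d \<le> x" "d \<le> 1 - x" using assms by (auto simp: d_def)
  \<comment> \<open>For large n both factors have arguments at least d/2, so \<open>r\<close> bounds
    the bump at \<open>x\<close> from below independently of n.\<close>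
  define r where "r = flat 1 (d/2) * flat 1 (d/2)"
  have r: "0 < r" "r \<le> 1" using d flat1_bounds by (auto simp: r_def mult_le_one)
  have mono: "flat 1 u \<le> flat 1 v" if "0 < u" "u \<le> v" for u v
    using that by (auto simp: flat_def divide_simps)
  have ev: "eventually (\<lambda>n. 1/(real n + 3) < d/2) sequentially"
    using d by real_asymp
  have "(\<lambda>n. (1 - r) ^ n) \<longlonglongrightarrow> 0" using r by (intro LIMSEQ_realpow_zero) auto
  then have "(\<lambda>n. 1 - cutoff n x) \<longlonglongrightarrow> 0"
  proof (rule tendsto_sandwich[rotated 3])
    show "eventually (\<lambda>n. 1 - cutoff n x \<le> (1 - r) ^ n) sequentially"
      using ev
    proof eventually_elim
      case (elim n)
      have "r \<le> flat 1 (x - 1 / (real n + 3)) * flat 1 (1 - 1 / (real n + 3) - x)"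
        unfolding r_def using elim d flat1_bounds by (intro mult_mono mono) auto
      moreover have "flat 1 (x - 1 / (real n + 3)) * flat 1 (1 - 1 / (real n + 3) - x) \<le> 1"
        using flat1_bounds by (intro mult_le_one) auto
      ultimately show ?case unfolding cutoff_def by (auto intro!: power_mono)
    qed
    show "eventually (\<lambda>n. 0 \<le> 1 - cutoff n x) sequentially"
      using cutoff_bounds by auto
  qed auto
  from tendsto_diff[OF tendsto_const[of 1] this] show ?thesis by simp
qed

subsection \<open>Primitives\<close>

lemma borel_measurable_mu: "f \<in> borel_measurable borel \<Longrightarrow> f \<in> borel_measurable mu"
  by (intro measurable_restrict_space1 measurable_completion) auto

lemma mu_id_borel: "(\<lambda>x. x) \<in> measurable mu borel"
  by (rule borel_measurable_mu) simp

lemma finite_measure_mu: "finite_measure mu"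
  by (rule finite_measure_lebesgue_on) auto

lemma measure_mu [simp]: "measure mu {0..1} = 1"
  by (simp add: measure_restrict_space)

lemma integrable_mu_const [simp]: "integrable mu (\<lambda>x. c::real)"
  using finite_measure.integrable_const[OF finite_measure_mu] .

lemma AE_mu_neq: "AE x in mu. x \<noteq> a"
proof -
  have "AE x in lebesgue. x \<noteq> a" using AE_completion[OF AE_lborel_singleton[of a]] by simp
  then show ?thesis by (subst AE_restrict_space_iff) auto
qed

lemma AE_mu_in: "AE x in mu. x \<in> {0<..<1}"
proof -
  have "AE x in mu. x \<in> space mu" by (rule AE_space)
  then show ?thesis using AE_mu_neq[of 0] AE_mu_neq[of 1]
    by eventually_elim auto
qed

interpretation mu2: pair_sigma_finite mu mu
  using finite_measure_mu finite_measure.axioms(1)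
  by (simp add: pair_sigma_finite_def finite_measure_def)

lemma integrable_mult_ind:
  fixes g :: "real \<Rightarrow> real"
  assumes "integrable mu g"
  shows "integrable mu (\<lambda>t. g t * indicator {..x} t)" "integrable mu (\<lambda>t. g t * indicator {..<x} t)"
proof -
  have *: "integrable mu (\<lambda>t. g t * (k t :: real))" if "k \<in> borel_measurable borel" "\<And>t. \<bar>k t\<bar> \<le> 1" for k
  proof (rule Bochner_Integration.integrable_bound[OF assms])
    show "(\<lambda>t. g t * k t) \<in> borel_measurable mu"
      using assms borel_measurable_mu[OF that(1)] by auto
    show "AE x in mu. norm (g x * k x) \<le> norm (g x)"
      using that(2) by (auto simp: abs_mult mult_left_le)
  qed
  show "integrable mu (\<lambda>t. g t * indicator {..x} t)" "integrable mu (\<lambda>t. g t * indicator {..<x} t)"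
    by (intro *; auto simp: indicator_def)+
qed

text \<open>The indicator kernel over \<open>mu\<close> makes the primitive a total function on the
  reals and turns integration by parts into an exchange of integrals.\<close>

definition prim :: "(real \<Rightarrow> real) \<Rightarrow> real \<Rightarrow> real" where
  "prim g x = (LINT t|mu. g t * indicator {..x} t)"

lemma prim_less: "prim g x = (LINT t|mu. g t * indicator {..<x} t)"
  if "integrable mu g"
  unfolding prim_def
proof (rule integral_cong_AE)
  show "AE t in mu. g t * indicator {..x} t = g t * indicator {..<x} t"
    using AE_mu_neq[of x] by eventually_elim (auto simp: indicator_def)
qed (use integrable_mult_ind[OF that] in auto)

lemma prim_abs_le: "integrable mu g \<Longrightarrow> \<bar>prim g x\<bar> \<le> (LINT t|mu. \<bar>g t\<bar>)"
  unfolding prim_def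
  by (rule order_trans[OF integral_abs_bound])
     (intro integral_mono integrable_abs integrable_mult_ind(1), auto simp: indicator_def)

lemma prim_diff_le:
  assumes "integrable mu g" "x \<le> y"
  shows "\<bar>prim g y - prim g x\<bar> \<le> (LINT t|mu. \<bar>g t\<bar> * indicator {x<..y} t)"
proof -
  have "prim g y - prim g x = (LINT t|mu. g t * indicator {..y} t - g t * indicator {..x} t)"
    unfolding prim_def by (intro Bochner_Integration.integral_diff[symmetric] integrable_mult_ind assms)
  also have "\<dots> = (LINT t|mu. g t * indicator {x<..y} t)"
    by (intro Bochner_Integration.integral_cong) (use assms(2) in \<open>auto simp: indicator_def\<close>)
  finally show ?thesis
    using integral_abs_bound[of mu "\<lambda>t. g t * indicator {x<..y} t"] by (simp add: abs_mult)
qed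

lemma prim_cmult: "prim (\<lambda>t. k * g t) x = k * prim g x"
  unfolding prim_def by (simp add: mult.assoc)

lemma prim_add: "integrable mu f \<Longrightarrow> integrable mu g \<Longrightarrow> prim (\<lambda>t. f t + g t) x = prim f x + prim g x"
  unfolding prim_def by (simp add: distrib_right integrable_mult_ind)

lemma prim_cong_AE:
  assumes "AE t in mu. f t = g t" "f \<in> borel_measurable mu" "g \<in> borel_measurable mu"
  shows "prim f x = prim g x"
  unfolding prim_def
proof (rule integral_cong_AE)
  show "AE t in mu. f t * indicator {..x} t = g t * indicator {..x} t"
    using assms(1) by eventually_elim simp
qed (intro borel_measurable_times assms borel_measurable_mu; simp)+

lemma isCont_prim:
  assumes g: "integrable mu g"
  shows "isCont (prim g) x"
proof (rule continuous_at_sequentiallyI)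
  fix u :: "nat \<Rightarrow> real" assume u: "u \<longlonglongrightarrow> x"
  show "(\<lambda>n. prim g (u n)) \<longlonglongrightarrow> prim g x"
    unfolding prim_def
  proof (rule integral_dominated_convergence)
    show "integrable mu (\<lambda>t. \<bar>g t\<bar>)" using g by simp
    show "AE t in mu. (\<lambda>n. g t * indicator {..u n} t) \<longlonglongrightarrow> g t * indicator {..x} t"
      using AE_mu_neq[of x]
    proof eventually_elim
      case (elim t)
      have "eventually (\<lambda>n. indicator {..x} t = (indicator {..u n} t :: real)) sequentially"
      proof (cases "t < x")
        case True
        then show ?thesis using order_tendstoD(1)[OF u True]
          by (auto elim!: eventually_mono simp: indicator_def)
      next
        case False
        then have "x < t" using elim by simp
        then show ?thesis using order_tendstoD(2)[OF u]
          by (auto elim!: eventually_mono simp: indicator_def not_le)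
      qed
      then show ?case by (intro tendsto_mult tendsto_const tendsto_eventually) (auto elim: eventually_mono)
    qed
  qed (use integrable_mult_ind[OF g] in \<open>auto simp: indicator_def\<close>)
qed

lemma continuous_on_prim: "integrable mu g \<Longrightarrow> continuous_on S (prim g)"
  using isCont_prim continuous_at_imp_continuous_on by blast

lemma prim_borel: "integrable mu g \<Longrightarrow> prim g \<in> borel_measurable borel"
  using continuous_on_prim[of g UNIV] by (rule borel_measurable_continuous_onI)

lemma prim_mu: "integrable mu g \<Longrightarrow> prim g \<in> borel_measurable mu"
  by (intro borel_measurable_mu prim_borel)

lemma prim_1: "prim g 1 = (LINT t|mu. g t)"
  unfolding prim_def by (intro Bochner_Integration.integral_cong) auto

text \<open>The finite exceptional set is there for the cusp: the fundamental theorem tolerates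
  finitely many points without derivative as long as \<open>F\<close> is continuous at them.\<close>

lemma prim_eqI:
  assumes g: "integrable mu g" and cont: "continuous_on {0..1} F" and fin: "finite S"
    and der: "\<And>x. x \<in> {0<..<1} - S \<Longrightarrow> (F has_real_derivative g x) (at x)"
    and x: "x \<in> {0..1}"
  shows "F x = F 0 + prim g x"
proof -
  have 1: "(g has_integral F x - F 0) {0..x}"
    using x by (intro fundamental_theorem_of_calculus_interior_strong[OF fin])
      (auto intro!: der[unfolded has_real_derivative_iff_has_vector_derivative] continuous_on_subset[OF cont])
  have "prim g x = integral {0..1} (\<lambda>t. g t * indicator {..x} t)"
    unfolding prim_def by (rule lebesgue_integral_eq_integral) (use integrable_mult_ind[OF g] in auto)
  also have "\<dots> = integral {0..1} (\<lambda>t. if t \<in> {0..x} then g t else 0)"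
    by (rule Henstock_Kurzweil_Integration.integral_cong) auto
  also have "\<dots> = integral {0..x} g"
    using x by (subst Henstock_Kurzweil_Integration.integral_restrict_Int) (simp add: Int_absorb2)
  also have "\<dots> = F x - F 0" using 1 by (rule integral_unique)
  finally show ?thesis by simp
qed

text \<open>With indicator kernels this one exchange yields the product rule, the test function
  identity for primitives and the weak derivative of the transfer operator.\<close>

lemma Fubini_kernel:
  fixes f r :: "real \<Rightarrow> real" and k :: "real \<Rightarrow> real \<Rightarrow> real"
  assumes f: "integrable mu f" and r: "integrable mu r"
    and k: "case_prod k \<in> borel_measurable (borel \<Otimes>\<^sub>M borel)" and kB: "\<And>x t. \<bar>k x t\<bar> \<le> 1"
  shows "(LINT x|mu. f x * (LINT t|mu. r t * k x t)) = (LINT t|mu. r t * (LINT x|mu. f x * k x t))"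
    and "integrable mu (\<lambda>x. f x * (LINT t|mu. r t * k x t))"
proof -
  have km: "case_prod k \<in> borel_measurable (mu \<Otimes>\<^sub>M mu)"
  proof -
    have "(\<lambda>z. z) \<in> measurable (mu \<Otimes>\<^sub>M mu) (borel \<Otimes>\<^sub>M borel)"
      by (rule measurable_pair) (use measurable_compose[OF measurable_fst mu_id_borel]
        measurable_compose[OF measurable_snd mu_id_borel] in \<open>auto simp: comp_def\<close>)
    from measurable_compose[OF this k] show ?thesis by simp
  qed
  have fm: "(\<lambda>z. f (fst z)) \<in> borel_measurable (mu \<Otimes>\<^sub>M mu)"
    using f by (intro measurable_compose[OF measurable_fst]) auto
  have rm: "(\<lambda>z. r (snd z)) \<in> borel_measurable (mu \<Otimes>\<^sub>M mu)"
    using r by (intro measurable_compose[OF measurable_snd]) auto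
  have ks: "k x \<in> borel_measurable borel" for x
    using measurable_compose[OF measurable_Pair1' k, of x] by simp
  have ri: "integrable mu (\<lambda>t. r t * k x t)" for x
  proof (rule Bochner_Integration.integrable_bound[OF r])
    show "(\<lambda>t. r t * k x t) \<in> borel_measurable mu" using r borel_measurable_mu[OF ks] by auto
    show "AE t in mu. norm (r t * k x t) \<le> norm (r t)" using kB by (auto simp: abs_mult mult_left_le)
  qed
  let ?F = "\<lambda>z. f (fst z) * (r (snd z) * case_prod k z)"
  have Fm: "?F \<in> borel_measurable (mu \<Otimes>\<^sub>M mu)" using fm rm km by auto
  have I: "integrable (mu \<Otimes>\<^sub>M mu) ?F"
  proof (rule mu2.Fubini_integrable[OF Fm])
    show "integrable mu (\<lambda>x. LINT y|mu. norm (?F (x, y)))"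
    proof (rule Bochner_Integration.integrable_bound[of _ "\<lambda>x. \<bar>f x\<bar> * (LINT t|mu. \<bar>r t\<bar>)"])
      show "integrable mu (\<lambda>x. \<bar>f x\<bar> * (LINT t|mu. \<bar>r t\<bar>))" using f by auto
      show "(\<lambda>x. LINT y|mu. norm (?F (x, y))) \<in> borel_measurable mu"
        using Fm by measurable
      have "norm (LINT y|mu. norm (?F (x, y))) \<le> norm (\<bar>f x\<bar> * (LINT t|mu. \<bar>r t\<bar>))" for x
      proof -
        have "(LINT y|mu. norm (?F (x, y))) = \<bar>f x\<bar> * (LINT y|mu. \<bar>r y * k x y\<bar>)"
          by (simp add: abs_mult)
        also have "\<dots> \<le> \<bar>f x\<bar> * (LINT t|mu. \<bar>r t\<bar>)"
          using ri r kB by (intro mult_left_mono integral_mono integrable_abs) (auto simp: abs_mult mult_left_le)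
        finally show ?thesis by (simp add: abs_mult)
      qed
      then show "AE x in mu. norm (LINT y|mu. norm (?F (x, y))) \<le> norm (\<bar>f x\<bar> * (LINT t|mu. \<bar>r t\<bar>))"
        by simp
    qed
    show "AE x in mu. integrable mu (\<lambda>y. ?F (x, y))" using ri by auto
  qed
  then have I': "integrable (mu \<Otimes>\<^sub>M mu) (case_prod (\<lambda>x t. f x * (r t * k x t)))"
    by (simp add: split_beta')
  have inner: "(LINT x|mu. f x * (r t * k x t)) = r t * (LINT x|mu. f x * k x t)" for t
    by (subst mult.left_commute) simp
  have "(LINT x|mu. (LINT t|mu. f x * (r t * k x t))) = (LINT t|mu. (LINT x|mu. f x * (r t * k x t)))"
    using mu2.integral_fst[OF I'] mu2.integral_snd[OF I'] by simp
  then show "(LINT x|mu. f x * (LINT t|mu. r t * k x t)) = (LINT t|mu. r t * (LINT x|mu. f x * k x t))"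
    using inner by simp
  show "integrable mu (\<lambda>x. f x * (LINT t|mu. r t * k x t))"
    using mu2.integrable_fst[OF I'] by simp
qed

lemma integrable_mult_bounded:
  fixes f g :: "real \<Rightarrow> real"
  assumes "integrable mu f" "g \<in> borel_measurable mu" "AE x in mu. \<bar>g x\<bar> \<le> B"
  shows "integrable mu (\<lambda>x. f x * g x)"
  using assms by (intro integrable_mult_Linf) (auto simp: Linf_space_def)

lemma integrable_mult_prim:
  assumes f: "integrable mu f" and g: "integrable mu g"
  shows "integrable mu (\<lambda>x. f x * prim g x)" "integrable mu (\<lambda>x. prim g x * f x)"
proof -
  show *: "integrable mu (\<lambda>x. f x * prim g x)"
    by (rule integrable_mult_bounded[OF f prim_mu[OF g] AE_I2]) (rule prim_abs_le[OF g])
  then show "integrable mu (\<lambda>x. prim g x * f x)" by (simp only: mult.commute)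
qed

text \<open>The product of the two primitives is a double integral over a square; cutting the square
  along its diagonal gives the two terms, the second one after exchanging the integrals.\<close>

lemma prim_mult:
  assumes f: "integrable mu f" and r: "integrable mu r"
  shows "prim f x * prim r x = prim (\<lambda>t. f t * prim r t + prim f t * r t) x"
proof -
  have m1: "(\<lambda>(s::real, t::real). indicator {..s} t :: real) \<in> borel_measurable (borel \<Otimes>\<^sub>M borel)"
    and m2: "(\<lambda>(s::real, t::real). indicator {..<t} s :: real) \<in> borel_measurable (borel \<Otimes>\<^sub>M borel)"
    unfolding indicator_def of_bool_def split_beta' atMost_iff lessThan_iff by measurable
  let ?f = "\<lambda>t. f t * indicator {..x} t" and ?r = "\<lambda>t. r t * indicator {..x} t"
  note fi = integrable_mult_ind(1)[OF f, of x] and ri = integrable_mult_ind(1)[OF r, of x]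
  note fr = integrable_mult_prim(1)[OF f r] and rf = integrable_mult_prim(2)[OF r f]
  have A: "(LINT s|mu. ?f s * (LINT t|mu. ?r t * indicator {..s} t)) = prim (\<lambda>t. f t * prim r t) x"
  proof -
    have eq: "?f s * (LINT t|mu. ?r t * indicator {..s} t) = (f s * prim r s) * indicator {..x} s" for s
    proof (cases "s \<le> x")
      case True
      then have "(LINT t|mu. ?r t * indicator {..s} t) = prim r s"
        unfolding prim_def by (intro Bochner_Integration.integral_cong) (auto simp: indicator_def)
      then show ?thesis by simp
    qed auto
    then show ?thesis unfolding prim_def[of "\<lambda>t. f t * prim r t"] by (simp only: eq)
  qed
  have B: "(LINT s|mu. ?f s * (LINT t|mu. ?r t * indicator {..<t} s)) = prim (\<lambda>t. prim f t * r t) x"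
  proof -
    have "(LINT s|mu. ?f s * (LINT t|mu. ?r t * indicator {..<t} s)) = (LINT t|mu. ?r t * (LINT s|mu. ?f s * indicator {..<t} s))"
      by (rule Fubini_kernel(1)[OF fi ri m2]) (auto simp: indicator_def)
    moreover have eq: "?r t * (LINT s|mu. ?f s * indicator {..<t} s) = (prim f t * r t) * indicator {..x} t" for t
    proof (cases "t \<le> x")
      case True
      then have "(LINT s|mu. ?f s * indicator {..<t} s) = prim f t"
        unfolding prim_less[OF f] by (intro Bochner_Integration.integral_cong) (auto simp: indicator_def)
      then show ?thesis by simp
    qed auto
    ultimately show ?thesis unfolding prim_def[of "\<lambda>t. prim f t * r t"] by (simp only: eq)
  qed
  have "prim f x * prim r x = (LINT s|mu. ?f s * prim r x)"
    unfolding prim_def[of f] by simp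
  also have "\<dots> = (LINT s|mu. ?f s * (LINT t|mu. ?r t * indicator {..s} t) + ?f s * (LINT t|mu. ?r t * indicator {..<t} s))"
  proof (rule Bochner_Integration.integral_cong[OF refl])
    fix s
    have "prim r x = (LINT t|mu. ?r t * indicator {..s} t + ?r t * indicator {s<..} t)"
      unfolding prim_def by (intro Bochner_Integration.integral_cong) (auto simp: indicator_def)
    also have "\<dots> = (LINT t|mu. ?r t * indicator {..s} t) + (LINT t|mu. ?r t * indicator {s<..} t)"
      by (intro Bochner_Integration.integral_add integrable_mult_ind ri integrable_mult_bounded[OF ri])
         (auto simp: indicator_def intro!: borel_measurable_mu)
    also have "(\<lambda>t. ?r t * indicator {s<..} t) = (\<lambda>t. ?r t * indicator {..<t} s)" by (auto simp: indicator_def)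
    finally show "?f s * prim r x = ?f s * (LINT t|mu. ?r t * indicator {..s} t) + ?f s * (LINT t|mu. ?r t * indicator {..<t} s)"
      by (simp add: distrib_left)
  qed
  also have "\<dots> = prim (\<lambda>t. f t * prim r t) x + prim (\<lambda>t. prim f t * r t) x"
    by (subst Bochner_Integration.integral_add)
       (use Fubini_kernel(2)[OF fi ri m1] Fubini_kernel(2)[OF fi ri m2] A B in \<open>auto simp: indicator_def\<close>)
  finally show ?thesis by (simp add: prim_add[OF fr rf])
qed

subsection \<open>Weak derivatives\<close>

lemma diff_times_DERIV:
  assumes "\<And>n. diff_times n f"
  shows "(f has_real_derivative deriv f x) (at x)" "continuous_on S f" "continuous_on S (deriv f)"
    "\<And>n. diff_times n (deriv f)"
proof -
  have "f field_differentiable at x" for x using assms[of 1] by simp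
  then show "(f has_real_derivative deriv f x) (at x)" "continuous_on S f"
    using DERIV_deriv_iff_field_differentiable
    by (auto intro!: continuous_at_imp_continuous_on dest: field_differentiable_imp_continuous_at)
  show *: "\<And>n. diff_times n (deriv f)" using assms[of "Suc _"] by simp
  show "continuous_on S (deriv f)" using *[of 1]
    by (auto intro!: continuous_at_imp_continuous_on dest: field_differentiable_imp_continuous_at)
qed

lemma continuous_integrable_mu:
  fixes f :: "real \<Rightarrow> real"
  assumes "continuous_on {0..1} f" shows "integrable mu f"
  using assms by (intro continuous_imp_integrable_real) auto

lemma continuous_bounded_mu:
  fixes f :: "real \<Rightarrow> real"
  assumes "continuous_on {0..1} f"
  obtains C where "\<And>x. x \<in> {0..1} \<Longrightarrow> \<bar>f x\<bar> \<le> C"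
proof -
  have "bounded (f ` {0..1})" by (intro compact_imp_bounded compact_continuous_image assms) auto
  then obtain C where "\<forall>y \<in> f ` {0..1}. norm y \<le> C" unfolding bounded_iff by blast
  then have "\<bar>f x\<bar> \<le> C" if "x \<in> {0..1}" for x using that by (metis imageI real_norm_def)
  then show thesis by (rule that)
qed

lemma continuous_Linf:
  fixes f :: "real \<Rightarrow> real"
  assumes "continuous_on {0..1} f"
  shows "f \<in> Linf_space"
proof -
  obtain C where "\<And>x. x \<in> {0..1} \<Longrightarrow> \<bar>f x\<bar> \<le> C" using continuous_bounded_mu[OF assms] by blast
  then have "AE x in mu. \<bar>f x\<bar> \<le> C" by (intro AE_I2) auto
  then show ?thesis using continuous_integrable_mu[OF assms] by (auto simp: Linf_space_def)
qed

lemma test_function_facts: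
  assumes "test_function \<phi>"
  shows "\<And>n. diff_times n \<phi>" "\<phi> 0 = 0" "\<phi> 1 = 0" "\<phi> \<in> Linf_space" "integrable mu (deriv \<phi>)" "integrable mu \<phi>"
    "t \<in> {0..1} \<Longrightarrow> prim (deriv \<phi>) t = \<phi> t"
proof -
  show d: "\<And>n. diff_times n \<phi>" and z: "\<phi> 0 = 0" and "\<phi> 1 = 0" using assms by (force simp: test_function_iff)+
  note D = diff_times_DERIV[OF d]
  show "integrable mu \<phi>" "integrable mu (deriv \<phi>)" using D by (auto intro: continuous_integrable_mu)
  show "\<phi> \<in> Linf_space" by (rule continuous_Linf[OF D(2)])
  show "prim (deriv \<phi>) t = \<phi> t" if "t \<in> {0..1}"
    using prim_eqI[of "deriv \<phi>" \<phi> "{}" t] D \<open>integrable mu (deriv \<phi>)\<close> z that by auto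
qed

lemma prim_kernel_meas: "(\<lambda>(s::real, t::real). indicator {..s} t :: real) \<in> borel_measurable (borel \<Otimes>\<^sub>M borel)"
  unfolding indicator_def of_bool_def split_beta' atMost_iff lessThan_iff by measurable

lemma integrable_mu_cong:
  fixes f g :: "real \<Rightarrow> real"
  assumes "integrable mu g" "f \<in> borel_measurable mu" "AE x in mu. f x = g x"
  shows "integrable mu f"
  using assms(1,2)
proof (rule integrable_cong_AE_imp)
  show "AE x in mu. g x = f x" using assms(3) by eventually_elim simp
qed

text \<open>Exchanging the integrals leaves the integral of \<open>deriv \<phi>\<close> from
  \<open>t\<close> to 1, which is \<open>- \<phi> t\<close>. Since \<phi> vanishes at both ends, the
  constant \<open>k\<close> drops out.\<close>

lemma has_weak_deriv_prim:
  assumes g: "integrable mu g" and f: "f \<in> borel_measurable mu" and eq: "AE x in mu. f x = k + prim g x"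
  shows "has_weak_deriv f g"
  unfolding has_weak_deriv_def
proof (intro conjI allI impI)
  have "integrable mu (\<lambda>x. k + prim g x)" by (intro continuous_integrable_mu continuous_intros continuous_on_prim g)
  then show "integrable mu f" by (rule integrable_mu_cong[OF _ f eq])
  show "integrable mu g" by fact
  fix \<phi> assume t: "test_function \<phi>"
  note T = test_function_facts[OF t]
  have A: "(LINT x|mu. deriv \<phi> x * prim g x) = (LINT t|mu. g t * (LINT x|mu. deriv \<phi> x * indicator {..x} t))"
    using Fubini_kernel(1)[OF T(5) g prim_kernel_meas] by (auto simp: prim_def)
  have B: "(LINT x|mu. deriv \<phi> x * indicator {..x} t) = - \<phi> t" if "t \<in> {0..1}" for t
  proof -
    have "(LINT x|mu. deriv \<phi> x * indicator {..x} t) = (LINT x|mu. deriv \<phi> x - deriv \<phi> x * indicator {..<t} x)"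
      by (intro Bochner_Integration.integral_cong) (auto simp: indicator_def)
    also have "\<dots> = prim (deriv \<phi>) 1 - prim (deriv \<phi>) t"
      using T by (simp add: integrable_mult_ind prim_1 prim_less)
    finally show ?thesis using T that by simp
  qed
  have "integrable mu (\<lambda>x. k * deriv \<phi> x)" "integrable mu (\<lambda>x. prim g x * deriv \<phi> x)"
    using T(5) integrable_mult_prim[OF T(5) g] by auto
  then have "(LINT x|mu. (k + prim g x) * deriv \<phi> x) = k * prim (deriv \<phi>) 1 + (LINT x|mu. deriv \<phi> x * prim g x)"
    by (simp add: distrib_right prim_1 mult.commute[of "prim g _"] del: integrable_mult_right_iff)
  also have "\<dots> = (LINT t|mu. g t * - \<phi> t)"
  proof -
    have "(LINT t|mu. g t * (LINT x|mu. deriv \<phi> x * indicator {..x} t)) = (LINT t|mu. g t * - \<phi> t)"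
      by (rule Bochner_Integration.integral_cong) (use B in auto)
    then show ?thesis unfolding A using T(3) T(7)[of 1] by simp
  qed
  finally have "(LINT x|mu. (k + prim g x) * deriv \<phi> x) = - (LINT x|mu. g x * \<phi> x)" by simp
  moreover have "(LINT x|mu. f x * deriv \<phi> x) = (LINT x|mu. (k + prim g x) * deriv \<phi> x)"
  proof (rule integral_cong_AE)
    show "AE x in mu. f x * deriv \<phi> x = (k + prim g x) * deriv \<phi> x" using eq by eventually_elim simp
  qed (use f prim_mu[OF g] T(5) in auto)
  ultimately show "(LINT x|mu. f x * deriv \<phi> x) = - (LINT x|mu. g x * \<phi> x)" by simp
qed

text \<open>Clamping the approximants to [-B, B] preserves the limit and supplies the majorant for
  dominated convergence.\<close>

lemma continuous_limit_mu:
  fixes f :: "real \<Rightarrow> real"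
  assumes f: "f \<in> borel_measurable mu" and B: "\<And>x. \<bar>f x\<bar> \<le> B"
  obtains g where "\<And>n. continuous_on UNIV (g n)" "\<And>n x. \<bar>g n x\<bar> \<le> B" "AE x in mu. (\<lambda>n. g n x) \<longlonglongrightarrow> f x"
proof -
  have "f measurable_on {0..1}" using f by (subst measurable_on_iff_borel_measurable) auto
  then obtain N g where N: "negligible N" and g: "\<And>n. continuous_on UNIV (g n :: real \<Rightarrow> real)"
    and lim: "\<And>x. x \<notin> N \<Longrightarrow> (\<lambda>n. g n x) \<longlonglongrightarrow> (if x \<in> {0..1} then f x else 0)"
    unfolding measurable_on_def by blast
  show thesis
  proof (rule that[of "\<lambda>n x. max (-B) (min B (g n x))"])
    show "continuous_on UNIV (\<lambda>x. max (-B) (min B (g n x)))" for n by (intro continuous_intros g)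
    show "\<bar>max (-B) (min B (g n x))\<bar> \<le> B" for n x using B[of x] by (auto simp: abs_le_iff)
    have "AE x in lebesgue. x \<notin> N" using N
      using AE_not_in negligible_iff_null_sets by blast
    then have "AE x in mu. x \<notin> N" by (subst AE_restrict_space_iff) auto
    then have "AE x in mu. x \<in> space mu \<and> x \<notin> N" using AE_space by eventually_elim auto
    then show "AE x in mu. (\<lambda>n. max (-B) (min B (g n x))) \<longlonglongrightarrow> f x"
    proof eventually_elim
      case (elim x)
      then have "(\<lambda>n. g n x) \<longlonglongrightarrow> f x" using lim[of x] by auto
      then have "(\<lambda>n. max (-B) (min B (g n x))) \<longlonglongrightarrow> max (-B) (min B (f x))" by (intro tendsto_intros)
      then show ?case using B[of x] by (simp add: abs_le_iff min_def max_def split: if_splits)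
    qed
  qed
qed

text \<open>The annihilated class is enlarged in stages: cutoffs admit all polynomials, uniform
  approximation all continuous functions, bounded almost everywhere limits finally
  \<open>sgn u\<close>. Pairing with the last one gives the L^1 norm of \<open>u\<close>.\<close>

lemma weak_zero_AE:
  assumes u: "integrable mu u" and z: "\<And>\<eta>. test_function \<eta> \<Longrightarrow> (LINT x|mu. u x * \<eta> x) = 0"
  shows "AE x in mu. u x = 0"
proof -
  have poly: "(LINT x|mu. u x * q x) = 0" if q: "real_polynomial_function q" for q
  proof -
    have qc: "continuous_on {0..1} q" by (rule diff_times_DERIV(2)) (rule diff_times_real_polynomial[OF q])
    obtain C where C: "\<And>x. x \<in> {0..1} \<Longrightarrow> \<bar>q x\<bar> \<le> C" using continuous_bounded_mu[OF qc] by blast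
    have qm: "q \<in> borel_measurable mu" using continuous_integrable_mu[OF qc] by auto
    have cm: "cutoff n \<in> borel_measurable mu" for n
      using continuous_integrable_mu[OF diff_times_DERIV(2)[OF diff_times_cutoff]] by auto
    have "(\<lambda>n. LINT x|mu. u x * (cutoff n x * q x)) \<longlonglongrightarrow> (LINT x|mu. u x * q x)"
    proof (rule integral_dominated_convergence)
      show "integrable mu (\<lambda>x. C * \<bar>u x\<bar>)" using u by auto
      show "AE x in mu. (\<lambda>n. u x * (cutoff n x * q x)) \<longlonglongrightarrow> u x * q x"
        using AE_mu_in
      proof eventually_elim
        case (elim x)
        then have "(\<lambda>n. u x * (cutoff n x * q x)) \<longlonglongrightarrow> u x * (1 * q x)"
          by (intro tendsto_intros cutoff_tendsto) auto
        then show ?case by simp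
      qed
      show "AE x in mu. norm (u x * (cutoff n x * q x)) \<le> C * \<bar>u x\<bar>" for n
      proof (rule AE_I2)
        fix x assume "x \<in> space mu"
        then have "cutoff n x * \<bar>q x\<bar> \<le> 1 * C" using cutoff_bounds C by (intro mult_mono) auto
        then have "(cutoff n x * \<bar>q x\<bar>) * \<bar>u x\<bar> \<le> C * \<bar>u x\<bar>" by (intro mult_right_mono) auto
        then show "norm (u x * (cutoff n x * q x)) \<le> C * \<bar>u x\<bar>"
          using cutoff_bounds[of n x] by (simp add: abs_mult mult_ac)
      qed
    qed (use u qm cm in auto)
    moreover have "(LINT x|mu. u x * (cutoff n x * q x)) = 0" for n
      by (intro z test_function_cutoff_mult diff_times_real_polynomial q)
    ultimately show ?thesis by (simp add: LIMSEQ_const_iff)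
  qed
  have cont: "(LINT x|mu. u x * g x) = 0" if g: "continuous_on {0..1} g" for g
  proof -
    have gi: "integrable mu (\<lambda>x. u x * g x)"
      by (rule integrable_mult_Linf[OF u continuous_Linf[OF g]])
    have "\<bar>LINT x|mu. u x * g x\<bar> \<le> e * (LINT x|mu. \<bar>u x\<bar>)" if "e > 0" for e
    proof -
      obtain q where q: "real_polynomial_function q" "\<And>x. x \<in> {0..1} \<Longrightarrow> \<bar>g x - q x\<bar> < e"
        using Stone_Weierstrass_real_polynomial_function[of "{0..1::real}" g e] g \<open>e > 0\<close> by auto
      have qc: "continuous_on {0..1} q" by (rule diff_times_DERIV(2)) (rule diff_times_real_polynomial[OF q(1)])
      have d: "integrable mu (\<lambda>x. u x * (g x - q x))"
        using continuous_integrable_mu[OF g] continuous_integrable_mu[OF qc] q(2)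
        by (intro integrable_mult_bounded[OF u, of _ e] AE_I2) (auto intro: less_imp_le)
      then have qi: "integrable mu (\<lambda>x. u x * q x)"
        using Bochner_Integration.integrable_diff[OF gi d] by (simp add: algebra_simps)
      have "(LINT x|mu. u x * g x) = (LINT x|mu. u x * (g x - q x))"
        using gi qi poly[OF q(1)] by (simp add: right_diff_distrib)
      also have "\<bar>\<dots>\<bar> \<le> (LINT x|mu. \<bar>u x * (g x - q x)\<bar>)" by (rule integral_abs_bound)
      also have "\<dots> \<le> (LINT x|mu. e * \<bar>u x\<bar>)"
      proof (rule integral_mono)
        fix x assume "x \<in> space mu"
        then have "\<bar>u x\<bar> * \<bar>g x - q x\<bar> \<le> \<bar>u x\<bar> * e"
          using q(2)[of x] by (intro mult_left_mono) auto
        then show "\<bar>u x * (g x - q x)\<bar> \<le> e * \<bar>u x\<bar>" by (simp add: abs_mult mult.commute)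
      qed (use d u in auto)
      finally show ?thesis by simp
    qed
    note * = this
    have "\<bar>LINT x|mu. u x * g x\<bar> \<le> 0"
    proof (rule field_le_epsilon)
      fix e :: real assume "e > 0"
      define I where "I = (LINT x|mu. \<bar>u x\<bar>)"
      have I: "0 \<le> I" by (simp add: I_def)
      then have "\<bar>LINT x|mu. u x * g x\<bar> \<le> (e / (I + 1)) * I"
        using \<open>e > 0\<close> *[of "e / (I + 1)"] by (simp add: I_def[symmetric])
      also have "\<dots> \<le> e" using \<open>e > 0\<close> I by (simp add: field_simps)
      finally show "\<bar>LINT x|mu. u x * g x\<bar> \<le> 0 + e" by simp
    qed
    then show ?thesis by simp
  qed
  have sm: "(\<lambda>x. sgn (u x)) \<in> borel_measurable mu" using u by auto
  obtain g where g: "\<And>n. continuous_on UNIV (g n)" "\<And>n x. \<bar>g n x\<bar> \<le> (1::real)" "AE x in mu. (\<lambda>n. g n x) \<longlonglongrightarrow> sgn (u x)"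
    using continuous_limit_mu[OF sm, of 1] by (auto simp: abs_sgn_eq)
  have gm: "g n \<in> borel_measurable mu" for n
    using continuous_integrable_mu[OF continuous_on_subset[OF g(1)]] by auto
  have "(\<lambda>n. LINT x|mu. u x * g n x) \<longlonglongrightarrow> (LINT x|mu. u x * sgn (u x))"
  proof (rule integral_dominated_convergence)
    show "integrable mu (\<lambda>x. \<bar>u x\<bar>)" using u by auto
    show "AE x in mu. (\<lambda>n. u x * g n x) \<longlonglongrightarrow> u x * sgn (u x)"
      using g(3) by eventually_elim (intro tendsto_intros)
    show "AE x in mu. norm (u x * g n x) \<le> \<bar>u x\<bar>" for n
      using g(2) by (auto simp: abs_mult mult_left_le)
  qed (use u sm gm in auto)
  moreover have "(LINT x|mu. u x * g n x) = 0" for n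
    using g(1) by (intro cont) (auto intro: continuous_on_subset)
  ultimately have "(LINT x|mu. u x * sgn (u x)) = 0" by (simp add: LIMSEQ_const_iff)
  moreover have "u x * sgn (u x) = \<bar>u x\<bar>" for x by (simp add: abs_sgn)
  ultimately have "(LINT x|mu. \<bar>u x\<bar>) = 0" by simp
  then show ?thesis using u by (subst (asm) integral_nonneg_eq_0_iff_AE) auto
qed

text \<open>The zero integral is what makes the antiderivative vanish again to the right of the
  support of \<open>w\<close>.\<close>

lemma test_function_antideriv:
  assumes "test_function w" "(LINT x|mu. w x) = 0"
  obtains \<phi> where "test_function \<phi>" "deriv \<phi> = w"
proof -
  obtain a b where ab: "0 < a" "a < b" "b < 1" and supp: "\<And>x. x \<notin> {a..b} \<Longrightarrow> w x = 0"
    using assms(1) by (auto simp: test_function_iff)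
  note T = test_function_facts[OF assms(1)]
  note D = diff_times_DERIV[OF T(1)]
  define F where "F x = integral {0..x} w" for x
  have F0: "F x = 0" if "x < a" for x
    using supp that unfolding F_def by (subst Henstock_Kurzweil_Integration.integral_cong[of _ _ "\<lambda>x. 0"]) auto
  have der: "(F has_real_derivative w x) (at x)" for x
  proof (cases "x < a")
    case True
    have "((\<lambda>x. 0) has_real_derivative w x) (at x)" using supp True by simp
    moreover have "eventually (\<lambda>x. 0 = F x) (nhds x)"
      using eventually_nhds_in_open[of "{..<a}" x] True F0 by (auto elim!: eventually_mono)
    ultimately show ?thesis by (subst (asm) DERIV_cong_ev[OF refl _ refl])
  next
    case False
    have "(F has_real_derivative w x) (at x within {0..x+1})"
      unfolding F_def[abs_def] using False ab D(2) by (intro integral_has_real_derivative) auto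
    then show ?thesis using False ab by (simp add: at_within_Icc_at)
  qed
  have Fc: "continuous_on {0..1} F"
    using der by (intro continuous_at_imp_continuous_on ballI DERIV_isCont)
  have pF: "prim w x = F x" if "x \<in> {0..1}" for x
    using prim_eqI[of w F "{}" x] T(6) der that F0[of 0] ab Fc by auto
  have F1: "F x = 0" if "x > b" for x
  proof -
    have "F x = F 1"
    proof (cases "x \<ge> 1")
      case True
      have "F x = F 1 + integral {1..x} w"
        unfolding F_def using True D(2)
        by (intro Henstock_Kurzweil_Integration.integral_combine[symmetric] integrable_continuous_interval) auto
      also have "integral {1..x} w = 0"
        using supp ab by (subst Henstock_Kurzweil_Integration.integral_cong[of _ _ "\<lambda>x. 0"]) auto
      finally show ?thesis by simp
    next
      case False
      have "F 1 = F x + integral {x..1} w"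
        unfolding F_def using False that ab D(2)
        by (intro Henstock_Kurzweil_Integration.integral_combine[symmetric] integrable_continuous_interval) auto
      also have "integral {x..1} w = 0"
        using supp that by (subst Henstock_Kurzweil_Integration.integral_cong[of _ _ "\<lambda>x. 0"]) auto
      finally show ?thesis by simp
    qed
    also have "F 1 = 0" using pF[of 1] assms(2) by (simp add: prim_1)
    finally show ?thesis .
  qed
  show thesis
  proof (rule that)
    show "deriv F = w" using der by (intro ext DERIV_imp_deriv)
    show "test_function F" unfolding test_function_iff
    proof (intro conjI allI exI)
      show "diff_times n F" for n using der T(1) by (rule diff_times_antideriv)
      show "x \<notin> {a..b} \<longrightarrow> F x = 0" for x using F0 F1 by force
    qed (use ab in auto)
  qed
qed

lemma test_function_lincomb:
  assumes "test_function f" "test_function g"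
  shows "test_function (\<lambda>x. f x + k * g x)"
proof -
  obtain a b where ab: "0 < a" "a < b" "b < 1" and supp: "\<And>x. x \<notin> {a..b} \<Longrightarrow> f x = 0"
    using assms(1) by (auto simp: test_function_iff)
  obtain a' b' where ab': "0 < a'" "a' < b'" "b' < 1" and supp': "\<And>x. x \<notin> {a'..b'} \<Longrightarrow> g x = 0"
    using assms(2) by (auto simp: test_function_iff)
  show ?thesis unfolding test_function_iff
  proof (intro conjI allI exI)
    show "diff_times n (\<lambda>x. f x + k * g x)" for n
      using assms by (intro diff_times_add diff_times_mult diff_times_const) (auto simp: test_function_iff)
    show "0 < min a a'" "min a a' < max b b'" "max b b' < 1" using ab ab' by auto
    show "x \<notin> {min a a'..max b b'} \<longrightarrow> f x + k * g x = 0" for x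
      using supp[of x] supp'[of x] by (auto simp: min_def max_def split: if_splits)
  qed
qed

text \<open>Du Bois-Reymond: adding a suitable multiple of a fixed \<open>\<psi>\<close> with
  nonzero integral turns any test function into the derivative of another one, so \<open>f\<close>
  pairs with test functions as the constant \<open>k\<close> does.\<close>

lemma weak_deriv_zero_const:
  assumes f: "integrable mu f" and z: "\<And>\<phi>. test_function \<phi> \<Longrightarrow> (LINT x|mu. f x * deriv \<phi> x) = 0"
  shows "\<exists>k. AE x in mu. f x = k"
proof -
  have tc: "test_function (cutoff n)" for n
    using test_function_cutoff_mult[of "\<lambda>x. 1" n] diff_times_const by simp
  \<comment> \<open>The cutoffs tend boundedly to 1, so their integrals cannot all be 0.\<close>
  have "\<exists>n. (LINT x|mu. cutoff n x) \<noteq> 0"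
  proof (rule ccontr)
    assume "\<not> ?thesis"
    moreover have "(\<lambda>n. LINT x|mu. cutoff n x) \<longlonglongrightarrow> (LINT x|mu. 1)"
    proof (rule integral_dominated_convergence)
      show "AE x in mu. (\<lambda>n. cutoff n x) \<longlonglongrightarrow> 1" using AE_mu_in by eventually_elim (simp add: cutoff_tendsto)
      show "AE x in mu. norm (cutoff n x) \<le> 1" for n using cutoff_bounds[of n] by auto
    qed (use test_function_facts(6)[OF tc] in auto)
    ultimately show False by (simp add: LIMSEQ_const_iff)
  qed
  then obtain n where n: "(LINT x|mu. cutoff n x) \<noteq> 0" by auto
  define \<psi> where "\<psi> = cutoff n"
  have tp: "test_function \<psi>" and psi: "(LINT x|mu. \<psi> x) \<noteq> 0" using tc n by (auto simp: \<psi>_def)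
  define k where "k = (LINT x|mu. f x * \<psi> x) / (LINT x|mu. \<psi> x)"
  have "AE x in mu. f x - k = 0"
  proof (rule weak_zero_AE)
    show "integrable mu (\<lambda>x. f x - k)" using f by auto
    fix \<eta> assume c: "test_function \<eta>"
    define r where "r = - (LINT x|mu. \<eta> x) / (LINT x|mu. \<psi> x)"
    note C = test_function_facts[OF c] and P = test_function_facts[OF tp]
    have "(LINT x|mu. \<eta> x + r * \<psi> x) = 0" using C P psi by (simp add: r_def)
    then obtain \<phi> where "test_function \<phi>" "deriv \<phi> = (\<lambda>x. \<eta> x + r * \<psi> x)"
      using test_function_antideriv[OF test_function_lincomb[OF c tp]] by blast
    then have "(LINT x|mu. f x * (\<eta> x + r * \<psi> x)) = 0" using z by force
    moreover have fi: "integrable mu (\<lambda>x. f x * \<eta> x)" "integrable mu (\<lambda>x. f x * \<psi> x)"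
      using f C(4) P(4) integrable_mult_Linf by blast+
    ultimately have "(LINT x|mu. f x * \<eta> x) + r * (LINT x|mu. f x * \<psi> x) = 0"
      by (simp add: distrib_left mult.left_commute)
    then show "(LINT x|mu. (f x - k) * \<eta> x) = 0"
      using fi C psi by (simp add: left_diff_distrib k_def r_def)
  qed
  then show ?thesis by (intro exI[of _ k]) (auto elim: eventually_mono)
qed

text \<open>\<open>f - prim g\<close> has weak derivative 0 and so is constant. This one-dimensional
  form carries most of the rules below and the sup norm bounds.\<close>

lemma has_weak_deriv_iff:
  "has_weak_deriv f g \<longleftrightarrow> f \<in> borel_measurable mu \<and> integrable mu g \<and> (\<exists>k. AE x in mu. f x = k + prim g x)"
proof
  assume w: "has_weak_deriv f g"
  then have f: "integrable mu f" and g: "integrable mu g" by (auto simp: has_weak_deriv_def)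
  have p: "has_weak_deriv (prim g) g"
    by (rule has_weak_deriv_prim[of _ _ 0]) (use g prim_mu[OF g] in auto)
  have "\<exists>k. AE x in mu. f x - prim g x = k"
  proof (rule weak_deriv_zero_const)
    show "integrable mu (\<lambda>x. f x - prim g x)" using f p by (auto simp: has_weak_deriv_def)
    fix \<phi> assume t: "test_function \<phi>"
    note T = test_function_facts[OF t]
    have "deriv \<phi> \<in> Linf_space" by (intro continuous_Linf diff_times_DERIV T)
    then have "integrable mu (\<lambda>x. f x * deriv \<phi> x)" "integrable mu (\<lambda>x. prim g x * deriv \<phi> x)"
      using f p integrable_mult_Linf by (auto simp: has_weak_deriv_def)
    then show "(LINT x|mu. (f x - prim g x) * deriv \<phi> x) = 0"
      using w p t by (simp add: left_diff_distrib has_weak_deriv_def)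
  qed
  then obtain k where "AE x in mu. f x - prim g x = k" ..
  then have "AE x in mu. f x = k + prim g x" by eventually_elim simp
  then show "f \<in> borel_measurable mu \<and> integrable mu g \<and> (\<exists>k. AE x in mu. f x = k + prim g x)"
    using f g by auto
qed (use has_weak_deriv_prim in blast)

lemma has_weak_deriv_unique:
  assumes "has_weak_deriv f g" "has_weak_deriv f' g'" "AE x in mu. f x = f' x"
  shows "AE x in mu. g x = g' x"
proof -
  have "AE x in mu. g x - g' x = 0"
  proof (rule weak_zero_AE)
    show "integrable mu (\<lambda>x. g x - g' x)" using assms by (auto simp: has_weak_deriv_def)
    fix \<eta> assume t: "test_function \<eta>"
    note T = test_function_facts[OF t]
    have "integrable mu (\<lambda>x. g x * \<eta> x)" "integrable mu (\<lambda>x. g' x * \<eta> x)"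
      using assms T integrable_mult_Linf by (auto simp: has_weak_deriv_def)
    moreover have "(LINT x|mu. f x * deriv \<eta> x) = (LINT x|mu. f' x * deriv \<eta> x)"
    proof (rule integral_cong_AE)
      show "AE x in mu. f x * deriv \<eta> x = f' x * deriv \<eta> x" using assms(3) by eventually_elim simp
    qed (use assms T(5) in \<open>auto simp: has_weak_deriv_def\<close>)
    ultimately show "(LINT x|mu. (g x - g' x) * \<eta> x) = 0"
      using assms t by (simp add: left_diff_distrib has_weak_deriv_def)
  qed
  then show ?thesis by eventually_elim simp
qed

section \<open>Calculus and sup norm bounds for weak derivatives\<close>

lemma has_weak_deriv_cong:
  assumes "has_weak_deriv f g" "AE x in mu. f' x = f x" "f' \<in> borel_measurable mu"
     "AE x in mu. g' x = g x" "g' \<in> borel_measurable mu"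
  shows "has_weak_deriv f' g'"
proof -
  from assms(1) obtain k where g: "integrable mu g" and k: "AE x in mu. f x = k + prim g x"
    unfolding has_weak_deriv_iff by auto
  have g': "integrable mu g'" by (rule integrable_mu_cong[OF g assms(5,4)])
  have eq: "prim g' x = prim g x" for x using assms(4,5) g by (intro prim_cong_AE) auto
  have "AE x in mu. f' x = k + prim g' x" using k assms(2) by eventually_elim (simp add: eq)
  then show ?thesis using g' assms(3) by (auto simp: has_weak_deriv_iff)
qed

lemma weak_deriv_AE:
  assumes "has_weak_deriv f g"
  shows "has_weak_deriv f (weak_deriv f)" "AE x in mu. weak_deriv f x = g x"
proof -
  show 1: "has_weak_deriv f (weak_deriv f)" unfolding weak_deriv_def by (rule someI[of "has_weak_deriv f", OF assms])
  show "AE x in mu. weak_deriv f x = g x" by (rule has_weak_deriv_unique[OF 1 assms]) simp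
qed

lemma has_weak_deriv_integrable: "has_weak_deriv f g \<Longrightarrow> integrable mu f" "has_weak_deriv f g \<Longrightarrow> integrable mu g"
  by (auto simp: has_weak_deriv_def)

lemma has_weak_deriv_add:
  assumes "has_weak_deriv f g" "has_weak_deriv f' g'"
  shows "has_weak_deriv (\<lambda>x. f x + f' x) (\<lambda>x. g x + g' x)"
proof -
  from assms obtain k k' where g: "integrable mu g" "integrable mu g'" and k: "AE x in mu. f x = k + prim g x" "AE x in mu. f' x = k' + prim g' x"
    and m: "f \<in> borel_measurable mu" "f' \<in> borel_measurable mu"
    unfolding has_weak_deriv_iff by auto
  have "AE x in mu. f x + f' x = (k + k') + prim (\<lambda>x. g x + g' x) x"
    using k by eventually_elim (simp add: prim_add[OF g])
  then show ?thesis using g m by (auto simp: has_weak_deriv_iff)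
qed

lemma has_weak_deriv_cmult:
  assumes "has_weak_deriv f g"
  shows "has_weak_deriv (\<lambda>x. c * f x) (\<lambda>x. c * g x)"
proof -
  from assms obtain k where g: "integrable mu g" and k: "AE x in mu. f x = k + prim g x"
    and m: "f \<in> borel_measurable mu"
    unfolding has_weak_deriv_iff by auto
  have "AE x in mu. c * f x = c * k + prim (\<lambda>x. c * g x) x"
    using k by eventually_elim (simp add: prim_cmult distrib_left)
  then show ?thesis using g m by (auto simp: has_weak_deriv_iff)
qed

lemma has_weak_deriv_diff:
  assumes "has_weak_deriv f g" "has_weak_deriv f' g'"
  shows "has_weak_deriv (\<lambda>x. f x - f' x) (\<lambda>x. g x - g' x)"
  using has_weak_deriv_add[OF assms(1) has_weak_deriv_cmult[OF assms(2), of "-1"]] by simp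

lemma has_weak_deriv_const: "has_weak_deriv (\<lambda>x. k) (\<lambda>x. 0)"
  by (rule has_weak_deriv_prim[of _ _ k]) (simp_all add: prim_def)

lemma has_weak_deriv_C1:
  assumes "\<And>x. x \<in> {0..1} \<Longrightarrow> (f has_real_derivative g x) (at x)" "continuous_on {0..1} g"
  shows "has_weak_deriv f g"
proof -
  have fc: "continuous_on {0..1} f" using assms(1) by (meson DERIV_continuous_on has_field_derivative_at_within)
  have gi: "integrable mu g" by (rule continuous_integrable_mu[OF assms(2)])
  have eq: "f x = f 0 + prim g x" if "x \<in> {0..1}" for x
    by (rule prim_eqI[OF gi fc finite.emptyI _ that]) (rule assms(1), simp)
  have "AE x in mu. f x = f 0 + prim g x" by (intro AE_I2 eq) simp
  then show ?thesis using gi continuous_integrable_mu[OF fc] unfolding has_weak_deriv_iff by blast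
qed

lemma has_weak_deriv_mult:
  assumes "has_weak_deriv f f'" "has_weak_deriv g g'"
  shows "has_weak_deriv (\<lambda>x. f x * g x) (\<lambda>x. f' x * g x + f x * g' x)"
proof -
  from assms obtain k l where g: "integrable mu f'" "integrable mu g'"
    and k: "AE x in mu. f x = k + prim f' x" "AE x in mu. g x = l + prim g' x"
    and m: "f \<in> borel_measurable mu" "g \<in> borel_measurable mu"
    unfolding has_weak_deriv_iff by auto
  let ?h = "\<lambda>x. f' x * prim g' x + prim f' x * g' x"
  have b: "integrable mu (\<lambda>x. f' x * prim g' x)" "integrable mu (\<lambda>x. prim f' x * g' x)"
    using integrable_mult_prim g by auto
  have hi: "integrable mu (\<lambda>x. l * f' x + (k * g' x + ?h x))" using g b by auto
  have "has_weak_deriv (\<lambda>x. f x * g x) (\<lambda>x. l * f' x + (k * g' x + ?h x))"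
    unfolding has_weak_deriv_iff
  proof (intro conjI exI hi)
    show "AE x in mu. f x * g x = k * l + prim (\<lambda>x. l * f' x + (k * g' x + ?h x)) x"
      using k
    proof eventually_elim
      case (elim x)
      have "prim (\<lambda>x. l * f' x + (k * g' x + ?h x)) x = l * prim f' x + (k * prim g' x + prim ?h x)"
        using g b by (subst prim_add; (subst prim_add)?) (auto simp: prim_cmult)
      then show ?case using elim prim_mult[OF g, of x] by (simp add: algebra_simps)
    qed
  qed (use m in auto)
  then show ?thesis
  proof (rule has_weak_deriv_cong)
    show "AE x in mu. f' x * g x + f x * g' x = l * f' x + (k * g' x + ?h x)"
      using k by eventually_elim (simp add: algebra_simps)
  qed (use m g in auto)
qed

text \<open>The deviation from the mean is an average of differences f(x) - f(y), each bounded by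
  the total variation. This embedding is what lets decay be measured on the derivative
  alone.\<close>

lemma has_weak_deriv_mean_bound:
  assumes "has_weak_deriv f g"
  shows "AE x in mu. \<bar>f x - (LINT y|mu. f y)\<bar> \<le> (LINT t|mu. \<bar>g t\<bar>)"
proof -
  from assms obtain k where g: "integrable mu g" and k: "AE x in mu. f x = k + prim g x"
    and m: "f \<in> borel_measurable mu"
    unfolding has_weak_deriv_iff by auto
  have fi: "integrable mu f" using assms by (rule has_weak_deriv_integrable)
  have D: "\<bar>prim g x - prim g y\<bar> \<le> (LINT t|mu. \<bar>g t\<bar>)" for x y
  proof -
    have *: "\<bar>prim g y - prim g x\<bar> \<le> (LINT t|mu. \<bar>g t\<bar>)" if "x \<le> y" for x y
    proof (rule order_trans[OF prim_diff_le[OF g that]])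
      show "(LINT t|mu. \<bar>g t\<bar> * indicator {x<..y} t) \<le> (LINT t|mu. \<bar>g t\<bar>)"
        using g by (intro integral_mono integrable_mult_bounded[of _ _ 1] integrable_abs borel_measurable_mu)
          (auto simp: indicator_def)
    qed
    from *[of x y] *[of y x] show ?thesis by (cases "x \<le> y") auto
  qed
  show ?thesis using k
  proof eventually_elim
    case (elim x)
    have "f x - (LINT y|mu. f y) = (LINT y|mu. f x - f y)" using fi by simp
    also have "\<bar>\<dots>\<bar> \<le> (LINT y|mu. \<bar>f x - f y\<bar>)" by (rule integral_abs_bound)
    also have "\<dots> \<le> (LINT y|mu. (LINT t|mu. \<bar>g t\<bar>))"
    proof (rule integral_mono_AE)
      show "AE y in mu. \<bar>f x - f y\<bar> \<le> (LINT t|mu. \<bar>g t\<bar>)"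
        using k by eventually_elim (use elim D in auto)
    qed (use fi in auto)
    finally show ?case by simp
  qed
qed

lemma has_weak_deriv_sup_bound:
  assumes "has_weak_deriv f g"
  shows "AE x in mu. \<bar>f x\<bar> \<le> (LINT t|mu. \<bar>g t\<bar>) + (LINT t|mu. \<bar>f t\<bar>)"
  using has_weak_deriv_mean_bound[OF assms]
proof eventually_elim
  case (elim x)
  then show ?case using integral_abs_bound[of mu f] by linarith
qed

text \<open>Truncation, bounded continuous approximation and Weierstrass each cost e/3. Polynomials
  have weak derivatives in every L^p, so decay of the iterates on the Sobolev space spreads to L^1
  in \<open>L1_decay\<close>.\<close>

lemma L1_polynomial_approx:
  assumes f: "integrable mu f" and e: "e > 0"
  obtains q where "real_polynomial_function q" "(LINT x|mu. \<bar>f x - q x\<bar>) < e"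
proof -
  have "(\<lambda>n. LINT x|mu. \<bar>f x - max (- real n) (min (real n) (f x))\<bar>) \<longlonglongrightarrow> (LINT x|mu. 0)"
  proof (rule integral_dominated_convergence)
    show "integrable mu (\<lambda>x. \<bar>f x\<bar>)" using f by auto
    show "AE x in mu. (\<lambda>n. \<bar>f x - max (- real n) (min (real n) (f x))\<bar>) \<longlonglongrightarrow> 0"
    proof (rule AE_I2)
      fix x
      obtain N where "\<bar>f x\<bar> \<le> real N" using real_arch_simple by blast
      then have "eventually (\<lambda>n. \<bar>f x - max (- real n) (min (real n) (f x))\<bar> = 0) sequentially"
        unfolding eventually_sequentially by (intro exI[of _ N]) auto
      then show "(\<lambda>n. \<bar>f x - max (- real n) (min (real n) (f x))\<bar>) \<longlonglongrightarrow> 0" by (rule tendsto_eventually)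
    qed
  qed (use f in \<open>auto intro!: AE_I2\<close>)
  then have "eventually (\<lambda>n. (LINT x|mu. \<bar>f x - max (- real n) (min (real n) (f x))\<bar>) < e/3) sequentially"
    using e by (intro order_tendstoD) auto
  then obtain n where n: "(LINT x|mu. \<bar>f x - max (- real n) (min (real n) (f x))\<bar>) < e/3"
    by (auto simp: eventually_sequentially)
  define b where "b x = max (- real n) (min (real n) (f x))" for x
  have bm: "b \<in> borel_measurable mu" and bb: "\<bar>b x\<bar> \<le> real n" for x using f by (auto simp: b_def[abs_def])
  have bi: "integrable mu b" using integrable_mult_bounded[OF integrable_mu_const[of 1] bm, of n] bb by simp
  obtain g where g: "\<And>m. continuous_on UNIV (g m)" "\<And>m x. \<bar>g m x\<bar> \<le> real n" "AE x in mu. (\<lambda>m. g m x) \<longlonglongrightarrow> b x"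
    using continuous_limit_mu[OF bm bb] by blast
  have gi: "integrable mu (g m)" for m using g(1) by (intro continuous_integrable_mu) (auto intro: continuous_on_subset)
  have "(\<lambda>m. LINT x|mu. \<bar>b x - g m x\<bar>) \<longlonglongrightarrow> (LINT x|mu. 0)"
  proof (rule integral_dominated_convergence)
    show "integrable mu (\<lambda>x. 2 * real n)" by simp
    show "AE x in mu. (\<lambda>m. \<bar>b x - g m x\<bar>) \<longlonglongrightarrow> 0" using g(3)
    proof eventually_elim
      case (elim x)
      have "(\<lambda>m. \<bar>b x - g m x\<bar>) \<longlonglongrightarrow> \<bar>b x - b x\<bar>" by (intro tendsto_intros elim)
      then show ?case by simp
    qed
    show "AE x in mu. norm \<bar>b x - g m x\<bar> \<le> 2 * real n" for m
      by (rule AE_I2) (use g(2)[of m] bb in \<open>smt (verit) real_norm_def\<close>)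
  qed (use bi gi in auto)
  then have "eventually (\<lambda>m. (LINT x|mu. \<bar>b x - g m x\<bar>) < e/3) sequentially"
    using e by (intro order_tendstoD) auto
  then obtain m where m: "(LINT x|mu. \<bar>b x - g m x\<bar>) < e/3"
    by (auto simp: eventually_sequentially)
  obtain q where q: "real_polynomial_function q" "\<And>x. x \<in> {0..1} \<Longrightarrow> \<bar>g m x - q x\<bar> < e/3"
    using Stone_Weierstrass_real_polynomial_function[of "{0..1::real}" "g m" "e/3"] g(1) e
    by (metis compact_Icc continuous_on_subset divide_pos_pos top_greatest zero_less_numeral)
  have qi: "integrable mu q" by (intro continuous_integrable_mu diff_times_DERIV(2) diff_times_real_polynomial q)
  have "(LINT x|mu. \<bar>f x - q x\<bar>) \<le> (LINT x|mu. \<bar>f x - b x\<bar> + \<bar>b x - g m x\<bar> + \<bar>g m x - q x\<bar>)"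
    using f bi gi qi by (intro integral_mono) auto
  also have "\<dots> = (LINT x|mu. \<bar>f x - b x\<bar>) + (LINT x|mu. \<bar>b x - g m x\<bar>) + (LINT x|mu. \<bar>g m x - q x\<bar>)"
    using f bi gi qi by simp
  also have "(LINT x|mu. \<bar>g m x - q x\<bar>) \<le> (LINT x|mu. e/3)"
    using gi qi q(2) by (intro integral_mono) (auto intro: less_imp_le)
  finally show thesis using n m by (intro that[OF q(1)]) (simp add: b_def)
qed

subsection \<open>The $L^p$ norm\<close>

text \<open>Real-valued companion of \<open>Lp_norm\<close>. It is 0 when the power is not
  integrable, so a bound on it is informative only together with membership in
  \<open>Lp_space\<close>.\<close>

definition nrm :: "real \<Rightarrow> (real \<Rightarrow> real) \<Rightarrow> real" where
  "nrm p f = (LINT x|mu. \<bar>f x\<bar> powr p) powr (1 / p)"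

lemma Lp_norm_nrm: "f \<in> Lp_space p \<Longrightarrow> Lp_norm p f = ennreal (nrm p f)"
  by (simp add: Lp_norm_def nrm_def)

lemma nrm_nonneg [simp]: "0 \<le> nrm p f"
  by (simp add: nrm_def)

lemma nrm_powr: "p > 0 \<Longrightarrow> nrm p f powr p = (LINT x|mu. \<bar>f x\<bar> powr p)"
  by (simp add: nrm_def powr_powr)

lemma nrm_leI: "p > 0 \<Longrightarrow> 0 \<le> B \<Longrightarrow> (LINT x|mu. \<bar>f x\<bar> powr p) \<le> B powr p \<Longrightarrow> nrm p f \<le> B"
  using powr_mono2[of "1/p" "LINT x|mu. \<bar>f x\<bar> powr p" "B powr p"] by (simp add: nrm_def powr_powr)

lemma Lp_meas: "f \<in> Lp_space p \<Longrightarrow> f \<in> borel_measurable mu"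
  by (simp add: Lp_space_def)

lemma Lp_int: "f \<in> Lp_space p \<Longrightarrow> integrable mu (\<lambda>x. \<bar>f x\<bar> powr p)"
  by (simp add: Lp_space_def)

lemma Lp_dominated:
  assumes "p > 0" "g \<in> Lp_space p" "f \<in> borel_measurable mu" "AE x in mu. \<bar>f x\<bar> \<le> \<bar>g x\<bar>"
  shows "f \<in> Lp_space p" "nrm p f \<le> nrm p g"
proof -
  have le: "AE x in mu. \<bar>f x\<bar> powr p \<le> \<bar>g x\<bar> powr p"
    using assms(4) by eventually_elim (use assms(1) in \<open>auto intro: powr_mono2\<close>)
  have i: "integrable mu (\<lambda>x. \<bar>f x\<bar> powr p)"
    by (rule Bochner_Integration.integrable_bound[OF Lp_int[OF assms(2)]])
       (use assms(3) le in auto)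
  then show "f \<in> Lp_space p" using assms(3) by (simp add: Lp_space_def)
  have "(LINT x|mu. \<bar>f x\<bar> powr p) \<le> (LINT x|mu. \<bar>g x\<bar> powr p)"
    by (rule integral_mono_AE[OF i Lp_int[OF assms(2)] le])
  then show "nrm p f \<le> nrm p g" using assms(1) by (intro nrm_leI) (auto simp: nrm_powr)
qed

lemma Lp_cong:
  assumes "p > 0" "g \<in> Lp_space p" "f \<in> borel_measurable mu" "AE x in mu. f x = g x"
  shows "f \<in> Lp_space p" "nrm p f = nrm p g"
proof -
  show f: "f \<in> Lp_space p" using assms(4) by (intro Lp_dominated[OF assms(1-3)]) (auto elim: eventually_mono)
  show "nrm p f = nrm p g"
  proof (rule antisym)
    have "AE x in mu. \<bar>f x\<bar> \<le> \<bar>g x\<bar>" "AE x in mu. \<bar>g x\<bar> \<le> \<bar>f x\<bar>" using assms(4) by (auto elim: eventually_mono)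
    then show "nrm p f \<le> nrm p g" "nrm p g \<le> nrm p f"
      using Lp_dominated(2)[OF assms(1,2,3)] Lp_dominated(2)[OF assms(1) f Lp_meas[OF assms(2)]] by auto
  qed
qed

lemma nrm_abs: "nrm p (\<lambda>x. \<bar>f x\<bar>) = nrm p f"
  by (simp add: nrm_def)

lemma Lp_abs: "f \<in> Lp_space p \<Longrightarrow> (\<lambda>x. \<bar>f x\<bar>) \<in> Lp_space p"
  unfolding Lp_space_def by (auto intro!: borel_measurable_abs)

lemma Lp_const: "(\<lambda>x. k) \<in> Lp_space p" "p > 0 \<Longrightarrow> nrm p (\<lambda>x. k) = \<bar>k\<bar>"
  by (simp_all add: Lp_space_def nrm_def powr_powr)

lemma Lp_cmult:
  assumes "p > 0" "f \<in> Lp_space p"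
  shows "(\<lambda>x. k * f x) \<in> Lp_space p" "nrm p (\<lambda>x. k * f x) = \<bar>k\<bar> * nrm p f"
  using assms by (auto simp: Lp_space_def nrm_def abs_mult powr_mult powr_powr)

lemma Lp_bounded:
  assumes "p > 0" "f \<in> borel_measurable mu" "AE x in mu. \<bar>f x\<bar> \<le> B"
  shows "f \<in> Lp_space p" "0 \<le> B \<Longrightarrow> nrm p f \<le> B"
proof -
  have *: "AE x in mu. \<bar>f x\<bar> \<le> \<bar>B\<bar>" using assms(3) by eventually_elim auto
  show "f \<in> Lp_space p" by (rule Lp_dominated(1)[OF assms(1) Lp_const(1)[of B] assms(2)]) (use * in simp)
  show "0 \<le> B \<Longrightarrow> nrm p f \<le> B"
    using Lp_dominated(2)[OF assms(1) Lp_const(1)[of B] assms(2)] * Lp_const(2)[OF assms(1), of B] by simp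
qed

text \<open>At a zero argument the claim reduces to \<open>u powr p \<le> u\<close> on [0,1];
  otherwise it is convexity on the positive reals.\<close>

lemma powr_convex_comb:
  fixes x y :: real
  assumes "p \<ge> 1" "0 \<le> x" "0 \<le> y" "0 \<le> u" "0 \<le> v" "u + v = 1"
  shows "(u * x + v * y) powr p \<le> u * x powr p + v * y powr p"
proof -
  have z: "(u * x) powr p \<le> u * x powr p" if "0 \<le> u" "u \<le> 1" "0 \<le> x" for u x :: real
  proof -
    have "u powr p \<le> u" using that assms(1)
      by (metis powr_le_one_le order_le_less powr_zero_eq_one powr_0)
    then show ?thesis using that by (simp add: powr_mult mult_right_mono)
  qed
  consider "x = 0" | "y = 0" | "x > 0" "y > 0" using assms by linarith
  then show ?thesis
  proof cases
    case 1 then show ?thesis using z[of v y] assms by auto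
  next
    case 2 then show ?thesis using z[of u x] assms by auto
  next
    case 3
    have "u = 1 - v" using assms by simp
    then show ?thesis using convex_onD[OF powr_convex[OF assms(1)], of v x y] assms(4,5) 3 by auto
  qed
qed

text \<open>Minkowski from convexity: (f + g)/(a + b) is a convex combination of f/a and g/b.
  Positive majorants \<open>a\<close>, \<open>b\<close> of the norms avoid division by zero and are
  removed at the end.\<close>

lemma Lp_add:
  assumes p: "p \<ge> 1" and f: "f \<in> Lp_space p" and g: "g \<in> Lp_space p"
  shows "(\<lambda>x. f x + g x) \<in> Lp_space p" "nrm p (\<lambda>x. f x + g x) \<le> nrm p f + nrm p g"
proof -
  have *: "(\<lambda>x. f x + g x) \<in> Lp_space p \<and> nrm p (\<lambda>x. f x + g x) \<le> a + b"
    if a: "a > 0" "nrm p f \<le> a" and b: "b > 0" "nrm p g \<le> b" for a b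
  proof -
    have pt: "\<bar>f x + g x\<bar> powr p \<le> (a + b) powr p * (a/(a+b) * (1/a powr p) * \<bar>f x\<bar> powr p + b/(a+b) * (1/b powr p) * \<bar>g x\<bar> powr p)" for x
    proof -
      have "\<bar>f x + g x\<bar> powr p \<le> (\<bar>f x\<bar> + \<bar>g x\<bar>) powr p" using p by (intro powr_mono2) auto
      also have "\<bar>f x\<bar> + \<bar>g x\<bar> = (a + b) * (a/(a+b) * (\<bar>f x\<bar>/a) + b/(a+b) * (\<bar>g x\<bar>/b))"
      proof -
        have "a/(a+b) * (\<bar>f x\<bar>/a) = \<bar>f x\<bar> / (a+b)" "b/(a+b) * (\<bar>g x\<bar>/b) = \<bar>g x\<bar> / (a+b)" "a + b \<noteq> 0"
          using a b by simp_all
        then show ?thesis by (simp add: add_divide_distrib[symmetric])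
      qed
      also have "\<dots> powr p = (a+b) powr p * (a/(a+b) * (\<bar>f x\<bar>/a) + b/(a+b) * (\<bar>g x\<bar>/b)) powr p"
        by (rule powr_mult)
      also have "\<dots> \<le> (a+b) powr p * (a/(a+b) * (\<bar>f x\<bar>/a) powr p + b/(a+b) * (\<bar>g x\<bar>/b) powr p)"
      proof (intro mult_left_mono powr_convex_comb)
        have "a + b > 0" using a b by simp
        then show "a/(a+b) + b/(a+b) = 1" by (simp add: add_divide_distrib[symmetric])
      qed (use a b p in auto)
      finally show ?thesis using a b by (simp add: powr_divide)
    qed
    have i: "integrable mu (\<lambda>x. (a + b) powr p * (a/(a+b) * (1/a powr p) * \<bar>f x\<bar> powr p + b/(a+b) * (1/b powr p) * \<bar>g x\<bar> powr p))"
      using Lp_int[OF f] Lp_int[OF g] by auto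
    have m: "(\<lambda>x. f x + g x) \<in> borel_measurable mu" using Lp_meas[OF f] Lp_meas[OF g] by simp
    have fg: "integrable mu (\<lambda>x. \<bar>f x + g x\<bar> powr p)"
    proof (rule Bochner_Integration.integrable_bound[OF i _ AE_I2])
      show "(\<lambda>x. \<bar>f x + g x\<bar> powr p) \<in> borel_measurable mu" using m by simp
      fix x
      show "norm (\<bar>f x + g x\<bar> powr p) \<le> norm ((a + b) powr p * (a/(a+b) * (1/a powr p) * \<bar>f x\<bar> powr p + b/(a+b) * (1/b powr p) * \<bar>g x\<bar> powr p))"
        using order_trans[OF pt abs_ge_self, of x] by (simp only: real_norm_def abs_of_nonneg[OF powr_ge_zero])
    qed
    have "(LINT x|mu. \<bar>f x + g x\<bar> powr p) \<le> (LINT x|mu. (a + b) powr p * (a/(a+b) * (1/a powr p) * \<bar>f x\<bar> powr p + b/(a+b) * (1/b powr p) * \<bar>g x\<bar> powr p))"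
      by (rule integral_mono[OF fg i pt])
    also have "\<dots> = (a + b) powr p * (a/(a+b) * (1/a powr p) * nrm p f powr p + b/(a+b) * (1/b powr p) * nrm p g powr p)"
      using Lp_int[OF f] Lp_int[OF g] p by (simp add: nrm_powr)
    also have "\<dots> \<le> (a + b) powr p * (a/(a+b) * (1/a powr p) * a powr p + b/(a+b) * (1/b powr p) * b powr p)"
      using a b p by (intro mult_left_mono add_mono powr_mono2) (auto simp: field_simps)
    also have "\<dots> = (a + b) powr p" using a b by (simp add: add_divide_distrib[symmetric])
    finally have "nrm p (\<lambda>x. f x + g x) \<le> a + b" using a b p by (intro nrm_leI) auto
    then show ?thesis using m fg by (simp add: Lp_space_def)
  qed
  show "(\<lambda>x. f x + g x) \<in> Lp_space p"
    using *[of "nrm p f + 1" "nrm p g + 1"] nrm_nonneg[of p f] nrm_nonneg[of p g] by auto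
  show "nrm p (\<lambda>x. f x + g x) \<le> nrm p f + nrm p g"
  proof (rule field_le_epsilon)
    fix e :: real assume "e > 0"
    then show "nrm p (\<lambda>x. f x + g x) \<le> nrm p f + nrm p g + e"
      using *[of "nrm p f + e/2" "nrm p g + e/2"] nrm_nonneg[of p f] nrm_nonneg[of p g] by auto
  qed
qed

lemma Lp_diff:
  assumes p: "p \<ge> 1" and f: "f \<in> Lp_space p" and g: "g \<in> Lp_space p"
  shows "(\<lambda>x. f x - g x) \<in> Lp_space p" "nrm p (\<lambda>x. f x - g x) \<le> nrm p f + nrm p g"
proof -
  have p0: "p > 0" using p by simp
  show "(\<lambda>x. f x - g x) \<in> Lp_space p" "nrm p (\<lambda>x. f x - g x) \<le> nrm p f + nrm p g"
    using Lp_add[OF p f Lp_cmult(1)[OF p0 g, of "-1"]] Lp_cmult(2)[OF p0 g, of "-1"] by simp_all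
qed

lemma Lp_sum:
  assumes p: "p \<ge> 1" and f: "\<And>i. i \<in> I \<Longrightarrow> f i \<in> Lp_space p"
  shows "(\<lambda>x. \<Sum>i\<in>I. f i x) \<in> Lp_space p \<and> nrm p (\<lambda>x. \<Sum>i\<in>I. f i x) \<le> (\<Sum>i\<in>I. nrm p (f i))"
  using f
proof (induction I rule: infinite_finite_induct)
  case (insert i I)
  then have "(\<lambda>x. \<Sum>i\<in>I. f i x) \<in> Lp_space p" "nrm p (\<lambda>x. \<Sum>i\<in>I. f i x) \<le> (\<Sum>i\<in>I. nrm p (f i))" "f i \<in> Lp_space p" by auto
  then show ?case using Lp_add[OF p, of "f i" "\<lambda>x. \<Sum>i\<in>I. f i x"] insert by auto
qed (use p Lp_const(1)[of 0 p] Lp_const(2)[of p 0] in auto)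

text \<open>The elementary bound \<open>t powr p \<le> 1 + t powr q\<close>, applied to f/s with
  \<open>s\<close> at least the L^q norm, gives an integral of at most 2. The resulting factor 2, in
  place of the 1 of Hoelder's inequality, is harmless below.\<close>

lemma Lp_mono_exponent:
  assumes "0 < p" "p \<le> q" "f \<in> Lp_space q"
  shows "f \<in> Lp_space p" "p \<ge> 1 \<Longrightarrow> nrm p f \<le> 2 * nrm q f"
proof -
  have pt: "t powr p \<le> 1 + t powr q" if "t \<ge> 0" for t :: real
  proof (cases "t \<le> 1")
    case True
    then have "t powr p \<le> 1" using that assms(1) by (simp add: powr_le1)
    then show ?thesis by (smt (verit) powr_ge_zero)
  next
    case False
    then have "t powr p \<le> t powr q" using assms by (intro powr_mono) auto
    then show ?thesis by simp
  qed
  have int: "integrable mu (\<lambda>x. \<bar>k * f x\<bar> powr p) \<and> (LINT x|mu. \<bar>k * f x\<bar> powr p) \<le> 1 + (LINT x|mu. \<bar>k * f x\<bar> powr q)" for k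
  proof -
    have kf: "(\<lambda>x. k * f x) \<in> Lp_space q" using assms by (intro Lp_cmult) auto
    have i: "integrable mu (\<lambda>x. 1 + \<bar>k * f x\<bar> powr q)" using Lp_int[OF kf] by auto
    have j: "integrable mu (\<lambda>x. \<bar>k * f x\<bar> powr p)"
      by (rule Bochner_Integration.integrable_bound[OF i]) (use Lp_meas[OF kf] pt in \<open>auto intro!: AE_I2\<close>)
    have "(LINT x|mu. \<bar>k * f x\<bar> powr p) \<le> (LINT x|mu. 1 + \<bar>k * f x\<bar> powr q)"
      by (rule integral_mono[OF j i]) (use pt in auto)
    then show ?thesis using j Lp_int[OF kf] by simp
  qed
  have m: "f \<in> borel_measurable mu" using assms by (auto dest: Lp_meas)
  show fp: "f \<in> Lp_space p" using int[of 1] m by (simp add: Lp_space_def)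
  show "nrm p f \<le> 2 * nrm q f" if p1: "p \<ge> 1"
  proof -
    have *: "nrm p f \<le> 2 * s" if s: "s > 0" "nrm q f \<le> s" for s
    proof -
      have "nrm q (\<lambda>x. (1/s) * f x) = nrm q f / s" using Lp_cmult(2)[of q f "1/s"] assms s by simp
      also have "\<dots> \<le> 1" using s by simp
      finally have "(LINT x|mu. \<bar>(1/s) * f x\<bar> powr q) \<le> 1"
        using powr_mono2[of q "nrm q (\<lambda>x. (1/s) * f x)" 1] assms nrm_powr[of q "\<lambda>x. (1/s) * f x"] by auto
      then have "(LINT x|mu. \<bar>(1/s) * f x\<bar> powr p) \<le> 2" using int[of "1/s"] by auto
      also have "2 \<le> 2 powr p" using powr_mono[of 1 p 2] p1 by simp
      finally have "nrm p (\<lambda>x. (1/s) * f x) \<le> 2" using assms by (intro nrm_leI) auto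
      then have "nrm p f / s \<le> 2" using Lp_cmult(2)[OF assms(1) fp, of "1/s"] s by simp
      then show ?thesis using s by (simp add: pos_divide_le_eq)
    qed
    show ?thesis
    proof (rule field_le_epsilon)
      fix e :: real assume "e > 0"
      then show "nrm p f \<le> 2 * nrm q f + e" using *[of "nrm q f + e/2"] nrm_nonneg[of q f] by auto
    qed
  qed
qed

lemma Lp_1: "f \<in> Lp_space 1 \<longleftrightarrow> integrable mu f" "nrm 1 f = (LINT x|mu. \<bar>f x\<bar>)"
proof -
  have "(\<bar>f x\<bar> powr 1) = \<bar>f x\<bar>" for x by simp
  then show "nrm 1 f = (LINT x|mu. \<bar>f x\<bar>)" by (simp add: nrm_def)
  show "f \<in> Lp_space 1 \<longleftrightarrow> integrable mu f" by (auto simp: Lp_space_def integrable_abs_iff)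
qed

lemma Lp_integrable:
  assumes "1 \<le> p" "f \<in> Lp_space p"
  shows "integrable mu f" "(LINT x|mu. \<bar>f x\<bar>) \<le> 2 * nrm p f"
  using Lp_mono_exponent[of 1 p f] assms by (auto simp: Lp_1)

lemma Lp_Fatou:
  assumes p: "p > 0" and u: "\<And>n. u n \<in> Lp_space p" "\<And>n. nrm p (u n) \<le> B"
    and f: "f \<in> borel_measurable mu" "AE x in mu. (\<lambda>n. u n x) \<longlonglongrightarrow> f x"
  shows "f \<in> Lp_space p" "nrm p f \<le> B"
proof -
  have B: "0 \<le> B" using u(2)[of 0] nrm_nonneg[of p "u 0"] by linarith
  have un: "(\<integral>\<^sup>+x. ennreal (\<bar>u n x\<bar> powr p) \<partial>mu) \<le> ennreal (B powr p)" for n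
  proof -
    have "(\<integral>\<^sup>+x. ennreal (\<bar>u n x\<bar> powr p) \<partial>mu) = ennreal (LINT x|mu. \<bar>u n x\<bar> powr p)"
      by (intro nn_integral_eq_integral Lp_int u) auto
    also have "\<dots> \<le> ennreal (B powr p)" using p u(2)[of n]
      by (subst nrm_powr[symmetric]) (auto intro!: ennreal_leI powr_mono2)
    finally show ?thesis .
  qed
  have "(\<integral>\<^sup>+x. ennreal (\<bar>f x\<bar> powr p) \<partial>mu) = (\<integral>\<^sup>+x. liminf (\<lambda>n. ennreal (\<bar>u n x\<bar> powr p)) \<partial>mu)"
  proof (rule nn_integral_cong_AE)
    show "AE x in mu. ennreal (\<bar>f x\<bar> powr p) = liminf (\<lambda>n. ennreal (\<bar>u n x\<bar> powr p))"
      using f(2)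
    proof eventually_elim
      case (elim x)
      have "(\<lambda>n. ennreal (\<bar>u n x\<bar> powr p)) \<longlonglongrightarrow> ennreal (\<bar>f x\<bar> powr p)"
        using p by (intro tendsto_ennrealI tendsto_powr2 tendsto_intros elim) auto
      then show ?case by (intro lim_imp_Liminf[symmetric]) simp_all
    qed
  qed
  also have "\<dots> \<le> liminf (\<lambda>n. \<integral>\<^sup>+x. ennreal (\<bar>u n x\<bar> powr p) \<partial>mu)"
    using Lp_meas[OF u(1)] by (intro nn_integral_liminf) auto
  also have "\<dots> \<le> ennreal (B powr p)"
    using un by (intro Liminf_le) (auto intro!: always_eventually)
  finally have le: "(\<integral>\<^sup>+x. ennreal (\<bar>f x\<bar> powr p) \<partial>mu) \<le> ennreal (B powr p)" .
  have i: "integrable mu (\<lambda>x. \<bar>f x\<bar> powr p)"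
    by (rule integrableI_bounded) (use f le in \<open>auto simp: le_less_trans\<close>)
  then show "f \<in> Lp_space p" using f by (simp add: Lp_space_def)
  have "ennreal (LINT x|mu. \<bar>f x\<bar> powr p) \<le> ennreal (B powr p)"
    using le nn_integral_eq_integral[OF i] by simp
  then have "(LINT x|mu. \<bar>f x\<bar> powr p) \<le> B powr p" by (simp add: ennreal_le_iff)
  then show "nrm p f \<le> B" using p B by (intro nrm_leI)
qed

text \<open>Completeness with an explicit limit: the sum is pointwise, so a Neumann series is a
  concrete function. Summable L^1 norms give absolute convergence almost everywhere, and Fatou gives
  the tail bound.\<close>

lemma Lp_series:
  assumes p: "1 \<le> p" and u: "\<And>n. u n \<in> Lp_space p" and s: "summable (\<lambda>n. nrm p (u n))"
  shows "AE x in mu. summable (\<lambda>n. \<bar>u n x\<bar>)"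
    "(\<lambda>x. \<Sum>n. u n x) \<in> Lp_space p"
    "nrm p (\<lambda>x. (\<Sum>n. u n x) - (\<Sum>n<N. u n x)) \<le> (\<Sum>n. nrm p (u (n + N)))"
proof -
  have p0: "p > 0" using p by simp
  note ui = Lp_integrable[OF p u] and um = Lp_meas[OF u]
  have s1: "summable (\<lambda>n. LINT x|mu. \<bar>u n x\<bar>)"
    by (rule summable_comparison_test'[OF summable_mult[OF s, of 2], of 0]) (use ui in auto)
  show ae: "AE x in mu. summable (\<lambda>n. \<bar>u n x\<bar>)"
  proof -
    have "(\<integral>\<^sup>+x. (\<Sum>n. ennreal \<bar>u n x\<bar>) \<partial>mu) = (\<Sum>n. \<integral>\<^sup>+x. ennreal \<bar>u n x\<bar> \<partial>mu)"
      using um by (intro nn_integral_suminf) auto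
    also have "\<dots> = (\<Sum>n. ennreal (LINT x|mu. \<bar>u n x\<bar>))"
      using ui by (intro suminf_cong nn_integral_eq_integral) auto
    also have "\<dots> = ennreal (\<Sum>n. LINT x|mu. \<bar>u n x\<bar>)"
      by (rule suminf_ennreal2) (use s1 in auto)
    finally have "(\<integral>\<^sup>+x. (\<Sum>n. ennreal \<bar>u n x\<bar>) \<partial>mu) \<noteq> \<infinity>" by simp
    then have "AE x in mu. (\<Sum>n. ennreal \<bar>u n x\<bar>) \<noteq> \<infinity>"
      using um by (intro nn_integral_PInf_AE) auto
    then show ?thesis
      by eventually_elim (auto intro!: summable_suminf_not_top)
  qed
  have sm: "(\<lambda>x. \<Sum>n. u n x) \<in> borel_measurable mu" using um by measurable
  have lim: "AE x in mu. (\<lambda>n. \<Sum>i<n. u i x) \<longlonglongrightarrow> (\<Sum>n. u n x)"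
    using ae by eventually_elim (auto intro: summable_LIMSEQ summable_rabs_cancel)
  show "(\<lambda>x. \<Sum>n. u n x) \<in> Lp_space p"
  proof (rule Lp_Fatou(1)[OF p0 _ _ sm lim])
    fix n
    show "(\<lambda>x. \<Sum>i<n. u i x) \<in> Lp_space p" using Lp_sum[of p "{..<n}" u] p u by blast
    have "nrm p (\<lambda>x. \<Sum>i<n. u i x) \<le> (\<Sum>i<n. nrm p (u i))" using Lp_sum[of p "{..<n}" u] p u by blast
    also have "\<dots> \<le> (\<Sum>i. nrm p (u i))" using s by (intro sum_le_suminf) auto
    finally show "nrm p (\<lambda>x. \<Sum>i<n. u i x) \<le> (\<Sum>i. nrm p (u i))" .
  qed
  show "nrm p (\<lambda>x. (\<Sum>n. u n x) - (\<Sum>n<N. u n x)) \<le> (\<Sum>n. nrm p (u (n + N)))"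
  proof (rule Lp_Fatou(2)[OF p0, where u="\<lambda>n x. \<Sum>i<n. u (i + N) x"])
    fix n
    show "(\<lambda>x. \<Sum>i<n. u (i + N) x) \<in> Lp_space p" using Lp_sum[of p "{..<n}" "\<lambda>i. u (i + N)"] p u by blast
    have "nrm p (\<lambda>x. \<Sum>i<n. u (i + N) x) \<le> (\<Sum>i<n. nrm p (u (i + N)))"
      using Lp_sum[of p "{..<n}" "\<lambda>i. u (i + N)"] p u by blast
    also have "\<dots> \<le> (\<Sum>i. nrm p (u (i + N)))" using s by (intro sum_le_suminf) (auto intro: summable_ignore_initial_segment[OF s])
    finally show "nrm p (\<lambda>x. \<Sum>i<n. u (i + N) x) \<le> (\<Sum>i. nrm p (u (i + N)))" .
  next
    show "AE x in mu. (\<lambda>n. \<Sum>i<n. u (i + N) x) \<longlonglongrightarrow> (\<Sum>n. u n x) - (\<Sum>n<N. u n x)"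
      using ae
    proof eventually_elim
      case (elim x)
      then have su: "summable (\<lambda>n. u n x)" by (rule summable_rabs_cancel)
      then have "(\<lambda>n. \<Sum>i<n. u (i + N) x) \<longlonglongrightarrow> (\<Sum>i. u (i + N) x)"
        by (intro summable_LIMSEQ summable_ignore_initial_segment[OF su])
      then show ?case using suminf_minus_initial_segment[OF su, of N] by simp
    qed
  qed (use sm um in auto)
qed

text \<open>The weak derivative is a closed operator: partial sums converge in L^1, and both sides
  of the defining identity pair them with bounded functions.\<close>

lemma Lp_series_weak_deriv:
  assumes p: "1 \<le> p" and u: "\<And>n. u n \<in> Lp_space p" "summable (\<lambda>n. nrm p (u n))"
    and v: "\<And>n. v n \<in> Lp_space p" "summable (\<lambda>n. nrm p (v n))"
    and w: "\<And>n. has_weak_deriv (u n) (v n)"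
  shows "has_weak_deriv (\<lambda>x. \<Sum>n. u n x) (\<lambda>x. \<Sum>n. v n x)"
proof -
  note U = Lp_series[OF p u] and V = Lp_series[OF p v]
  have L1: "(\<lambda>N. LINT x|mu. \<bar>(\<Sum>n. f n x) - (\<Sum>n<N. f n x)\<bar>) \<longlonglongrightarrow> 0"
    if f: "\<And>n. f n \<in> Lp_space p" "summable (\<lambda>n. nrm p (f n))" for f :: "nat \<Rightarrow> real \<Rightarrow> real"
  proof (rule tendsto_sandwich[of "\<lambda>_. 0" _ _ "\<lambda>N. 2 * (\<Sum>n. nrm p (f (n + N)))"])
    show "(\<lambda>N. 2 * (\<Sum>n. nrm p (f (n + N)))) \<longlonglongrightarrow> 0"
      using tendsto_mult[OF tendsto_const[of 2] suminf_exist_split2[OF f(2)]] by simp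
    have "(LINT x|mu. \<bar>(\<Sum>n. f n x) - (\<Sum>n<N. f n x)\<bar>) \<le> 2 * (\<Sum>n. nrm p (f (n + N)))" for N
    proof -
      have "(\<lambda>x. (\<Sum>n. f n x) - (\<Sum>n<N. f n x)) \<in> Lp_space p"
        using Lp_sum[of p "{..<N}" f] p f(1) by (intro Lp_diff p Lp_series(2)[OF p f]) blast
      from Lp_integrable(2)[OF p this] Lp_series(3)[OF p f, of N] show ?thesis by linarith
    qed
    then show "\<forall>\<^sub>F N in sequentially. (LINT x|mu. \<bar>(\<Sum>n. f n x) - (\<Sum>n<N. f n x)\<bar>) \<le> 2 * (\<Sum>n. nrm p (f (n + N)))" by simp
  qed auto
  have conv: "(\<lambda>N. LINT x|mu. (\<Sum>n<N. f n x) * \<phi> x) \<longlonglongrightarrow> (LINT x|mu. (\<Sum>n. f n x) * \<phi> x)"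
    if f: "\<And>n. f n \<in> Lp_space p" "summable (\<lambda>n. nrm p (f n))" and phi: "\<phi> \<in> Linf_space" for f \<phi>
  proof -
    obtain C where C: "AE x in mu. \<bar>\<phi> x\<bar> \<le> C" and pm: "\<phi> \<in> borel_measurable mu" using phi by (auto simp: Linf_space_def)
    have si: "integrable mu (\<lambda>x. \<Sum>n. f n x)" by (intro Lp_integrable(1)[OF p] Lp_series(2) p f)
    have fi: "integrable mu (\<lambda>x. \<Sum>n<N. f n x)" for N using Lp_integrable(1)[OF p f(1)] by auto
    have "(\<lambda>N. (LINT x|mu. (\<Sum>n<N. f n x) * \<phi> x) - (LINT x|mu. (\<Sum>n. f n x) * \<phi> x)) \<longlonglongrightarrow> 0"
    proof (rule Lim_null_comparison)
      show "(\<lambda>N. C * (LINT x|mu. \<bar>(\<Sum>n. f n x) - (\<Sum>n<N. f n x)\<bar>)) \<longlonglongrightarrow> 0"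
        using tendsto_mult[OF tendsto_const[of C] L1[OF f]] by simp
      have "norm ((LINT x|mu. (\<Sum>n<N. f n x) * \<phi> x) - (LINT x|mu. (\<Sum>n. f n x) * \<phi> x))
         \<le> C * (LINT x|mu. \<bar>(\<Sum>n. f n x) - (\<Sum>n<N. f n x)\<bar>)" for N
      proof -
        have i: "integrable mu (\<lambda>x. ((\<Sum>n<N. f n x) - (\<Sum>n. f n x)) * \<phi> x)"
          using si fi by (intro integrable_mult_Linf phi) auto
        have "(LINT x|mu. (\<Sum>n<N. f n x) * \<phi> x) - (LINT x|mu. (\<Sum>n. f n x) * \<phi> x)
            = (LINT x|mu. ((\<Sum>n<N. f n x) - (\<Sum>n. f n x)) * \<phi> x)"
          using integrable_mult_Linf[OF si phi] integrable_mult_Linf[OF fi phi]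
          by (subst Bochner_Integration.integral_diff[symmetric]) (auto simp: left_diff_distrib)
        also have "norm \<dots> \<le> (LINT x|mu. norm (((\<Sum>n<N. f n x) - (\<Sum>n. f n x)) * \<phi> x))"
          by (rule integral_norm_bound)
        also have "\<dots> \<le> (LINT x|mu. C * \<bar>(\<Sum>n. f n x) - (\<Sum>n<N. f n x)\<bar>)"
        proof (rule integral_mono_AE)
          show "AE x in mu. norm (((\<Sum>n<N. f n x) - (\<Sum>n. f n x)) * \<phi> x) \<le> C * \<bar>(\<Sum>n. f n x) - (\<Sum>n<N. f n x)\<bar>"
            using C
          proof eventually_elim
            case (elim x)
            have "\<bar>(\<Sum>n<N. f n x) - (\<Sum>n. f n x)\<bar> * \<bar>\<phi> x\<bar> \<le> \<bar>(\<Sum>n<N. f n x) - (\<Sum>n. f n x)\<bar> * C"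
              by (intro mult_left_mono elim) auto
            then show ?case by (simp add: abs_mult mult.commute abs_minus_commute)
          qed
        qed (use i si fi in auto)
        finally show ?thesis by simp
      qed
      then show "\<forall>\<^sub>F N in sequentially. norm ((LINT x|mu. (\<Sum>n<N. f n x) * \<phi> x) - (LINT x|mu. (\<Sum>n. f n x) * \<phi> x))
         \<le> C * (LINT x|mu. \<bar>(\<Sum>n. f n x) - (\<Sum>n<N. f n x)\<bar>)" by simp
    qed
    then show ?thesis by (rule LIM_zero_cancel)
  qed
  show ?thesis unfolding has_weak_deriv_def
  proof (intro conjI allI impI)
    show "integrable mu (\<lambda>x. \<Sum>n. u n x)" "integrable mu (\<lambda>x. \<Sum>n. v n x)"
      using Lp_integrable(1)[OF p] U(2) V(2) by auto
    fix \<phi> assume t: "test_function \<phi>"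
    have "deriv \<phi> \<in> Linf_space"
      by (intro continuous_Linf diff_times_DERIV test_function_facts(1)[OF t])
    from conv[OF u this] have 1: "(\<lambda>N. LINT x|mu. (\<Sum>n<N. u n x) * deriv \<phi> x) \<longlonglongrightarrow> (LINT x|mu. (\<Sum>n. u n x) * deriv \<phi> x)" .
    from conv[OF v test_function_facts(4)[OF t]] have 2: "(\<lambda>N. LINT x|mu. (\<Sum>n<N. v n x) * \<phi> x) \<longlonglongrightarrow> (LINT x|mu. (\<Sum>n. v n x) * \<phi> x)" .
    have "has_weak_deriv (\<lambda>x. \<Sum>n<N. u n x) (\<lambda>x. \<Sum>n<N. v n x)" for N
      by (induction N) (auto intro!: has_weak_deriv_add w simp: has_weak_deriv_const)
    then have "(LINT x|mu. (\<Sum>n<N. u n x) * deriv \<phi> x) = - (LINT x|mu. (\<Sum>n<N. v n x) * \<phi> x)" for N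
      using t by (auto simp: has_weak_deriv_def)
    then have "(\<lambda>N. LINT x|mu. (\<Sum>n<N. u n x) * deriv \<phi> x) \<longlonglongrightarrow> - (LINT x|mu. (\<Sum>n. v n x) * \<phi> x)"
      using tendsto_minus[OF 2] by simp
    then show "(LINT x|mu. (\<Sum>n. u n x) * deriv \<phi> x) = - (LINT x|mu. (\<Sum>n. v n x) * \<phi> x)"
      using LIMSEQ_unique[OF 1] by blast
  qed
qed

text \<open>Splitting the integrand at height \<open>l\<close> replaces Hoelder's inequality. For p
  > 1 a large \<open>l\<close> makes the second term small, after which a short distance handles the
  first.\<close>

lemma prim_modulus:
  assumes p: "1 \<le> p" and g: "g \<in> Lp_space p" "nrm p g \<le> B" and l: "l > 0" and xy: "x \<le> y"
  shows "\<bar>prim g y - prim g x\<bar> \<le> l * (y - x) + l powr (1 - p) * B powr p"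
proof -
  have pt: "t \<le> l + l powr (1 - p) * t powr p" if "t \<ge> 0" for t
  proof (cases "t \<le> l")
    case True then show ?thesis by (smt (verit) mult_nonneg_nonneg powr_ge_zero)
  next
    case False
    then have "l powr (1 - p) * t powr p = t * (t / l) powr (p - 1)"
      using l by (simp add: powr_divide powr_diff field_simps)
    moreover have "(t / l) powr (p - 1) \<ge> 1" using False l p by (intro ge_one_powr_ge_zero) (auto simp: field_simps)
    ultimately have "l powr (1 - p) * t powr p \<ge> t" using that by (simp add: mult_le_cancel_left1 mult_le_cancel_left2 mult_left_mono)
    then show ?thesis using l by linarith
  qed
  note gi = Lp_integrable(1)[OF p g(1)]
  have im: "(\<lambda>t. indicator {x<..y} t :: real) \<in> borel_measurable mu" by (intro borel_measurable_mu) auto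
  have ii: "integrable mu (\<lambda>t. indicator {x<..y} t :: real)"
    using integrable_mult_bounded[OF integrable_mu_const[of 1] im, of 1] by (auto simp: indicator_def)
  have "\<bar>prim g y - prim g x\<bar> \<le> (LINT t|mu. \<bar>g t\<bar> * indicator {x<..y} t)"
    by (rule prim_diff_le[OF gi xy])
  also have "\<dots> \<le> (LINT t|mu. l * indicator {x<..y} t + l powr (1 - p) * \<bar>g t\<bar> powr p)"
  proof (rule integral_mono)
    show "integrable mu (\<lambda>t. \<bar>g t\<bar> * indicator {x<..y} t)"
      by (rule integrable_mult_bounded[OF integrable_abs[OF gi] im, of 1]) (auto simp: indicator_def)
    show "integrable mu (\<lambda>t. l * indicator {x<..y} t + l powr (1 - p) * \<bar>g t\<bar> powr p)"
      using ii Lp_int[OF g(1)] by auto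
    show "\<bar>g t\<bar> * indicator {x<..y} t \<le> l * indicator {x<..y} t + l powr (1 - p) * \<bar>g t\<bar> powr p" for t
      using pt[of "\<bar>g t\<bar>"] by (auto simp: indicator_def)
  qed
  also have "\<dots> = l * (LINT t|mu. indicator {x<..y} t) + l powr (1 - p) * nrm p g powr p"
    using ii Lp_int[OF g(1)] p by (simp add: nrm_powr)
  also have "\<dots> \<le> l * (y - x) + l powr (1 - p) * B powr p"
  proof (intro add_mono mult_left_mono powr_mono2 g)
    have "(LINT t|mu. indicator {x<..y} t) = measure mu ({x<..y} \<inter> {0..1})"
      by simp
    also have "\<dots> = measure lebesgue ({x<..y} \<inter> {0..1})"
      by (subst measure_restrict_space) auto
    also have "\<dots> \<le> measure lebesgue {x<..y}"
      by (intro measure_mono_fmeasurable) (use xy in \<open>auto simp: fmeasurable_def\<close>)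
    also have "\<dots> = y - x" using xy by simp
    finally show "(LINT t|mu. indicator {x<..y} t) \<le> y - x" .
  qed (use l p in auto)
  finally show ?thesis .
qed

text \<open>Arzela-Ascoli for the continuous representatives \<open>k n + prim (g n)\<close>, with
  equicontinuity from \<open>prim_modulus\<close>. Continuity of the limit is recorded because
  \<open>exact\<close> needs an interval on which it is positive.\<close>

lemma weak_deriv_compactness:
  assumes p: "1 < p" and w: "\<And>n. has_weak_deriv (f n) (g n)" and g: "\<And>n. g n \<in> Lp_space p" "\<And>n. nrm p (g n) \<le> B"
    and f: "\<And>n. (LINT x|mu. \<bar>f n x\<bar>) \<le> A"
  obtains h r where "continuous_on {0..1} h" "strict_mono (r :: nat \<Rightarrow> nat)" "(\<lambda>n. LINT x|mu. \<bar>f (r n) x - h x\<bar>) \<longlonglongrightarrow> 0"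
proof -
  have p1: "1 \<le> p" using p by simp
  have B0: "0 \<le> B" using g(2)[of 0] nrm_nonneg[of p "g 0"] by linarith
  have "\<forall>n. \<exists>k. AE x in mu. f n x = k + prim (g n) x" using w by (auto simp: has_weak_deriv_iff)
  then obtain k where k: "\<And>n. AE x in mu. f n x = k n + prim (g n) x" by metis
  define F where "F n x = k n + prim (g n) x" for n x
  note gi = Lp_integrable[OF p1 g(1)]
  have fi: "integrable mu (f n)" for n by (rule has_weak_deriv_integrable(1)[OF w])
  have Fc: "continuous_on {0..1} (F n)" for n unfolding F_def by (intro continuous_intros continuous_on_prim gi)
  have pB: "\<bar>prim (g n) x\<bar> \<le> 2 * B" for n x
    using prim_abs_le[OF gi(1), of n x] gi(2)[of n] g(2)[of n] by linarith
  have kB: "\<bar>k n\<bar> \<le> A + 2 * B" for n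
  proof -
    have "\<bar>k n\<bar> = (LINT x|mu. \<bar>k n\<bar>)" by simp
    also have "\<dots> \<le> (LINT x|mu. \<bar>f n x\<bar> + 2 * B)"
    proof (rule integral_mono_AE)
      show "AE x in mu. \<bar>k n\<bar> \<le> \<bar>f n x\<bar> + 2 * B" using k[of n] by eventually_elim (use pB in \<open>smt (verit)\<close>)
    qed (use fi in auto)
    also have "\<dots> \<le> A + 2 * B" using fi f[of n] by simp
    finally show ?thesis .
  qed
  have FB: "norm (F n x) \<le> A + 4 * B" for n x
    using kB[of n] pB[of n x] by (simp add: F_def)
  have eq: "\<exists>d>0. \<forall>n y. y \<in> {0..1} \<and> norm (x - y) < d \<longrightarrow> norm (F n x - F n y) < e" if e: "e > 0" for x e :: real
  proof -
    have "((\<lambda>l. l powr (1 - p) * B powr p) \<longlongrightarrow> 0 * B powr p) at_top"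
      using p by (intro tendsto_intros tendsto_neg_powr filterlim_ident) auto
    then have "eventually (\<lambda>l. l powr (1 - p) * B powr p < e / 2) at_top"
      using e by (intro order_tendstoD(2)) auto
    then obtain l where l: "l > 0" "l powr (1 - p) * B powr p < e / 2"
      by (metis (mono_tags, lifting) eventually_at_top_dense gt_ex less_max_iff_disj max_less_iff_conj)
    show ?thesis
    proof (intro exI[of _ "e / (2 * l)"] conjI allI impI)
      show "0 < e / (2 * l)" using e l by simp
      fix n y assume y: "y \<in> {0..1} \<and> norm (x - y) < e / (2 * l)"
      have "\<bar>F n x - F n y\<bar> \<le> l * \<bar>x - y\<bar> + l powr (1 - p) * B powr p"
        using prim_modulus[OF p1 g l(1), of x y n] prim_modulus[OF p1 g l(1), of y x n]
        by (cases "x \<le> y") (auto simp: F_def abs_minus_commute)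
      moreover have "l * \<bar>x - y\<bar> < e / 2" using y l(1) by (auto simp: field_simps)
      ultimately show "norm (F n x - F n y) < e" using l(2) by simp
    qed
  qed
  obtain h r where h: "continuous_on {0..1} h" "strict_mono (r :: nat \<Rightarrow> nat)"
    "\<And>e. 0 < e \<Longrightarrow> \<exists>N. \<forall>n x. n \<ge> N \<and> x \<in> {0..1} \<longrightarrow> norm (F (r n) x - h x) < e"
    using Arzela_Ascoli[of "{0..1}" F "A + 4 * B"] FB eq by (metis compact_Icc)
  have hi: "integrable mu h" by (rule continuous_integrable_mu[OF h(1)])
  have Fi: "integrable mu (F n)" for n by (rule continuous_integrable_mu[OF Fc])
  have "(\<lambda>n. LINT x|mu. \<bar>f (r n) x - h x\<bar>) \<longlonglongrightarrow> 0"
  proof (rule LIMSEQ_I)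
    fix e :: real assume e: "e > 0"
    then obtain N where N: "\<And>n x. n \<ge> N \<Longrightarrow> x \<in> {0..1} \<Longrightarrow> norm (F (r n) x - h x) < e/2" using h(3)[of "e/2"] by auto
    show "\<exists>N. \<forall>n\<ge>N. norm ((LINT x|mu. \<bar>f (r n) x - h x\<bar>) - 0) < e"
    proof (intro exI allI impI)
      fix n assume n: "N \<le> n"
      have "(LINT x|mu. \<bar>f (r n) x - h x\<bar>) = (LINT x|mu. \<bar>F (r n) x - h x\<bar>)"
      proof (rule integral_cong_AE)
        show "AE x in mu. \<bar>f (r n) x - h x\<bar> = \<bar>F (r n) x - h x\<bar>"
          using k[of "r n"] by eventually_elim (simp add: F_def)
      qed (use fi hi Fi in auto)
      also have "\<dots> \<le> (LINT x|mu. e/2)"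
        using Fi hi N[OF n] by (intro integral_mono) (auto intro: less_imp_le)
      finally show "norm ((LINT x|mu. \<bar>f (r n) x - h x\<bar>) - 0) < e" using e by simp
    qed
  qed
  with h show thesis using that by blast
qed

subsection \<open>Sobolev spaces\<close>

lemma sobolev1_iff: "f \<in> sobolev_space 1 p \<longleftrightarrow> f \<in> Lp_space p \<and> (\<exists>g\<in>Lp_space p. has_weak_deriv f g)"
  by simp

lemma sobolev2_iff: "f \<in> sobolev_space 2 p \<longleftrightarrow> f \<in> Lp_space p \<and> (\<exists>g\<in>sobolev_space 1 p. has_weak_deriv f g)"
  by (simp add: numeral_2_eq_2)

lemma has_weak_deriv_Lp:
  assumes "p > 0" "has_weak_deriv f g"
  shows "f \<in> Lp_space p"
  using has_weak_deriv_sup_bound[OF assms(2)] assms has_weak_deriv_integrable[OF assms(2)]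
  by (intro Lp_bounded) auto

lemma sobolev1_I:
  assumes "p > 0" "has_weak_deriv f g" "g \<in> Lp_space p"
  shows "f \<in> sobolev_space 1 p"
  using has_weak_deriv_Lp[OF assms(1,2)] assms unfolding sobolev1_iff by blast

lemma W1p_norm_eq:
  assumes "p > 0" "has_weak_deriv f g" "g \<in> Lp_space p"
  shows "W1p_norm p f = ennreal (nrm p f + nrm p g)"
proof -
  have "weak_deriv f \<in> Lp_space p" "nrm p (weak_deriv f) = nrm p g"
    using Lp_cong[OF assms(1,3), of "weak_deriv f"] weak_deriv_AE[OF assms(2)]
    by (auto simp: has_weak_deriv_def)
  then show ?thesis using sobolev1_I[OF assms] has_weak_deriv_Lp[OF assms(1,2)]
    by (simp add: W1p_norm_def Lp_norm_nrm)
qed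

lemma sobolev1_cong:
  assumes "p > 0" "f \<in> sobolev_space 1 p" "AE x in mu. f' x = f x" "f' \<in> borel_measurable mu"
  shows "f' \<in> sobolev_space 1 p"
proof -
  from assms(2) obtain g where g: "has_weak_deriv f g" "g \<in> Lp_space p" unfolding sobolev1_iff by auto
  have "has_weak_deriv f' g" by (rule has_weak_deriv_cong[OF g(1) assms(3,4)]) (use g in \<open>auto dest: Lp_meas\<close>)
  then show ?thesis using g(2) assms(1) by (intro sobolev1_I)
qed

subsection \<open>Cusp maps and their transfer operators\<close>

text \<open>No map occurs here: every constant of the later inequalities is defined from these
  numbers alone, which is how uniformity in \<epsilon> is expressed. \<open>m\<close> and
  \<open>M\<close> stand for the lower and upper bounds of (A8).\<close>

locale cusp_params =
  fixes c \<beta> p \<theta> m M :: real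
  assumes c01: "0 < c" "c < 1" and beta: "-1 < \<beta>" "\<beta> < (1 - 2 * p) / (2 * p)"
    and p1: "1 < p" and theta: "1 < \<theta>" and m0: "0 < m" and M0: "0 < M"
begin

lemma p_beta: "2 * p * (1 + \<beta>) < 1"
proof -
  have "\<beta> * (2 * p) < 1 - 2 * p" using beta(2) p1 by (simp add: pos_less_divide_eq)
  then show ?thesis by (simp add: algebra_simps)
qed

lemma beta_half: "\<beta> < -1/2"
proof -
  have "1 * (1 + \<beta>) < p * (1 + \<beta>)" using p1 beta by (intro mult_strict_right_mono) auto
  then show ?thesis using p_beta by simp
qed

lemma p0: "0 < p" and pge1: "1 \<le> p" using p1 by auto

definition "D \<equiv> {0..1} - {c}"

lemma AE_D: "AE x in mu. x \<in> {0<..<1} - {c}"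
  using AE_mu_in AE_mu_neq[of c] by eventually_elim auto

lemma continuous_on_D_measurable:
  fixes f :: "real \<Rightarrow> real"
  assumes "continuous_on D f" shows "f \<in> borel_measurable mu"
proof -
  have Dl: "D \<in> sets lebesgue" by (simp add: D_def)
  have "f \<in> borel_measurable (lebesgue_on D)"
    by (rule continuous_imp_measurable_on_sets_lebesgue[OF assms Dl])
  then have "(\<lambda>x. if x \<in> D then f x else 0) \<in> borel_measurable mu"
    by (subst borel_measurable_if_lebesgue_on) (auto simp: D_def)
  moreover have "(\<lambda>x. if x = c then f c else 0) \<in> borel_measurable mu"
    by (intro borel_measurable_mu) auto
  ultimately have "(\<lambda>x. (if x \<in> D then f x else 0) + (if x = c then f c else 0)) \<in> borel_measurable mu"
    by (rule borel_measurable_add)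
  then show ?thesis
    by (rule measurable_cong[THEN iffD1, rotated]) (auto simp: D_def)
qed

text \<open>The antiderivative carries the sign of x - c and is continuous through the cusp because
  s + 1 > 0; nonnegativity upgrades the gauge integral to absolute integrability.\<close>

lemma rpow_integrable:
  assumes "s > -1" shows "integrable mu (\<lambda>x. \<bar>x - c\<bar> powr s)"
proof -
  define F where "F x = sgn (x - c) * \<bar>x - c\<bar> powr (s + 1) / (s + 1)" for x
  have d: "(F has_real_derivative \<bar>x - c\<bar> powr s) (at x)" if x: "x \<noteq> c" for x
  proof (cases "x < c")
    case True
    have "((\<lambda>x. - ((c - x) powr (s + 1) / (s + 1))) has_real_derivative \<bar>x - c\<bar> powr s) (at x)"
      using True assms by (auto intro!: derivative_eq_intros simp: powr_diff)
    then show ?thesis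
    proof (rule has_field_derivative_transform_within_open)
      show "open {..<c}" "x \<in> {..<c}" using True by auto
    qed (auto simp: F_def)
  next
    case False
    have "((\<lambda>x. (x - c) powr (s + 1) / (s + 1)) has_real_derivative \<bar>x - c\<bar> powr s) (at x)"
      using False x assms by (auto intro!: derivative_eq_intros simp: powr_diff)
    then show ?thesis
    proof (rule has_field_derivative_transform_within_open)
      show "open {c<..}" "x \<in> {c<..}" using False x by auto
    qed (auto simp: F_def)
  qed
  have "isCont F x" for x
  proof (cases "x = c")
    case False
    then show ?thesis using d DERIV_isCont by blast
  next
    case True
    have "((\<lambda>x. \<bar>x - c\<bar> powr (s + 1) / (s + 1)) \<longlongrightarrow> \<bar>c - c\<bar> powr (s + 1) / (s + 1)) (at c)"
      using assms by (intro tendsto_intros tendsto_powr2) auto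
    then have "((\<lambda>x. \<bar>x - c\<bar> powr (s + 1) / (s + 1)) \<longlongrightarrow> 0) (at c)" using assms by simp
    then have "(F \<longlongrightarrow> 0) (at c)"
      by (rule Lim_null_comparison[rotated]) (use assms in \<open>auto simp: F_def abs_mult sgn_real_def\<close>)
    then show ?thesis using True by (simp add: isCont_def F_def)
  qed
  then have "((\<lambda>x. \<bar>x - c\<bar> powr s) has_integral F 1 - F 0) {0..1}"
    using d unfolding has_real_derivative_iff_has_vector_derivative
    by (intro fundamental_theorem_of_calculus_interior_strong[of "{c}"] continuous_at_imp_continuous_on) auto
  then have "(\<lambda>x. \<bar>x - c\<bar> powr s) integrable_on {0..1}" by blast
  then have "(\<lambda>x. \<bar>x - c\<bar> powr s) absolutely_integrable_on {0..1}"
    by (rule nonnegative_absolutely_integrable_1) auto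
  then show ?thesis by (simp add: integrable_restrict_space set_integrable_def)
qed

lemma rpow_Lp:
  assumes "s * r > -1" shows "(\<lambda>x. C * \<bar>x - c\<bar> powr s) \<in> Lp_space r"
proof -
  have "integrable mu (\<lambda>x. \<bar>C\<bar> powr r * \<bar>x - c\<bar> powr (s * r))" using rpow_integrable[OF assms] by auto
  moreover have "\<bar>C * \<bar>x - c\<bar> powr s\<bar> powr r = \<bar>C\<bar> powr r * \<bar>x - c\<bar> powr (s * r)" for x
    by (simp add: abs_mult powr_mult powr_powr)
  moreover have "(\<lambda>x. C * \<bar>x - c\<bar> powr s) \<in> borel_measurable mu" by (intro borel_measurable_mu) measurable
  ultimately show ?thesis by (simp add: Lp_space_def)
qed

lemma rpow_le_1: "0 \<le> s \<Longrightarrow> x \<in> {0..1} \<Longrightarrow> \<bar>x - c\<bar> powr s \<le> 1"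
  using c01 by (intro powr_le1) auto

lemma rpow_tendsto_0: "0 < s \<Longrightarrow> ((\<lambda>x. C * \<bar>x - c\<bar> powr s) \<longlongrightarrow> 0) (at c)"
proof -
  assume s: "0 < s"
  have "((\<lambda>x. C * \<bar>x - c\<bar> powr s) \<longlongrightarrow> C * \<bar>c - c\<bar> powr s) (at c)"
    using s by (intro tendsto_intros tendsto_powr2) auto
  then show ?thesis using s by simp
qed

end

text \<open>A representative of the transfer operator fixed at every point. The end points and the
  cusp are left out of the fibre, since derivatives there are one-sided or junk.\<close>

definition PF :: "real \<Rightarrow> (real \<Rightarrow> real) \<Rightarrow> (real \<Rightarrow> real) \<Rightarrow> (real \<Rightarrow> real) \<Rightarrow> real \<Rightarrow> real" where
  "PF c T T1 f y = (\<Sum>x | x \<in> {0<..<1} - {c} \<and> T x = y. f x / \<bar>T1 x\<bar>)"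

locale cusp_map = cusp_params +
  fixes T T1 T2 T3 :: "real \<Rightarrow> real" and a :: real
  assumes T_maps: "T \<in> {0..1} \<rightarrow> {0..1}" and T_nonsing: "nonsingular T"
    and der: "\<And>x. x \<in> D \<Longrightarrow> (T has_real_derivative T1 x) (at x within {0..1})"
      "\<And>x. x \<in> D \<Longrightarrow> (T1 has_real_derivative T2 x) (at x within {0..1})"
      "\<And>x. x \<in> D \<Longrightarrow> (T2 has_real_derivative T3 x) (at x within {0..1})"
    and T3_cont: "continuous_on D T3"
    and inj: "inj_on T {0..<c}" "inj_on T {c<..1}"
    and T01: "T 0 = 0" "T 1 = 0" and Ta: "(T \<longlongrightarrow> a) (at c)"
    and T1_theta: "\<And>x. x \<in> D \<Longrightarrow> \<theta> \<le> \<bar>T1 x\<bar>"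
    and T1_lower: "\<And>x. x \<in> D \<Longrightarrow> m * \<bar>x - c\<bar> powr \<beta> \<le> \<bar>T1 x\<bar>"
    and T1_upper: "\<And>x. x \<in> D \<Longrightarrow> \<bar>T1 x\<bar> \<le> M * \<bar>x - c\<bar> powr \<beta>"
    and T2_upper: "\<And>x. x \<in> D \<Longrightarrow> \<bar>T2 x\<bar> \<le> M * \<bar>x - c\<bar> powr (\<beta> - 1)"
    and T3_upper: "\<And>x. x \<in> D \<Longrightarrow> \<bar>T3 x\<bar> \<le> M * \<bar>x - c\<bar> powr (\<beta> - 2)"
begin

abbreviation "P \<equiv> PF c T T1"

lemma der_int: assumes "x \<in> {0<..<1} - {c}"
  shows "(T has_real_derivative T1 x) (at x)" "(T1 has_real_derivative T2 x) (at x)" "(T2 has_real_derivative T3 x) (at x)"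
proof -
  have x: "x \<in> D" "x \<in> interior {0..1}" using assms by (auto simp: D_def)
  show "(T has_real_derivative T1 x) (at x)" "(T1 has_real_derivative T2 x) (at x)" "(T2 has_real_derivative T3 x) (at x)"
    using der[OF x(1)] at_within_interior[OF x(2)] by simp_all
qed

lemma cont_D: "continuous_on D T" "continuous_on D T1" "continuous_on D T2"
proof -
  have "continuous_on D f" if "\<And>x. x \<in> D \<Longrightarrow> (f has_real_derivative f' x) (at x within {0..1})" for f f'
    by (rule DERIV_continuous_on, rule DERIV_subset[OF that]) (auto simp: D_def)
  then show "continuous_on D T" "continuous_on D T1" "continuous_on D T2" using der by blast+
qed

lemma meas_D: "T1 \<in> borel_measurable mu" "T2 \<in> borel_measurable mu" "T3 \<in> borel_measurable mu"
  using continuous_on_D_measurable cont_D T3_cont by auto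

lemma T1_pos: "x \<in> D \<Longrightarrow> 0 < \<bar>T1 x\<bar>" "x \<in> D \<Longrightarrow> T1 x \<noteq> 0"
  using T1_theta[of x] theta by auto

lemma T_mu: "T \<in> measurable mu mu" using T_nonsing by (simp add: nonsingular_def)

section \<open>The sum over preimages and its pointwise algebra\<close>

lemma fib_sub: "\<exists>x1 x2. {x. x \<in> {0<..<1} - {c} \<and> T x = y} \<subseteq> {x1, x2}"
proof -
  have *: "\<exists>x1. {x \<in> B. T x = y} \<subseteq> {x1}" if "inj_on T B" for B
  proof (cases "\<exists>x\<in>B. T x = y")
    case True
    then obtain x1 where "x1 \<in> B" "T x1 = y" by blast
    then show ?thesis using inj_onD[OF that] by (intro exI[of _ x1]) auto
  qed auto
  have 1: "\<exists>x1. {x \<in> {0<..<c}. T x = y} \<subseteq> {x1}" and 2: "\<exists>x2. {x \<in> {c<..<1}. T x = y} \<subseteq> {x2}"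
    using c01 by (intro * inj_on_subset[OF inj(1)] inj_on_subset[OF inj(2)]; force)+
  have "{x. x \<in> {0<..<1} - {c} \<and> T x = y} \<subseteq> {x \<in> {0<..<c}. T x = y} \<union> {x \<in> {c<..<1}. T x = y}" by auto
  then show ?thesis using 1 2 by blast
qed

lemma fib_finite: "finite {x. x \<in> {0<..<1} - {c} \<and> T x = y}"
  using fib_sub[of y] finite_subset by blast

lemma P_add: "P (\<lambda>x. f x + g x) y = P f y + P g y"
  unfolding PF_def by (simp add: add_divide_distrib sum.distrib)

lemma P_diff: "P (\<lambda>x. f x - g x) y = P f y - P g y"
  unfolding PF_def by (simp add: diff_divide_distrib sum_subtractf)

lemma P_cmult: "P (\<lambda>x. k * f x) y = k * P f y"
  unfolding PF_def by (simp add: sum_distrib_left)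

lemma P_comp: "P (\<lambda>x. f x * g (T x)) y = P f y * g y"
  unfolding PF_def by (auto simp: sum_distrib_right intro!: sum.cong)

lemma P_mono:
  assumes "\<And>x. x \<in> {0<..<1} - {c} \<Longrightarrow> T x = y \<Longrightarrow> f x \<le> g x"
  shows "P f y \<le> P g y"
  unfolding PF_def using assms by (intro sum_mono divide_right_mono) auto

lemma P_nonneg: "(\<And>x. x \<in> {0<..<1} - {c} \<Longrightarrow> T x = y \<Longrightarrow> 0 \<le> f x) \<Longrightarrow> 0 \<le> P f y"
  unfolding PF_def by (intro sum_nonneg) auto

lemma P_abs: "\<bar>P f y\<bar> \<le> P (\<lambda>x. \<bar>f x\<bar>) y"
  unfolding PF_def by (rule order_trans[OF sum_abs]) simp

lemma P_pos:
  assumes "\<And>x. x \<in> {0<..<1} - {c} \<Longrightarrow> T x = y \<Longrightarrow> 0 \<le> f x" "x \<in> {0<..<1} - {c}" "T x = y" "0 < f x"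
  shows "0 < P f y"
  unfolding PF_def
proof (rule sum_pos2[of _ x])
  show "0 < f x / \<bar>T1 x\<bar>" using assms T1_pos[of x] by (simp add: D_def)
qed (use fib_finite assms in auto)

lemma P_tendsto:
  assumes "\<And>x. x \<in> {0<..<1} - {c} \<Longrightarrow> T x = y \<Longrightarrow> (\<lambda>n. f n x) \<longlonglongrightarrow> g x"
  shows "(\<lambda>n. P (f n) y) \<longlonglongrightarrow> P g y"
  unfolding PF_def divide_inverse using assms by (intro tendsto_intros) auto

section \<open>Conservation of integrals, null sets and duality\<close>

lemma mu_abs_integrable: "integrable mu f \<longleftrightarrow> f absolutely_integrable_on {0..1}" for f :: "real \<Rightarrow> real"
  by (simp add: integrable_restrict_space set_integrable_def)

text \<open>On an injective branch the sum has a single term, so the Jacobian cancels in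
  \<open>\<bar>T1 x\<bar> * g (T x) = f x\<close>. Off the image \<open>g\<close> is 0, hence it
  makes no difference whether one integrates over the image or over [0,1].\<close>

lemma branch_integral:
  assumes B: "B \<in> sets lebesgue" "B \<subseteq> {0<..<1} - {c}" "inj_on T B" and f: "integrable mu f"
  defines "g \<equiv> \<lambda>y. \<Sum>x | x \<in> B \<and> T x = y. f x / \<bar>T1 x\<bar>"
  shows "integrable mu g" "(LINT y|mu. g y) = integral B f"
proof -
  have gT: "\<bar>T1 x\<bar> * g (T x) = f x" if "x \<in> B" for x
  proof -
    have "{x'. x' \<in> B \<and> T x' = T x} = {x}" using that inj_onD[OF B(3)] by auto
    moreover have "x \<in> D" using that B(2) by (auto simp: D_def)
    then have "T1 x \<noteq> 0" by (rule T1_pos)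
    ultimately show ?thesis by (simp add: g_def)
  qed
  have Bs: "B \<subseteq> {0..1}" using B by auto
  have fB: "f absolutely_integrable_on B" using f B(1) Bs
    unfolding mu_abs_integrable by (rule set_integrable_subset)
  then have "(\<lambda>x. \<bar>T1 x\<bar> * g (T x)) absolutely_integrable_on B \<and> integral B (\<lambda>x. \<bar>T1 x\<bar> * g (T x)) = integral B f"
    using fB set_integrable_cong[where M=lebesgue and M'=lebesgue and A=B and A'=B, OF refl refl gT]
      Henstock_Kurzweil_Integration.integral_cong[where s=B, OF gT] by simp
  then have g: "g absolutely_integrable_on T ` B" "integral (T ` B) g = integral B f"
    by (subst (asm) has_absolute_integral_change_of_variables_1'[OF B(1) _ B(3)];
        use der_int(1) B(2) has_field_derivative_at_within in blast)+
  have g0: "g y = 0" if "y \<notin> T ` B" for y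
  proof -
    have "{x. x \<in> B \<and> T x = y} = {}" using that by auto
    then show ?thesis unfolding g_def by (simp only: sum.empty)
  qed
  have TB: "T ` B \<subseteq> {0..1}" using T_maps Bs by auto
  have *: "(\<lambda>y. if y \<in> S then g y else 0) = g" if "T ` B \<subseteq> S" for S
  proof
    fix y
    show "(if y \<in> S then g y else 0) = g y"
      using g0[of y] that by (cases "y \<in> S") auto
  qed
  note eq = *[OF subset_refl] *[OF TB]
  have "g absolutely_integrable_on UNIV"
    using g(1) absolutely_integrable_restrict_UNIV[of "T ` B" g] by (simp only: eq)
  then have "g absolutely_integrable_on {0..1}"
    using absolutely_integrable_restrict_UNIV[of "{0..1}" g] by (simp only: eq)
  then show gi: "integrable mu g" by (simp only: mu_abs_integrable)
  have "(LINT y|mu. g y) = integral {0..1} g" by (rule lebesgue_integral_eq_integral[OF gi]) auto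
  also have "\<dots> = integral UNIV g" using Henstock_Kurzweil_Integration.integral_restrict_UNIV[of "{0..1}" g] by (simp only: eq)
  also have "\<dots> = integral (T ` B) g" using Henstock_Kurzweil_Integration.integral_restrict_UNIV[of "T ` B" g] by (simp only: eq)
  finally show "(LINT y|mu. g y) = integral B f" using g by simp
qed

lemma P_integrable:
  assumes f: "integrable mu f"
  shows "integrable mu (P f)" "(LINT y|mu. P f y) = (LINT x|mu. f x)"
proof -
  let ?g = "\<lambda>B y. \<Sum>x | x \<in> B \<and> T x = y. f x / \<bar>T1 x\<bar>"
  have L: "integrable mu (?g {0<..<c})" "(LINT y|mu. ?g {0<..<c} y) = integral {0<..<c} f"
    by (rule branch_integral[OF _ _ inj_on_subset[OF inj(1)] f]; use c01 in force)+
  have R: "integrable mu (?g {c<..<1})" "(LINT y|mu. ?g {c<..<1} y) = integral {c<..<1} f"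
    by (rule branch_integral[OF _ _ inj_on_subset[OF inj(2)] f]; use c01 in force)+
  have eq: "P f = (\<lambda>y. ?g {0<..<c} y + ?g {c<..<1} y)"
  proof
    fix y
    have "{x. x \<in> {0<..<1} - {c} \<and> T x = y} = {x. x \<in> {0<..<c} \<and> T x = y} \<union> {x. x \<in> {c<..<1} \<and> T x = y}"
      using c01 by auto
    moreover have "finite {x. x \<in> {0<..<c} \<and> T x = y}"
      by (rule finite_subset[OF _ fib_finite[of y]]) (use c01 in force)
    moreover have "finite {x. x \<in> {c<..<1} \<and> T x = y}"
      by (rule finite_subset[OF _ fib_finite[of y]]) (use c01 in force)
    ultimately show "P f y = ?g {0<..<c} y + ?g {c<..<1} y"
      unfolding PF_def by (simp only: ) (rule sum.union_disjoint, assumption, assumption, force)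
  qed
  show "integrable mu (P f)" unfolding eq using L R by auto
  have fi: "f integrable_on {0..1}" using f by (simp add: integrable_on_lebesgue_on)
  have "(LINT y|mu. P f y) = integral {0<..<c} f + integral {c<..<1} f"
    unfolding eq using L R by simp
  also have "\<dots> = integral {0..c} f + integral {c..1} f"
    by (simp add: integral_open_interval_real)
  also have "\<dots> = integral {0..1} f"
    using c01 fi by (intro Henstock_Kurzweil_Integration.integral_combine) auto
  also have "\<dots> = (LINT x|mu. f x)" using f by (simp add: lebesgue_integral_eq_integral)
  finally show "(LINT y|mu. P f y) = (LINT x|mu. f x)" .
qed

lemma clamp_tendsto: "(\<lambda>n. max (- real n) (min (real n) t)) \<longlonglongrightarrow> t"
proof -
  obtain N where "\<bar>t\<bar> \<le> real N" using real_arch_simple by blast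
  then have "eventually (\<lambda>n. max (- real n) (min (real n) t) = t) sequentially"
    unfolding eventually_sequentially by (intro exI[of _ N]) auto
  then show ?thesis by (rule tendsto_eventually)
qed

lemma clamp_integrable: "f \<in> borel_measurable mu \<Longrightarrow> integrable mu (\<lambda>x. max (- real n) (min (real n) (f x)))"
  using integrable_mult_bounded[OF integrable_mu_const[of 1], of "\<lambda>x. max (- real n) (min (real n) (f x))" "real n"]
  by auto

lemma P_meas:
  assumes f: "f \<in> borel_measurable mu" shows "P f \<in> borel_measurable mu"
proof (rule borel_measurable_LIMSEQ_real)
  show "(\<lambda>n. P (\<lambda>x. max (- real n) (min (real n) (f x))) y) \<longlonglongrightarrow> P f y" for y
    by (intro P_tendsto clamp_tendsto)
  show "P (\<lambda>x. max (- real n) (min (real n) (f x))) \<in> borel_measurable mu" for n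
    using P_integrable(1)[OF clamp_integrable[OF f]] by auto
qed

text \<open>Truncations keep their integrals under \<open>P\<close>, and Fatou passes to the limit.
  This supplies integrability in \<open>is_transfer_unique\<close>, where \<open>f\<close> is only
  measurable.\<close>

lemma P_integrable_rev:
  assumes f: "f \<in> borel_measurable mu" "\<And>x. 0 \<le> f x" and Pf: "integrable mu (P f)"
  shows "integrable mu f"
proof -
  have "f \<in> Lp_space 1"
  proof (rule Lp_Fatou(1)[of 1 "\<lambda>n x. max (- real n) (min (real n) (f x))" "LINT y|mu. P f y"])
    fix n
    have i: "integrable mu (\<lambda>x. max (- real n) (min (real n) (f x)))" by (rule clamp_integrable[OF f(1)])
    show "(\<lambda>x. max (- real n) (min (real n) (f x))) \<in> Lp_space 1" using i by (simp add: Lp_1)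
    have nn: "0 \<le> max (- real n) (min (real n) (f x))" for x using f(2)[of x] by auto
    have "nrm 1 (\<lambda>x. max (- real n) (min (real n) (f x))) = (LINT x|mu. max (- real n) (min (real n) (f x)))"
      unfolding Lp_1(2) using nn by simp
    also have "\<dots> = (LINT y|mu. P (\<lambda>x. max (- real n) (min (real n) (f x))) y)"
      by (rule P_integrable(2)[OF i, symmetric])
    also have "\<dots> \<le> (LINT y|mu. P f y)"
    proof (rule integral_mono[OF P_integrable(1)[OF i] Pf], rule P_mono)
      fix x show "max (- real n) (min (real n) (f x)) \<le> f x" using f(2)[of x] by (simp add: max_def min_def)
    qed
    finally show "nrm 1 (\<lambda>x. max (- real n) (min (real n) (f x))) \<le> (LINT y|mu. P f y)" .
  qed (use f clamp_tendsto in auto)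
  then show ?thesis by (simp add: Lp_1)
qed

text \<open>\<open>P\<close> of the indicator of the exceptional null set has integral 0, yet it is
  positive at each \<open>y\<close> with a preimage in that set.\<close>

lemma P_AE:
  assumes "AE x in mu. Q x"
  shows "AE y in mu. \<forall>x \<in> {0<..<1} - {c}. T x = y \<longrightarrow> Q x"
proof -
  obtain N where N: "N \<in> null_sets mu" "{x \<in> space mu. \<not> Q x} \<subseteq> N"
    using assms by (auto elim!: AE_E simp: null_sets_def)
  let ?f = "indicator N :: real \<Rightarrow> real"
  have fi: "integrable mu ?f" using N(1) by (intro integrable_real_indicator) (auto simp: null_sets_def)
  have "N \<inter> {0..1} = N" using N(1) sets.sets_into_space[of N mu] by (auto simp: null_sets_def)
  then have "(LINT x|mu. ?f x) = 0" using N(1) by (auto simp: null_sets_def measure_def)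
  then have "(LINT y|mu. P ?f y) = 0" using P_integrable(2)[OF fi] by simp
  then have "AE y in mu. P ?f y = 0"
    using P_integrable(1)[OF fi] by (subst (asm) integral_nonneg_eq_0_iff_AE) (auto intro!: P_nonneg)
  then show ?thesis
  proof eventually_elim
    case (elim y)
    show ?case
    proof (intro ballI impI, rule ccontr)
      fix x assume x: "x \<in> {0<..<1} - {c}" "T x = y" "\<not> Q x"
      then have "x \<in> N" using N(2) by auto
      then have "0 < P ?f y" using x by (intro P_pos[of y ?f x]) auto
      then show False using elim by simp
    qed
  qed
qed

lemma P_mono_AE: "AE x in mu. f x \<le> g x \<Longrightarrow> AE y in mu. P f y \<le> P g y"
  by (drule P_AE, erule eventually_mono) (auto intro: P_mono)

lemma P_cong_AE: "AE x in mu. f x = g x \<Longrightarrow> AE y in mu. P f y = P g y"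
  by (drule P_AE, erule eventually_mono) (auto simp: PF_def intro!: sum.cong)

lemma P_contraction: "integrable mu f \<Longrightarrow> (LINT y|mu. \<bar>P f y\<bar>) \<le> (LINT x|mu. \<bar>f x\<bar>)"
proof -
  assume f: "integrable mu f"
  have "(LINT y|mu. \<bar>P f y\<bar>) \<le> (LINT y|mu. P (\<lambda>x. \<bar>f x\<bar>) y)"
    using P_integrable[OF f] P_integrable[OF integrable_abs[OF f]] by (intro integral_mono P_abs) auto
  also have "\<dots> = (LINT x|mu. \<bar>f x\<bar>)" by (rule P_integrable(2)[OF integrable_abs[OF f]])
  finally show ?thesis .
qed

lemma is_transfer_P:
  assumes "f \<in> borel_measurable mu" shows "is_transfer T f (P f)"
  unfolding is_transfer_def
proof (intro conjI ballI impI P_meas assms)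
  fix \<phi> assume i: "integrable mu (\<lambda>x. f x * \<phi> (T x))"
  have eq: "P (\<lambda>x. f x * \<phi> (T x)) = (\<lambda>y. P f y * \<phi> y)" by (intro ext P_comp)
  from P_integrable[OF i, unfolded eq] show "integrable mu (\<lambda>x. P f x * \<phi> x)"
    "(LINT x|mu. P f x * \<phi> x) = (LINT x|mu. f x * \<phi> (T x))"
    by simp_all
qed

text \<open>For measurable \<open>f\<close> the duality speaks only about those \<phi> whose
  composition with \<open>T\<close> has an integrable product with \<open>f\<close>. Restricting the
  sign of \<open>g - P f\<close> to the set where \<open>P\<close> of |f| is at most
  \<open>n\<close> achieves this, and these sets exhaust the interval.\<close>

lemma is_transfer_unique:
  assumes f: "f \<in> borel_measurable mu" and g: "is_transfer T f g"
  shows "AE y in mu. g y = P f y"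
proof -
  have gm: "g \<in> borel_measurable mu" using g by (simp add: is_transfer_def)
  have Pm: "P f \<in> borel_measurable mu" "P (\<lambda>x. \<bar>f x\<bar>) \<in> borel_measurable mu" using f by (auto intro!: P_meas)
  have *: "AE y in mu. P (\<lambda>x. \<bar>f x\<bar>) y \<le> real n \<longrightarrow> g y = P f y" for n
  proof -
    define \<phi> where "\<phi> y = (if P (\<lambda>x. \<bar>f x\<bar>) y \<le> real n then sgn (g y - P f y) else 0)" for y
    have phm: "\<phi> \<in> borel_measurable mu" unfolding \<phi>_def[abs_def] using Pm gm by measurable
    have phb: "\<bar>\<phi> y\<bar> \<le> 1" for y by (simp add: \<phi>_def abs_sgn_eq)
    have phL: "\<phi> \<in> Linf_space" using phm phb by (auto simp: Linf_space_def)
    have fm: "(\<lambda>x. f x * \<phi> (T x)) \<in> borel_measurable mu"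
      using f measurable_compose[OF T_mu phm] by simp
    have "integrable mu (\<lambda>x. \<bar>f x * \<phi> (T x)\<bar>)"
    proof (rule P_integrable_rev)
      show "(\<lambda>x. \<bar>f x * \<phi> (T x)\<bar>) \<in> borel_measurable mu" using fm by simp
      have eq: "P (\<lambda>x. \<bar>f x * \<phi> (T x)\<bar>) = (\<lambda>y. P (\<lambda>x. \<bar>f x\<bar>) y * \<bar>\<phi> y\<bar>)"
        unfolding abs_mult by (intro ext P_comp)
      have "\<bar>P (\<lambda>x. \<bar>f x\<bar>) y * \<bar>\<phi> y\<bar>\<bar> \<le> real n" for y
      proof (cases "P (\<lambda>x. \<bar>f x\<bar>) y \<le> real n")
        case True
        have nn: "0 \<le> P (\<lambda>x. \<bar>f x\<bar>) y" by (rule P_nonneg) simp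
        have "P (\<lambda>x. \<bar>f x\<bar>) y * \<bar>\<phi> y\<bar> \<le> real n * 1" using True phb nn by (intro mult_mono) auto
        then show ?thesis using nn by (simp add: abs_mult)
      qed (auto simp: \<phi>_def)
      then show "integrable mu (P (\<lambda>x. \<bar>f x * \<phi> (T x)\<bar>))"
      proof -
        assume le: "\<And>y. \<bar>P (\<lambda>x. \<bar>f x\<bar>) y * \<bar>\<phi> y\<bar>\<bar> \<le> real n"
        have "(\<lambda>y. P (\<lambda>x. \<bar>f x\<bar>) y * \<bar>\<phi> y\<bar>) \<in> borel_measurable mu"
          by (intro borel_measurable_times borel_measurable_abs Pm phm)
        from integrable_mult_bounded[OF integrable_mu_const[of 1] this, of "real n"] le
        show ?thesis unfolding eq by simp
      qed
    qed simp
    then have fi: "integrable mu (\<lambda>x. f x * \<phi> (T x))" using fm by (simp add: integrable_abs_iff)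
    have "integrable mu (\<lambda>x. g x * \<phi> x)" "integrable mu (\<lambda>x. P f x * \<phi> x)"
      "(LINT x|mu. g x * \<phi> x) = (LINT x|mu. P f x * \<phi> x)"
      using g is_transfer_P[OF f] phL fi by (auto simp: is_transfer_def)
    then have 1: "integrable mu (\<lambda>x. (g x - P f x) * \<phi> x)" "(LINT x|mu. (g x - P f x) * \<phi> x) = 0"
      by (auto simp: left_diff_distrib)
    have nn: "0 \<le> (g x - P f x) * \<phi> x" for x by (auto simp: \<phi>_def sgn_real_def)
    have "AE x in mu. (g x - P f x) * \<phi> x = 0" using 1 nn by (subst (asm) integral_nonneg_eq_0_iff_AE) auto
    then show ?thesis by eventually_elim (auto simp: \<phi>_def sgn_zero_iff)
  qed
  then have "AE y in mu. \<forall>n. P (\<lambda>x. \<bar>f x\<bar>) y \<le> real n \<longrightarrow> g y = P f y" by (subst AE_all_countable) blast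
  then show ?thesis
  proof eventually_elim
    case (elim y)
    obtain n where "P (\<lambda>x. \<bar>f x\<bar>) y \<le> real n" using real_arch_simple by blast
    then show ?case using elim by blast
  qed
qed

lemma transfer_op_P:
  assumes "f \<in> borel_measurable mu"
  shows "AE y in mu. transfer_op T f y = P f y" "transfer_op T f \<in> borel_measurable mu"
proof -
  have "is_transfer T f (transfer_op T f)"
    unfolding transfer_op_def by (rule someI[of "is_transfer T f", OF is_transfer_P[OF assms]])
  then show "AE y in mu. transfer_op T f y = P f y" "transfer_op T f \<in> borel_measurable mu"
    using is_transfer_unique[OF assms] by (auto simp: is_transfer_def)
qed

subsection \<open>The weak derivative of the transfer operator\<close>

lemma T1_integrable: "integrable mu T1"
proof (rule Bochner_Integration.integrable_bound)
  show "integrable mu (\<lambda>x. M * \<bar>x - c\<bar> powr \<beta>)" using rpow_integrable beta by auto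
  show "AE x in mu. norm (T1 x) \<le> norm (M * \<bar>x - c\<bar> powr \<beta>)"
    using AE_D
  proof eventually_elim
    case (elim x) then show ?case using T1_upper[of x] by (auto simp: D_def)
  qed
qed (rule meas_D)

text \<open>Integration by parts against \<open>\<phi> \<circ> T\<close>: the boundary terms at the end points vanish because
  \<open>T 0 = T 1 = 0\<close>, the one at the cusp because the primitive is normalised to vanish there.\<close>

lemma has_weak_deriv_P_prim:
  assumes g: "integrable mu \<gamma>"
  defines "G \<equiv> \<lambda>x. prim \<gamma> x - prim \<gamma> c"
  shows "integrable mu (\<lambda>x. T1 x * G x)" "has_weak_deriv (P (\<lambda>x. T1 x * G x)) (P \<gamma>)"
proof -
  \<comment> \<open>Integrating \<gamma> against this kernel gives \<open>G\<close>, the primitive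
    normalised at the cusp.\<close>
  let ?k = "\<lambda>x t. indicator {..x} t - indicator {..c} t :: real"
  have km: "case_prod ?k \<in> borel_measurable (borel \<Otimes>\<^sub>M borel)"
    unfolding indicator_def of_bool_def split_beta' atMost_iff by measurable
  have kB: "\<bar>?k x t\<bar> \<le> 1" for x t by (auto simp: indicator_def)
  have Gk: "(LINT t|mu. \<gamma> t * ?k x t) = G x" for x
    using integrable_mult_ind[OF g] by (simp add: right_diff_distrib G_def prim_def)
  show TG: "integrable mu (\<lambda>x. T1 x * G x)"
    using Fubini_kernel(2)[OF T1_integrable g km kB] by (simp add: Gk)
  show "has_weak_deriv (P (\<lambda>x. T1 x * G x)) (P \<gamma>)"
    unfolding has_weak_deriv_def
  proof (intro conjI allI impI P_integrable(1) TG g)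
    fix \<phi> assume t: "test_function \<phi>"
    note F = test_function_facts[OF t]
    note D' = diff_times_DERIV[OF F(1)]
    have dL: "deriv \<phi> \<in> Linf_space" by (rule continuous_Linf[OF D'(3)])
    let ?u = "\<lambda>x. T1 x * deriv \<phi> (T x)"
    have ui: "integrable mu ?u" by (rule integrable_mult_Linf[OF T1_integrable Linf_compose[OF T_nonsing dL]])
    have pu: "prim ?u t = \<phi> (T t)" if t: "t \<in> D" for t
    proof -
      \<comment> \<open>The arbitrary value \<open>T c\<close> is replaced by the limit
        \<open>a\<close>, which makes the composition continuous on the whole interval.\<close>
      define S where "S x = \<phi> (if x = c then a else T x)" for x
      have "S t = S 0 + prim ?u t"
      proof (rule prim_eqI[OF ui, of _ "{c}"])
        show "continuous_on {0..1} S" unfolding S_def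
        proof (rule continuous_on_compose2[of UNIV \<phi>])
          show "continuous_on {0..1} (\<lambda>x. if x = c then a else T x)"
            unfolding continuous_on_eq_continuous_within
          proof
            fix x :: real assume x: "x \<in> {0..1}"
            show "continuous (at x within {0..1}) (\<lambda>x. if x = c then a else T x)"
            proof (cases "x = c")
              case True
              have "((\<lambda>x. if x = c then a else T x) \<longlongrightarrow> a) (at c within {0..1})"
                by (rule Lim_transform_eventually[OF tendsto_within_subset[OF Ta, of "{0..1}"]])
                   (auto simp: eventually_at_filter)
              then show ?thesis using True by (simp add: continuous_within)
            next
              case False
              then have "(T has_real_derivative T1 x) (at x within {0..1})" using der x by (auto simp: D_def)
              then have "(T \<longlongrightarrow> T x) (at x within {0..1})"
                using DERIV_continuous continuous_within by blast
              moreover have "\<forall>\<^sub>F y in at x within {0..1}. T y = (if y = c then a else T y)"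
                unfolding eventually_at_filter using t1_space_nhds[OF False] by eventually_elim auto
              ultimately have "((\<lambda>x. if x = c then a else T x) \<longlongrightarrow> T x) (at x within {0..1})"
                by (rule Lim_transform_eventually)
              then show ?thesis using False by (simp add: continuous_within)
            qed
          qed
        qed (use D' in auto)
        fix x assume x: "x \<in> {0<..<1} - {c}"
        have "((\<lambda>x. \<phi> (T x)) has_real_derivative deriv \<phi> (T x) * T1 x) (at x)"
          by (rule DERIV_chain2[OF D'(1) der_int(1)[OF x]])
        then have "(S has_real_derivative deriv \<phi> (T x) * T1 x) (at x)"
        proof (rule has_field_derivative_transform_within_open)
          show "open (-{c})" "x \<in> -{c}" using x by auto
        qed (auto simp: S_def)
        then show "(S has_real_derivative T1 x * deriv \<phi> (T x)) (at x)" by (simp add: mult.commute)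
      qed (use t in \<open>auto simp: D_def\<close>)
      then show ?thesis using t c01 T01 F by (auto simp: S_def D_def)
    qed
    have inner: "(LINT x|mu. ?u x * ?k x t) = - \<phi> (T t)" if t: "t \<in> D" for t
    proof (cases "t < c")
      case True
      have "(LINT x|mu. ?u x * ?k x t) = (LINT x|mu. - (?u x * indicator {..<t} x))"
        by (intro Bochner_Integration.integral_cong) (use True in \<open>auto simp: indicator_def\<close>)
      also have "\<dots> = - prim ?u t" by (simp add: prim_less[OF ui])
      finally show ?thesis using pu[OF t] by simp
    next
      case False
      then have tc: "t > c" using t by (auto simp: D_def)
      have "(LINT x|mu. ?u x * ?k x t) = (LINT x|mu. ?u x - ?u x * indicator {..<t} x)"
        by (intro Bochner_Integration.integral_cong) (use tc in \<open>auto simp: indicator_def\<close>)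
      also have "\<dots> = prim ?u 1 - prim ?u t"
        unfolding prim_1 prim_less[OF ui, of t] by (rule Bochner_Integration.integral_diff[OF ui integrable_mult_ind(2)[OF ui]])
      finally show ?thesis using pu[OF t] pu[of 1] T01 F c01 by (simp add: D_def)
    qed
    have "(LINT x|mu. P (\<lambda>x. T1 x * G x) x * deriv \<phi> x) = (LINT x|mu. (T1 x * G x) * deriv \<phi> (T x))"
      using is_transfer_P[of "\<lambda>x. T1 x * G x"] TG dL integrable_mult_Linf[OF TG Linf_compose[OF T_nonsing dL]]
      by (auto simp: is_transfer_def)
    also have "\<dots> = (LINT x|mu. ?u x * (LINT t|mu. \<gamma> t * ?k x t))" unfolding Gk by (simp add: mult_ac)
    also have "\<dots> = (LINT t|mu. \<gamma> t * (LINT x|mu. ?u x * ?k x t))" by (rule Fubini_kernel(1)[OF ui g km kB])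
    also have "\<dots> = (LINT t|mu. - (\<gamma> t * \<phi> (T t)))"
    proof (rule integral_cong_AE)
      show "AE t in mu. \<gamma> t * (LINT x|mu. ?u x * ?k x t) = - (\<gamma> t * \<phi> (T t))"
        using AE_D
      proof eventually_elim
        case (elim t) then show ?case using inner[of t] by (auto simp: D_def)
      qed
      show "(\<lambda>t. \<gamma> t * (LINT x|mu. ?u x * ?k x t)) \<in> borel_measurable mu"
      proof -
        have km': "case_prod (\<lambda>t x. ?k x t) \<in> borel_measurable (borel \<Otimes>\<^sub>M borel)"
          unfolding indicator_def of_bool_def split_beta' atMost_iff by measurable
        show ?thesis using Fubini_kernel(2)[OF g ui km'] kB by (auto intro: borel_measurable_integrable)
      qed
      show "(\<lambda>t. - (\<gamma> t * \<phi> (T t))) \<in> borel_measurable mu"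
        using integrable_mult_Linf[OF g Linf_compose[OF T_nonsing F(4)]] by auto
    qed
    also have "\<dots> = - (LINT t|mu. \<gamma> t * \<phi> (T t))" by simp
    also have "(LINT t|mu. \<gamma> t * \<phi> (T t)) = (LINT x|mu. P \<gamma> x * \<phi> x)"
      using is_transfer_P[of \<gamma>] g F(4) integrable_mult_Linf[OF g Linf_compose[OF T_nonsing F(4)]]
      by (auto simp: is_transfer_def)
    finally show "(LINT x|mu. P (\<lambda>x. T1 x * G x) x * deriv \<phi> x) = - (LINT x|mu. P \<gamma> x * \<phi> x)" .
  qed
qed

end

subsection \<open>Lasota--Yorke inequalities\<close>

lemma AE_mu_interval:
  assumes "AE x in mu. Q x" "0 \<le> a" "a < b" "b \<le> 1"
  obtains x where "a < x" "x < b" "Q x"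
proof -
  have "\<exists>x. a < x \<and> x < b \<and> Q x"
  proof (rule ccontr)
    assume n: "\<not> ?thesis"
    have "(LINT x|mu. indicator {a<..<b} x :: real) = (LINT x|mu. 0)"
    proof (rule integral_cong_AE)
      show "AE x in mu. (indicator {a<..<b} x :: real) = 0" using assms(1)
        by eventually_elim (use n in \<open>auto simp: indicator_def\<close>)
      show "(\<lambda>x. indicator {a<..<b} x :: real) \<in> borel_measurable mu" by (rule borel_measurable_mu) auto
    qed auto
    moreover have "(LINT x|mu. indicator {a<..<b} x :: real) = measure mu {a<..<b}"
      using assms by (simp add: Int_absorb2 subset_iff)
    moreover have "measure mu {a<..<b} = b - a"
      using assms by (subst measure_restrict_space) (auto simp: subset_iff)
    ultimately show False using assms by simp
  qed
  then show thesis using that by blast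
qed

context cusp_params
begin

text \<open>The coefficients of \<open>f\<close> in the first and the second derivative of \<open>P f\<close> are \<open>om = (1/T')'\<close>
  and \<open>sig = (om / T')'\<close>. They are dominated by \<open>Om\<close> and \<open>Om2\<close>, which lie in $L^p$
  because \<open>2 * p * (1 + \<beta>) < 1\<close>.\<close>

definition "Om x = M / m\<^sup>2 * \<bar>x - c\<bar> powr (-1 - \<beta>)"
definition "Ct = M / m ^ 3"
definition "C1 = M / m\<^sup>2 + 2 * M\<^sup>2 / m ^ 3"
definition "Om2 x = (C1 / m + (M / m\<^sup>2)\<^sup>2) * \<bar>x - c\<bar> powr (-2 - 2 * \<beta>)"

lemma Om_Lp: "Om \<in> Lp_space p" and Om2_Lp: "Om2 \<in> Lp_space p"
proof -
  have "- 1 - \<beta> \<ge> -2 - 2 * \<beta>" using beta by simp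
  moreover have "(-2 - 2 * \<beta>) * p > -1" using p_beta by (simp add: algebra_simps)
  ultimately have "(- 1 - \<beta>) * p > -1" "(-2 - 2 * \<beta>) * p > -1"
    using mult_right_mono[of "-2 - 2 * \<beta>" "-1 - \<beta>" p] p0 by linarith+
  then show "Om \<in> Lp_space p" "Om2 \<in> Lp_space p"
    unfolding Om_def[abs_def] Om2_def[abs_def] by (intro rpow_Lp; simp)+
qed

lemma Om_nonneg: "0 \<le> Om x" and Om2_nonneg: "0 \<le> Om2 x"
  using m0 M0 by (auto simp: Om_def Om2_def C1_def)

lemma Om_int: "integrable mu Om" and Om2_int: "integrable mu Om2"
  using Lp_integrable(1)[OF pge1] Om_Lp Om2_Lp by auto

text \<open>Cutting \<open>Om\<close> at height \<open>KL\<close> leaves a part of small integral, whence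
  \<open>\<parallel>(P f)'\<parallel>\<^sub>1 \<le> kap \<parallel>f'\<parallel>\<^sub>1 + KK \<parallel>f\<parallel>\<^sub>1\<close>; iterating from \<open>f = 1\<close> bounds all \<open>P\<^sup>n 1\<close> by \<open>K2\<close>.
  Adding \<open>BB\<close> times the $L^1$ norm to an equivalent $L^p$ norm gives a norm \<open>V\<close> with
  \<open>V ((P f)') \<le> lam V (f') + RR \<parallel>f\<parallel>\<^sub>1\<close>, where \<open>BB\<close> is chosen to absorb the $L^1$ norm of \<open>f'\<close>.\<close>

definition "kap = (1 + 1 / \<theta>) / 2"
definition "KL = (SOME K. 0 \<le> K \<and> (LINT x|mu. max (Om x - K) 0) \<le> (1 - 1 / \<theta>) / 2)"
definition "KK = KL + 1"
definition "K1 = KK / (1 - kap)"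
definition "K2 = K1 + 1"
definition "QQ = K2 * nrm p Om"
definition "BB = 2 * (QQ + 1) / (1 - kap)"
definition "lam = (1 + kap) / 2"
definition "RR = QQ + BB * KK"
definition "R1 = RR / (1 - lam)"

lemma kap: "1 / \<theta> \<le> kap" "kap < 1" "0 < kap" and lam: "kap < lam" "lam < 1" "0 < lam"
  using theta by (auto simp: kap_def lam_def field_simps)

lemma Om_trunc_int: "0 \<le> K \<Longrightarrow> integrable mu (\<lambda>x. max (Om x - K) 0)"
  by (rule Bochner_Integration.integrable_bound[OF Om_int])
     (use Om_int Om_nonneg in \<open>auto intro!: AE_I2 borel_measurable_max simp: max_def\<close>)

lemma KL: "0 \<le> KL" "(LINT x|mu. max (Om x - KL) 0) \<le> (1 - 1 / \<theta>) / 2"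
proof -
  have "(\<lambda>n. LINT x|mu. max (Om x - real n) 0) \<longlonglongrightarrow> (LINT x|mu. 0)"
  proof (rule integral_dominated_convergence)
    show "AE x in mu. (\<lambda>n. max (Om x - real n) 0) \<longlonglongrightarrow> 0"
    proof (rule AE_I2)
      fix x
      obtain N where "Om x \<le> real N" using real_arch_simple by blast
      then have "eventually (\<lambda>n. max (Om x - real n) 0 = 0) sequentially"
        unfolding eventually_sequentially by (intro exI[of _ N]) auto
      then show "(\<lambda>n. max (Om x - real n) 0) \<longlonglongrightarrow> 0" by (rule tendsto_eventually)
    qed
    show "AE x in mu. norm (max (Om x - real n) 0) \<le> Om x" for n using Om_nonneg by (auto simp: max_def)
  qed (use Om_int Om_trunc_int in \<open>auto intro: borel_measurable_integrable\<close>)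
  moreover have "0 < (1 - 1 / \<theta>) / 2" using theta by simp
  ultimately have "eventually (\<lambda>n. (LINT x|mu. max (Om x - real n) 0) < (1 - 1 / \<theta>) / 2) sequentially"
    by (intro order_tendstoD(2)) auto
  then obtain n where "(LINT x|mu. max (Om x - real n) 0) < (1 - 1 / \<theta>) / 2" by (auto simp: eventually_sequentially)
  then have "\<exists>K. 0 \<le> K \<and> (LINT x|mu. max (Om x - K) 0) \<le> (1 - 1 / \<theta>) / 2" by (intro exI[of _ "real n"]) auto
  then have "0 \<le> KL \<and> (LINT x|mu. max (Om x - KL) 0) \<le> (1 - 1 / \<theta>) / 2" unfolding KL_def by (rule someI_ex)
  then show "0 \<le> KL" "(LINT x|mu. max (Om x - KL) 0) \<le> (1 - 1 / \<theta>) / 2" by auto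
qed

lemma const_bounds: "1 \<le> KK" "0 \<le> K1" "1 \<le> K2" "0 \<le> QQ" "1 \<le> BB" "0 \<le> RR" "0 \<le> R1"
proof -
  show KK: "1 \<le> KK" using KL by (simp add: KK_def)
  show K1: "0 \<le> K1" using KK kap by (simp add: K1_def)
  then show K2: "1 \<le> K2" by (simp add: K2_def)
  then show Q: "0 \<le> QQ" by (simp add: QQ_def)
  show B: "1 \<le> BB" using Q kap unfolding BB_def by (subst le_divide_eq) auto
  show R: "0 \<le> RR" unfolding RR_def using Q B KK by (intro add_nonneg_nonneg mult_nonneg_nonneg) auto
  then show "0 \<le> R1" using lam by (simp add: R1_def)
qed

end

context cusp_map
begin

text \<open>The value \<open>0\<close> at the cusp, where \<open>T1 c\<close> is junk, makes \<open>1/T'\<close> continuous.\<close>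

definition "rho x = (if x = c then 0 else 1 / T1 x)"
definition "om x = - T2 x / (T1 x)\<^sup>2"
definition "om1 x = - T3 x / (T1 x)\<^sup>2 + 2 * (T2 x)\<^sup>2 / (T1 x) ^ 3"

lemma rho_le: "\<bar>rho x\<bar> \<le> 1 / \<theta>" "\<bar>rho x\<bar> \<le> 1 / m * \<bar>x - c\<bar> powr (- \<beta>)" if "x \<in> {0..1}"
proof -
  show "\<bar>rho x\<bar> \<le> 1 / \<theta>" using T1_theta[of x] that theta
    by (cases "x = c") (auto simp: rho_def D_def intro!: divide_left_mono mult_pos_pos)
  show "\<bar>rho x\<bar> \<le> 1 / m * \<bar>x - c\<bar> powr (- \<beta>)"
  proof (cases "x = c")
    case True then show ?thesis using m0 by (simp add: rho_def)
  next
    case False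
    then have "\<bar>rho x\<bar> = 1 / \<bar>T1 x\<bar>" by (simp add: rho_def)
    also have "\<dots> \<le> 1 / (m * \<bar>x - c\<bar> powr \<beta>)"
      using T1_lower[of x] that False m0 T1_pos[of x] by (intro divide_left_mono mult_pos_pos) (auto simp: D_def)
    finally show ?thesis by (simp add: powr_minus_divide)
  qed
qed

lemma T1_pow: "x \<in> D \<Longrightarrow> (m * \<bar>x - c\<bar> powr \<beta>) ^ k \<le> \<bar>T1 x\<bar> ^ k" "x \<in> D \<Longrightarrow> 0 < (m * \<bar>x - c\<bar> powr \<beta>) ^ k"
  using T1_lower[of x] m0 by (auto intro!: power_mono simp: D_def)

lemma powr_pow: "x \<in> D \<Longrightarrow> (m * \<bar>x - c\<bar> powr \<beta>) ^ k = m ^ k * \<bar>x - c\<bar> powr (real k * \<beta>)"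
  by (simp add: power_mult_distrib powr_power D_def mult.commute)

lemma quot_bound:
  assumes "x \<in> D" "\<bar>A\<bar> \<le> C * \<bar>x - c\<bar> powr s" "0 \<le> C"
  shows "\<bar>A / T1 x ^ k\<bar> \<le> C / m ^ k * \<bar>x - c\<bar> powr (s - real k * \<beta>)"
proof -
  have "\<bar>A / T1 x ^ k\<bar> = \<bar>A\<bar> / \<bar>T1 x\<bar> ^ k" by (simp add: power_abs)
  also have "\<dots> \<le> (C * \<bar>x - c\<bar> powr s) / (m * \<bar>x - c\<bar> powr \<beta>) ^ k"
    using T1_pow[OF assms(1), of k] assms by (intro frac_le) auto
  also have "\<dots> = C / m ^ k * \<bar>x - c\<bar> powr (s - real k * \<beta>)"
    using assms(1) by (simp add: powr_pow powr_diff)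
  finally show ?thesis .
qed

lemma om_le: assumes "x \<in> D" shows "\<bar>om x\<bar> \<le> Om x"
  using quot_bound[OF assms T2_upper[OF assms], of 2] M0 by (simp add: om_def Om_def algebra_simps)

lemma om1_le: assumes "x \<in> D" shows "\<bar>om1 x\<bar> \<le> C1 * \<bar>x - c\<bar> powr (-2 - \<beta>)"
proof -
  have 1: "\<bar>- T3 x / (T1 x)\<^sup>2\<bar> \<le> M / m\<^sup>2 * \<bar>x - c\<bar> powr (-2 - \<beta>)"
  proof -
    have e: "\<beta> - 2 - real 2 * \<beta> = - 2 - \<beta>" by simp
    have "\<bar>- T3 x\<bar> \<le> M * \<bar>x - c\<bar> powr (\<beta> - 2)" using T3_upper[OF assms] by simp
    from quot_bound[OF assms this, of 2] M0 show ?thesis unfolding e by linarith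
  qed
  have "\<bar>T2 x\<bar> ^ 2 \<le> (M * \<bar>x - c\<bar> powr (\<beta> - 1)) ^ 2" using T2_upper[OF assms] by (intro power_mono) auto
  also have "\<dots> = M\<^sup>2 * \<bar>x - c\<bar> powr (2 * \<beta> - 2)"
    using assms by (simp add: power_mult_distrib powr_power D_def algebra_simps)
  finally have "\<bar>2 * (T2 x)\<^sup>2\<bar> \<le> (2 * M\<^sup>2) * \<bar>x - c\<bar> powr (2 * \<beta> - 2)" by simp
  from quot_bound[OF assms this, of 3] have "\<bar>2 * (T2 x)\<^sup>2 / T1 x ^ 3\<bar> \<le> 2 * M\<^sup>2 / m ^ 3 * \<bar>x - c\<bar> powr (2 * \<beta> - 2 - real 3 * \<beta>)" by simp
  moreover have "2 * \<beta> - 2 - real 3 * \<beta> = - 2 - \<beta>" by simp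
  ultimately have 2: "\<bar>2 * (T2 x)\<^sup>2 / T1 x ^ 3\<bar> \<le> 2 * M\<^sup>2 / m ^ 3 * \<bar>x - c\<bar> powr (-2 - \<beta>)" by (simp only:)
  have "\<bar>om1 x\<bar> \<le> \<bar>- T3 x / (T1 x)\<^sup>2\<bar> + \<bar>2 * (T2 x)\<^sup>2 / T1 x ^ 3\<bar>" unfolding om1_def by (rule abs_triangle_ineq)
  also have "\<dots> \<le> M / m\<^sup>2 * \<bar>x - c\<bar> powr (-2 - \<beta>) + 2 * M\<^sup>2 / m ^ 3 * \<bar>x - c\<bar> powr (-2 - \<beta>)" using 1 2 by linarith
  finally show ?thesis by (simp add: C1_def distrib_right)
qed

text \<open>Half the derivative of the square of 1/T'. While \<open>om\<close> may blow up at the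
  cusp, \<open>tau\<close> is bounded by a positive power of the distance to it, because \<beta> <
  -1/2; \<open>sig\<close> is its derivative.\<close>

definition "tau x = rho x * om x"
definition "sig x = om1 x * rho x + om x * om x"

lemma tau_le: assumes "x \<in> D" shows "\<bar>tau x\<bar> \<le> Ct * \<bar>x - c\<bar> powr (-1 - 2 * \<beta>)" "\<bar>tau x\<bar> \<le> Ct"
proof -
  have "\<bar>tau x\<bar> = \<bar>rho x\<bar> * \<bar>om x\<bar>" by (simp add: tau_def abs_mult)
  also have "\<dots> \<le> (1 / m * \<bar>x - c\<bar> powr (- \<beta>)) * Om x"
    using rho_le(2)[of x] om_le[OF assms] assms Om_nonneg m0 by (intro mult_mono) (auto simp: D_def)
  also have "\<dots> = Ct * (\<bar>x - c\<bar> powr (- \<beta>) * \<bar>x - c\<bar> powr (-1 - \<beta>))"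
    by (simp add: Om_def Ct_def power2_eq_square power3_eq_cube mult_ac)
  also have "\<dots> = Ct * \<bar>x - c\<bar> powr (-1 - 2 * \<beta>)"
  proof -
    have e: "- \<beta> + (- 1 - \<beta>) = - 1 - 2 * \<beta>" by simp
    show ?thesis unfolding powr_add[symmetric] e ..
  qed
  finally show *: "\<bar>tau x\<bar> \<le> Ct * \<bar>x - c\<bar> powr (-1 - 2 * \<beta>)" .
  have "Ct * \<bar>x - c\<bar> powr (-1 - 2 * \<beta>) \<le> Ct * 1"
    using M0 m0 rpow_le_1[of "-1 - 2 * \<beta>" x] beta_half assms by (intro mult_left_mono) (auto simp: Ct_def D_def)
  with * show "\<bar>tau x\<bar> \<le> Ct" by simp
qed

lemma sig_le: assumes "x \<in> D" shows "\<bar>sig x\<bar> \<le> Om2 x"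
proof -
  have C1: "0 \<le> C1" using m0 M0 by (simp add: C1_def)
  have "\<bar>sig x\<bar> \<le> \<bar>om1 x\<bar> * \<bar>rho x\<bar> + \<bar>om x\<bar> * \<bar>om x\<bar>" unfolding sig_def abs_mult[symmetric] by (rule abs_triangle_ineq)
  also have "\<dots> \<le> (C1 * \<bar>x - c\<bar> powr (-2 - \<beta>)) * (1 / m * \<bar>x - c\<bar> powr (- \<beta>)) + Om x * Om x"
    using om1_le[OF assms] rho_le(2)[of x] om_le[OF assms] assms Om_nonneg C1
    by (intro add_mono mult_mono) (auto simp: D_def)
  also have "\<dots> = C1 / m * (\<bar>x - c\<bar> powr (-2 - \<beta>) * \<bar>x - c\<bar> powr (- \<beta>))
      + (M / m\<^sup>2)\<^sup>2 * (\<bar>x - c\<bar> powr (-1 - \<beta>) * \<bar>x - c\<bar> powr (-1 - \<beta>))"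
    by (simp add: Om_def power2_eq_square mult_ac)
  also have "\<dots> = Om2 x"
  proof -
    have e: "- 2 - \<beta> + - \<beta> = - 2 - 2 * \<beta>" "- 1 - \<beta> + (- 1 - \<beta>) = - 2 - 2 * \<beta>" by simp_all
    show ?thesis unfolding Om2_def powr_add[symmetric] e by (simp add: distrib_right)
  qed
  finally show ?thesis .
qed

lemma meas_om: "rho \<in> borel_measurable mu" "om \<in> borel_measurable mu" "om1 \<in> borel_measurable mu" "tau \<in> borel_measurable mu" "sig \<in> borel_measurable mu"
proof -
  have "(\<lambda>x. x) \<in> measurable mu borel" by (rule mu_id_borel)
  then show 1: "rho \<in> borel_measurable mu" unfolding rho_def[abs_def] using meas_D by measurable
  show 2: "om \<in> borel_measurable mu" "om1 \<in> borel_measurable mu" unfolding om_def[abs_def] om1_def[abs_def] using meas_D by measurable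
  show "tau \<in> borel_measurable mu" "sig \<in> borel_measurable mu" unfolding tau_def[abs_def] sig_def[abs_def] using 1 2 by measurable
qed

lemma AE_le_D: "(\<And>x. x \<in> D \<Longrightarrow> Q x) \<Longrightarrow> AE x in mu. Q x"
  using AE_D by (rule eventually_mono) (auto simp: D_def)

lemma dominated_by:
  fixes f B :: "real \<Rightarrow> real"
  assumes "integrable mu B" "f \<in> borel_measurable mu" "\<And>x. x \<in> D \<Longrightarrow> \<bar>f x\<bar> \<le> B x"
  shows "integrable mu f"
proof (rule Bochner_Integration.integrable_bound[OF assms(1,2)])
  show "AE x in mu. norm (f x) \<le> norm (B x)"
    by (rule AE_le_D) (use assms(3) in \<open>force intro: order_trans\<close>)
qed

text \<open>The bound by a positive power forces the limit 0 at \<open>c\<close>, so the function is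
  continuous on [0,1] and a merely integrable derivative off the cusp is its weak
  derivative.\<close>

lemma has_weak_deriv_off_cusp:
  assumes der: "\<And>x. x \<in> {0<..<1} - {c} \<Longrightarrow> (f has_real_derivative g x) (at x)"
    and cont: "continuous_on D f" and fc: "f c = 0"
    and B: "\<And>x. x \<in> D \<Longrightarrow> \<bar>f x\<bar> \<le> C * \<bar>x - c\<bar> powr s" "0 < s"
    and g: "integrable mu g"
  shows "has_weak_deriv f g"
proof -
  have "continuous_on {0..1} f" unfolding continuous_on_eq_continuous_within
  proof
    fix x :: real assume x: "x \<in> {0..1}"
    show "continuous (at x within {0..1}) f"
    proof (cases "x = c")
      case True
      have "(f \<longlongrightarrow> 0) (at c within {0..1})"
      proof (rule Lim_null_comparison)
        show "\<forall>\<^sub>F x in at c within {0..1}. norm (f x) \<le> C * \<bar>x - c\<bar> powr s"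
          using B(1) by (auto simp: eventually_at_filter D_def)
        show "((\<lambda>x. C * \<bar>x - c\<bar> powr s) \<longlongrightarrow> 0) (at c within {0..1})"
          by (rule tendsto_within_subset[OF rpow_tendsto_0[OF B(2)]]) auto
      qed
      then show ?thesis using True fc by (simp add: continuous_within)
    next
      case False
      have "continuous (at x within D) f" using cont x False by (simp add: continuous_on_eq_continuous_within D_def)
      moreover have "at x within D = at x within {0..1}"
        unfolding D_def using False by (intro at_within_nhd[of _ "-{c}"]) auto
      ultimately show ?thesis by (simp add: continuous_within)
    qed
  qed
  then have eq: "f x = f 0 + prim g x" if "x \<in> {0..1}" for x
    using der by (intro prim_eqI[OF g _ _ _ that, of _ "{c}"]) auto
  show ?thesis
  proof (rule has_weak_deriv_prim[OF g])
    show "AE x in mu. f x = f 0 + prim g x" by (intro AE_I2 eq) simp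
    show "f \<in> borel_measurable mu" by (rule continuous_on_D_measurable[OF cont])
  qed
qed

lemma cont_rho: "continuous_on D rho"
proof -
  have "continuous_on D (\<lambda>x. 1 / T1 x)" using T1_pos by (intro continuous_intros cont_D) auto
  then show ?thesis by (rule continuous_on_eq) (auto simp: rho_def D_def)
qed

lemma cont_om: "continuous_on D om"
  unfolding om_def[abs_def] using T1_pos by (intro continuous_intros cont_D) auto

lemma DERIV_rho_om: assumes x: "x \<in> {0<..<1} - {c}"
  shows "(rho has_real_derivative om x) (at x)" "(om has_real_derivative om1 x) (at x)"
proof -
  have nz: "T1 x \<noteq> 0" using T1_pos[of x] x by (auto simp: D_def)
  have "((\<lambda>x. 1 / T1 x) has_real_derivative om x) (at x)"
    using nz by (auto intro!: derivative_eq_intros der_int[OF x] simp: om_def power2_eq_square)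
  then show "(rho has_real_derivative om x) (at x)"
  proof (rule has_field_derivative_transform_within_open)
    show "open (-{c})" "x \<in> -{c}" using x by auto
  qed (auto simp: rho_def)
  have "(om has_real_derivative ((- T3 x) * (T1 x)\<^sup>2 - (- T2 x) * (2 * T1 x * T2 x)) / ((T1 x)\<^sup>2 * (T1 x)\<^sup>2)) (at x)"
    unfolding om_def[abs_def] using nz
    by (intro DERIV_divide) (auto intro!: derivative_eq_intros der_int[OF x])
  also have "((- T3 x) * (T1 x)\<^sup>2 - (- T2 x) * (2 * T1 x * T2 x)) / ((T1 x)\<^sup>2 * (T1 x)\<^sup>2) = om1 x"
    using nz by (simp add: om1_def field_simps power2_eq_square power3_eq_cube)
  finally show "(om has_real_derivative om1 x) (at x)" .
qed

lemma om_int: "integrable mu om" by (rule dominated_by[OF Om_int meas_om(2) om_le])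
lemma sig_int: "integrable mu sig" by (rule dominated_by[OF Om2_int meas_om(5) sig_le])

lemma has_weak_deriv_rho: "has_weak_deriv rho om"
proof (rule has_weak_deriv_off_cusp[OF DERIV_rho_om(1) cont_rho _ _ _ om_int])
  show "\<bar>rho x\<bar> \<le> 1 / m * \<bar>x - c\<bar> powr (- \<beta>)" if "x \<in> D" for x using rho_le(2)[of x] that by (simp add: D_def)
qed (use beta_half in \<open>auto simp: rho_def\<close>)

lemma has_weak_deriv_tau: "has_weak_deriv tau sig"
proof (rule has_weak_deriv_off_cusp[OF _ _ _ tau_le(1) _ sig_int])
  show "continuous_on D tau" unfolding tau_def[abs_def] by (intro continuous_intros cont_rho cont_om)
  fix x assume "x \<in> {0<..<1} - {c}"
  from DERIV_mult[OF DERIV_rho_om[OF this]]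
  show "(tau has_real_derivative sig x) (at x)" by (simp add: tau_def[abs_def] sig_def mult.commute add.commute)
qed (use beta_half in \<open>auto simp: tau_def rho_def\<close>)

text \<open>\<open>F\<close> stands for f/T'. Its continuous representative must vanish at the cusp,
  so it is the primitive normalised there, to which the integration by parts applies.\<close>

lemma has_weak_deriv_P_gen:
  assumes w: "has_weak_deriv F \<gamma>" and B: "AE x in mu. \<bar>F x\<bar> \<le> B x" "(B \<longlongrightarrow> 0) (at c)"
    and eq: "AE x in mu. f x = T1 x * F x" and fm: "f \<in> borel_measurable mu"
  shows "integrable mu f" "has_weak_deriv (P f) (P \<gamma>)"
proof -
  obtain k where g: "integrable mu \<gamma>" and k: "AE x in mu. F x = k + prim \<gamma> x"
    using w by (auto simp: has_weak_deriv_iff)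
  \<comment> \<open>Otherwise the continuous representative would exceed \<open>B\<close> on an
    interval ending at \<open>c\<close>, against the bound almost everywhere.\<close>
  have k0: "k + prim \<gamma> c = 0"
  proof (rule ccontr)
    assume nz: "k + prim \<gamma> c \<noteq> 0"
    define e where "e = \<bar>k + prim \<gamma> c\<bar> / 2"
    have e: "e > 0" using nz by (simp add: e_def)
    have "((\<lambda>x. \<bar>k + prim \<gamma> x\<bar>) \<longlongrightarrow> \<bar>k + prim \<gamma> c\<bar>) (at c)"
      by (intro tendsto_intros isCont_prim[OF g, unfolded isCont_def])
    then have "\<forall>\<^sub>F x in at c. e < \<bar>k + prim \<gamma> x\<bar>" using nz by (intro order_tendstoD) (auto simp: e_def)
    moreover have "\<forall>\<^sub>F x in at c. B x < e" using B(2) e by (intro order_tendstoD)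
    ultimately have "\<forall>\<^sub>F x in at c. B x < \<bar>k + prim \<gamma> x\<bar>" by eventually_elim simp
    then obtain d where d: "d > 0" "\<And>x. x \<noteq> c \<Longrightarrow> dist x c < d \<Longrightarrow> B x < \<bar>k + prim \<gamma> x\<bar>"
      unfolding eventually_at by blast
    have "AE x in mu. \<bar>k + prim \<gamma> x\<bar> \<le> B x" using k B(1) by eventually_elim auto
    then obtain x where x: "max 0 (c - d) < x" "x < c" "\<bar>k + prim \<gamma> x\<bar> \<le> B x"
      by (rule AE_mu_interval[of _ "max 0 (c - d)" c]) (use c01 d in auto)
    then show False using d(2)[of x] by (auto simp: dist_real_def)
  qed
  have eq': "AE x in mu. f x = T1 x * (prim \<gamma> x - prim \<gamma> c)"
    using eq k by eventually_elim (use k0 in \<open>simp add: add_eq_0_iff\<close>)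
  note G = has_weak_deriv_P_prim[OF g]
  show fi: "integrable mu f" by (rule integrable_mu_cong[OF G(1) fm eq'])
  show "has_weak_deriv (P f) (P \<gamma>)"
    by (rule has_weak_deriv_cong[OF G(2) P_cong_AE[OF eq'] P_meas[OF fm]]) (use P_integrable(1)[OF g] in auto)
qed

text \<open>Taken with F = f/T': \<open>f\<close> is bounded, and 1/T' vanishes at the cusp like the
  power -\<beta> of the distance.\<close>

lemma has_weak_deriv_P:
  assumes w: "has_weak_deriv f f'"
  shows "has_weak_deriv (P f) (P (\<lambda>x. f' x * rho x + f x * om x))"
proof -
  define s where "s = (LINT t|mu. \<bar>f' t\<bar>) + (LINT t|mu. \<bar>f t\<bar>)"
  have s: "AE x in mu. \<bar>f x\<bar> \<le> s" unfolding s_def by (rule has_weak_deriv_sup_bound[OF w])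
  show ?thesis
  proof (rule has_weak_deriv_P_gen(2)[OF has_weak_deriv_mult[OF w has_weak_deriv_rho]])
    show "AE x in mu. \<bar>f x * rho x\<bar> \<le> (s * (1 / m)) * \<bar>x - c\<bar> powr (- \<beta>)"
      using s AE_D
    proof eventually_elim
      case (elim x)
      then have "\<bar>f x\<bar> * \<bar>rho x\<bar> \<le> s * (1 / m * \<bar>x - c\<bar> powr (- \<beta>))"
        using rho_le(2)[of x] by (intro mult_mono) auto
      then show ?case by (simp add: abs_mult)
    qed
    show "((\<lambda>x. (s * (1 / m)) * \<bar>x - c\<bar> powr (- \<beta>)) \<longlongrightarrow> 0) (at c)"
      by (rule rpow_tendsto_0) (use beta_half in simp)
    show "AE x in mu. f x = T1 x * (f x * rho x)"
      using AE_D
    proof eventually_elim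
      case (elim x) then show ?case using T1_pos[of x] by (auto simp: rho_def D_def)
    qed
  qed (use w in \<open>auto simp: has_weak_deriv_def\<close>)
qed

text \<open>The integrand \<open>f' x * rho x + f x * om x\<close> cannot be differentiated as it
  stands, since the derivative of \<open>om\<close> is controlled only by a non-integrable power.
  Dividing by T' once more leaves f' rho^2 + f tau, whose terms are both weakly differentiable. The
  factor 3 is 2 from rho^2 and 1 from f tau.\<close>

lemma has_weak_deriv2_P:
  assumes w: "has_weak_deriv f f'" and w2: "has_weak_deriv f' f''"
  shows "has_weak_deriv (P (\<lambda>x. f' x * rho x + f x * om x))
     (P (\<lambda>x. f'' x * (rho x * rho x) + 3 * f' x * tau x + f x * sig x))"
proof -
  define s where "s = (LINT t|mu. \<bar>f' t\<bar>) + (LINT t|mu. \<bar>f t\<bar>)"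
  define s' where "s' = (LINT t|mu. \<bar>f'' t\<bar>) + (LINT t|mu. \<bar>f' t\<bar>)"
  have s: "AE x in mu. \<bar>f x\<bar> \<le> s" unfolding s_def by (rule has_weak_deriv_sup_bound[OF w])
  have s': "AE x in mu. \<bar>f' x\<bar> \<le> s'" unfolding s'_def by (rule has_weak_deriv_sup_bound[OF w2])
  have m: "f \<in> borel_measurable mu" "f' \<in> borel_measurable mu" "f'' \<in> borel_measurable mu"
    using w w2 by (auto simp: has_weak_deriv_def)
  have "has_weak_deriv (\<lambda>x. f' x * rho x * rho x + f x * tau x)
     (\<lambda>x. ((f'' x * rho x + f' x * om x) * rho x + f' x * rho x * om x) + (f' x * tau x + f x * sig x))"
    by (intro has_weak_deriv_add has_weak_deriv_mult w w2 has_weak_deriv_rho has_weak_deriv_tau)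
  then have W: "has_weak_deriv (\<lambda>x. f' x * rho x * rho x + f x * tau x)
     (\<lambda>x. f'' x * (rho x * rho x) + 3 * f' x * tau x + f x * sig x)"
    by (simp add: tau_def algebra_simps)
  show ?thesis
  proof (rule has_weak_deriv_P_gen(2)[OF W])
    show "AE x in mu. \<bar>f' x * rho x * rho x + f x * tau x\<bar> \<le> (s' * (1 / m)) * \<bar>x - c\<bar> powr (- \<beta>) + (s * Ct) * \<bar>x - c\<bar> powr (-1 - 2 * \<beta>)"
      using s s' AE_D
    proof eventually_elim
      case (elim x)
      have "\<bar>rho x\<bar> \<le> 1" using rho_le(1)[of x] elim theta by (auto intro: order_trans)
      then have "\<bar>rho x\<bar> * \<bar>rho x\<bar> \<le> \<bar>rho x\<bar> * 1" by (intro mult_left_mono) auto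
      also have "\<dots> \<le> 1 / m * \<bar>x - c\<bar> powr (- \<beta>)" using rho_le(2)[of x] elim by simp
      finally have r2: "\<bar>rho x\<bar> * \<bar>rho x\<bar> \<le> 1 / m * \<bar>x - c\<bar> powr (- \<beta>)" .
      have "\<bar>f' x\<bar> * (\<bar>rho x\<bar> * \<bar>rho x\<bar>) \<le> s' * (1 / m * \<bar>x - c\<bar> powr (- \<beta>))"
        by (rule mult_mono[OF elim(2) r2]) (use elim(2) in auto)
      moreover have "\<bar>f x\<bar> * \<bar>tau x\<bar> \<le> s * (Ct * \<bar>x - c\<bar> powr (-1 - 2 * \<beta>))"
        using tau_le(1)[of x] elim by (intro mult_mono) (auto simp: D_def)
      ultimately show ?case
        using abs_triangle_ineq[of "f' x * rho x * rho x" "f x * tau x"] by (simp add: abs_mult mult.assoc)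
    qed
    have "((\<lambda>x. (s' * (1 / m)) * \<bar>x - c\<bar> powr (- \<beta>) + (s * Ct) * \<bar>x - c\<bar> powr (-1 - 2 * \<beta>)) \<longlongrightarrow> 0 + 0) (at c)"
      by (intro tendsto_add rpow_tendsto_0) (use beta_half in auto)
    then show "((\<lambda>x. (s' * (1 / m)) * \<bar>x - c\<bar> powr (- \<beta>) + (s * Ct) * \<bar>x - c\<bar> powr (-1 - 2 * \<beta>)) \<longlongrightarrow> 0) (at c)" by simp
    show "AE x in mu. f' x * rho x + f x * om x = T1 x * (f' x * rho x * rho x + f x * tau x)"
      using AE_D
    proof eventually_elim
      case (elim x)
      then have "T1 x * rho x = 1" using T1_pos[of x] by (auto simp: rho_def D_def)
      have "T1 x * (f' x * rho x * rho x + f x * tau x) = (T1 x * rho x) * (f' x * rho x + f x * om x)"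
        by (simp add: tau_def algebra_simps)
      then show ?case using \<open>T1 x * rho x = 1\<close> by simp
    qed
    show "(\<lambda>x. f' x * rho x + f x * om x) \<in> borel_measurable mu" using m meas_om by measurable
  qed
qed

text \<open>The first form keeps \<open>Om\<close>, which lies in L^p; the second cuts it at
  \<open>KL\<close>, so that in L^1 the factor of the derivative stays below 1.\<close>

lemma deriv_integrand_bound:
  assumes w: "has_weak_deriv f f'"
  shows "AE x in mu. \<bar>f' x * rho x + f x * om x\<bar> \<le> 1 / \<theta> * \<bar>f' x\<bar> + ((LINT t|mu. \<bar>f' t\<bar>) + (LINT t|mu. \<bar>f t\<bar>)) * Om x"
    "AE x in mu. \<bar>f' x * rho x + f x * om x\<bar> \<le> 1 / \<theta> * \<bar>f' x\<bar> + (KL * \<bar>f x\<bar> + ((LINT t|mu. \<bar>f' t\<bar>) + (LINT t|mu. \<bar>f t\<bar>)) * max (Om x - KL) 0)"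
proof -
  define s where "s = (LINT t|mu. \<bar>f' t\<bar>) + (LINT t|mu. \<bar>f t\<bar>)"
  have s: "AE x in mu. \<bar>f x\<bar> \<le> s" unfolding s_def by (rule has_weak_deriv_sup_bound[OF w])
  have *: "AE x in mu. \<bar>f' x * rho x + f x * om x\<bar> \<le> 1 / \<theta> * \<bar>f' x\<bar> + \<bar>f x\<bar> * Om x"
    using AE_D
  proof eventually_elim
    case (elim x)
    then have "\<bar>f' x\<bar> * \<bar>rho x\<bar> \<le> \<bar>f' x\<bar> * (1 / \<theta>)" "\<bar>f x\<bar> * \<bar>om x\<bar> \<le> \<bar>f x\<bar> * Om x"
      using rho_le(1)[of x] om_le[of x] by (auto intro!: mult_left_mono simp del: times_divide_eq_right simp: D_def)
    then show ?case using abs_triangle_ineq[of "f' x * rho x" "f x * om x"] by (simp add: abs_mult)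
  qed
  show "AE x in mu. \<bar>f' x * rho x + f x * om x\<bar> \<le> 1 / \<theta> * \<bar>f' x\<bar> + ((LINT t|mu. \<bar>f' t\<bar>) + (LINT t|mu. \<bar>f t\<bar>)) * Om x"
    using * s unfolding s_def[symmetric]
  proof eventually_elim
    case (elim x) then show ?case using mult_right_mono[OF elim(2) Om_nonneg[of x]] by linarith
  qed
  show "AE x in mu. \<bar>f' x * rho x + f x * om x\<bar> \<le> 1 / \<theta> * \<bar>f' x\<bar> + (KL * \<bar>f x\<bar> + ((LINT t|mu. \<bar>f' t\<bar>) + (LINT t|mu. \<bar>f t\<bar>)) * max (Om x - KL) 0)"
    using * s unfolding s_def[symmetric]
  proof eventually_elim
    case (elim x)
    have "\<bar>f x\<bar> * Om x \<le> \<bar>f x\<bar> * (KL + max (Om x - KL) 0)" by (intro mult_left_mono) auto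
    also have "\<dots> = KL * \<bar>f x\<bar> + \<bar>f x\<bar> * max (Om x - KL) 0" by (simp add: distrib_left mult.commute)
    also have "\<dots> \<le> KL * \<bar>f x\<bar> + s * max (Om x - KL) 0" using elim by (intro add_left_mono mult_right_mono) auto
    finally show ?case using elim by linarith
  qed
qed

text \<open>The part of \<open>Om\<close> above \<open>KL\<close> is paid for by the sup norm of
  \<open>f\<close> and has integral at most (1 - 1/\<theta>)/2, so the derivative gets the factor
  1/\<theta> + (1 - 1/\<theta>)/2 = \<open>kap\<close>. The part below \<open>KL\<close> is paid for
  by the L^1 norm of \<open>f\<close>.\<close>

lemma LY_L1:
  assumes w: "has_weak_deriv f f'"
  shows "(LINT x|mu. \<bar>P (\<lambda>x. f' x * rho x + f x * om x) x\<bar>) \<le> kap * (LINT x|mu. \<bar>f' x\<bar>) + KK * (LINT x|mu. \<bar>f x\<bar>)"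
proof -
  define A where "A = (LINT x|mu. \<bar>f' x\<bar>)" define F where "F = (LINT x|mu. \<bar>f x\<bar>)"
  note i = has_weak_deriv_integrable[OF w]
  have gi: "integrable mu (\<lambda>x. f' x * rho x + f x * om x)"
    using has_weak_deriv_mult[OF w has_weak_deriv_rho] by (simp add: has_weak_deriv_def)
  note ti = Om_trunc_int[OF KL(1)]
  have AF: "0 \<le> A" "0 \<le> F" by (simp_all add: A_def F_def)
  have "(LINT x|mu. \<bar>P (\<lambda>x. f' x * rho x + f x * om x) x\<bar>) \<le> (LINT x|mu. \<bar>f' x * rho x + f x * om x\<bar>)"
    by (rule P_contraction[OF gi])
  also have "\<dots> \<le> (LINT x|mu. 1 / \<theta> * \<bar>f' x\<bar> + (KL * \<bar>f x\<bar> + (A + F) * max (Om x - KL) 0))"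
    by (rule integral_mono_AE[OF _ _ deriv_integrand_bound(2)[OF w, folded A_def F_def]]) (use gi i ti in auto)
  also have "\<dots> = 1 / \<theta> * A + (KL * F + (A + F) * (LINT x|mu. max (Om x - KL) 0))"
    using i ti by (simp add: A_def F_def)
  also have "\<dots> \<le> 1 / \<theta> * A + (KL * F + (A + F) * ((1 - 1 / \<theta>) / 2))"
    using KL(2) AF by (intro add_left_mono mult_left_mono) auto
  also have "\<dots> = kap * A + (KL + (1 - 1 / \<theta>) / 2) * F"
  proof -
    have "t * A + (KL * F + (A + F) * ((1 - t) / 2)) = (1 + t) / 2 * A + (KL + (1 - t) / 2) * F" for t :: real
      by (simp add: field_simps)
    then show ?thesis unfolding kap_def .
  qed
  also have "\<dots> \<le> kap * A + KK * F"
  proof -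
    have "(1 - 1 / \<theta>) / 2 \<le> 1" using theta by (simp add: field_simps)
    then show ?thesis using AF by (intro add_left_mono mult_right_mono) (auto simp: KK_def)
  qed
  finally show ?thesis by (simp add: A_def F_def)
qed

section \<open>Iterates of the operator and their derivatives\<close>

primrec dit :: "(real \<Rightarrow> real) \<Rightarrow> (real \<Rightarrow> real) \<Rightarrow> nat \<Rightarrow> real \<Rightarrow> real" where
  "dit f f' 0 = f'"
| "dit f f' (Suc n) = P (\<lambda>x. dit f f' n x * rho x + (P ^^ n) f x * om x)"

lemma has_weak_deriv_Pn: "has_weak_deriv f f' \<Longrightarrow> has_weak_deriv ((P ^^ n) f) (dit f f' n)"
  by (induction n) (auto dest: has_weak_deriv_P)

lemma Pn_integrable: "integrable mu f \<Longrightarrow> integrable mu ((P ^^ n) f)"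
  by (induction n) (auto intro: P_integrable)

lemma Pn_meas: "f \<in> borel_measurable mu \<Longrightarrow> (P ^^ n) f \<in> borel_measurable mu"
  by (induction n) (auto intro: P_meas)

lemma Pn_integral: "integrable mu f \<Longrightarrow> (LINT x|mu. (P ^^ n) f x) = (LINT x|mu. f x)"
  by (induction n) (auto simp: P_integrable(2)[OF Pn_integrable])

lemma Pn_contraction: "integrable mu f \<Longrightarrow> (LINT x|mu. \<bar>(P ^^ n) f x\<bar>) \<le> (LINT x|mu. \<bar>f x\<bar>)"
  by (induction n) (auto intro: order_trans[OF P_contraction[OF Pn_integrable]])

lemma Pn_add: "(P ^^ n) (\<lambda>x. f x + g x) = (\<lambda>x. (P ^^ n) f x + (P ^^ n) g x)"
  by (induction n) (auto simp: P_add)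

lemma Pn_diff: "(P ^^ n) (\<lambda>x. f x - g x) = (\<lambda>x. (P ^^ n) f x - (P ^^ n) g x)"
  by (induction n) (auto simp: P_diff)

lemma Pn_cmult: "(P ^^ n) (\<lambda>x. k * f x) = (\<lambda>x. k * (P ^^ n) f x)"
  by (induction n) (auto simp: P_cmult)

lemma Pn_mono: "(\<And>x. f x \<le> g x) \<Longrightarrow> (P ^^ n) f y \<le> (P ^^ n) g y"
  by (induction n arbitrary: y) (auto intro: P_mono)

lemma Pn_mono_AE:
  assumes "AE x in mu. f x \<le> g x" shows "AE y in mu. (P ^^ n) f y \<le> (P ^^ n) g y"
proof (induction n)
  case (Suc n) show ?case using P_mono_AE[OF Suc] by simp
qed (use assms in simp)

lemma Pn_nonneg: "(\<And>x. 0 \<le> f x) \<Longrightarrow> 0 \<le> (P ^^ n) f y"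
  by (induction n arbitrary: y) (auto intro: P_nonneg)

lemma Pn_abs: "\<bar>(P ^^ n) f y\<bar> \<le> (P ^^ n) (\<lambda>x. \<bar>f x\<bar>) y"
proof (induction n arbitrary: y)
  case (Suc n)
  have "\<bar>(P ^^ Suc n) f y\<bar> \<le> P (\<lambda>x. \<bar>(P ^^ n) f x\<bar>) y" using P_abs by simp
  also have "\<dots> \<le> (P ^^ Suc n) (\<lambda>x. \<bar>f x\<bar>) y" using Suc by (simp add: P_mono)
  finally show ?case .
qed simp

lemma dit_L1:
  assumes w: "has_weak_deriv f f'"
  shows "(LINT x|mu. \<bar>dit f f' n x\<bar>) \<le> kap ^ n * (LINT x|mu. \<bar>f' x\<bar>) + K1 * (LINT x|mu. \<bar>f x\<bar>)"
proof (induction n)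
  case 0 show ?case using const_bounds by simp
next
  case (Suc n)
  define F where "F = (LINT x|mu. \<bar>f x\<bar>)" define A where "A = (LINT x|mu. \<bar>f' x\<bar>)"
  have F: "0 \<le> F" by (simp add: F_def)
  have "(LINT x|mu. \<bar>dit f f' (Suc n) x\<bar>) \<le> kap * (LINT x|mu. \<bar>dit f f' n x\<bar>) + KK * (LINT x|mu. \<bar>(P ^^ n) f x\<bar>)"
    using LY_L1[OF has_weak_deriv_Pn[OF w]] by simp
  also have "\<dots> \<le> kap * (kap ^ n * A + K1 * F) + KK * F"
    using Suc Pn_contraction[of f n] w kap const_bounds unfolding F_def A_def
    by (intro add_mono mult_left_mono) (auto simp: has_weak_deriv_def)
  also have "\<dots> = kap ^ Suc n * A + (kap * K1 + KK) * F" by (simp add: algebra_simps)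
  \<comment> \<open>\<open>K1\<close> is the fixed point of the recursion, so the constant does not
    grow with \<open>n\<close>.\<close>
  also have "kap * K1 + KK = K1" using kap by (simp add: K1_def field_simps)
  finally show ?case by (simp add: F_def A_def)
qed

lemma Pn_one_le: "AE x in mu. (P ^^ n) (\<lambda>x. 1) x \<le> K2"
proof -
  note w = has_weak_deriv_const[of 1]
  have "(LINT x|mu. \<bar>dit (\<lambda>x. 1) (\<lambda>x. 0) n x\<bar>) \<le> K1" using dit_L1[OF w, of n] by simp
  moreover have "(LINT x|mu. \<bar>(P ^^ n) (\<lambda>x. 1) x\<bar>) \<le> 1" using Pn_contraction[of "\<lambda>x. 1" n] by simp
  ultimately show ?thesis using has_weak_deriv_sup_bound[OF has_weak_deriv_Pn[OF w, of n]]
    unfolding K2_def by (auto elim!: eventually_mono)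
qed

text \<open>Jensen's inequality for the positive operator \<open>P ^^ n\<close>, whose total weight
  is almost everywhere at most \<open>K2\<close>: the tangent of the power function at
  \<open>l\<close> is pushed through the operator, and \<open>l\<close> is chosen as the value of
  the iterate divided by \<open>K2\<close>.\<close>

lemma Pn_Lp:
  assumes u: "u \<in> Lp_space p"
  shows "(P ^^ n) u \<in> Lp_space p" "nrm p ((P ^^ n) u) \<le> K2 * nrm p u"
proof -
  define v where "v x = \<bar>u x\<bar>" for x
  have v0: "0 \<le> v x" for x by (simp add: v_def)
  have vi: "integrable mu (\<lambda>x. v x powr p)" using Lp_int[OF u] by (simp add: v_def)
  have um: "u \<in> borel_measurable mu" "v \<in> borel_measurable mu" using Lp_meas[OF u] by (auto simp: v_def[abs_def])
  \<comment> \<open>The tangent line inequality at \<open>l\<close>, obtained from Young's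
    inequality with the conjugate exponents p and p/(p - 1).\<close>
  have pt: "p * l powr (p - 1) * t - (p - 1) * l powr p \<le> t powr p" if "0 \<le> t" "0 \<le> l" for t l :: real
  proof -
    define q where "q = p / (p - 1)"
    have q: "1 < q" "1 / p + 1 / q = 1" using p1 by (auto simp: q_def field_simps)
    have "t * l powr (p - 1) \<le> t powr p / p + (l powr (p - 1)) powr q / q"
      by (rule Youngs_inequality) (use that p1 q in auto)
    also have "(l powr (p - 1)) powr q = l powr p" using p1 by (simp add: powr_powr q_def)
    also have "l powr p / q = (p - 1) * l powr p / p" by (simp add: q_def mult.commute)
    finally have "p * (t * l powr (p - 1)) \<le> p * (t powr p / p + (p - 1) * l powr p / p)"
      using p0 by (intro mult_left_mono) auto
    also have "\<dots> = t powr p + (p - 1) * l powr p" using p0 by (simp add: distrib_left)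
    finally show ?thesis by (simp add: mult_ac)
  qed
  have key: "((P ^^ n) v y) powr p \<le> K2 powr (p - 1) * (P ^^ n) (\<lambda>x. v x powr p) y" if K: "(P ^^ n) (\<lambda>x. 1) y \<le> K2" for y
  proof -
    define l where "l = (P ^^ n) v y / K2"
    have nn: "0 \<le> (P ^^ n) v y" by (rule Pn_nonneg[OF v0])
    have K2: "0 < K2" using const_bounds by simp
    then have l: "0 \<le> l" using nn by (simp add: l_def)
    have lK: "(P ^^ n) v y = l * K2" using K2 by (simp add: l_def)
    have "p * l powr (p - 1) * (P ^^ n) v y - (p - 1) * l powr p * (P ^^ n) (\<lambda>x. 1) y
       = (P ^^ n) (\<lambda>x. p * l powr (p - 1) * v x - (p - 1) * l powr p * 1) y"
      by (simp only: Pn_diff Pn_cmult)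
    also have "\<dots> \<le> (P ^^ n) (\<lambda>x. v x powr p) y" by (rule Pn_mono) (use pt[OF v0 l] in simp)
    finally have "p * l powr (p - 1) * (P ^^ n) v y - (p - 1) * l powr p * (P ^^ n) (\<lambda>x. 1) y \<le> (P ^^ n) (\<lambda>x. v x powr p) y" .
    moreover have "(p - 1) * l powr p * (P ^^ n) (\<lambda>x. 1) y \<le> (p - 1) * l powr p * K2"
      using K p1 by (intro mult_left_mono) auto
    moreover have "p * l powr (p - 1) * (P ^^ n) v y = p * l powr p * K2"
      using l lK by (cases "l = 0") (auto simp: powr_diff)
    moreover have "(p - 1) * l powr p * K2 = p * l powr p * K2 - l powr p * K2" by (simp add: algebra_simps)
    ultimately have "l powr p * K2 \<le> (P ^^ n) (\<lambda>x. v x powr p) y" by linarith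
    then have "K2 powr (p - 1) * (l powr p * K2) \<le> K2 powr (p - 1) * (P ^^ n) (\<lambda>x. v x powr p) y"
      by (intro mult_left_mono) auto
    moreover have "((P ^^ n) v y) powr p = K2 powr (p - 1) * (l powr p * K2)"
      unfolding lK using K2 by (simp add: powr_mult powr_diff)
    ultimately show ?thesis by simp
  qed
  have ae: "AE y in mu. ((P ^^ n) v y) powr p \<le> K2 powr (p - 1) * (P ^^ n) (\<lambda>x. v x powr p) y"
    using Pn_one_le[of n] by eventually_elim (rule key)
  have Pi: "integrable mu (\<lambda>y. K2 powr (p - 1) * (P ^^ n) (\<lambda>x. v x powr p) y)" using Pn_integrable[OF vi] by auto
  have nn: "0 \<le> (P ^^ n) v y" for y by (rule Pn_nonneg[OF v0])
  have i: "integrable mu (\<lambda>y. ((P ^^ n) v y) powr p)"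
  proof (rule Bochner_Integration.integrable_bound[OF Pi])
    show "(\<lambda>y. ((P ^^ n) v y) powr p) \<in> borel_measurable mu" using Pn_meas[OF um(2)] by measurable
    show "AE y in mu. norm (((P ^^ n) v y) powr p) \<le> norm (K2 powr (p - 1) * (P ^^ n) (\<lambda>x. v x powr p) y)"
      using ae by eventually_elim (simp add: order_trans[OF _ abs_ge_self])
  qed
  have vL: "(P ^^ n) v \<in> Lp_space p" using i Pn_meas[OF um(2)] nn by (simp add: Lp_space_def)
  have "(LINT y|mu. \<bar>(P ^^ n) v y\<bar> powr p) \<le> (LINT y|mu. K2 powr (p - 1) * (P ^^ n) (\<lambda>x. v x powr p) y)"
    using nn by (simp only: abs_of_nonneg) (rule integral_mono_AE[OF i Pi ae])
  also have "\<dots> = K2 powr (p - 1) * nrm p u powr p"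
    using Pn_integral[OF vi, of n] p0 by (simp add: nrm_powr v_def)
  also have "\<dots> \<le> K2 powr p * nrm p u powr p" using const_bounds by (intro mult_right_mono powr_mono) auto
  also have "\<dots> = (K2 * nrm p u) powr p" using const_bounds by (simp add: powr_mult)
  finally have nv: "nrm p ((P ^^ n) v) \<le> K2 * nrm p u" using p0 const_bounds by (intro nrm_leI) auto
  have le: "AE y in mu. \<bar>(P ^^ n) u y\<bar> \<le> \<bar>(P ^^ n) v y\<bar>" using Pn_abs[of n u] nn unfolding v_def by auto
  show "(P ^^ n) u \<in> Lp_space p" by (rule Lp_dominated(1)[OF p0 vL Pn_meas[OF um(1)] le])
  show "nrm p ((P ^^ n) u) \<le> K2 * nrm p u"
    using Lp_dominated(2)[OF p0 vL Pn_meas[OF um(1)] le] nv by linarith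
qed

lemma P_Lp: "u \<in> Lp_space p \<Longrightarrow> P u \<in> Lp_space p" "u \<in> Lp_space p \<Longrightarrow> nrm p (P u) \<le> K2 * nrm p u"
  using Pn_Lp[of u 1] by auto

text \<open>\<open>P\<close> may expand the $L^p$ norm, but it does not expand the following equivalent one.\<close>

definition star :: "(real \<Rightarrow> real) \<Rightarrow> real" where
  "star u = (SUP n. nrm p ((P ^^ n) (\<lambda>x. \<bar>u x\<bar>)))"

lemma star_bdd: "u \<in> Lp_space p \<Longrightarrow> bdd_above (range (\<lambda>n. nrm p ((P ^^ n) (\<lambda>x. \<bar>u x\<bar>))))"
  using Pn_Lp(2)[OF Lp_abs] by (intro bdd_aboveI2[of _ _ "K2 * nrm p u"]) (simp add: nrm_abs)

lemma star_upper: "u \<in> Lp_space p \<Longrightarrow> nrm p ((P ^^ n) (\<lambda>x. \<bar>u x\<bar>)) \<le> star u"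
  unfolding star_def by (rule cSUP_upper[OF _ star_bdd]) auto

lemma star_ge:
  assumes "u \<in> Lp_space p"
  shows "nrm p u \<le> star u" "0 \<le> star u"
proof -
  show *: "nrm p u \<le> star u" using star_upper[OF assms, of 0] by (simp add: nrm_abs)
  show "0 \<le> star u" by (rule order_trans[OF nrm_nonneg *])
qed

lemma star_le: "u \<in> Lp_space p \<Longrightarrow> star u \<le> K2 * nrm p u"
  unfolding star_def using Pn_Lp(2)[OF Lp_abs] by (intro cSUP_least) (auto simp: nrm_abs)

lemma star_mono:
  assumes v: "v \<in> Lp_space p" and u: "u \<in> borel_measurable mu" and le: "AE x in mu. \<bar>u x\<bar> \<le> \<bar>v x\<bar>"
  shows "star u \<le> star v"
  unfolding star_def[of u]
proof (rule cSUP_least)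
  fix n
  have "nrm p ((P ^^ n) (\<lambda>x. \<bar>u x\<bar>)) \<le> nrm p ((P ^^ n) (\<lambda>x. \<bar>v x\<bar>))"
  proof (rule Lp_dominated(2)[OF p0 Pn_Lp(1)[OF Lp_abs[OF v]]])
    show "(P ^^ n) (\<lambda>x. \<bar>u x\<bar>) \<in> borel_measurable mu" by (intro Pn_meas borel_measurable_abs u)
    show "AE x in mu. \<bar>(P ^^ n) (\<lambda>x. \<bar>u x\<bar>) x\<bar> \<le> \<bar>(P ^^ n) (\<lambda>x. \<bar>v x\<bar>) x\<bar>"
      using Pn_mono_AE[OF le, of n] by eventually_elim (simp add: Pn_nonneg)
  qed
  then show "nrm p ((P ^^ n) (\<lambda>x. \<bar>u x\<bar>)) \<le> star v" using star_upper[OF v, of n] by linarith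
qed simp

lemma star_add:
  assumes u: "u \<in> Lp_space p" and v: "v \<in> Lp_space p" and nn: "\<And>x. 0 \<le> u x" "\<And>x. 0 \<le> v x"
  shows "star (\<lambda>x. u x + v x) \<le> star u + star v"
  unfolding star_def[of "\<lambda>x. u x + v x"]
proof (rule cSUP_least)
  fix n
  have "(P ^^ n) (\<lambda>x. \<bar>u x + v x\<bar>) = (\<lambda>x. (P ^^ n) (\<lambda>x. \<bar>u x\<bar>) x + (P ^^ n) (\<lambda>x. \<bar>v x\<bar>) x)"
    using nn by (simp add: Pn_add)
  then show "nrm p ((P ^^ n) (\<lambda>x. \<bar>u x + v x\<bar>)) \<le> star u + star v"
    using Lp_add(2)[OF pge1 Pn_Lp(1)[OF Lp_abs[OF u]] Pn_Lp(1)[OF Lp_abs[OF v]], of n n]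
      star_upper[OF u, of n] star_upper[OF v, of n] by simp
qed simp

lemma star_cmult:
  assumes u: "u \<in> Lp_space p" "0 \<le> k"
  shows "star (\<lambda>x. k * \<bar>u x\<bar>) \<le> k * star u"
  unfolding star_def[of "\<lambda>x. k * \<bar>u x\<bar>"]
proof (rule cSUP_least)
  fix n
  have "(P ^^ n) (\<lambda>x. \<bar>k * \<bar>u x\<bar>\<bar>) = (\<lambda>x. k * (P ^^ n) (\<lambda>x. \<bar>u x\<bar>) x)" using u by (simp add: abs_mult Pn_cmult)
  then show "nrm p ((P ^^ n) (\<lambda>x. \<bar>k * \<bar>u x\<bar>\<bar>)) \<le> k * star u"
    using Lp_cmult(2)[OF p0 Pn_Lp(1)[OF Lp_abs[OF u(1)]], of k n] mult_left_mono[OF star_upper[OF u(1), of n] u(2)] u(2) by simp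
qed simp

text \<open>Once the absolute value is moved inside, \<open>P\<close> shifts the sequence under the
  supremum by one.\<close>

lemma star_P:
  assumes u: "u \<in> Lp_space p"
  shows "star (P u) \<le> star u"
  unfolding star_def[of "P u"]
proof (rule cSUP_least)
  fix n
  have um: "u \<in> borel_measurable mu" by (rule Lp_meas[OF u])
  have "nrm p ((P ^^ n) (\<lambda>x. \<bar>P u x\<bar>)) \<le> nrm p ((P ^^ Suc n) (\<lambda>x. \<bar>u x\<bar>))"
  proof (rule Lp_dominated(2)[OF p0 Pn_Lp(1)[OF Lp_abs[OF u]]])
    show "(P ^^ n) (\<lambda>x. \<bar>P u x\<bar>) \<in> borel_measurable mu" by (intro Pn_meas borel_measurable_abs P_meas um)
    have "\<bar>(P ^^ n) (\<lambda>x. \<bar>P u x\<bar>) x\<bar> \<le> \<bar>(P ^^ Suc n) (\<lambda>x. \<bar>u x\<bar>) x\<bar>" for x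
    proof -
      have "(P ^^ n) (\<lambda>x. \<bar>P u x\<bar>) x \<le> (P ^^ n) (P (\<lambda>x. \<bar>u x\<bar>)) x" by (rule Pn_mono[OF P_abs])
      also have "(P ^^ n) (P (\<lambda>x. \<bar>u x\<bar>)) = (P ^^ Suc n) (\<lambda>x. \<bar>u x\<bar>)" by (simp add: funpow_swap1)
      finally show ?thesis using Pn_nonneg[of "\<lambda>x. \<bar>P u x\<bar>" n x] Pn_nonneg[of "\<lambda>x. \<bar>u x\<bar>" "Suc n" x] by simp
    qed
    then show "AE x in mu. \<bar>(P ^^ n) (\<lambda>x. \<bar>P u x\<bar>) x\<bar> \<le> \<bar>(P ^^ Suc n) (\<lambda>x. \<bar>u x\<bar>) x\<bar>" by simp
  qed
  then show "nrm p ((P ^^ n) (\<lambda>x. \<bar>P u x\<bar>)) \<le> star u" using star_upper[OF u, of "Suc n"] by linarith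
qed simp

lemma LY_star:
  assumes w: "has_weak_deriv f f'" and f': "f' \<in> Lp_space p"
  shows "P (\<lambda>x. f' x * rho x + f x * om x) \<in> Lp_space p"
    "star (P (\<lambda>x. f' x * rho x + f x * om x)) \<le> 1 / \<theta> * star f' + QQ * ((LINT t|mu. \<bar>f' t\<bar>) + (LINT t|mu. \<bar>f t\<bar>))"
proof -
  define s where "s = (LINT t|mu. \<bar>f' t\<bar>) + (LINT t|mu. \<bar>f t\<bar>)"
  have s0: "0 \<le> s" by (simp add: s_def)
  let ?g = "\<lambda>x. f' x * rho x + f x * om x"
  have gm: "?g \<in> borel_measurable mu"
    using has_weak_deriv_integrable(2)[OF has_weak_deriv_mult[OF w has_weak_deriv_rho]] by (rule borel_measurable_integrable)
  have A: "(\<lambda>x. 1 / \<theta> * \<bar>f' x\<bar>) \<in> Lp_space p" "(\<lambda>x. s * \<bar>Om x\<bar>) \<in> Lp_space p"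
    by (intro Lp_cmult(1)[OF p0] Lp_abs f' Om_Lp)+
  have th: "0 \<le> 1 / \<theta>" using theta by simp
  have nn: "\<And>x. 0 \<le> 1 / \<theta> * \<bar>f' x\<bar>" "\<And>x. 0 \<le> s * \<bar>Om x\<bar>" using th s0 by auto
  have S: "(\<lambda>x. 1 / \<theta> * \<bar>f' x\<bar> + s * \<bar>Om x\<bar>) \<in> Lp_space p" by (rule Lp_add(1)[OF pge1 A])
  have le: "AE x in mu. \<bar>?g x\<bar> \<le> \<bar>1 / \<theta> * \<bar>f' x\<bar> + s * \<bar>Om x\<bar>\<bar>"
    using deriv_integrand_bound(1)[OF w, folded s_def]
    by eventually_elim (use nn Om_nonneg in \<open>simp add: order_trans[OF _ abs_ge_self]\<close>)
  have gL: "?g \<in> Lp_space p" by (rule Lp_dominated(1)[OF p0 S gm le])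
  show "P ?g \<in> Lp_space p" by (rule P_Lp(1)[OF gL])
  have "star (P ?g) \<le> star ?g" by (rule star_P[OF gL])
  also have "\<dots> \<le> star (\<lambda>x. 1 / \<theta> * \<bar>f' x\<bar> + s * \<bar>Om x\<bar>)" by (rule star_mono[OF S gm le])
  also have "\<dots> \<le> star (\<lambda>x. 1 / \<theta> * \<bar>f' x\<bar>) + star (\<lambda>x. s * \<bar>Om x\<bar>)" by (rule star_add[OF A nn])
  also have "\<dots> \<le> 1 / \<theta> * star f' + s * star Om" by (intro add_mono star_cmult f' Om_Lp th s0)
  also have "\<dots> \<le> 1 / \<theta> * star f' + s * QQ"
    unfolding QQ_def by (intro add_left_mono mult_left_mono star_le Om_Lp s0)
  finally show "star (P ?g) \<le> 1 / \<theta> * star f' + QQ * ((LINT t|mu. \<bar>f' t\<bar>) + (LINT t|mu. \<bar>f t\<bar>))"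
    by (simp add: s_def mult.commute)
qed

definition V :: "(real \<Rightarrow> real) \<Rightarrow> real" where "V f' = star f' + BB * (LINT x|mu. \<bar>f' x\<bar>)"

lemma LY_V:
  assumes w: "has_weak_deriv f f'" and f': "f' \<in> Lp_space p"
  shows "V (P (\<lambda>x. f' x * rho x + f x * om x)) \<le> lam * V f' + RR * (LINT t|mu. \<bar>f t\<bar>)"
proof -
  define F where "F = (LINT x|mu. \<bar>f x\<bar>)" define A where "A = (LINT x|mu. \<bar>f' x\<bar>)"
  have AF: "0 \<le> F" "0 \<le> A" by (simp_all add: F_def A_def)
  have st: "0 \<le> star f'" by (rule star_ge(2)[OF f'])
  have "V (P (\<lambda>x. f' x * rho x + f x * om x)) \<le> (1 / \<theta> * star f' + QQ * (A + F)) + BB * (kap * A + KK * F)"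
    unfolding V_def A_def F_def using LY_star(2)[OF w f'] LY_L1[OF w] const_bounds by (intro add_mono mult_left_mono) auto
  also have "\<dots> = 1 / \<theta> * star f' + (QQ + BB * kap) * A + RR * F" by (simp add: RR_def algebra_simps)
  also have "\<dots> \<le> lam * star f' + (lam * BB) * A + RR * F"
  proof (intro add_mono mult_right_mono order_refl AF st)
    show "1 / \<theta> \<le> lam" using kap lam by linarith
    have "2 * QQ \<le> BB * (1 - kap)" using kap by (simp add: BB_def)
    then show "QQ + BB * kap \<le> lam * BB" by (simp add: lam_def field_simps)
  qed
  finally show ?thesis by (simp add: V_def A_def F_def algebra_simps)
qed

lemma dit_Lp: "has_weak_deriv f f' \<Longrightarrow> f' \<in> Lp_space p \<Longrightarrow> dit f f' n \<in> Lp_space p"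
  by (induction n) (auto intro: LY_star(1)[OF has_weak_deriv_Pn])

lemma V_iter:
  assumes w: "has_weak_deriv f f'" and f': "f' \<in> Lp_space p"
  shows "V (dit f f' n) \<le> lam ^ n * V f' + R1 * (LINT t|mu. \<bar>f t\<bar>)"
proof (induction n)
  case 0 show ?case using const_bounds by simp
next
  case (Suc n)
  define F where "F = (LINT x|mu. \<bar>f x\<bar>)"
  have "V (dit f f' (Suc n)) \<le> lam * V (dit f f' n) + RR * (LINT t|mu. \<bar>(P ^^ n) f t\<bar>)"
    using LY_V[OF has_weak_deriv_Pn[OF w] dit_Lp[OF w f']] by simp
  also have "\<dots> \<le> lam * (lam ^ n * V f' + R1 * F) + RR * F"
    using Suc Pn_contraction[of f n] w lam const_bounds unfolding F_def
    by (intro add_mono mult_left_mono) (auto simp: has_weak_deriv_def)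
  also have "\<dots> = lam ^ Suc n * V f' + (lam * R1 + RR) * F" by (simp add: algebra_simps)
  also have "lam * R1 + RR = R1" using lam by (simp add: R1_def field_simps)
  finally show ?case by (simp add: F_def)
qed

lemma V_ge: "f' \<in> Lp_space p \<Longrightarrow> nrm p f' \<le> V f'" "f' \<in> Lp_space p \<Longrightarrow> (LINT x|mu. \<bar>f' x\<bar>) \<le> V f'"
  "f' \<in> Lp_space p \<Longrightarrow> 0 \<le> V f'"
proof -
  assume f: "f' \<in> Lp_space p"
  have I: "0 \<le> (LINT x|mu. \<bar>f' x\<bar>)" by simp
  have "(LINT x|mu. \<bar>f' x\<bar>) \<le> BB * (LINT x|mu. \<bar>f' x\<bar>)" using mult_right_mono[OF const_bounds(5) I] by simp
  then show "nrm p f' \<le> V f'" "(LINT x|mu. \<bar>f' x\<bar>) \<le> V f'" "0 \<le> V f'" unfolding V_def using star_ge[OF f] I by linarith+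
qed

lemma V_le: "f' \<in> Lp_space p \<Longrightarrow> V f' \<le> (K2 + 2 * BB) * nrm p f'"
proof -
  assume f: "f' \<in> Lp_space p"
  have "BB * (LINT x|mu. \<bar>f' x\<bar>) \<le> BB * (2 * nrm p f')"
    by (intro mult_left_mono Lp_integrable(2)[OF pge1 f]) (use const_bounds in auto)
  then show ?thesis using star_le[OF f] by (simp add: V_def algebra_simps)
qed

end

subsection \<open>Consequences of a spectral gap\<close>

text \<open>Serves the second derivatives, whose norms contract up to a geometrically small error.
  The partial sums are absorbed into themselves because l < 1.\<close>

lemma summable_recursive_bound:
  fixes x g :: "nat \<Rightarrow> real"
  assumes x: "\<And>n. 0 \<le> x n" "\<And>n. x (Suc n) \<le> l * x n + g n" and l: "0 \<le> l" "l < 1"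
    and g: "\<And>n. 0 \<le> g n" "summable g"
  shows "summable x"
proof (rule summableI_nonneg_bounded)
  fix N
  show "sum x {..<N} \<le> (x 0 + suminf g) / (1 - l)"
  proof -
    have "sum x {..<N} \<le> sum x {..<Suc N}" using x by simp
    also have "\<dots> = x 0 + (\<Sum>n<N. x (Suc n))" by (rule sum.lessThan_Suc_shift)
    also have "\<dots> \<le> x 0 + (\<Sum>n<N. l * x n + g n)" by (intro add_left_mono sum_mono x)
    also have "\<dots> = x 0 + (l * sum x {..<N} + sum g {..<N})" by (simp add: sum.distrib sum_distrib_left)
    also have "sum g {..<N} \<le> suminf g" using g by (intro sum_le_suminf) auto
    finally have "(1 - l) * sum x {..<N} \<le> x 0 + suminf g" by (simp add: algebra_simps)
    then show ?thesis using l by (simp add: pos_le_divide_eq mult.commute)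
  qed
qed (use x in auto)

context cusp_map
begin

text \<open>One of the two factors 1/T' gives 1/\<theta>, the other is merely bounded by 1. The
  remaining terms involve only f' and f, for whose iterates decay will be available.\<close>

lemma second_deriv_star:
  assumes w: "has_weak_deriv f f'" and w2: "has_weak_deriv f' f''" and L: "f'' \<in> Lp_space p"
  shows "P (\<lambda>x. f'' x * (rho x * rho x) + 3 * f' x * tau x + f x * sig x) \<in> Lp_space p"
    "star (P (\<lambda>x. f'' x * (rho x * rho x) + 3 * f' x * tau x + f x * sig x))
      \<le> 1 / \<theta> * star f'' + (3 * Ct * star f' + ((LINT t|mu. \<bar>f' t\<bar>) + (LINT t|mu. \<bar>f t\<bar>)) * star Om2)"
proof -
  define s where "s = (LINT t|mu. \<bar>f' t\<bar>) + (LINT t|mu. \<bar>f t\<bar>)"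
  have s0: "0 \<le> s" by (simp add: s_def)
  have s: "AE x in mu. \<bar>f x\<bar> \<le> s" unfolding s_def by (rule has_weak_deriv_sup_bound[OF w])
  have L': "f' \<in> Lp_space p" by (rule has_weak_deriv_Lp[OF p0 w2])
  let ?g = "\<lambda>x. f'' x * (rho x * rho x) + 3 * f' x * tau x + f x * sig x"
  have m: "f \<in> borel_measurable mu" "f' \<in> borel_measurable mu" "f'' \<in> borel_measurable mu"
    using w w2 by (auto simp: has_weak_deriv_def)
  have gm: "?g \<in> borel_measurable mu" using m meas_om by measurable
  have Ct0: "0 \<le> Ct" using m0 M0 by (simp add: Ct_def)
  have th: "0 \<le> 1 / \<theta>" "1 / \<theta> \<le> 1" using theta by auto
  let ?a = "\<lambda>x. 1 / \<theta> * \<bar>f'' x\<bar>" let ?b = "\<lambda>x. 3 * Ct * \<bar>f' x\<bar>" let ?e = "\<lambda>x. s * \<bar>Om2 x\<bar>"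
  have A: "?a \<in> Lp_space p" "?b \<in> Lp_space p" "?e \<in> Lp_space p"
    by (intro Lp_cmult(1)[OF p0] Lp_abs L L' Om2_Lp)+
  have BE: "(\<lambda>x. ?b x + ?e x) \<in> Lp_space p" by (rule Lp_add(1)[OF pge1 A(2,3)])
  have S: "(\<lambda>x. ?a x + (?b x + ?e x)) \<in> Lp_space p" by (rule Lp_add(1)[OF pge1 A(1) BE])
  have nn: "\<And>x. 0 \<le> ?a x" "\<And>x. 0 \<le> ?b x" "\<And>x. 0 \<le> ?e x" "\<And>x. 0 \<le> ?b x + ?e x" using th s0 Ct0 by auto
  have le: "AE x in mu. \<bar>?g x\<bar> \<le> \<bar>?a x + (?b x + ?e x)\<bar>"
    using s AE_D
  proof eventually_elim
    case (elim x)
    then have xD: "x \<in> D" "x \<in> {0..1}" by (auto simp: D_def)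
    have "\<bar>rho x\<bar> * \<bar>rho x\<bar> \<le> (1 / \<theta>) * 1" using rho_le(1)[OF xD(2)] th by (intro mult_mono) auto
    then have 1: "\<bar>f'' x\<bar> * (\<bar>rho x\<bar> * \<bar>rho x\<bar>) \<le> \<bar>f'' x\<bar> * (1 / \<theta>)" by (intro mult_left_mono) auto
    have 2: "\<bar>f' x\<bar> * \<bar>tau x\<bar> \<le> \<bar>f' x\<bar> * Ct" using tau_le(2)[OF xD(1)] by (intro mult_left_mono) auto
    have 3: "\<bar>f x\<bar> * \<bar>sig x\<bar> \<le> s * Om2 x" using elim sig_le[OF xD(1)] s0 by (intro mult_mono) auto
    have "\<bar>?g x\<bar> \<le> \<bar>f'' x * (rho x * rho x)\<bar> + \<bar>3 * f' x * tau x\<bar> + \<bar>f x * sig x\<bar>"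
      by (intro order_trans[OF abs_triangle_ineq] add_mono abs_triangle_ineq order_refl)
    also have "\<dots> = \<bar>f'' x\<bar> * (\<bar>rho x\<bar> * \<bar>rho x\<bar>) + 3 * (\<bar>f' x\<bar> * \<bar>tau x\<bar>) + \<bar>f x\<bar> * \<bar>sig x\<bar>" by (simp only: abs_mult abs_numeral mult.assoc)
    also have "\<dots> \<le> ?a x + (?b x + ?e x)" using 1 2 3 Om2_nonneg[of x] by (simp add: algebra_simps)
    finally show ?case using abs_ge_self order_trans by blast
  qed
  have gL: "?g \<in> Lp_space p" by (rule Lp_dominated(1)[OF p0 S gm le])
  show "P ?g \<in> Lp_space p" by (rule P_Lp(1)[OF gL])
  have "star (P ?g) \<le> star ?g" by (rule star_P[OF gL])
  also have "\<dots> \<le> star (\<lambda>x. ?a x + (?b x + ?e x))" by (rule star_mono[OF S gm le])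
  also have "\<dots> \<le> star ?a + star (\<lambda>x. ?b x + ?e x)" by (rule star_add[OF A(1) BE nn(1,4)])
  also have "\<dots> \<le> star ?a + (star ?b + star ?e)" by (intro add_left_mono star_add A nn)
  also have "\<dots> \<le> 1 / \<theta> * star f'' + (3 * Ct * star f' + s * star Om2)"
    by (intro add_mono star_cmult L L' Om2_Lp th s0) (use Ct0 in simp)
  finally show "star (P ?g) \<le> 1 / \<theta> * star f'' + (3 * Ct * star f' + ((LINT t|mu. \<bar>f' t\<bar>) + (LINT t|mu. \<bar>f t\<bar>)) * star Om2)"
    by (simp add: s_def)
qed

text \<open>Decay is demanded of the derivative only, since on mean zero functions it controls the
  function. The constants are arguments, so that one pair can serve all small \<epsilon>.\<close>

definition gap :: "real \<Rightarrow> real \<Rightarrow> bool" where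
  "gap C r \<longleftrightarrow> 0 \<le> C \<and> 0 < r \<and> r < 1 \<and> (\<forall>f f' n. has_weak_deriv f f' \<longrightarrow> f' \<in> Lp_space p \<longrightarrow>
     (LINT x|mu. f x) = 0 \<longrightarrow> V (dit f f' n) \<le> C * r ^ n * V f')"

lemma mean_zero_bound:
  assumes "has_weak_deriv f f'" "(LINT x|mu. f x) = 0"
  shows "AE x in mu. \<bar>f x\<bar> \<le> (LINT x|mu. \<bar>f' x\<bar>)" "(LINT x|mu. \<bar>f x\<bar>) \<le> (LINT x|mu. \<bar>f' x\<bar>)" "nrm p f \<le> (LINT x|mu. \<bar>f' x\<bar>)"
proof -
  show *: "AE x in mu. \<bar>f x\<bar> \<le> (LINT x|mu. \<bar>f' x\<bar>)" using has_weak_deriv_mean_bound[OF assms(1)] assms(2) by simp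
  note i = has_weak_deriv_integrable[OF assms(1)]
  have "(LINT x|mu. \<bar>f x\<bar>) \<le> (LINT x|mu. (LINT x|mu. \<bar>f' x\<bar>))" using i by (intro integral_mono_AE *) auto
  then show "(LINT x|mu. \<bar>f x\<bar>) \<le> (LINT x|mu. \<bar>f' x\<bar>)" by simp
  show "nrm p f \<le> (LINT x|mu. \<bar>f' x\<bar>)" using i by (intro Lp_bounded(2)[OF p0 _ *]) auto
qed

lemma dit_add: "dit f f' (k + n) = dit ((P ^^ k) f) (dit f f' k) n"
proof (induction n)
  case (Suc n)
  have "(P ^^ (k + n)) f = (P ^^ n) ((P ^^ k) f)" by (simp add: funpow_add add.commute[of k])
  then show ?case using Suc by simp
qed simp

text \<open>After \<open>N\<close> steps the weak norm is small, and \<open>k\<close> further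
  Lasota-Yorke steps turn this into a halving of \<open>V\<close>. A general number of steps is a
  number of such blocks plus a remainder.\<close>

lemma gapI:
  assumes N: "\<And>f f'. has_weak_deriv f f' \<Longrightarrow> f' \<in> Lp_space p \<Longrightarrow> (LINT x|mu. f x) = 0 \<Longrightarrow>
     (LINT x|mu. \<bar>(P ^^ N) f x\<bar>) \<le> eta * nrm p f'"
    and eta: "0 \<le> eta" and k: "lam ^ k * (1 + R1) + R1 * eta \<le> 1 / 2" "0 < k"
  shows "gap (2 * (1 + R1)) ((1 / 2) powr (1 / real (N + k)))"
proof -
  define n0 where "n0 = N + k"
  have n0: "0 < n0" using k by (simp add: n0_def)
  \<comment> \<open>Chosen so that one block halves. The remainder of length i costs 1 + R1, and the
    2 in the constant pays for the fact that r^i is only known to be at least 1/2.\<close>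
  define r where "r = (1 / 2 :: real) powr (1 / real n0)"
  have r: "0 < r" "r < 1" "r ^ n0 = 1 / 2"
    using n0 powr_less_mono2[of "1 / real n0" "1/2" 1] by (auto simp: r_def powr_power)
  have one: "V (dit f f' j) \<le> (1 + R1) * V f'"
    if w: "has_weak_deriv f f'" "f' \<in> Lp_space p" "(LINT x|mu. f x) = 0" for f f' j
  proof -
    have F: "(LINT x|mu. \<bar>f x\<bar>) \<le> V f'" using mean_zero_bound(2)[OF w(1,3)] V_ge(2)[OF w(2)] by linarith
    have "V (dit f f' j) \<le> lam ^ j * V f' + R1 * (LINT t|mu. \<bar>f t\<bar>)" by (rule V_iter[OF w(1,2)])
    also have "\<dots> \<le> 1 * V f' + R1 * V f'" using lam const_bounds F V_ge(3)[OF w(2)]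
      by (intro add_mono mult_right_mono mult_left_mono power_le_one) auto
    finally show ?thesis by (simp add: algebra_simps)
  qed
  have half: "V (dit f f' n0) \<le> 1 / 2 * V f'"
    if w: "has_weak_deriv f f'" "f' \<in> Lp_space p" "(LINT x|mu. f x) = 0" for f f'
  proof -
    have "V (dit f f' n0) \<le> lam ^ k * V (dit f f' N) + R1 * (LINT t|mu. \<bar>(P ^^ N) f t\<bar>)"
      unfolding n0_def dit_add by (rule V_iter[OF has_weak_deriv_Pn[OF w(1)] dit_Lp[OF w(1,2)]])
    also have "\<dots> \<le> lam ^ k * ((1 + R1) * V f') + R1 * (eta * V f')"
    proof (intro add_mono mult_left_mono one w)
      have "(LINT x|mu. \<bar>(P ^^ N) f x\<bar>) \<le> eta * nrm p f'" by (rule N[OF w])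
      also have "\<dots> \<le> eta * V f'" by (intro mult_left_mono V_ge w eta)
      finally show "(LINT x|mu. \<bar>(P ^^ N) f x\<bar>) \<le> eta * V f'" .
    qed (use lam const_bounds in auto)
    also have "\<dots> = (lam ^ k * (1 + R1) + R1 * eta) * V f'" by (simp add: algebra_simps)
    also have "\<dots> \<le> 1 / 2 * V f'" by (intro mult_right_mono k V_ge w)
    finally show ?thesis .
  qed
  have iter: "V (dit f f' (j * n0)) \<le> (1 / 2) ^ j * V f'"
    if w: "has_weak_deriv f f'" "f' \<in> Lp_space p" "(LINT x|mu. f x) = 0" for f f' j
  proof (induction j)
    case (Suc j)
    have "V (dit f f' (Suc j * n0)) = V (dit ((P ^^ (j * n0)) f) (dit f f' (j * n0)) n0)"
      by (simp only: dit_add[symmetric]) (simp add: add.commute)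
    also have "\<dots> \<le> 1 / 2 * V (dit f f' (j * n0))"
      using w by (intro half has_weak_deriv_Pn dit_Lp) (auto simp: Pn_integral has_weak_deriv_def)
    also have "\<dots> \<le> 1 / 2 * ((1 / 2) ^ j * V f')" using Suc by simp
    finally show ?case by simp
  qed simp
  have "V (dit f f' n) \<le> 2 * (1 + R1) * r ^ n * V f'"
    if w: "has_weak_deriv f f'" "f' \<in> Lp_space p" "(LINT x|mu. f x) = 0" for f f' n
  proof -
    define j where "j = n div n0" define i where "i = n mod n0"
    have n: "n = j * n0 + i" by (simp add: j_def i_def)
    have "V (dit f f' n) = V (dit ((P ^^ (j * n0)) f) (dit f f' (j * n0)) i)" by (simp add: n dit_add)
    also have "\<dots> \<le> (1 + R1) * V (dit f f' (j * n0))"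
      using w by (intro one has_weak_deriv_Pn dit_Lp) (auto simp: Pn_integral has_weak_deriv_def)
    also have "\<dots> \<le> (1 + R1) * ((1 / 2) ^ j * V f')" using const_bounds by (intro mult_left_mono iter w) auto
    also have "\<dots> \<le> (1 + R1) * (2 * r ^ n * V f')"
    proof (intro mult_left_mono mult_right_mono V_ge w)
      show "(1 / 2 :: real) ^ j \<le> 2 * r ^ n"
    proof -
      have "1 / 2 = r ^ n0" using r by simp
      also have "\<dots> \<le> r ^ i" using r n0 by (intro power_decreasing) (auto simp: i_def)
      finally have "1 \<le> 2 * r ^ i" by simp
      then have "(1 / 2) ^ j * 1 \<le> (1 / 2) ^ j * (2 * r ^ i)" by (intro mult_left_mono) auto
      also have "\<dots> = 2 * ((r ^ n0) ^ j * r ^ i)" unfolding r(3) by simp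
      also have "\<dots> = 2 * r ^ n" by (simp add: n power_add power_mult[symmetric] mult.commute)
      finally show ?thesis by simp
      qed
    qed (use const_bounds in auto)
    finally show ?thesis by (simp add: algebra_simps)
  qed
  then show ?thesis using r const_bounds unfolding gap_def by (auto simp: r_def n0_def)
qed

section \<open>The Neumann series and decay in L^1\<close>

definition "Res w = (\<lambda>x. \<Sum>n. (P ^^ n) w x)"
definition "Res' w w' = (\<lambda>x. \<Sum>n. dit w w' n x)"

text \<open>At each point \<open>P\<close> is a finite sum, so it commutes with a series that
  converges at all preimages of the point.\<close>

lemma P_suminf:
  assumes "AE x in mu. summable (\<lambda>n. u n x)"
  shows "AE y in mu. P (\<lambda>x. \<Sum>n. u n x) y = (\<Sum>n. P (u n) y)"
  using P_AE[OF assms]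
proof eventually_elim
  case (elim y)
  have "(\<Sum>n. P (u n) y) = (\<Sum>x | x \<in> {0<..<1} - {c} \<and> T x = y. \<Sum>n. u n x / \<bar>T1 x\<bar>)"
    unfolding PF_def by (rule suminf_sum) (use elim in \<open>auto intro: summable_divide\<close>)
  also have "\<dots> = P (\<lambda>x. \<Sum>n. u n x) y"
    unfolding PF_def by (rule sum.cong) (use elim in \<open>auto intro: suminf_divide\<close>)
  finally show ?case by simp
qed

context
  fixes C r assumes gap: "gap C r"
begin

lemma gapD: "0 \<le> C" "0 < r" "r < 1"
   "has_weak_deriv f f' \<Longrightarrow> f' \<in> Lp_space p \<Longrightarrow> (LINT x|mu. f x) = 0 \<Longrightarrow> V (dit f f' n) \<le> C * r ^ n * V f'"
  using gap by (auto simp: gap_def)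

lemma gap_Pn:
  assumes w: "has_weak_deriv f f'" "f' \<in> Lp_space p" "(LINT x|mu. f x) = 0"
  shows "nrm p ((P ^^ n) f) \<le> C * r ^ n * V f'" "nrm p (dit f f' n) \<le> C * r ^ n * V f'"
    "(LINT x|mu. \<bar>(P ^^ n) f x\<bar>) \<le> C * r ^ n * V f'" "(LINT x|mu. \<bar>dit f f' n x\<bar>) \<le> C * r ^ n * V f'"
proof -
  note g = gapD(4)[OF w, of n] and D = dit_Lp[OF w(1,2), of n]
  have z: "(LINT x|mu. (P ^^ n) f x) = 0" using w by (simp add: Pn_integral has_weak_deriv_def)
  note b = mean_zero_bound[OF has_weak_deriv_Pn[OF w(1)] z]
  show "nrm p ((P ^^ n) f) \<le> C * r ^ n * V f'" "nrm p (dit f f' n) \<le> C * r ^ n * V f'"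
    "(LINT x|mu. \<bar>(P ^^ n) f x\<bar>) \<le> C * r ^ n * V f'" "(LINT x|mu. \<bar>dit f f' n x\<bar>) \<le> C * r ^ n * V f'"
    using b(2,3) V_ge(1,2)[OF D] g by linarith+
qed

lemma geometric_sums: "summable (\<lambda>n. C * r ^ n * K)" "(\<Sum>n. C * r ^ n * K) = C / (1 - r) * K"
proof -
  have s: "summable (\<lambda>n. r ^ n)" "(\<Sum>n. r ^ n) = 1 / (1 - r)" using gapD(2,3) by (auto simp: suminf_geometric)
  show "summable (\<lambda>n. C * r ^ n * K)" by (intro summable_mult2 summable_mult s)
  show "(\<Sum>n. C * r ^ n * K) = C / (1 - r) * K"
    using suminf_mult2[OF summable_mult[OF s(1), of C], of K] suminf_mult[OF s(1), of C] s(2) by simp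
qed

lemma Res_props:
  assumes w: "has_weak_deriv f f'" "f' \<in> Lp_space p" "(LINT x|mu. f x) = 0"
  shows "has_weak_deriv (Res f) (Res' f f')" "Res' f f' \<in> Lp_space p"
    "nrm p (Res f) \<le> C / (1 - r) * V f'" "nrm p (Res' f f') \<le> C / (1 - r) * V f'"
    "(LINT x|mu. Res f x) = 0" "AE x in mu. summable (\<lambda>n. (P ^^ n) f x)"
    "AE x in mu. Res f x - P (Res f) x = f x"
    "nrm p (\<lambda>x. Res f x - (\<Sum>n<N. (P ^^ n) f x)) \<le> C / (1 - r) * r ^ N * V f'"
proof -
  have U: "(P ^^ n) f \<in> Lp_space p" for n by (rule has_weak_deriv_Lp[OF p0 has_weak_deriv_Pn[OF w(1)]])
  have U': "dit f f' n \<in> Lp_space p" for n by (rule dit_Lp[OF w(1,2)])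
  note b = gap_Pn[OF w]
  have s: "summable (\<lambda>n. nrm p ((P ^^ n) f))" "summable (\<lambda>n. nrm p (dit f f' n))"
    by (rule summable_comparison_test'[OF geometric_sums(1)[of "V f'"], of 0], use b in simp)+
  show wd: "has_weak_deriv (Res f) (Res' f f')" unfolding Res_def Res'_def
    by (rule Lp_series_weak_deriv[OF pge1 U s(1) U' s(2) has_weak_deriv_Pn[OF w(1)]])
  show "Res' f f' \<in> Lp_space p" unfolding Res'_def by (rule Lp_series(2)[OF pge1 U' s(2)])
  have tail: "(\<Sum>n. nrm p (u (n + N))) \<le> C / (1 - r) * r ^ N * V f'"
    if u: "\<And>n. nrm p (u n) \<le> C * r ^ n * V f'" "summable (\<lambda>n. nrm p (u n))" for u :: "nat \<Rightarrow> real \<Rightarrow> real" and N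
  proof -
    have "(\<Sum>n. nrm p (u (n + N))) \<le> (\<Sum>n. C * r ^ n * (r ^ N * V f'))"
      using u(1)[of "_ + N"] by (intro suminf_le summable_ignore_initial_segment[OF u(2)] geometric_sums)
        (simp add: power_add mult_ac)
    then show ?thesis unfolding geometric_sums(2) by (simp add: mult_ac)
  qed
  show "nrm p (Res f) \<le> C / (1 - r) * V f'"
    using Lp_series(3)[OF pge1 U s(1), of 0] tail[of "\<lambda>n. (P ^^ n) f" 0, OF b(1) s(1)] by (simp add: Res_def)
  show "nrm p (Res' f f') \<le> C / (1 - r) * V f'"
    using Lp_series(3)[OF pge1 U' s(2), of 0] tail[of "dit f f'" 0, OF b(2) s(2)] by (simp add: Res'_def)
  show "nrm p (\<lambda>x. Res f x - (\<Sum>n<N. (P ^^ n) f x)) \<le> C / (1 - r) * r ^ N * V f'"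
    using Lp_series(3)[OF pge1 U s(1), of N] tail[of "\<lambda>n. (P ^^ n) f" N, OF b(1) s(1)] by (simp add: Res_def)
  have ae: "AE x in mu. summable (\<lambda>n. \<bar>(P ^^ n) f x\<bar>)" by (rule Lp_series(1)[OF pge1 U s(1)])
  then show ae': "AE x in mu. summable (\<lambda>n. (P ^^ n) f x)" by eventually_elim (rule summable_rabs_cancel)
  have fi: "integrable mu f" using w by (simp add: has_weak_deriv_def)
  have "(\<lambda>n. LINT x|mu. (P ^^ n) f x) sums (LINT x|mu. (\<Sum>n. (P ^^ n) f x))"
  proof (rule sums_integral[OF Pn_integrable[OF fi]])
    show "AE x in mu. summable (\<lambda>n. norm ((P ^^ n) f x))" using ae by simp
    show "summable (\<lambda>n. LINT x|mu. norm ((P ^^ n) f x))"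
      by (rule summable_comparison_test'[OF geometric_sums(1)[of "V f'"], of 0]) (use b(3) in simp)
  qed
  then have "(\<lambda>n. 0) sums (LINT x|mu. Res f x)" using Pn_integral[OF fi] w(3) by (simp add: Res_def)
  then show "(LINT x|mu. Res f x) = 0" using sums_unique2[OF _ sums_zero] by blast
  show "AE x in mu. Res f x - P (Res f) x = f x"
    using ae' P_suminf[OF ae']
  proof eventually_elim
    case (elim x)
    have "Res f x = f x + (\<Sum>n. (P ^^ Suc n) f x)" unfolding Res_def using suminf_split_head[OF elim(1)] by simp
    then show ?case using elim(2) by (simp add: Res_def)
  qed
qed

text \<open>Needed for uniqueness among all integrable densities. A polynomial close to
  \<open>f\<close> is corrected by its mean, which is small because \<open>f\<close> has mean 0; the
  corrected polynomial decays and the error is contracted.\<close>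

lemma L1_decay:
  assumes f: "integrable mu f" "(LINT x|mu. f x) = 0"
  shows "(\<lambda>n. LINT x|mu. \<bar>(P ^^ n) f x\<bar>) \<longlonglongrightarrow> 0"
proof (rule LIMSEQ_I)
  fix e :: real assume e: "e > 0"
  obtain q where q: "real_polynomial_function q" "(LINT x|mu. \<bar>f x - q x\<bar>) < e / 4"
    using L1_polynomial_approx[OF f(1), of "e/4"] e by auto
  obtain q' where q': "real_polynomial_function q'" "\<And>x. (q has_real_derivative q' x) (at x)"
    using has_real_derivative_polynomial_function[OF q(1)] by blast
  have q'c: "continuous_on {0..1} q'" by (rule diff_times_DERIV(2)[OF diff_times_real_polynomial[OF q'(1)]])
  have wq: "has_weak_deriv q q'" by (rule has_weak_deriv_C1[OF q'(2) q'c])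
  have q'L: "q' \<in> Lp_space p"
    using continuous_bounded_mu[OF q'c] continuous_integrable_mu[OF q'c]
    by (metis AE_I2 Lp_bounded(1) borel_measurable_integrable p0 space_lebesgue_on)
  define k where "k = (LINT x|mu. q x)"
  have qi: "integrable mu q" using wq by (simp add: has_weak_deriv_def)
  have k: "\<bar>k\<bar> < e / 4"
  proof -
    have "k = (LINT x|mu. q x - f x)" using f qi by (simp add: k_def)
    also have "\<bar>\<dots>\<bar> \<le> (LINT x|mu. \<bar>q x - f x\<bar>)" by (rule integral_abs_bound)
    finally show ?thesis using q(2) by (simp add: abs_minus_commute)
  qed
  have w: "has_weak_deriv (\<lambda>x. q x - k) q'" using has_weak_deriv_diff[OF wq has_weak_deriv_const[of k]] by simp
  have z: "(LINT x|mu. q x - k) = 0" using qi by (simp add: k_def)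
  have "(\<lambda>n. C * r ^ n * V q') \<longlonglongrightarrow> C * 0 * V q'" using gapD(2,3) by (intro tendsto_intros LIMSEQ_realpow_zero) auto
  then have "eventually (\<lambda>n. C * r ^ n * V q' < e / 4) sequentially" using e by (intro order_tendstoD(2)) auto
  then obtain N where N: "\<And>n. n \<ge> N \<Longrightarrow> C * r ^ n * V q' < e / 4" by (auto simp: eventually_sequentially)
  show "\<exists>N. \<forall>n\<ge>N. norm ((LINT x|mu. \<bar>(P ^^ n) f x\<bar>) - 0) < e"
  proof (intro exI allI impI)
    fix n assume n: "N \<le> n"
    have di: "integrable mu (\<lambda>x. f x - (q x - k))" using f qi by auto
    have "(LINT x|mu. \<bar>(P ^^ n) f x\<bar>) \<le> (LINT x|mu. \<bar>(P ^^ n) (\<lambda>x. f x - (q x - k)) x\<bar> + \<bar>(P ^^ n) (\<lambda>x. q x - k) x\<bar>)"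
      using Pn_integrable[OF f(1), of n] Pn_integrable[OF di, of n] Pn_integrable[of "\<lambda>x. q x - k" n] qi
      by (intro integral_mono) (auto simp: Pn_diff)
    also have "\<dots> = (LINT x|mu. \<bar>(P ^^ n) (\<lambda>x. f x - (q x - k)) x\<bar>) + (LINT x|mu. \<bar>(P ^^ n) (\<lambda>x. q x - k) x\<bar>)"
      using Pn_integrable[OF di, of n] Pn_integrable[of "\<lambda>x. q x - k" n] qi by (intro Bochner_Integration.integral_add) auto
    also have "\<dots> \<le> (LINT x|mu. \<bar>f x - (q x - k)\<bar>) + C * r ^ n * V q'"
      by (intro add_mono Pn_contraction di gap_Pn(3)[OF w q'L z])
    also have "(LINT x|mu. \<bar>f x - (q x - k)\<bar>) \<le> (LINT x|mu. \<bar>f x - q x\<bar> + \<bar>k\<bar>)"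
      using f qi by (intro integral_mono) auto
    also have "\<dots> < e / 4 + e / 4" using q(2) k f qi by simp
    finally have "(LINT x|mu. \<bar>(P ^^ n) f x\<bar>) < e" using N[OF n] e by linarith
    then show "norm ((LINT x|mu. \<bar>(P ^^ n) f x\<bar>) - 0) < e" by simp
  qed
qed

lemma fixed_zero:
  assumes f: "integrable mu f" "(LINT x|mu. f x) = 0" "AE x in mu. P f x = f x"
  shows "AE x in mu. f x = 0"
proof -
  have *: "AE x in mu. (P ^^ n) f x = f x" for n
  proof (induction n)
    case (Suc n)
    from P_cong_AE[OF Suc] f(3) show ?case by eventually_elim simp
  qed simp
  have "(LINT x|mu. \<bar>(P ^^ n) f x\<bar>) = (LINT x|mu. \<bar>f x\<bar>)" for n
  proof (rule integral_cong_AE)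
    show "AE x in mu. \<bar>(P ^^ n) f x\<bar> = \<bar>f x\<bar>" using *[of n] by eventually_elim simp
  qed (use Pn_integrable[OF f(1), of n] f in auto)
  then have "(LINT x|mu. \<bar>f x\<bar>) = 0" using L1_decay[OF f(1,2)] by (simp add: LIMSEQ_const_iff)
  then show ?thesis using f(1) by (subst (asm) integral_nonneg_eq_0_iff_AE) auto
qed

lemma resolvent_unique:
  assumes f: "integrable mu f" "(LINT x|mu. f x) = k" "AE x in mu. f x - P f x = w x"
    and g: "integrable mu g" "(LINT x|mu. g x) = k" "AE x in mu. g x - P g x = w x"
  shows "AE x in mu. f x = g x"
proof -
  have "AE x in mu. f x - g x = 0"
  proof (rule fixed_zero)
    show "AE x in mu. P (\<lambda>x. f x - g x) x = f x - g x" using f(3) g(3) by eventually_elim (simp add: P_diff)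
  qed (use f g in auto)
  then show ?thesis by eventually_elim simp
qed

section \<open>The invariant density and its regularity\<close>

definition "hinv = (\<lambda>x. 1 + Res (\<lambda>x. P (\<lambda>x. 1) x - 1) x)"

lemma hinv_start: "has_weak_deriv (\<lambda>x. P (\<lambda>x. 1) x - 1) (P om)" "P om \<in> Lp_space p" "(LINT x|mu. P (\<lambda>x. 1) x - 1) = 0"
  "has_weak_deriv (P om) (P sig)" "P sig \<in> Lp_space p"
proof -
  have "has_weak_deriv (P (\<lambda>x. 1)) (P (\<lambda>x. 0 * rho x + 1 * om x))" by (rule has_weak_deriv_P[OF has_weak_deriv_const])
  from has_weak_deriv_diff[OF this has_weak_deriv_const[of 1]]
  show "has_weak_deriv (\<lambda>x. P (\<lambda>x. 1) x - 1) (P om)" by simp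
  show 2: "has_weak_deriv (P om) (P sig)" using has_weak_deriv2_P[OF has_weak_deriv_const[of 1] has_weak_deriv_const[of 0]] by simp
  show "P om \<in> Lp_space p" by (rule has_weak_deriv_Lp[OF p0 2])
  show "(LINT x|mu. P (\<lambda>x. 1) x - 1) = 0" using P_integrable[OF integrable_mu_const[of 1]] by simp
  have "AE x in mu. \<bar>sig x\<bar> \<le> \<bar>Om2 x\<bar>" using sig_le Om2_nonneg by (intro AE_le_D) auto
  from Lp_dominated(1)[OF p0 Om2_Lp meas_om(5) this] show "P sig \<in> Lp_space p" by (rule P_Lp(1))
qed

lemma hinv_invariant:
  shows "integrable mu hinv" "(LINT x|mu. hinv x) = 1" "AE x in mu. P hinv x = hinv x" "AE x in mu. 0 \<le> hinv x"
proof -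
  let ?w = "\<lambda>x. P (\<lambda>x. 1) x - 1"
  note R = Res_props[OF hinv_start(1-3)]
  have Ri: "integrable mu (Res ?w)" using R(1) by (simp add: has_weak_deriv_def)
  show "integrable mu hinv" "(LINT x|mu. hinv x) = 1" using Ri R(5) by (auto simp: hinv_def)
  show "AE x in mu. P hinv x = hinv x" using R(7)
  proof eventually_elim
    case (elim x)
    have "P hinv x = P (\<lambda>x. 1) x + P (Res ?w) x" unfolding hinv_def by (rule P_add)
    then show ?case using elim by (simp add: hinv_def)
  qed
  show "AE x in mu. 0 \<le> hinv x" using R(6)
  proof eventually_elim
    case (elim x)
    \<comment> \<open>The partial sums telescope to the iterates of 1, so \<open>hinv\<close> is a
      limit of nonnegative functions.\<close>
    have tele: "1 + (\<Sum>n<N. (P ^^ n) ?w x) = (P ^^ N) (\<lambda>x. 1) x" for N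
    proof (induction N)
      case (Suc N)
      have "(P ^^ N) ?w x = (P ^^ Suc N) (\<lambda>x. 1) x - (P ^^ N) (\<lambda>x. 1) x"
        by (simp only: Pn_diff funpow_Suc_right o_apply)
      then show ?case using Suc by simp
    qed simp
    have "(\<lambda>N. 1 + (\<Sum>n<N. (P ^^ n) ?w x)) \<longlonglongrightarrow> hinv x"
      unfolding hinv_def Res_def by (intro tendsto_intros summable_LIMSEQ elim)
    then show ?case unfolding tele by (rule LIMSEQ_le_const) (intro exI allI impI Pn_nonneg, simp)
  qed
qed

primrec dit2 :: "(real \<Rightarrow> real) \<Rightarrow> (real \<Rightarrow> real) \<Rightarrow> (real \<Rightarrow> real) \<Rightarrow> nat \<Rightarrow> real \<Rightarrow> real" where
  "dit2 f f' f'' 0 = f''"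
| "dit2 f f' f'' (Suc n) = P (\<lambda>x. dit2 f f' f'' n x * (rho x * rho x) + 3 * dit f f' n x * tau x + (P ^^ n) f x * sig x)"

text \<open>Second derivatives of the iterates contract by 1/\<theta> up to lower order terms that
  the gap makes geometrically small, so their series converges in L^p and closedness of the weak
  derivative applies.\<close>

lemma hinv_W2:
  obtains h' h'' where "has_weak_deriv hinv h'" "has_weak_deriv h' h''" "h' \<in> Lp_space p" "h'' \<in> Lp_space p"
proof -
  let ?w = "\<lambda>x. P (\<lambda>x. 1) x - 1"
  note S = hinv_start
  note R = Res_props[OF S(1-3)]
  let ?d = "dit ?w (P om)" let ?d2 = "dit2 ?w (P om) (P sig)"
  have d: "has_weak_deriv (?d n) (?d2 n) \<and> ?d2 n \<in> Lp_space p" for n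
  proof (induction n)
    case (Suc n)
    then have "has_weak_deriv (?d n) (?d2 n)" "?d2 n \<in> Lp_space p" by auto
    from has_weak_deriv2_P[OF has_weak_deriv_Pn[OF S(1), of n] this(1)]
      second_deriv_star(1)[OF has_weak_deriv_Pn[OF S(1), of n] this]
    show ?case by simp
  qed (use S in simp)
  have V0: "0 \<le> V (P om)" by (rule V_ge(3)[OF S(2)])
  \<comment> \<open>Collects the lower order coefficients; the 2 appears because the function and
    its first derivative obey the same decay bound.\<close>
  define B where "B = 3 * Ct + 2 * star Om2"
  have Ct0: "0 \<le> Ct" using m0 M0 by (simp add: Ct_def)
  have B0: "0 \<le> B" using Ct0 star_ge(2)[OF Om2_Lp] by (simp add: B_def)
  have rec: "star (?d2 (Suc n)) \<le> 1 / \<theta> * star (?d2 n) + C * r ^ n * (V (P om) * B)" for n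
  proof -
    have dl: "?d n \<in> Lp_space p" by (rule dit_Lp[OF S(1,2)])
    note g = gap_Pn[OF S(1-3), of n] and v = gapD(4)[OF S(1-3), of n]
    have st: "star (?d n) \<le> C * r ^ n * V (P om)"
      using v const_bounds(5) by (simp add: V_def[of "?d n"]) (smt (verit) integral_nonneg_AE AE_I2 abs_ge_zero mult_nonneg_nonneg)
    have "star (?d2 (Suc n)) \<le> 1 / \<theta> * star (?d2 n) + (3 * Ct * star (?d n) + ((LINT t|mu. \<bar>?d n t\<bar>) + (LINT t|mu. \<bar>(P ^^ n) ?w t\<bar>)) * star Om2)"
      using second_deriv_star(2)[OF has_weak_deriv_Pn[OF S(1), of n], of "?d2 n"] d[of n] by simp
    also have "\<dots> \<le> 1 / \<theta> * star (?d2 n) + (3 * Ct * (C * r ^ n * V (P om)) + (C * r ^ n * V (P om) + C * r ^ n * V (P om)) * star Om2)"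
      using Ct0 by (intro add_left_mono add_mono mult_left_mono mult_right_mono st g star_ge(2)[OF Om2_Lp]) auto
    also have "\<dots> = 1 / \<theta> * star (?d2 n) + C * r ^ n * (V (P om) * B)" by (simp add: B_def algebra_simps)
    finally show ?thesis .
  qed
  have "summable (\<lambda>n. star (?d2 n))"
  proof (rule summable_recursive_bound[where l = "1 / \<theta>" and g = "\<lambda>n. C * r ^ n * (V (P om) * B)"])
    show "0 \<le> C * r ^ n * (V (P om) * B)" for n using gapD(1,2) V0 B0 by (intro mult_nonneg_nonneg) auto
    show "0 \<le> star (?d2 n)" for n using star_ge(2) d by blast
  qed (use theta rec geometric_sums(1) in auto)
  then have s2: "summable (\<lambda>n. nrm p (?d2 n))"
    by (rule summable_comparison_test'[of _ 0]) (use star_ge(1) d in auto)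
  have s1: "summable (\<lambda>n. nrm p (?d n))"
    by (rule summable_comparison_test'[OF geometric_sums(1)[of "V (P om)"], of 0]) (use gap_Pn(2)[OF S(1-3)] in simp)
  have dl: "?d n \<in> Lp_space p" for n by (rule dit_Lp[OF S(1,2)])
  show thesis
  proof (rule that)
    show "has_weak_deriv hinv (Res' ?w (P om))"
      using has_weak_deriv_add[OF has_weak_deriv_const[of 1] R(1)] by (simp add: hinv_def)
    show "has_weak_deriv (Res' ?w (P om)) (\<lambda>x. \<Sum>n. ?d2 n x)" unfolding Res'_def
      by (rule Lp_series_weak_deriv[OF pge1 dl s1 _ s2]) (use d in auto)
    show "Res' ?w (P om) \<in> Lp_space p" by (rule R(2))
    show "(\<lambda>x. \<Sum>n. ?d2 n x) \<in> Lp_space p" by (rule Lp_series(2)[OF pge1 _ s2]) (use d in auto)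
  qed
qed

lemma hinv_sobolev: "hinv \<in> sobolev_space 2 p"
proof -
  obtain h' h'' where h: "has_weak_deriv hinv h'" "has_weak_deriv h' h''" "h' \<in> Lp_space p" "h'' \<in> Lp_space p"
    by (rule hinv_W2)
  then show ?thesis using has_weak_deriv_Lp[OF p0 h(1)] sobolev1_I[OF p0 h(2,4)] unfolding sobolev2_iff by blast
qed

lemma hinv_density:
  shows "invariant_density T hinv" "\<And>g. invariant_density T g \<Longrightarrow> AE x in mu. g x = hinv x"
proof -
  note H = hinv_invariant
  have "AE x in mu. transfer_op T hinv x = hinv x"
    using transfer_op_P(1)[OF borel_measurable_integrable[OF H(1)]] H(3) by eventually_elim simp
  then show "invariant_density T hinv" using H by (simp add: invariant_density_def)
  fix g assume g: "invariant_density T g"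
  then have gi: "integrable mu g" and g1: "(LINT x|mu. g x) = 1" and gt: "AE x in mu. transfer_op T g x = g x"
    by (auto simp: invariant_density_def)
  have "AE x in mu. g x - P g x = 0" using gt transfer_op_P(1)[OF borel_measurable_integrable[OF gi]] by eventually_elim simp
  moreover have "AE x in mu. hinv x - P hinv x = 0" using H(3) by eventually_elim simp
  ultimately show "AE x in mu. g x = hinv x" by (intro resolvent_unique[OF gi g1 _ H(1,2)])
qed

section \<open>The resolvent equation on mean zero Sobolev functions\<close>

lemma sobolev_mean_zeroE:
  assumes "v \<in> W1p_mean_zero p"
  obtains v' where "has_weak_deriv v v'" "v' \<in> Lp_space p" "(LINT x|mu. v x) = 0"
  using assms unfolding W1p_mean_zero_def sobolev1_iff by blast

lemma sobolev_mean_zeroI: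
  assumes "has_weak_deriv v v'" "v' \<in> Lp_space p" "(LINT x|mu. v x) = 0"
  shows "v \<in> W1p_mean_zero p"
  using sobolev1_I[OF p0 assms(1,2)] assms(3) by (simp add: W1p_mean_zero_def)

lemma I_minus_P_bijective: "I_minus_P_bij p T"
  unfolding I_minus_P_bij_def
proof (intro conjI ballI)
  fix v assume "v \<in> W1p_mean_zero p"
  then obtain v' where v: "has_weak_deriv v v'" "v' \<in> Lp_space p" "(LINT x|mu. v x) = 0" by (rule sobolev_mean_zeroE)
  have vi: "integrable mu v" using v by (simp add: has_weak_deriv_def)
  note t = transfer_op_P[OF borel_measurable_integrable[OF vi]]
  have "has_weak_deriv (\<lambda>x. v x - P v x) (\<lambda>x. v' x - P (\<lambda>x. v' x * rho x + v x * om x) x)"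
    by (intro has_weak_deriv_diff v has_weak_deriv_P)
  then have w: "has_weak_deriv (\<lambda>x. v x - transfer_op T v x) (\<lambda>x. v' x - P (\<lambda>x. v' x * rho x + v x * om x) x)"
  proof (rule has_weak_deriv_cong)
    show "AE x in mu. v x - transfer_op T v x = v x - P v x" using t(1) by eventually_elim simp
    show "(\<lambda>x. v' x - P (\<lambda>x. v' x * rho x + v x * om x) x) \<in> borel_measurable mu"
      by (intro Lp_meas[of _ p] Lp_diff[OF pge1] v(2) LY_star(1)[OF v(1,2)])
  qed (use vi t in auto)
  have ti: "integrable mu (transfer_op T v)" by (rule integrable_mu_cong[OF P_integrable(1)[OF vi] t(2,1)])
  have "(LINT x|mu. transfer_op T v x) = (LINT x|mu. P v x)"
    by (rule integral_cong_AE[OF _ _ t(1)]) (use ti P_integrable(1)[OF vi] in auto)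
  then show "(\<lambda>x. v x - transfer_op T v x) \<in> W1p_mean_zero p"
    using v vi ti P_integrable(2)[OF vi] by (intro sobolev_mean_zeroI[OF w] Lp_diff[OF pge1] LY_star) auto
next
  fix w assume "w \<in> W1p_mean_zero p"
  then obtain w' where w: "has_weak_deriv w w'" "w' \<in> Lp_space p" "(LINT x|mu. w x) = 0" by (rule sobolev_mean_zeroE)
  note R = Res_props[OF w]
  have Ri: "integrable mu (Res w)" using R(1) by (simp add: has_weak_deriv_def)
  note t = transfer_op_P[OF borel_measurable_integrable[OF Ri]]
  show "\<exists>v\<in>W1p_mean_zero p. (AE x in mu. v x - transfer_op T v x = w x) \<and>
      (\<forall>v'\<in>W1p_mean_zero p. (AE x in mu. v' x - transfer_op T v' x = w x) \<longrightarrow> (AE x in mu. v' x = v x))"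
  proof (intro bexI conjI ballI impI)
    show "Res w \<in> W1p_mean_zero p" by (rule sobolev_mean_zeroI[OF R(1,2,5)])
    show "AE x in mu. Res w x - transfer_op T (Res w) x = w x" using t(1) R(7) by eventually_elim simp
    fix v assume v: "v \<in> W1p_mean_zero p" "AE x in mu. v x - transfer_op T v x = w x"
    then have vi: "integrable mu v" "(LINT x|mu. v x) = 0" by (auto elim!: sobolev_mean_zeroE simp: has_weak_deriv_def)
    have "AE x in mu. v x - P v x = w x"
      using v(2) transfer_op_P(1)[OF borel_measurable_integrable[OF vi(1)]] by eventually_elim simp
    then show "AE x in mu. v x = Res w x" by (rule resolvent_unique[OF vi _ Ri R(5,7)])
  qed
qed

text \<open>\<open>SOME\<close> picks an unspecified representative, so agreement can hold only
  almost everywhere; it follows from uniqueness in L^1. The separate \<open>q\<close> allows for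
  \<open>q_fun\<close>, which is known only up to a null set.\<close>

lemma I_minus_P_inv_Res:
  assumes w: "has_weak_deriv w w'" "w' \<in> Lp_space p" "(LINT x|mu. w x) = 0"
    and eq: "AE x in mu. q x = w x"
  shows "AE x in mu. I_minus_P_inv p T q x = Res w x" "I_minus_P_inv p T q \<in> borel_measurable mu"
proof -
  note R = Res_props[OF w]
  have Ri: "integrable mu (Res w)" using R(1) by (simp add: has_weak_deriv_def)
  have "\<exists>v. v \<in> W1p_mean_zero p \<and> (AE x in mu. v x - transfer_op T v x = q x)"
  proof (intro exI conjI)
    show "Res w \<in> W1p_mean_zero p" by (rule sobolev_mean_zeroI[OF R(1,2,5)])
    show "AE x in mu. Res w x - transfer_op T (Res w) x = q x"
      using transfer_op_P(1)[OF borel_measurable_integrable[OF Ri]] R(7) eq by eventually_elim simp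
  qed
  then have I: "I_minus_P_inv p T q \<in> W1p_mean_zero p"
    "AE x in mu. I_minus_P_inv p T q x - transfer_op T (I_minus_P_inv p T q) x = q x"
    using someI_ex[of "\<lambda>v. v \<in> W1p_mean_zero p \<and> (AE x in mu. v x - transfer_op T v x = q x)"]
    unfolding I_minus_P_inv_def by blast+
  then have vi: "integrable mu (I_minus_P_inv p T q)" "(LINT x|mu. I_minus_P_inv p T q x) = 0"
    by (auto elim!: sobolev_mean_zeroE simp: has_weak_deriv_def)
  then show "I_minus_P_inv p T q \<in> borel_measurable mu" by auto
  have "AE x in mu. I_minus_P_inv p T q x - P (I_minus_P_inv p T q) x = w x"
    using I(2) transfer_op_P(1)[OF borel_measurable_integrable[OF vi(1)]] eq by eventually_elim simp
  then show "AE x in mu. I_minus_P_inv p T q x = Res w x" by (rule resolvent_unique[OF vi _ Ri R(5,7)])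
qed

end

end

subsection \<open>Exactness of a full cusp map\<close>

context cusp_map
begin

section \<open>Monotone branches and preimages\<close>

lemma T_MVT:
  assumes "x < y" "{x..y} \<subseteq> D"
  obtains z where "x < z" "z < y" "T y - T x = (y - x) * T1 z"
proof -
  have c: "continuous_on {x..y} T" using cont_D(1) assms(2) continuous_on_subset by blast
  have d: "(T has_derivative (*) (T1 z)) (at z)" if "x < z" "z < y" for z
  proof -
    have "z \<in> {x..y}" "x \<in> {x..y}" "y \<in> {x..y}" using that assms by auto
    then have "z \<in> D" "x \<in> D" "y \<in> D" using assms(2) by auto
    then have "z \<in> {0<..<1} - {c}" using that by (auto simp: D_def)
    then show ?thesis using der_int(1) by (simp add: has_field_derivative_def)
  qed
  from mvt[OF assms(1) c d] obtain z where "x < z" "z < y" "T y - T x = T1 z * (y - x)" by blast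
  then show thesis using that by (simp add: mult.commute)
qed

lemma T1_sign:
  assumes "S \<subseteq> D" "connected S" "x \<in> S" "0 < k * T1 x" "y \<in> S"
  shows "0 < k * T1 y"
proof (rule ccontr)
  assume n: "\<not> 0 < k * T1 y"
  have "continuous_on S (\<lambda>x. k * T1 x)" using cont_D(2) assms(1) by (intro continuous_intros) (auto intro: continuous_on_subset)
  then have "connected ((\<lambda>x. k * T1 x) ` S)" by (rule connected_continuous_image[OF _ assms(2)])
  then have "0 \<in> (\<lambda>x. k * T1 x) ` S"
    using connected_contains_Icc[of "(\<lambda>x. k * T1 x) ` S" "k * T1 y" "k * T1 x"] assms n by force
  moreover have "k \<noteq> 0" using assms(4) by auto
  ultimately show False using T1_pos(2) assms(1) by auto
qed

text \<open>Since T 0 = 0 and T is nonnegative, the derivative is nonnegative somewhere on the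
  branch; being continuous and never 0, it keeps that sign.\<close>

lemma T1_left: assumes "x \<in> {0..<c}" shows "0 < T1 x"
proof -
  have sub: "{0..<c} \<subseteq> D" using c01 by (auto simp: D_def)
  obtain z where z: "0 < z" "z < c / 2" "T (c/2) - T 0 = (c/2 - 0) * T1 z"
    by (rule T_MVT[of 0 "c/2"]) (use c01 in \<open>auto simp: D_def\<close>)
  have "0 \<le> T (c/2)" using T_maps c01 by (auto simp: Pi_iff)
  then have "0 \<le> c / 2 * T1 z" using z T01 by simp
  then have "0 \<le> T1 z" using c01 by (simp add: zero_le_mult_iff)
  moreover have "T1 z \<noteq> 0" using T1_pos(2)[of z] z c01 by (auto simp: D_def)
  ultimately have "0 < 1 * T1 z" by simp
  from T1_sign[OF sub _ _ this, of x] assms z c01 show ?thesis by auto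
qed

lemma T1_right: assumes "x \<in> {c<..1}" shows "T1 x < 0"
proof -
  have sub: "{c<..1} \<subseteq> D" using c01 by (auto simp: D_def)
  define e where "e = (c + 1) / 2"
  have e: "c < e" "e < 1" using c01 by (auto simp: e_def)
  obtain z where z: "e < z" "z < 1" "T 1 - T e = (1 - e) * T1 z"
    by (rule T_MVT[of e 1]) (use c01 e in \<open>auto simp: D_def\<close>)
  have "0 \<le> T e" using T_maps c01 e by (auto simp: Pi_iff)
  then have "(1 - e) * T1 z \<le> 0" using z T01 by simp
  then have "T1 z \<le> 0" using e by (simp add: mult_le_0_iff)
  moreover have "T1 z \<noteq> 0" using T1_pos(2)[of z] z c01 e by (auto simp: D_def)
  ultimately have "0 < (-1) * T1 z" by simp
  from T1_sign[OF sub _ _ this, of x] assms z e show ?thesis by auto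
qed

lemma T_left: assumes "0 \<le> x" "x \<le> y" "y < c" shows "\<theta> * (y - x) \<le> T y - T x"
proof (cases "x = y")
  case False
  then have xy: "x < y" "{x..y} \<subseteq> D" using assms c01 by (auto simp: D_def)
  obtain z where z: "x < z" "z < y" "T y - T x = (y - x) * T1 z" by (rule T_MVT[OF xy])
  have "\<theta> \<le> T1 z" using T1_theta[of z] T1_left[of z] z assms c01 by (auto simp: D_def)
  then have "\<theta> * (y - x) \<le> T1 z * (y - x)" using z by (intro mult_right_mono) auto
  then show ?thesis using z by (simp add: mult.commute)
qed simp

lemma T_right: assumes "c < x" "x \<le> y" "y \<le> 1" shows "\<theta> * (y - x) \<le> T x - T y"
proof (cases "x = y")
  case False
  then have xy: "x < y" "{x..y} \<subseteq> D" using assms c01 by (auto simp: D_def)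
  obtain z where z: "x < z" "z < y" "T y - T x = (y - x) * T1 z" by (rule T_MVT[OF xy])
  have "\<theta> \<le> - T1 z" using T1_theta[of z] T1_right[of z] z assms c01 by (auto simp: D_def)
  then have "\<theta> * (y - x) \<le> - T1 z * (y - x)" using z by (intro mult_right_mono) auto
  then show ?thesis using z by (simp add: algebra_simps)
qed simp

lemma T_less_a: assumes "x \<in> D" shows "T x < a"
proof -
  consider "x < c" | "c < x" using assms by (force simp: D_def)
  then show ?thesis
  proof cases
    case 1
    define y where "y = (x + c) / 2"
    have y: "x < y" "y < c" "0 \<le> x" using 1 assms by (auto simp: y_def D_def)
    have "0 < \<theta> * (y - x)" using y theta by auto
    then have "T x < T y" using T_left[of x y] y by auto
    also have "T y \<le> a"
    proof (rule tendsto_lowerbound[OF tendsto_within_subset[OF Ta, of "{..<c}"]])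
      show "\<forall>\<^sub>F t in at_left c. T y \<le> T t"
        unfolding eventually_at_left_field
      proof (intro exI conjI allI impI)
        fix t assume "y < t" "t < c"
        moreover from this have "0 \<le> \<theta> * (t - y)" using theta by auto
        ultimately show "T y \<le> T t" using T_left[of y t] y by auto
      qed (use y in auto)
    qed auto
    finally show ?thesis .
  next
    case 2
    define y where "y = (x + c) / 2"
    have y: "c < y" "y < x" "x \<le> 1" using 2 assms by (auto simp: y_def D_def)
    have "0 < \<theta> * (x - y)" using y theta by auto
    then have "T x < T y" using T_right[of y x] y by auto
    also have "T y \<le> a"
    proof (rule tendsto_lowerbound[OF tendsto_within_subset[OF Ta, of "{c<..}"]])
      show "\<forall>\<^sub>F t in at_right c. T y \<le> T t"
        unfolding eventually_at_right_field
      proof (intro exI conjI allI impI)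
        fix t assume "c < t" "t < y"
        moreover from this have "0 \<le> \<theta> * (y - t)" using theta by auto
        ultimately show "T y \<le> T t" using T_right[of t y] y by auto
      qed (use y in auto)
    qed auto
    finally show ?thesis .
  qed
qed

lemma T_near_c_left: assumes "y < a" "0 \<le> x" "x < c" obtains x' where "x < x'" "x' < c" "y < T x'"
proof -
  have "\<forall>\<^sub>F t in at_left c. y < T t"
    using order_tendstoD(1)[OF tendsto_within_subset[OF Ta, of "{..<c}"] assms(1)] by auto
  then obtain b where "b < c" "\<And>t. b < t \<Longrightarrow> t < c \<Longrightarrow> y < T t" unfolding eventually_at_left_field by auto
  moreover obtain t where "max b x < t" "t < c" using \<open>b < c\<close> assms dense[of "max b x" c] by auto
  ultimately show thesis using that[of t] by auto
qed

lemma T_near_c_right: assumes "y < a" "c < x" "x \<le> 1" obtains x' where "c < x'" "x' < x" "y < T x'"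
proof -
  have "\<forall>\<^sub>F t in at_right c. y < T t"
    using order_tendstoD(1)[OF tendsto_within_subset[OF Ta, of "{c<..}"] assms(1)] by auto
  then obtain b where "c < b" "\<And>t. c < t \<Longrightarrow> t < b \<Longrightarrow> y < T t" unfolding eventually_at_right_field by auto
  moreover obtain t where "c < t" "t < min b x" using \<open>c < b\<close> assms dense[of c "min b x"] by auto
  ultimately show thesis using that[of t] by auto
qed

lemma IVT_left:
  assumes "0 \<le> x" "x < x'" "x' < c" "T x < y" "y < T x'"
  shows "\<exists>z. x < z \<and> z < x' \<and> T z = y"
proof -
  have "continuous_on {x..x'} T" by (rule continuous_on_subset[OF cont_D(1)]) (use assms c01 in \<open>auto simp: D_def\<close>)
  then obtain z where "x \<le> z" "z \<le> x'" "T z = y" using IVT'[of T x y x'] assms by auto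
  then show ?thesis using assms by (intro exI[of _ z]) (auto simp: less_le)
qed

lemma IVT_right:
  assumes "c < x" "x < x'" "x' \<le> 1" "T x' < y" "y < T x"
  shows "\<exists>z. x < z \<and> z < x' \<and> T z = y"
proof -
  have "continuous_on {x..x'} T" by (rule continuous_on_subset[OF cont_D(1)]) (use assms c01 in \<open>auto simp: D_def\<close>)
  then obtain z where "x \<le> z" "z \<le> x'" "T z = y" using IVT2'[of T x' y x] assms by auto
  then show ?thesis using assms by (intro exI[of _ z]) (auto simp: less_le)
qed

lemma preimage_left: assumes "0 \<le> x" "x < c" "T x < y" "y < a" shows "\<exists>z. x < z \<and> z < c \<and> T z = y"
proof -
  obtain x' where x': "x < x'" "x' < c" "y < T x'" using T_near_c_left assms by metis
  then obtain z where "x < z" "z < x'" "T z = y" using IVT_left[of x x' y] assms by blast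
  then show ?thesis using x' by (intro exI[of _ z]) auto
qed

lemma preimage_right: assumes "c < x" "x \<le> 1" "T x < y" "y < a" shows "\<exists>z. c < z \<and> z < x \<and> T z = y"
proof -
  obtain x' where x': "c < x'" "x' < x" "y < T x'" using T_near_c_right assms by metis
  then obtain z where "x' < z" "z < x" "T z = y" using IVT_right[of x' x y] assms by blast
  then show ?thesis using x' by (intro exI[of _ z]) auto
qed

lemma T_unit: "x \<in> {0..1} \<Longrightarrow> 0 \<le> T x \<and> T x \<le> 1"
  using T_maps by (auto simp: Pi_iff)

text \<open>Replaces the assertion that some forward image of the interval is the whole of (0,1).
  Spreading of mass under \<open>P\<close> is what \<open>exact\<close> uses, and it spares tracking
  images of the exceptional points.\<close>

definition covers :: "real \<Rightarrow> real \<Rightarrow> bool" where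
  "covers \<alpha> b \<longleftrightarrow> (\<exists>m. \<forall>u :: real \<Rightarrow> real. (\<forall>x. 0 \<le> u x) \<longrightarrow> (\<forall>x. \<alpha> < x \<longrightarrow> x < b \<longrightarrow> 0 < u x) \<longrightarrow>
     (\<forall>y. 0 < y \<longrightarrow> y < 1 \<longrightarrow> 0 < (P ^^ m) u y))"

lemma covers_mono: "covers \<alpha> b \<Longrightarrow> \<alpha>' \<le> \<alpha> \<Longrightarrow> b \<le> b' \<Longrightarrow> covers \<alpha>' b'"
  unfolding covers_def by (meson order_le_less_trans order_less_le_trans)

lemma covers_step:
  assumes "covers \<alpha>' b'" and pre: "\<And>y. \<alpha>' < y \<Longrightarrow> y < b' \<Longrightarrow> \<exists>x\<in>{0<..<1} - {c}. \<alpha> < x \<and> x < b \<and> T x = y"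
  shows "covers \<alpha> b"
proof -
  obtain k where k: "\<And>(u :: real \<Rightarrow> real) y. (\<forall>x. 0 \<le> u x) \<Longrightarrow> (\<forall>x. \<alpha>' < x \<longrightarrow> x < b' \<longrightarrow> 0 < u x) \<Longrightarrow> 0 < y \<Longrightarrow> y < 1 \<Longrightarrow> 0 < (P ^^ k) u y"
    using assms(1) unfolding covers_def by blast
  show ?thesis unfolding covers_def
  proof (intro exI allI impI)
    fix u :: "real \<Rightarrow> real" and y :: real assume u: "\<forall>x. 0 \<le> u x" "\<forall>x. \<alpha> < x \<longrightarrow> x < b \<longrightarrow> 0 < u x" and y: "0 < y" "y < (1::real)"
    have "0 < (P ^^ k) (P u) y"
    proof (rule k[OF _ _ y])
      show "\<forall>x. 0 \<le> P u x" using u by (auto intro: P_nonneg)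
      show "\<forall>x. \<alpha>' < x \<longrightarrow> x < b' \<longrightarrow> 0 < P u x"
      proof (intro allI impI)
        fix t assume "\<alpha>' < t" "t < b'"
        then obtain x where "x \<in> {0<..<1} - {c}" "\<alpha> < x" "x < b" "T x = t" using pre by blast
        then show "0 < P u t" using u by (intro P_pos[of t u x]) auto
      qed
    qed
    then show "0 < (P ^^ Suc k) u y" by (simp only: funpow_Suc_right o_apply)
  qed
qed

lemma T_left_ge: "0 \<le> x \<Longrightarrow> x < c \<Longrightarrow> \<theta> * x \<le> T x"
  using T_left[of 0 x] T01 by simp

context assumes a1: "a = 1"
begin

lemma covers_0_c: "covers 0 c"
proof (rule covers_step)
  show "covers 0 1" unfolding covers_def by (intro exI[of _ 0]) auto
  fix y :: real assume "0 < y" "y < 1"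
  then show "\<exists>x\<in>{0<..<1} - {c}. 0 < x \<and> x < c \<and> T x = y"
    using preimage_left[of 0 y] T01 c01 a1 by force
qed

text \<open>Near 0 the left branch satisfies T x \<ge> \<theta> x, so an interval starting at 0
  grows until it reaches \<open>c\<close>, and the left branch is onto.\<close>

lemma covers_0: "0 < s \<Longrightarrow> covers 0 s"
proof -
  have "covers 0 s" if "0 < s" "c \<le> \<theta> ^ n * s" for n s
    using that
  proof (induction n arbitrary: s)
    case 0 then show ?case using covers_mono[OF covers_0_c] by auto
  next
    case (Suc n)
    show ?case
    proof (cases "c \<le> s")
      case True then show ?thesis using covers_mono[OF covers_0_c] by auto
    next
      case False
      have "covers 0 (\<theta> * s)" using Suc theta by (intro Suc.IH) (auto simp: mult_ac)
      then show ?thesis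
      proof (rule covers_step)
        fix y assume y: "0 < y" "y < \<theta> * s"
        have "y < T s" using T_left_ge[of s] False Suc.prems y by auto
        then show "\<exists>x\<in>{0<..<1} - {c}. 0 < x \<and> x < s \<and> T x = y"
          using IVT_left[of 0 s y] False Suc.prems y T01 c01 by force
      qed
    qed
  qed
  note * = this
  assume s: "0 < s"
  obtain n where "c / s < \<theta> ^ n" using real_arch_pow[OF theta] by blast
  then show ?thesis using s by (intro *[of _ n]) (auto simp: field_simps)
qed

text \<open>The right branch carries an interval ending at 1 onto one starting at 0.\<close>

lemma covers_1: assumes "s < 1" shows "covers s 1"
proof -
  define \<alpha> where "\<alpha> = max ((1 + c) / 2) s"
  have al: "c < \<alpha>" "\<alpha> < 1" "s \<le> \<alpha>" using assms c01 by (auto simp: \<alpha>_def less_max_iff_disj)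
  have "0 < \<theta> * (1 - \<alpha>)" using al theta by auto
  then have Ta': "0 < T \<alpha>" using T_right[of \<alpha> 1] al T01 by auto
  have "covers \<alpha> 1"
  proof (rule covers_step[OF covers_0[OF Ta']])
    fix y assume "0 < y" "y < T \<alpha>"
    then show "\<exists>x\<in>{0<..<1} - {c}. \<alpha> < x \<and> x < 1 \<and> T x = y"
      using IVT_right[of \<alpha> 1 y] al T01 c01 by force
  qed
  then show ?thesis using covers_mono al by blast
qed

lemma covers_c: assumes "0 \<le> s" "s < c" shows "covers s c"
proof (rule covers_step[OF covers_1])
  show "T s < 1" using T_less_a[of s] assms c01 a1 by (auto simp: D_def)
  fix y assume "T s < y" "y < 1"
  then show "\<exists>x\<in>{0<..<1} - {c}. s < x \<and> x < c \<and> T x = y" using preimage_left[of s y] assms c01 a1 by force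
qed

lemma covers_c': assumes "c < s" "s \<le> 1" shows "covers c s"
proof (rule covers_step[OF covers_1])
  show "T s < 1" using T_less_a[of s] assms c01 a1 by (auto simp: D_def)
  fix y assume "T s < y" "y < 1"
  then show "\<exists>x\<in>{0<..<1} - {c}. c < x \<and> x < s \<and> T x = y" using preimage_right[of s y] assms c01 a1 by force
qed

text \<open>An interval missing the cusp is stretched by \<theta>, which cannot go on within [0,1].
  Once \<open>c\<close> lies in it or is an end point, it contains a one-sided neighbourhood of
  \<open>c\<close>, and these cover everything.\<close>

lemma covers_interval:
  assumes "0 \<le> \<alpha>" "\<alpha> < b" "b \<le> 1"
  shows "covers \<alpha> b"
proof -
  have "covers \<alpha> b" if "0 \<le> \<alpha>" "\<alpha> < b" "b \<le> 1" "1 \<le> \<theta> ^ n * (b - \<alpha>)" for n \<alpha> b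
    using that
  proof (induction n arbitrary: \<alpha> b)
    \<comment> \<open>A length of at least 1 forces the interval to be all of (0,1).\<close>
    case 0
    then show ?case using covers_mono[OF covers_0_c, of \<alpha> b] c01 by auto
  next
    case (Suc n)
    have big: "1 \<le> \<theta> ^ n * l" if "\<theta> * (b - \<alpha>) \<le> l" for l
    proof -
      have "\<theta> ^ n * (\<theta> * (b - \<alpha>)) \<le> \<theta> ^ n * l" using that theta by (intro mult_left_mono) auto
      then show ?thesis using Suc.prems by (simp add: mult_ac)
    qed
    have pos: "0 < \<theta> * (b - \<alpha>)" using Suc.prems theta by auto
    consider "\<alpha> < c" "c \<le> b" | "b < c" | "\<alpha> = c" | "c < \<alpha>" by linarith
    then show ?case
    proof cases
      case 1 then show ?thesis using covers_mono[OF covers_c[of \<alpha>]] Suc.prems by auto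
    next
      case 2
      have l: "\<theta> * (b - \<alpha>) \<le> T b - T \<alpha>" using T_left[of \<alpha> b] Suc.prems 2 by auto
      have "covers (T \<alpha>) (T b)"
        using T_unit[of \<alpha>] T_unit[of b] Suc.prems 2 l pos by (intro Suc.IH big) auto
      then show ?thesis
        by (rule covers_step) (use IVT_left[of \<alpha> b] Suc.prems 2 c01 in force)
    next
      case 3 then show ?thesis using covers_c'[of b] Suc.prems by auto
    next
      case 4
      have l: "\<theta> * (b - \<alpha>) \<le> T \<alpha> - T b" using T_right[of \<alpha> b] Suc.prems 4 by auto
      have "covers (T b) (T \<alpha>)"
        using T_unit[of \<alpha>] T_unit[of b] Suc.prems 4 l pos by (intro Suc.IH big) auto
      then show ?thesis
        by (rule covers_step) (use IVT_right[of \<alpha> b] Suc.prems 4 c01 in force)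
    qed
  qed
  note * = this
  obtain n where "1 / (b - \<alpha>) < \<theta> ^ n" using real_arch_pow[OF theta] by blast
  then show ?thesis using assms by (intro *[of _ _ n]) (auto simp: field_simps)
qed

end

text \<open>The value of \<open>T\<close> at the cusp is unconstrained, so orbits through \<open>c\<close> may leave the
  invariant core \<open>[min (T a) c, a]\<close>; they do so only along a finite set \<open>E\<close>.\<close>

lemma mixing_imp_full:
  assumes mix: "topologically_mixing_on {0..a} T" and a: "a \<in> {0..1}"
  shows "a = 1"
proof (rule ccontr)
  assume "a \<noteq> 1"
  then have a1: "a < 1" using a by simp
  \<comment> \<open>Points left of the cusp satisfy \<theta> x \<le> T x < a, and close to the cusp
    \<theta> x exceeds \<open>c\<close>.\<close>
  have ca: "c < a"
  proof -
    have "c < \<theta> * c" using theta c01 by simp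
    then obtain x where x: "c < \<theta> * x" "0 < x" "x < c"
    proof -
      have "c / \<theta> < c" using theta c01 by (simp add: field_simps)
      then obtain x where x: "c / \<theta> < x" "x < c" using dense by blast
      have "0 < c / \<theta>" using theta c01 by simp
      then have "0 < x" using x by linarith
      moreover have "c < \<theta> * x" using x theta by (simp add: pos_divide_less_eq mult.commute)
      ultimately show thesis using that[of x] x by blast
    qed
    have "\<theta> * x \<le> T x" using T_left_ge x by auto
    also have "T x < a" using T_less_a x c01 by (auto simp: D_def)
    finally show ?thesis using x by simp
  qed
  have "T a \<noteq> T 1" using inj_onD[OF inj(2), of a 1] ca a1 by auto
  then have Ta0: "0 < T a" using T_unit[of a] a T01 by auto
  \<comment> \<open>Left of \<open>c\<close> the map pushes points to the right, and between
    \<open>c\<close> and \<open>a\<close> its smallest value is T a; hence [b, a] is mapped into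
    itself, the cusp aside.\<close>
  define b where "b = min (T a) c"
  have b: "0 < b" "b \<le> c" "b \<le> T a" using Ta0 c01 by (auto simp: b_def)
  define K where "K = {b..a}"
  have K: "T x \<in> K" if "x \<in> K" "x \<noteq> c" for x
  proof -
    have xD: "x \<in> D" using that b a by (auto simp: K_def D_def)
    have "b \<le> T x"
    proof (cases "x < c")
      case True
      have "b \<le> x" "0 \<le> x" using that b by (auto simp: K_def)
      moreover have "1 * x \<le> \<theta> * x" using theta \<open>0 \<le> x\<close> by (intro mult_right_mono) auto
      ultimately show ?thesis using T_left_ge[of x] True by linarith
    next
      case False
      have "0 \<le> \<theta> * (a - x)" using theta that by (simp add: K_def)
      then show ?thesis using T_right[of x a] that b False a by (auto simp: K_def)
    qed
    then show ?thesis using T_less_a[OF xD] by (simp add: K_def)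
  qed
  have cK: "c \<in> K" using b ca by (simp add: K_def)
  define z where "z = T c"
  have orb01: "(T ^^ j) z \<in> {0..1}" for j
    by (induction j) (use T_maps c01 in \<open>auto simp: z_def Pi_iff\<close>)
  \<comment> \<open>The stretch of the orbit of T c before it first enters \<open>K\<close>.\<close>
  define E where "E = {(T ^^ j) z | j. \<forall>i\<le>j. (T ^^ i) z \<notin> K}"
  have inv: "T x \<in> K \<union> E" if "x \<in> K \<union> E" for x
  proof -
    consider "x \<in> K" "x \<noteq> c" | "x = c" | j where "x = (T ^^ j) z" "\<forall>i\<le>j. (T ^^ i) z \<notin> K"
      using \<open>x \<in> K \<union> E\<close> by (auto simp: E_def)
    then show ?thesis
    proof cases
      case 1 then show ?thesis using K by auto
    next
      case 2
      have "z \<in> E" if "z \<notin> K" using that by (auto simp: E_def intro!: exI[of _ 0])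
      then show ?thesis using 2 by (auto simp: z_def)
    next
      case 3
      have "T x = (T ^^ Suc j) z" using 3 by simp
      moreover have "(T ^^ Suc j) z \<in> E" if "(T ^^ Suc j) z \<notin> K"
        using that 3 unfolding E_def by (blast intro: le_SucE)
      ultimately show ?thesis by auto
    qed
  qed
  have orbit: "(T ^^ n) x \<in> K \<union> E" if "x \<in> K" for n x
    by (induction n) (use that inv in auto)
  have fin: "finite E"
  proof (cases "\<exists>J. (T ^^ J) z \<in> K")
    case True
    then obtain J where J: "(T ^^ J) z \<in> K" ..
    have "E \<subseteq> (\<lambda>j. (T ^^ j) z) ` {..<J}"
    proof
      fix e assume "e \<in> E"
      then obtain j where j: "e = (T ^^ j) z" "\<forall>i\<le>j. (T ^^ i) z \<notin> K" by (auto simp: E_def)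
      then have "j < J" using J not_le by blast
      then show "e \<in> (\<lambda>j. (T ^^ j) z) ` {..<J}" using j by blast
    qed
    then show ?thesis by (rule finite_subset) auto
  next
    case False
    \<comment> \<open>The first point \<open>z\<close> is arbitrary and may lie above
      \<open>a\<close>, hence the shift by one: later points are below \<open>a\<close>, and being
      outside \<open>K\<close> they are below \<open>b\<close>.\<close>
    have lt: "(T ^^ Suc j) z < b" for j
    proof -
      have "(T ^^ j) z \<noteq> c" using False cK by metis
      then have "(T ^^ j) z \<in> D" using orb01[of j] by (simp add: D_def)
      then have "(T ^^ Suc j) z < a" using T_less_a by simp
      moreover have "(T ^^ Suc j) z \<notin> K" using False by blast
      ultimately show ?thesis by (auto simp: K_def not_le simp del: funpow.simps)
    qed
    have grow: "\<theta> ^ k * (T ^^ Suc j) z \<le> (T ^^ (k + Suc j)) z" for k j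
    proof (induction k)
      case (Suc k)
      have "\<theta> ^ Suc k * (T ^^ Suc j) z = \<theta> * (\<theta> ^ k * (T ^^ Suc j) z)" by simp
      also have "\<dots> \<le> \<theta> * (T ^^ (k + Suc j)) z" using Suc theta by (intro mult_left_mono) auto
      also have "\<dots> \<le> T ((T ^^ (k + Suc j)) z)"
        using lt[of "k + j"] orb01[of "k + Suc j"] b by (intro T_left_ge) auto
      finally show ?case by simp
    qed simp
    \<comment> \<open>Below b \<le> c every step multiplies by at least \<theta>, so a positive
      point would leave [0,1].\<close>
    have "(T ^^ Suc j) z = 0" for j
    proof (rule ccontr)
      assume "(T ^^ Suc j) z \<noteq> 0"
      then have pos: "0 < (T ^^ Suc j) z" using orb01[of "Suc j"] by auto
      obtain k where "1 / (T ^^ Suc j) z < \<theta> ^ k" using real_arch_pow[OF theta] by blast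
      then have "1 < \<theta> ^ k * (T ^^ Suc j) z" using pos by (simp only: pos_divide_less_eq)
      then show False using grow[of k j] orb01[of "k + Suc j"] by auto
    qed
    then have "E \<subseteq> {z, 0}" unfolding E_def by (auto, metis funpow_0 not0_implies_Suc)
    then show ?thesis by (rule finite_subset) auto
  qed
  \<comment> \<open>Removing finitely many points leaves an open nonempty set which no orbit
    starting in \<open>U\<close> ever meets, against mixing.\<close>
  define W where "W = {0<..<b} - E"
  define U where "U = {b<..<a}"
  have "infinite {0<..<b}" using b by (simp add: infinite_Ioo)
  then have "W \<noteq> {}" unfolding W_def using fin finite_subset by (metis Diff_eq_empty_iff)
  moreover have "U \<noteq> {}" using b ca by (simp add: U_def)
  moreover have "open W" "open U" unfolding W_def U_def using fin by (auto intro: open_Diff finite_imp_closed)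
  then have "openin (top_of_set {0..a}) W" "openin (top_of_set {0..a}) U"
    using b ca by (auto intro!: open_subset simp: W_def U_def)
  ultimately obtain N where "\<And>n. n \<ge> N \<Longrightarrow> (T ^^ n) ` U \<inter> W \<noteq> {}"
    using mix unfolding topologically_mixing_on_def by blast
  then obtain x where x: "x \<in> U" "(T ^^ N) x \<in> W" by blast
  have "x \<in> K" using x by (simp add: U_def K_def)
  then have "(T ^^ N) x \<in> K \<union> E" by (rule orbit)
  then show False using x(2) by (auto simp: W_def K_def)
qed

end

context cusp_map
begin

context assumes a1: "a = 1"
begin

text \<open>A limit point \<open>h\<close> of \<open>P^n f\<close> has \<open>\<bar>P^m h\<bar>\<^sub>1\<close> independent of \<open>m\<close>, so \<open>P^m\<close> never
  mixes its positive and negative parts; but \<open>P^m\<close> of the positive part is eventually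
  positive everywhere.\<close>

lemma exact:
  assumes w: "has_weak_deriv f f'" "f' \<in> Lp_space p" "(LINT x|mu. f x) = 0"
  shows "(\<lambda>n. LINT x|mu. \<bar>(P ^^ n) f x\<bar>) \<longlonglongrightarrow> 0"
proof -
  have fi: "integrable mu f" using w by (simp add: has_weak_deriv_def)
  note Pi = Pn_integrable[OF fi]
  define A where "A n = (LINT x|mu. \<bar>(P ^^ n) f x\<bar>)" for n
  have d: "decseq A"
  proof (rule decseq_SucI)
    fix n show "A (Suc n) \<le> A n" unfolding A_def using P_contraction[OF Pi[of n]] by simp
  qed
  have nn: "\<forall>n. 0 \<le> A n" by (simp add: A_def)
  have "convergent A"
    by (rule Bseq_monoseq_convergent[OF BseqI'[of A "A 0"]])
      (use d nn decseqD[OF d, of 0] in \<open>auto simp: monoseq_iff\<close>)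
  then obtain L where L: "A \<longlonglongrightarrow> L" unfolding convergent_def by blast
  \<comment> \<open>Lasota-Yorke bounds the derivatives of all iterates at once, as compactness
    requires.\<close>
  have dB: "nrm p (dit f f' n) \<le> V f' + R1 * (LINT x|mu. \<bar>f x\<bar>)" for n
  proof -
    have "nrm p (dit f f' n) \<le> V (dit f f' n)" by (rule V_ge(1)[OF dit_Lp[OF w(1,2)]])
    also have "\<dots> \<le> lam ^ n * V f' + R1 * (LINT x|mu. \<bar>f x\<bar>)" by (rule V_iter[OF w(1,2)])
    also have "lam ^ n * V f' \<le> 1 * V f'" using lam V_ge(3)[OF w(2)] by (intro mult_right_mono power_le_one) auto
    finally show ?thesis by simp
  qed
  obtain h r where h: "continuous_on {0..1} h" "strict_mono (r :: nat \<Rightarrow> nat)" "(\<lambda>n. LINT x|mu. \<bar>(P ^^ (r n)) f x - h x\<bar>) \<longlonglongrightarrow> 0"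
    by (rule weak_deriv_compactness[where f = "\<lambda>n. (P ^^ n) f" and g = "dit f f'",
          OF p1 has_weak_deriv_Pn[OF w(1)] dit_Lp[OF w(1,2)] dB Pn_contraction[OF fi]])
  have hi: "integrable mu h" by (rule continuous_integrable_mu[OF h(1)])
  have const: "(LINT x|mu. \<bar>(P ^^ k) h x\<bar>) = L" for k
  proof -
    have 1: "(\<lambda>n. A (r n + k)) \<longlonglongrightarrow> L"
      using LIMSEQ_subseq_LIMSEQ[OF LIMSEQ_ignore_initial_segment[OF L, of k] h(2)] by (simp add: o_def)
    have bound: "\<bar>(LINT x|mu. \<bar>(P ^^ k) h x\<bar>) - A (r n + k)\<bar> \<le> (LINT x|mu. \<bar>(P ^^ (r n)) f x - h x\<bar>)" for n
    proof -
      define g where "g = (P ^^ r n) f"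
      have gi: "integrable mu g" unfolding g_def by (rule Pi)
      have i: "integrable mu ((P ^^ k) h)" "integrable mu ((P ^^ k) g)"
        by (rule Pn_integrable[OF hi], rule Pn_integrable[OF gi])
      have di: "integrable mu (\<lambda>x. g x - h x)" using gi hi by simp
      have "(P ^^ (k + r n)) f = (P ^^ k) g" unfolding g_def by (simp only: funpow_add o_apply)
      then have "A (r n + k) = (LINT x|mu. \<bar>(P ^^ k) g x\<bar>)" by (simp only: A_def add.commute[of "r n"])
      then have eq: "(LINT x|mu. \<bar>(P ^^ k) h x\<bar>) - A (r n + k) = (LINT x|mu. \<bar>(P ^^ k) h x\<bar> - \<bar>(P ^^ k) g x\<bar>)"
        using i by simp
      have "\<bar>(LINT x|mu. \<bar>(P ^^ k) h x\<bar> - \<bar>(P ^^ k) g x\<bar>)\<bar> \<le> (LINT x|mu. \<bar>\<bar>(P ^^ k) h x\<bar> - \<bar>(P ^^ k) g x\<bar>\<bar>)" by (rule integral_abs_bound)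
      also have "\<dots> \<le> (LINT x|mu. \<bar>(P ^^ k) (\<lambda>x. g x - h x) x\<bar>)"
        using i Pn_integrable[OF di, of k] by (intro integral_mono) (auto simp: Pn_diff)
      also have "\<dots> \<le> (LINT x|mu. \<bar>g x - h x\<bar>)" by (rule Pn_contraction[OF di])
      finally show ?thesis unfolding eq g_def .
    qed
    have 2: "(\<lambda>n. (LINT x|mu. \<bar>(P ^^ k) h x\<bar>) - A (r n + k)) \<longlonglongrightarrow> 0"
      by (rule Lim_null_comparison[OF always_eventually[OF allI] h(3)]) (simp only: real_norm_def bound)
    have "(\<lambda>n. LINT x|mu. \<bar>(P ^^ k) h x\<bar>) \<longlonglongrightarrow> L" using tendsto_add[OF 1 2] by simp
    then show ?thesis by (simp only: LIMSEQ_const_iff)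
  qed
  have h0: "(LINT x|mu. h x) = 0"
  proof -
    have "\<bar>LINT x|mu. h x\<bar> \<le> (LINT x|mu. \<bar>(P ^^ (r n)) f x - h x\<bar>)" for n
    proof -
      have "(LINT x|mu. (P ^^ (r n)) f x - h x) = - (LINT x|mu. h x)" using Pi hi w(3) Pn_integral[OF fi] by simp
      then show ?thesis using integral_abs_bound[of mu "\<lambda>x. (P ^^ (r n)) f x - h x"] by simp
    qed
    then have "\<bar>LINT x|mu. h x\<bar> \<le> 0" by (intro LIMSEQ_le_const[OF h(3)]) auto
    then show ?thesis by simp
  qed
  have "L = 0"
  proof (rule ccontr)
    assume "L \<noteq> 0"
    moreover have "0 \<le> L" by (rule LIMSEQ_le_const[OF L]) (use nn in blast)
    ultimately have Lp: "0 < L" by simp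
    define hp where "hp x = max (h x) 0" for x
    define hm where "hm x = max (- h x) 0" for x
    have hpi: "integrable mu hp" "integrable mu hm" unfolding hp_def[abs_def] hm_def[abs_def] using hi by auto
    have hd: "h x = hp x - hm x" "\<bar>h x\<bar> = hp x + hm x" for x by (auto simp: hp_def hm_def)
    have nn: "0 \<le> hp x" "0 \<le> hm x" for x by (auto simp: hp_def hm_def)
    have "(LINT x|mu. hp x) - (LINT x|mu. hm x) = 0" using h0 hpi by (simp add: hd(1))
    moreover have "(LINT x|mu. hp x) + (LINT x|mu. hm x) = L" using const[of 0] hpi by (simp add: hd(2))
    ultimately have I: "0 < (LINT x|mu. hp x)" "0 < (LINT x|mu. hm x)" using Lp by auto
    have "\<exists>x\<in>{0..1}. 0 < h x"
    proof (rule ccontr)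
      assume "\<not> ?thesis"
      then have "(LINT x|mu. hp x) = (LINT x|mu. 0)"
        by (intro Bochner_Integration.integral_cong) (force simp: hp_def max_def not_less)+
      then show False using I by simp
    qed
    then obtain x0 where x0: "x0 \<in> {0..1}" "0 < h x0" by blast
    obtain d where d: "0 < d" "\<And>x. x \<in> {0..1} \<Longrightarrow> dist x x0 < d \<Longrightarrow> dist (h x) (h x0) < h x0"
      using h(1) x0 unfolding continuous_on_iff by blast
    define \<alpha> where "\<alpha> = max 0 (x0 - d)" define b where "b = min 1 (x0 + d)"
    have ab: "0 \<le> \<alpha>" "\<alpha> < b" "b \<le> 1" using d x0 by (auto simp: \<alpha>_def b_def)
    have pos: "0 < hp x" if "\<alpha> < x" "x < b" for x
    proof -
      have "dist (h x) (h x0) < h x0" using that x0 by (intro d(2)) (auto simp: \<alpha>_def b_def dist_real_def)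
      then show ?thesis by (auto simp: hp_def dist_real_def)
    qed
    obtain k where k: "\<And>y. 0 < y \<Longrightarrow> y < 1 \<Longrightarrow> 0 < (P ^^ k) hp y"
      using covers_interval[OF a1 ab] pos nn unfolding covers_def by metis
    have Pk: "integrable mu ((P ^^ k) hp)" "integrable mu ((P ^^ k) hm)" by (intro Pn_integrable hpi)+
    have Pkn: "0 \<le> (P ^^ k) hp x" "0 \<le> (P ^^ k) hm x" for x by (intro Pn_nonneg nn)+
    have eq: "(P ^^ k) h = (\<lambda>x. (P ^^ k) hp x - (P ^^ k) hm x)"
    proof -
      have "h = (\<lambda>x. hp x - hm x)" using hd(1) by (rule ext)
      then have "(P ^^ k) h = (P ^^ k) (\<lambda>x. hp x - hm x)" by (rule arg_cong)
      then show ?thesis by (simp only: Pn_diff)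
    qed
    have "(LINT x|mu. (P ^^ k) hp x + (P ^^ k) hm x - \<bar>(P ^^ k) h x\<bar>) = 0"
    proof -
      have "(LINT x|mu. (P ^^ k) hp x + (P ^^ k) hm x - \<bar>(P ^^ k) h x\<bar>)
         = (LINT x|mu. (P ^^ k) hp x) + (LINT x|mu. (P ^^ k) hm x) - (LINT x|mu. \<bar>(P ^^ k) h x\<bar>)"
        using Pk Pn_integrable[OF hi, of k] by simp
      also have "\<dots> = 0" using Pn_integral[OF hpi(1)] Pn_integral[OF hpi(2)] const[of k] const[of 0] hpi by (simp add: hd(2))
      finally show ?thesis .
    qed
    moreover have "0 \<le> (P ^^ k) hp x + (P ^^ k) hm x - \<bar>(P ^^ k) h x\<bar>" for x using Pkn[of x] by (simp add: eq abs_le_iff)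
    ultimately have "AE x in mu. (P ^^ k) hp x + (P ^^ k) hm x - \<bar>(P ^^ k) h x\<bar> = 0"
      using Pk Pn_integrable[OF hi, of k] by (subst (asm) integral_nonneg_eq_0_iff_AE) auto
    \<comment> \<open>No mass cancels, so where the image of the positive part is strictly positive
      the image of the negative part is 0. This contradicts the conservation of its positive
      integral.\<close>
    then have "AE x in mu. (P ^^ k) hm x = 0"
      using AE_mu_in
    proof eventually_elim
      case (elim x)
      then have "0 < (P ^^ k) hp x" using k by auto
      then show ?case using elim Pkn[of x] by (auto simp: eq abs_if split: if_splits)
    qed
    then have "(LINT x|mu. (P ^^ k) hm x) = (LINT x|mu. 0)" by (rule integral_cong_AE[rotated 2]) (use Pk in auto)
    then show False using I Pn_integral[OF hpi(2)] by simp
  qed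
  then show ?thesis using L by (simp add: A_def[abs_def])
qed

text \<open>A counterexample for each \<open>N\<close>, normalised to derivatives of norm 1,
  converges in L^1 along a subsequence. So the iterate of a late function is L^1-close to the same
  iterate of one fixed function of the subsequence, and that decays by \<open>exact\<close>.\<close>

lemma exact_uniform:
  assumes eta: "0 < eta"
  shows "\<exists>N. \<forall>f f'. has_weak_deriv f f' \<longrightarrow> f' \<in> Lp_space p \<longrightarrow> (LINT x|mu. f x) = 0 \<longrightarrow>
     (LINT x|mu. \<bar>(P ^^ N) f x\<bar>) \<le> eta * nrm p f'"
proof (rule ccontr)
  assume "\<not> ?thesis"
  then have "\<forall>N. \<exists>f f'. has_weak_deriv f f' \<and> f' \<in> Lp_space p \<and> (LINT x|mu. f x) = 0 \<and>
     eta * nrm p f' < (LINT x|mu. \<bar>(P ^^ N) f x\<bar>)" by (meson not_le)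
  then obtain f f' where f: "\<And>N. has_weak_deriv (f N) (f' N)" "\<And>N. f' N \<in> Lp_space p" "\<And>N. (LINT x|mu. f N x) = 0"
    "\<And>N. eta * nrm p (f' N) < (LINT x|mu. \<bar>(P ^^ N) (f N) x\<bar>)" by metis
  have fi: "integrable mu (f N)" for N using f(1) by (simp add: has_weak_deriv_def)
  \<comment> \<open>A mean zero function with zero derivative vanishes, so the strict inequality
    rules it out.\<close>
  have s: "0 < nrm p (f' N)" for N
  proof (rule ccontr)
    assume "\<not> ?thesis"
    then have z: "nrm p (f' N) = 0" using nrm_nonneg[of p "f' N"] by linarith
    have "(LINT x|mu. \<bar>(P ^^ N) (f N) x\<bar>) \<le> (LINT x|mu. \<bar>f N x\<bar>)" by (rule Pn_contraction[OF fi])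
    also have "\<dots> \<le> (LINT x|mu. \<bar>f' N x\<bar>)" by (rule mean_zero_bound(2)[OF f(1,3)])
    also have "\<dots> \<le> 0" using Lp_integrable(2)[OF pge1 f(2), of N] z by simp
    finally show False using f(4)[of N] z by simp
  qed
  define F where "F N = (\<lambda>x. 1 / nrm p (f' N) * f N x)" for N
  define F' where "F' N = (\<lambda>x. 1 / nrm p (f' N) * f' N x)" for N
  have wF: "has_weak_deriv (F N) (F' N)" for N unfolding F_def F'_def by (rule has_weak_deriv_cmult[OF f(1)])
  have F'L: "F' N \<in> Lp_space p" "nrm p (F' N) \<le> 1" for N
    unfolding F'_def using Lp_cmult[OF p0 f(2), of "1 / nrm p (f' N)" N] s[of N] by auto
  have F0: "(LINT x|mu. F N x) = 0" for N using f(3) by (simp add: F_def)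
  have FN: "eta < (LINT x|mu. \<bar>(P ^^ N) (F N) x\<bar>)" for N
  proof -
    have "(LINT x|mu. \<bar>(P ^^ N) (F N) x\<bar>) = 1 / nrm p (f' N) * (LINT x|mu. \<bar>(P ^^ N) (f N) x\<bar>)"
    proof -
      have eq: "(P ^^ N) (F N) = (\<lambda>x. 1 / nrm p (f' N) * (P ^^ N) (f N) x)"
        unfolding F_def by (rule Pn_cmult)
      show ?thesis unfolding eq using s[of N] by (simp add: abs_mult)
    qed
    then have "eta * nrm p (f' N) < (LINT x|mu. \<bar>(P ^^ N) (F N) x\<bar>) * nrm p (f' N)"
      using f(4)[of N] s[of N] by simp
    then show ?thesis using s[of N] by (simp add: mult_less_cancel_right)
  qed
  have FB: "(LINT x|mu. \<bar>F N x\<bar>) \<le> 2" for N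
    using mean_zero_bound(2)[OF wF F0, of N] Lp_integrable(2)[OF pge1 F'L(1), of N] F'L(2)[of N] by linarith
  have Fi: "integrable mu (F N)" for N using wF by (simp add: has_weak_deriv_def)
  obtain h r where h: "continuous_on {0..1} h" "strict_mono (r :: nat \<Rightarrow> nat)" "(\<lambda>n. LINT x|mu. \<bar>F (r n) x - h x\<bar>) \<longlonglongrightarrow> 0"
    by (rule weak_deriv_compactness[where f = F and g = F', OF p1 wF F'L FB])
  have hi: "integrable mu h" by (rule continuous_integrable_mu[OF h(1)])
  have "eventually (\<lambda>n. (LINT x|mu. \<bar>F (r n) x - h x\<bar>) < eta / 4) sequentially"
    using h(3) eta by (intro order_tendstoD(2)) auto
  then obtain k where k: "\<And>n. k \<le> n \<Longrightarrow> (LINT x|mu. \<bar>F (r n) x - h x\<bar>) < eta / 4" by (auto simp: eventually_sequentially)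
  have "(\<lambda>n. LINT x|mu. \<bar>(P ^^ r n) (F (r k)) x\<bar>) \<longlonglongrightarrow> 0"
    using LIMSEQ_subseq_LIMSEQ[OF exact[OF wF F'L(1) F0] h(2)] by (simp add: o_def)
  then have "eventually (\<lambda>n. (LINT x|mu. \<bar>(P ^^ r n) (F (r k)) x\<bar>) < eta / 4) sequentially"
    using eta by (intro order_tendstoD(2)) auto
  then obtain n where n: "k \<le> n" "(LINT x|mu. \<bar>(P ^^ r n) (F (r k)) x\<bar>) < eta / 4"
    unfolding eventually_sequentially by (metis nle_le)
  have di: "integrable mu (\<lambda>x. F (r n) x - F (r k) x)" using Fi by auto
  have "(LINT x|mu. \<bar>(P ^^ r n) (F (r n)) x\<bar>) \<le> (LINT x|mu. \<bar>(P ^^ r n) (\<lambda>x. F (r n) x - F (r k) x) x\<bar> + \<bar>(P ^^ r n) (F (r k)) x\<bar>)"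
    using Pn_integrable[OF Fi] by (intro integral_mono) (auto simp: Pn_diff)
  also have "\<dots> = (LINT x|mu. \<bar>(P ^^ r n) (\<lambda>x. F (r n) x - F (r k) x) x\<bar>) + (LINT x|mu. \<bar>(P ^^ r n) (F (r k)) x\<bar>)"
    using Pn_integrable[OF Fi] Pn_integrable[OF di] by (intro Bochner_Integration.integral_add) auto
  also have "(LINT x|mu. \<bar>(P ^^ r n) (\<lambda>x. F (r n) x - F (r k) x) x\<bar>) \<le> (LINT x|mu. \<bar>F (r n) x - F (r k) x\<bar>)"
    by (rule Pn_contraction[OF di])
  also have "\<dots> \<le> (LINT x|mu. \<bar>F (r n) x - h x\<bar> + \<bar>F (r k) x - h x\<bar>)"
    using Fi hi by (intro integral_mono) auto
  also have "\<dots> = (LINT x|mu. \<bar>F (r n) x - h x\<bar>) + (LINT x|mu. \<bar>F (r k) x - h x\<bar>)"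
    using Fi hi by (intro Bochner_Integration.integral_add) auto
  finally show False using k[OF n(1)] k[OF order_refl] n(2) FN[of "r n"] eta by linarith
qed

end


end

subsection \<open>Families of cusp maps\<close>

text \<open>Fullness is available at \<epsilon> = 0 only. For \<epsilon> > 0 the peak
  \<open>a \<epsilon>\<close> may lie below 1, and the gap is obtained by perturbation.\<close>

locale cusp_family = cusp_params +
  fixes \<delta> :: real and T T1 T2 T3 :: "real \<Rightarrow> real \<Rightarrow> real" and a :: "real \<Rightarrow> real"
  assumes delta: "0 < \<delta>"
    and cm: "\<And>\<epsilon>. \<epsilon> \<in> {0..<\<delta>} \<Longrightarrow> cusp_map c \<beta> p \<theta> m M (T \<epsilon>) (T1 \<epsilon>) (T2 \<epsilon>) (T3 \<epsilon>) (a \<epsilon>)"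
    and a0: "a 0 = 1"
    and A9_norm: "((\<lambda>\<epsilon>. SUP f \<in> {f. W1p_norm p f \<le> 1}.
          Lp_norm (2 * p) (\<lambda>x. transfer_op (T 0) f x - transfer_op (T \<epsilon>) f x))
        \<longlongrightarrow> 0) (at_right 0)"
    and A9_deriv: "\<And>f. f \<in> sobolev_space 2 p \<Longrightarrow> \<exists>D \<in> sobolev_space 1 p.
        ((\<lambda>\<epsilon>. W1p_norm p (\<lambda>x. transfer_op (T \<epsilon>) f x - transfer_op (T 0) f x - \<epsilon> * D x)
               / ennreal \<epsilon>) \<longlongrightarrow> 0) (at_right 0)"
begin

abbreviation "Q \<epsilon> \<equiv> PF c (T \<epsilon>) (T1 \<epsilon>)"

lemma zero_in: "0 \<in> {0..<\<delta>}" using delta by simp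

sublocale Z: cusp_map c \<beta> p \<theta> m M "T 0" "T1 0" "T2 0" "T3 0" "a 0"
  by (rule cm[OF zero_in])

text \<open>(A9) speaks of the unit ball and of L^{2p}; scaling and the factor 2 of
  \<open>Lp_mono_exponent\<close> give the linear form in L^p. The scale \<open>t\<close> is kept
  strictly positive to include functions of norm 0.\<close>

lemma Q_close:
  assumes eta: "0 < eta"
  shows "eventually (\<lambda>\<epsilon>. \<forall>f f'. has_weak_deriv f f' \<longrightarrow> f' \<in> Lp_space p \<longrightarrow>
     nrm p (\<lambda>x. Q 0 f x - Q \<epsilon> f x) \<le> eta * (nrm p f + nrm p f')) (at_right 0)"
proof -
  have "eventually (\<lambda>\<epsilon>. (SUP f \<in> {f. W1p_norm p f \<le> 1}.
          Lp_norm (2 * p) (\<lambda>x. transfer_op (T 0) f x - transfer_op (T \<epsilon>) f x)) < ennreal (eta / 2)) (at_right 0)"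
    using eta by (intro order_tendstoD(2)[OF A9_norm]) auto
  moreover have "eventually (\<lambda>\<epsilon>. \<epsilon> \<in> {0<..<\<delta>}) (at_right 0)"
    using delta by (intro eventually_at_right_real) auto
  ultimately show ?thesis
  proof eventually_elim
    case (elim \<epsilon>)
    then have e: "\<epsilon> \<in> {0..<\<delta>}" by auto
    interpret E: cusp_map c \<beta> p \<theta> m M "T \<epsilon>" "T1 \<epsilon>" "T2 \<epsilon>" "T3 \<epsilon>" "a \<epsilon>" by (rule cm[OF e])
    have unit: "nrm p (\<lambda>x. Q 0 F x - Q \<epsilon> F x) \<le> eta"
      if F: "has_weak_deriv F F'" "F' \<in> Lp_space p" "nrm p F + nrm p F' \<le> 1" for F F'
    proof -
      let ?t = "\<lambda>x. transfer_op (T 0) F x - transfer_op (T \<epsilon>) F x"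
      have Fm: "F \<in> borel_measurable mu" using F(1) by (auto simp: has_weak_deriv_def)
      have "W1p_norm p F \<le> 1" unfolding W1p_norm_eq[OF p0 F(1,2)] using ennreal_leI[OF F(3)] by (simp only: ennreal_1)
      then have "Lp_norm (2 * p) ?t \<le> (SUP f \<in> {f. W1p_norm p f \<le> 1}.
          Lp_norm (2 * p) (\<lambda>x. transfer_op (T 0) f x - transfer_op (T \<epsilon>) f x))"
        by (intro SUP_upper2[of F]) auto
      then have lt: "Lp_norm (2 * p) ?t < ennreal (eta / 2)" using elim by auto
      then have tL: "?t \<in> Lp_space (2 * p)" by (auto simp: Lp_norm_def split: if_splits)
      then have t2: "nrm (2 * p) ?t < eta / 2" using lt by (simp add: Lp_norm_nrm ennreal_less_iff)
      have tp: "?t \<in> Lp_space p" "nrm p ?t \<le> 2 * nrm (2 * p) ?t"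
        using Lp_mono_exponent[of p "2 * p" ?t] tL p0 pge1 by auto
      have "nrm p (\<lambda>x. Q 0 F x - Q \<epsilon> F x) = nrm p ?t"
      proof (rule Lp_cong(2)[OF p0 tp(1)])
        show "(\<lambda>x. Q 0 F x - Q \<epsilon> F x) \<in> borel_measurable mu" using Z.P_meas[OF Fm] E.P_meas[OF Fm] by simp
        show "AE x in mu. Q 0 F x - Q \<epsilon> F x = ?t x"
          using Z.transfer_op_P(1)[OF Fm] E.transfer_op_P(1)[OF Fm] by eventually_elim simp
      qed
      then show ?thesis using tp t2 by linarith
    qed
    show ?case
    proof (intro allI impI)
      fix f f' assume f: "has_weak_deriv f f'" "f' \<in> Lp_space p"
      define s where "s = nrm p f + nrm p f'"
      have s: "0 \<le> s" by (simp add: s_def)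
      have fL: "f \<in> Lp_space p" by (rule has_weak_deriv_Lp[OF p0 f(1)])
      have fm: "f \<in> borel_measurable mu" using fL by (rule Lp_meas)
      have *: "nrm p (\<lambda>x. Q 0 f x - Q \<epsilon> f x) \<le> eta * t" if t: "s \<le> t" "0 < t" for t
      proof -
        have "nrm p (\<lambda>x. Q 0 (\<lambda>x. 1 / t * f x) x - Q \<epsilon> (\<lambda>x. 1 / t * f x) x) \<le> eta"
        proof (rule unit[OF has_weak_deriv_cmult[OF f(1)] Lp_cmult(1)[OF p0 f(2)]])
          show "nrm p (\<lambda>x. 1 / t * f x) + nrm p (\<lambda>x. 1 / t * f' x) \<le> 1"
            unfolding Lp_cmult(2)[OF p0 fL] Lp_cmult(2)[OF p0 f(2)] using t by (simp add: s_def add_divide_distrib[symmetric])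
        qed
        moreover have "(\<lambda>x. Q 0 (\<lambda>x. 1 / t * f x) x - Q \<epsilon> (\<lambda>x. 1 / t * f x) x) = (\<lambda>x. 1 / t * (Q 0 f x - Q \<epsilon> f x))"
          unfolding Z.P_cmult E.P_cmult by (simp add: right_diff_distrib)
        moreover have "(\<lambda>x. Q 0 f x - Q \<epsilon> f x) \<in> Lp_space p"
          by (intro Lp_diff[OF pge1] Z.P_Lp E.P_Lp fL)
        ultimately have "\<bar>1 / t\<bar> * nrm p (\<lambda>x. Q 0 f x - Q \<epsilon> f x) \<le> eta"
          using Lp_cmult(2)[OF p0, of "\<lambda>x. Q 0 f x - Q \<epsilon> f x" "1 / t"] by metis
        then show ?thesis using t by (simp add: pos_divide_le_eq)
      qed
      have "nrm p (\<lambda>x. Q 0 f x - Q \<epsilon> f x) \<le> eta * s"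
      proof (rule field_le_epsilon)
        fix e :: real assume "0 < e"
        then have "nrm p (\<lambda>x. Q 0 f x - Q \<epsilon> f x) \<le> eta * (s + e / eta)" using s eta by (intro *) (auto intro: add_nonneg_pos)
        then show "nrm p (\<lambda>x. Q 0 f x - Q \<epsilon> f x) \<le> eta * s + e" using eta by (simp add: distrib_left)
      qed
      then show "nrm p (\<lambda>x. Q 0 f x - Q \<epsilon> f x) \<le> eta * (nrm p f + nrm p f')" by (simp add: s_def)
    qed
  qed
qed

lemma telescope_step:
  assumes e: "\<epsilon> \<in> {0..<\<delta>}"
  shows "(Q \<epsilon> ^^ Suc n) f x - (Q 0 ^^ Suc n) f x = Q \<epsilon> (\<lambda>x. (Q \<epsilon> ^^ n) f x - (Q 0 ^^ n) f x) x - (Q 0 ((Q 0 ^^ n) f) x - Q \<epsilon> ((Q 0 ^^ n) f) x)"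
proof -
  interpret E: cusp_map c \<beta> p \<theta> m M "T \<epsilon>" "T1 \<epsilon>" "T2 \<epsilon>" "T3 \<epsilon>" "a \<epsilon>" by (rule cm[OF e])
  show ?thesis by (simp add: E.P_diff)
qed

text \<open>\<open>Q \<epsilon>\<close> contracts the L^1 norm, so the one-step errors, taken along
  the unperturbed orbit, merely add up.\<close>

lemma telescope_L1:
  assumes e: "\<epsilon> \<in> {0..<\<delta>}" and f: "integrable mu f"
    and b: "\<And>j. j < n \<Longrightarrow> (LINT x|mu. \<bar>Q 0 ((Q 0 ^^ j) f) x - Q \<epsilon> ((Q 0 ^^ j) f) x\<bar>) \<le> B"
  shows "(LINT x|mu. \<bar>(Q \<epsilon> ^^ n) f x - (Q 0 ^^ n) f x\<bar>) \<le> real n * B"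
  using b
proof (induction n)
  case (Suc n)
  interpret E: cusp_map c \<beta> p \<theta> m M "T \<epsilon>" "T1 \<epsilon>" "T2 \<epsilon>" "T3 \<epsilon>" "a \<epsilon>" by (rule cm[OF e])
  let ?d = "\<lambda>x. (Q \<epsilon> ^^ n) f x - (Q 0 ^^ n) f x" and ?g = "\<lambda>x. Q 0 ((Q 0 ^^ n) f) x - Q \<epsilon> ((Q 0 ^^ n) f) x"
  have di: "integrable mu ?d" using E.Pn_integrable[OF f] Z.Pn_integrable[OF f] by simp
  have gi: "integrable mu ?g" using Z.P_integrable(1)[OF Z.Pn_integrable[OF f]] E.P_integrable(1)[OF Z.Pn_integrable[OF f]] by simp
  have Qd: "integrable mu (Q \<epsilon> ?d)" by (rule E.P_integrable(1)[OF di])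
  have "(LINT x|mu. \<bar>(Q \<epsilon> ^^ Suc n) f x - (Q 0 ^^ Suc n) f x\<bar>) \<le> (LINT x|mu. \<bar>Q \<epsilon> ?d x\<bar> + \<bar>?g x\<bar>)"
    unfolding telescope_step[OF e] using Qd gi by (intro integral_mono) auto
  also have "\<dots> = (LINT x|mu. \<bar>Q \<epsilon> ?d x\<bar>) + (LINT x|mu. \<bar>?g x\<bar>)" using Qd gi by simp
  also have "\<dots> \<le> real n * B + B"
    using E.P_contraction[OF di] Suc.IH Suc.prems by (intro add_mono) (auto intro: order_trans)
  finally show ?case by (simp add: algebra_simps)
qed simp

lemma uniform_gap:
  obtains \<delta>2 C r where "0 < \<delta>2" "\<delta>2 \<le> \<delta>"
    "\<And>\<epsilon>. \<epsilon> \<in> {0..<\<delta>2} \<Longrightarrow> cusp_map.gap c \<beta> p \<theta> m M (T \<epsilon>) (T1 \<epsilon>) (T2 \<epsilon>) C r"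
proof -
  \<comment> \<open>Of the 1/2 allowed in \<open>gapI\<close>, one half goes to
    \<open>R1 * eta\<close> and the other to the choice of \<open>k\<close>. The amount
    \<open>eta\<close> is shared equally between exactness and the perturbation error.\<close>
  define eta where "eta = 1 / (4 * (R1 + 1))"
  have R1: "0 \<le> R1" by (rule const_bounds)
  have eta: "0 < eta" "R1 * eta \<le> 1 / 4" using R1 by (auto simp: eta_def field_simps)
  obtain N where N: "\<And>f f'. has_weak_deriv f f' \<Longrightarrow> f' \<in> Lp_space p \<Longrightarrow> (LINT x|mu. f x) = 0 \<Longrightarrow>
     (LINT x|mu. \<bar>(Q 0 ^^ N) f x\<bar>) \<le> eta / 2 * nrm p f'"
    using Z.exact_uniform[OF a0, of "eta / 2"] eta by auto
  have "(\<lambda>k. lam ^ k * (1 + R1)) \<longlonglongrightarrow> 0 * (1 + R1)" using lam by (intro tendsto_intros LIMSEQ_realpow_zero) auto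
  then have "eventually (\<lambda>k. lam ^ k * (1 + R1) < 1 / 4) sequentially" by (intro order_tendstoD(2)) auto
  then have "eventually (\<lambda>k. lam ^ k * (1 + R1) < 1 / 4 \<and> 0 < k) sequentially"
    using eventually_gt_at_top[of 0] by eventually_elim auto
  then obtain k where k: "lam ^ k * (1 + R1) < 1 / 4" "0 < k" by (auto simp: eventually_sequentially)
  \<comment> \<open>Bounds all iterates of the unperturbed operator: 1 + R1 comes from
    \<open>V_iter\<close>, the second factor from \<open>V_le\<close>.\<close>
  define G where "G = (1 + R1) * (K2 + 2 * BB)"
  have G: "0 < G" using const_bounds by (auto simp: G_def intro!: mult_pos_pos)
  \<comment> \<open>The N telescoped errors, each at most 4 eta' G times the norm of f', must stay
    below eta/2 in total. The 4 is 2 for the pair of norms in \<open>Q_close\<close> and 2 for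
    passing from L^p to L^1.\<close>
  define eta' where "eta' = eta / (8 * (real N + 1) * G)"
  have eta': "0 < eta'" using eta G by (auto simp: eta'_def intro!: mult_pos_pos divide_pos_pos)
  have "eventually (\<lambda>\<epsilon>. \<forall>f f'. has_weak_deriv f f' \<longrightarrow> f' \<in> Lp_space p \<longrightarrow>
     nrm p (\<lambda>x. Q 0 f x - Q \<epsilon> f x) \<le> eta' * (nrm p f + nrm p f')) (at_right 0)"
    by (rule Q_close[OF eta'])
  then obtain b where b: "0 < b" "\<And>\<epsilon>. 0 < \<epsilon> \<Longrightarrow> \<epsilon> < b \<Longrightarrow> \<forall>f f'. has_weak_deriv f f' \<longrightarrow> f' \<in> Lp_space p \<longrightarrow>
     nrm p (\<lambda>x. Q 0 f x - Q \<epsilon> f x) \<le> eta' * (nrm p f + nrm p f')"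
    unfolding eventually_at_right_field by auto
  show thesis
  proof (rule that)
    show "0 < min b \<delta>" "min b \<delta> \<le> \<delta>" using b delta by auto
    fix \<epsilon> assume e2: "\<epsilon> \<in> {0..<min b \<delta>}"
    then have e: "\<epsilon> \<in> {0..<\<delta>}" by auto
    interpret E: cusp_map c \<beta> p \<theta> m M "T \<epsilon>" "T1 \<epsilon>" "T2 \<epsilon>" "T3 \<epsilon>" "a \<epsilon>" by (rule cm[OF e])
    show "E.gap (2 * (1 + R1)) ((1 / 2) powr (1 / real (N + k)))"
    proof (rule E.gapI[of N eta])
      fix f f' assume f: "has_weak_deriv f f'" "f' \<in> Lp_space p" "(LINT x|mu. f x) = 0"
      have fi: "integrable mu f" using f(1) by (simp add: has_weak_deriv_def)
      have "(LINT x|mu. \<bar>(Q \<epsilon> ^^ N) f x - (Q 0 ^^ N) f x\<bar>) \<le> real N * (4 * eta' * G * nrm p f')"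
      proof (rule telescope_L1[OF e fi])
        fix j
        let ?u = "(Q 0 ^^ j) f" and ?u' = "Z.dit f f' j"
        have u: "has_weak_deriv ?u ?u'" "?u' \<in> Lp_space p" "(LINT x|mu. ?u x) = 0"
          using Z.has_weak_deriv_Pn[OF f(1)] Z.dit_Lp[OF f(1,2)] Z.Pn_integral[OF fi] f(3) by auto
        have ui: "integrable mu ?u" using u(1) by (simp add: has_weak_deriv_def)
        have "Z.V ?u' \<le> lam ^ j * Z.V f' + R1 * (LINT x|mu. \<bar>f x\<bar>)" by (rule Z.V_iter[OF f(1,2)])
        also have "\<dots> \<le> 1 * Z.V f' + R1 * Z.V f'"
        proof (intro add_mono mult_right_mono mult_left_mono)
          show "lam ^ j \<le> 1" using lam by (intro power_le_one) auto
          show "(LINT x|mu. \<bar>f x\<bar>) \<le> Z.V f'" using Z.mean_zero_bound(2)[OF f(1,3)] Z.V_ge(2)[OF f(2)] by linarith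
        qed (use R1 Z.V_ge(3)[OF f(2)] in auto)
        also have "\<dots> = (1 + R1) * Z.V f'" by (simp add: algebra_simps)
        also have "\<dots> \<le> (1 + R1) * ((K2 + 2 * BB) * nrm p f')" using R1 by (intro mult_left_mono Z.V_le f) auto
        finally have V: "Z.V ?u' \<le> G * nrm p f'" by (simp add: G_def mult.assoc)
        have nu: "nrm p ?u + nrm p ?u' \<le> 2 * (G * nrm p f')"
          using Z.mean_zero_bound(3)[OF u(1,3)] Z.V_ge(1,2)[OF u(2)] V by linarith
        have dL: "(\<lambda>x. Q 0 ?u x - Q \<epsilon> ?u x) \<in> Lp_space p"
          using has_weak_deriv_Lp[OF p0 u(1)] by (intro Lp_diff[OF pge1] Z.P_Lp E.P_Lp)
        show "(LINT x|mu. \<bar>Q 0 ?u x - Q \<epsilon> ?u x\<bar>) \<le> 4 * eta' * G * nrm p f'"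
        proof (cases "\<epsilon> = 0")
          case True
          then show ?thesis using eta' G by simp
        next
          case False
          then have "nrm p (\<lambda>x. Q 0 ?u x - Q \<epsilon> ?u x) \<le> eta' * (nrm p ?u + nrm p ?u')"
            using b(2)[of \<epsilon>] e2 u by auto
          also have "\<dots> \<le> eta' * (2 * (G * nrm p f'))" using eta' nu by (intro mult_left_mono) auto
          finally show ?thesis using Lp_integrable(2)[OF pge1 dL] by (simp add: mult_ac)
        qed
      qed
      also have "\<dots> \<le> eta / 2 * nrm p f'"
      proof -
        have "real N * (4 * eta' * G) = (real N / (real N + 1)) * (eta / 2)"
        proof -
          have "real N + 1 \<noteq> 0" by linarith
          moreover have "eta' * G = eta / (8 * (real N + 1))" using G by (simp add: eta'_def)
          moreover have "real N * (4 * eta' * G) = real N * 4 * (eta' * G)" by simp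
          ultimately have "real N * (4 * eta' * G) = real N * 4 * (eta / (8 * (real N + 1)))" by metis
          also have "\<dots> = (real N / (real N + 1)) * (eta / 2)"
          proof -
            have "k * 4 * (eta / (8 * x)) = k / x * (eta / 2)" for k x :: real by (cases "x = 0") (simp_all add: field_simps)
            then show ?thesis .
          qed
          finally show ?thesis .
        qed
        also have "\<dots> \<le> 1 * (eta / 2)" using eta by (intro mult_right_mono) auto
        finally have "real N * (4 * eta' * G) * nrm p f' \<le> eta / 2 * nrm p f'" by (intro mult_right_mono) auto
        then show ?thesis by (simp add: mult.assoc)
      qed
      finally have d: "(LINT x|mu. \<bar>(Q \<epsilon> ^^ N) f x - (Q 0 ^^ N) f x\<bar>) \<le> eta / 2 * nrm p f'" .
      have i: "integrable mu ((Q \<epsilon> ^^ N) f)" "integrable mu ((Q 0 ^^ N) f)"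
        using E.Pn_integrable[OF fi] Z.Pn_integrable[OF fi] by auto
      have "(LINT x|mu. \<bar>(Q \<epsilon> ^^ N) f x\<bar>) \<le> (LINT x|mu. \<bar>(Q \<epsilon> ^^ N) f x - (Q 0 ^^ N) f x\<bar> + \<bar>(Q 0 ^^ N) f x\<bar>)"
        using i by (intro integral_mono) auto
      also have "\<dots> = (LINT x|mu. \<bar>(Q \<epsilon> ^^ N) f x - (Q 0 ^^ N) f x\<bar>) + (LINT x|mu. \<bar>(Q 0 ^^ N) f x\<bar>)" using i by simp
      finally show "(LINT x|mu. \<bar>(Q \<epsilon> ^^ N) f x\<bar>) \<le> eta * nrm p f'" using d N[OF f] by simp
    qed (use eta k in auto)
  qed
qed

text \<open>On L^p all \<open>Q \<epsilon>\<close> share the bound \<open>K2\<close>, so the earlier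
  error is only multiplied by a constant; the new one is taken at a fixed Sobolev function, where
  (A9) applies.\<close>

lemma Qn_tendsto:
  assumes q: "has_weak_deriv q q'" "q' \<in> Lp_space p"
  shows "((\<lambda>\<epsilon>. nrm p (\<lambda>x. (Q \<epsilon> ^^ n) q x - (Q 0 ^^ n) q x)) \<longlongrightarrow> 0) (at_right 0)"
proof (induction n)
  case (Suc n)
  let ?u = "(Q 0 ^^ n) q" and ?u' = "Z.dit q q' n"
  have u: "has_weak_deriv ?u ?u'" "?u' \<in> Lp_space p"
    using Z.has_weak_deriv_Pn[OF q(1)] Z.dit_Lp[OF q(1,2)] by auto
  have uL: "?u \<in> Lp_space p" by (rule has_weak_deriv_Lp[OF p0 u(1)])
  have DL: "q \<in> Lp_space p" by (rule has_weak_deriv_Lp[OF p0 q(1)])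
  have 1: "((\<lambda>\<epsilon>. nrm p (\<lambda>x. Q 0 ?u x - Q \<epsilon> ?u x)) \<longlongrightarrow> 0) (at_right 0)"
  proof (rule tendstoI)
    fix e :: real assume e: "0 < e"
    define eta where "eta = e / (2 * (nrm p ?u + nrm p ?u' + 1))"
    have nn: "0 \<le> nrm p ?u + nrm p ?u'" by simp
    have "0 < nrm p ?u + nrm p ?u' + 1" by (rule add_nonneg_pos[OF nn]) simp
    then have "0 < 2 * (nrm p ?u + nrm p ?u' + 1)" by (rule mult_pos_pos[rotated]) simp
    then have eta: "0 < eta" using e unfolding eta_def by (rule divide_pos_pos[rotated])
    have "e / (2 * x) * x = e / 2" if "0 < 2 * x" for x :: real using that by simp
    then have eta2: "eta * (nrm p ?u + nrm p ?u' + 1) = e / 2" using \<open>0 < 2 * _\<close> unfolding eta_def by blast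
    have "eta * (nrm p ?u + nrm p ?u') < e"
    proof -
      have "eta * (nrm p ?u + nrm p ?u') \<le> eta * (nrm p ?u + nrm p ?u' + 1)" using eta by (intro mult_left_mono) auto
      also have "\<dots> = e / 2" by (rule eta2)
      finally show ?thesis using e by simp
    qed
    note lt = this
    show "\<forall>\<^sub>F \<epsilon> in at_right 0. dist (nrm p (\<lambda>x. Q 0 ?u x - Q \<epsilon> ?u x)) 0 < e"
      using Q_close[OF eta]
    proof eventually_elim
      case (elim \<epsilon>)
      then have "nrm p (\<lambda>x. Q 0 ?u x - Q \<epsilon> ?u x) \<le> eta * (nrm p ?u + nrm p ?u')" using u by blast
      then have "nrm p (\<lambda>x. Q 0 ?u x - Q \<epsilon> ?u x) < e" using lt by linarith
      then show ?case by (simp only: dist_real_def diff_0_right abs_of_nonneg nrm_nonneg)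
    qed
  qed
  have "((\<lambda>\<epsilon>. K2 * nrm p (\<lambda>x. (Q \<epsilon> ^^ n) q x - (Q 0 ^^ n) q x) + nrm p (\<lambda>x. Q 0 ?u x - Q \<epsilon> ?u x)) \<longlongrightarrow> K2 * 0 + 0) (at_right 0)"
    by (intro tendsto_intros Suc 1)
  then have lim: "((\<lambda>\<epsilon>. K2 * nrm p (\<lambda>x. (Q \<epsilon> ^^ n) q x - (Q 0 ^^ n) q x) + nrm p (\<lambda>x. Q 0 ?u x - Q \<epsilon> ?u x)) \<longlongrightarrow> 0) (at_right 0)" by simp
  show ?case
  proof (rule tendsto_sandwich[OF _ _ tendsto_const lim])
    have "eventually (\<lambda>\<epsilon>. \<epsilon> \<in> {0<..<\<delta>}) (at_right 0)" using delta by (intro eventually_at_right_real) auto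
    then show "\<forall>\<^sub>F \<epsilon> in at_right 0. nrm p (\<lambda>x. (Q \<epsilon> ^^ Suc n) q x - (Q 0 ^^ Suc n) q x)
        \<le> K2 * nrm p (\<lambda>x. (Q \<epsilon> ^^ n) q x - (Q 0 ^^ n) q x) + nrm p (\<lambda>x. Q 0 ?u x - Q \<epsilon> ?u x)"
    proof eventually_elim
      case (elim \<epsilon>)
      then have e: "\<epsilon> \<in> {0..<\<delta>}" by auto
      interpret E: cusp_map c \<beta> p \<theta> m M "T \<epsilon>" "T1 \<epsilon>" "T2 \<epsilon>" "T3 \<epsilon>" "a \<epsilon>" by (rule cm[OF e])
      have dL: "(\<lambda>x. (Q \<epsilon> ^^ n) q x - (Q 0 ^^ n) q x) \<in> Lp_space p" by (intro Lp_diff[OF pge1] E.Pn_Lp Z.Pn_Lp DL)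
      have gL: "(\<lambda>x. Q 0 ?u x - Q \<epsilon> ?u x) \<in> Lp_space p" by (intro Lp_diff[OF pge1] E.P_Lp Z.P_Lp uL)
      have "nrm p (\<lambda>x. (Q \<epsilon> ^^ Suc n) q x - (Q 0 ^^ Suc n) q x)
        \<le> nrm p (Q \<epsilon> (\<lambda>x. (Q \<epsilon> ^^ n) q x - (Q 0 ^^ n) q x)) + nrm p (\<lambda>x. Q 0 ?u x - Q \<epsilon> ?u x)"
        unfolding telescope_step[OF e] by (rule Lp_diff(2)[OF pge1 E.P_Lp(1)[OF dL] gL])
      then show ?case using E.P_Lp(2)[OF dL] by linarith
    qed
  qed simp
qed (simp add: nrm_def)

text \<open>The common \<open>C\<close> and \<open>r\<close> make the tails small uniformly in
  \<epsilon>, leaving finitely many terms. Convergence is claimed in L^p, which is what (A9) yields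
  for a function merely in W^{1,p}.\<close>

lemma Res_tendsto:
  assumes q: "has_weak_deriv q q'" "q' \<in> Lp_space p" "(LINT x|mu. q x) = 0"
    and d2: "0 < \<delta>2" "\<delta>2 \<le> \<delta>" and gap: "\<And>\<epsilon>. \<epsilon> \<in> {0..<\<delta>2} \<Longrightarrow> cusp_map.gap c \<beta> p \<theta> m M (T \<epsilon>) (T1 \<epsilon>) (T2 \<epsilon>) C r"
  shows "((\<lambda>\<epsilon>. nrm p (\<lambda>x. cusp_map.Res c (T \<epsilon>) (T1 \<epsilon>) q x - Z.Res q x)) \<longlongrightarrow> 0) (at_right 0)"
proof (rule tendstoI)
  fix e :: real assume e: "0 < e"
  have g0: "Z.gap C r" using gap[of 0] d2 by simp
  note r = Z.gapD(1-3)[OF g0]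
  define W where "W = C / (1 - r) * ((K2 + 2 * BB) * nrm p q')"
  have DL: "q \<in> Lp_space p" by (rule has_weak_deriv_Lp[OF p0 q(1)])
  have "(\<lambda>N. r ^ N * W) \<longlonglongrightarrow> 0 * W" using r by (intro tendsto_intros LIMSEQ_realpow_zero) auto
  then have "eventually (\<lambda>N. r ^ N * W < e / 4) sequentially" using e by (intro order_tendstoD(2)) auto
  then obtain N where N: "r ^ N * W < e / 4" by (auto simp: eventually_sequentially)
  have "((\<lambda>\<epsilon>. \<Sum>n<N. nrm p (\<lambda>x. (Q \<epsilon> ^^ n) q x - (Q 0 ^^ n) q x)) \<longlongrightarrow> (\<Sum>n<N. 0)) (at_right 0)"
    by (intro tendsto_sum Qn_tendsto[OF q(1,2)])
  then have "eventually (\<lambda>\<epsilon>. (\<Sum>n<N. nrm p (\<lambda>x. (Q \<epsilon> ^^ n) q x - (Q 0 ^^ n) q x)) < e / 4) (at_right 0)"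
    using e by (intro order_tendstoD(2)) auto
  moreover have "eventually (\<lambda>\<epsilon>. \<epsilon> \<in> {0<..<\<delta>2}) (at_right 0)" using d2 by (intro eventually_at_right_real) auto
  ultimately show "\<forall>\<^sub>F \<epsilon> in at_right 0. dist (nrm p (\<lambda>x. cusp_map.Res c (T \<epsilon>) (T1 \<epsilon>) q x - Z.Res q x)) 0 < e"
  proof eventually_elim
    case (elim \<epsilon>)
    then have e': "\<epsilon> \<in> {0..<\<delta>}" "\<epsilon> \<in> {0..<\<delta>2}" using d2 by auto
    interpret E: cusp_map c \<beta> p \<theta> m M "T \<epsilon>" "T1 \<epsilon>" "T2 \<epsilon>" "T3 \<epsilon>" "a \<epsilon>" by (rule cm[OF e'(1)])
    note RE = E.Res_props[OF gap[OF e'(2)] q] and RZ = Z.Res_props[OF g0 q]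
    have tail: "C / (1 - r) * r ^ N * v \<le> r ^ N * W" if "v \<le> (K2 + 2 * BB) * nrm p q'" for v
    proof -
      have "(C / (1 - r) * r ^ N) * v \<le> (C / (1 - r) * r ^ N) * ((K2 + 2 * BB) * nrm p q')"
        using r that by (intro mult_left_mono) auto
      then show ?thesis by (simp add: W_def mult_ac)
    qed
    have EL: "E.Res q \<in> Lp_space p" "Z.Res q \<in> Lp_space p" using has_weak_deriv_Lp[OF p0] RE(1) RZ(1) by auto
    have SL: "(\<lambda>x. \<Sum>n<N. (Q \<epsilon> ^^ n) q x) \<in> Lp_space p" "(\<lambda>x. \<Sum>n<N. (Q 0 ^^ n) q x) \<in> Lp_space p"
      using Lp_sum[OF pge1, of "{..<N}" "\<lambda>n. (Q \<epsilon> ^^ n) q"] Lp_sum[OF pge1, of "{..<N}" "\<lambda>n. (Q 0 ^^ n) q"] E.Pn_Lp(1)[OF DL] Z.Pn_Lp(1)[OF DL] by auto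
    have dL: "(\<lambda>x. (Q \<epsilon> ^^ n) q x - (Q 0 ^^ n) q x) \<in> Lp_space p" for n by (intro Lp_diff[OF pge1] E.Pn_Lp Z.Pn_Lp DL)
    have 1: "nrm p (\<lambda>x. E.Res q x - (\<Sum>n<N. (Q \<epsilon> ^^ n) q x)) \<le> r ^ N * W"
      using RE(8)[of N] tail[OF E.V_le[OF q(2)]] by linarith
    have 2: "nrm p (\<lambda>x. Z.Res q x - (\<Sum>n<N. (Q 0 ^^ n) q x)) \<le> r ^ N * W"
      using RZ(8)[of N] tail[OF Z.V_le[OF q(2)]] by linarith
    have 3: "nrm p (\<lambda>x. \<Sum>n<N. (Q \<epsilon> ^^ n) q x - (Q 0 ^^ n) q x) \<le> (\<Sum>n<N. nrm p (\<lambda>x. (Q \<epsilon> ^^ n) q x - (Q 0 ^^ n) q x))"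
      using Lp_sum[OF pge1, of "{..<N}" "\<lambda>n x. (Q \<epsilon> ^^ n) q x - (Q 0 ^^ n) q x"] dL by auto
    let ?A = "\<lambda>x. E.Res q x - (\<Sum>n<N. (Q \<epsilon> ^^ n) q x)" and ?B = "\<lambda>x. Z.Res q x - (\<Sum>n<N. (Q 0 ^^ n) q x)"
      and ?S = "\<lambda>x. \<Sum>n<N. (Q \<epsilon> ^^ n) q x - (Q 0 ^^ n) q x"
    have AL: "?A \<in> Lp_space p" "?B \<in> Lp_space p" by (intro Lp_diff[OF pge1] EL SL)+
    have SSL: "?S \<in> Lp_space p" using Lp_sum[OF pge1, of "{..<N}" "\<lambda>n x. (Q \<epsilon> ^^ n) q x - (Q 0 ^^ n) q x"] dL by auto
    have "(\<lambda>x. E.Res q x - Z.Res q x) = (\<lambda>x. ?A x - ?B x + ?S x)" by (simp add: sum_subtractf)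
    then have "nrm p (\<lambda>x. E.Res q x - Z.Res q x) \<le> nrm p ?A + nrm p ?B + nrm p ?S"
      using Lp_add(2)[OF pge1 Lp_diff(1)[OF pge1 AL] SSL] Lp_diff(2)[OF pge1 AL] by simp
    then have "nrm p (\<lambda>x. E.Res q x - Z.Res q x) < e" using 1 2 3 N elim e by linarith
    then show ?case by simp
  qed
qed

text \<open>Since \<open>(I - P\<^sub>\<epsilon>) (h\<^sub>\<epsilon> - h\<^sub>0) = (P\<^sub>\<epsilon> - P\<^sub>0) h\<^sub>0 = \<epsilon> q + o(\<epsilon>)\<close>, the expansion of the density
  follows from the uniform bound on the resolvents and their convergence on \<open>q\<close>.\<close>

lemma expansion:
  assumes d2: "0 < \<delta>2" "\<delta>2 \<le> \<delta>" and gap: "\<And>\<epsilon>. \<epsilon> \<in> {0..<\<delta>2} \<Longrightarrow> cusp_map.gap c \<beta> p \<theta> m M (T \<epsilon>) (T1 \<epsilon>) (T2 \<epsilon>) C r"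
  obtains q q' where "has_weak_deriv q q'" "q' \<in> Lp_space p" "(LINT x|mu. q x) = 0"
    "((\<lambda>\<epsilon>. nrm p (\<lambda>x. Q \<epsilon> Z.hinv x - Q 0 Z.hinv x - \<epsilon> * q x) / \<epsilon>) \<longlongrightarrow> 0) (at_right 0)"
    "\<And>u. u \<in> borel_measurable mu \<Longrightarrow> AE x in mu. u x = Z.Res q x \<Longrightarrow>
      ((\<lambda>\<epsilon>. Lp_norm p (\<lambda>x. cusp_map.hinv c (T \<epsilon>) (T1 \<epsilon>) x - Z.hinv x - \<epsilon> * u x) / ennreal \<epsilon>) \<longlongrightarrow> 0) (at_right 0)"
proof -
  have g0: "Z.gap C r" using gap[of 0] d2 by simp
  note rr = Z.gapD(1-3)[OF g0]
  let ?h = "Z.hinv"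
  note H = Z.hinv_invariant[OF g0]
  have hm: "?h \<in> borel_measurable mu" using H(1) by auto
  obtain q where q: "q \<in> sobolev_space 1 p" "((\<lambda>\<epsilon>. W1p_norm p (\<lambda>x. transfer_op (T \<epsilon>) ?h x - transfer_op (T 0) ?h x - \<epsilon> * q x)
               / ennreal \<epsilon>) \<longlongrightarrow> 0) (at_right 0)"
    using A9_deriv[OF Z.hinv_sobolev[OF g0]] by blast
  obtain q' where q': "has_weak_deriv q q'" "q' \<in> Lp_space p" using q(1) unfolding sobolev1_iff by blast
  have DL: "q \<in> Lp_space p" by (rule has_weak_deriv_Lp[OF p0 q'(1)])
  have Di: "integrable mu q" using q' by (simp add: has_weak_deriv_def)
  obtain h' where h': "has_weak_deriv ?h h'" "h' \<in> Lp_space p" by (rule Z.hinv_W2[OF g0])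
  have hL: "?h \<in> Lp_space p" by (rule has_weak_deriv_Lp[OF p0 h'(1)])
  define rem where "rem \<epsilon> = (\<lambda>x. Q \<epsilon> ?h x - Q 0 ?h x - \<epsilon> * q x)" for \<epsilon>
  define wn where "wn \<epsilon> = (W1p_norm p (rem \<epsilon>))" for \<epsilon>
  have wn: "\<exists>rem'. has_weak_deriv (rem \<epsilon>) rem' \<and> rem' \<in> Lp_space p \<and> wn \<epsilon> = ennreal (nrm p (rem \<epsilon>) + nrm p rem')"
    "W1p_norm p (\<lambda>x. transfer_op (T \<epsilon>) ?h x - transfer_op (T 0) ?h x - \<epsilon> * q x) = wn \<epsilon>" if e: "\<epsilon> \<in> {0..<\<delta>}" for \<epsilon>
  proof -
    interpret E: cusp_map c \<beta> p \<theta> m M "T \<epsilon>" "T1 \<epsilon>" "T2 \<epsilon>" "T3 \<epsilon>" "a \<epsilon>" by (rule cm[OF e])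
    let ?r' = "\<lambda>x. Q \<epsilon> (\<lambda>x. h' x * E.rho x + ?h x * E.om x) x - Q 0 (\<lambda>x. h' x * Z.rho x + ?h x * Z.om x) x - \<epsilon> * q' x"
    have w: "has_weak_deriv (rem \<epsilon>) ?r'" unfolding rem_def
      by (intro has_weak_deriv_diff has_weak_deriv_cmult E.has_weak_deriv_P Z.has_weak_deriv_P h' q')
    have L: "?r' \<in> Lp_space p"
      by (intro Lp_diff[OF pge1] Lp_cmult[OF p0] E.LY_star(1) Z.LY_star(1) h' q')
    from W1p_norm_eq[OF p0 w L] show "\<exists>rem'. has_weak_deriv (rem \<epsilon>) rem' \<and> rem' \<in> Lp_space p \<and> wn \<epsilon> = ennreal (nrm p (rem \<epsilon>) + nrm p rem')"
      unfolding wn_def using w L by blast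
    have w2: "has_weak_deriv (\<lambda>x. transfer_op (T \<epsilon>) ?h x - transfer_op (T 0) ?h x - \<epsilon> * q x) ?r'"
    proof (rule has_weak_deriv_cong[OF w])
      show "AE x in mu. transfer_op (T \<epsilon>) ?h x - transfer_op (T 0) ?h x - \<epsilon> * q x = rem \<epsilon> x"
        using E.transfer_op_P(1)[OF hm] Z.transfer_op_P(1)[OF hm] by eventually_elim (simp add: rem_def)
      show "?r' \<in> borel_measurable mu" by (rule Lp_meas[OF L])
    qed (use E.transfer_op_P(2)[OF hm] Z.transfer_op_P(2)[OF hm] Di in auto)
    have remL: "rem \<epsilon> \<in> Lp_space p" by (rule has_weak_deriv_Lp[OF p0 w])
    have "nrm p (\<lambda>x. transfer_op (T \<epsilon>) ?h x - transfer_op (T 0) ?h x - \<epsilon> * q x) = nrm p (rem \<epsilon>)"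
    proof (rule Lp_cong(2)[OF p0 remL])
      show "AE x in mu. transfer_op (T \<epsilon>) ?h x - transfer_op (T 0) ?h x - \<epsilon> * q x = rem \<epsilon> x"
        using E.transfer_op_P(1)[OF hm] Z.transfer_op_P(1)[OF hm] by eventually_elim (simp add: rem_def)
    qed (use w2 in \<open>auto simp: has_weak_deriv_def\<close>)
    then show "W1p_norm p (\<lambda>x. transfer_op (T \<epsilon>) ?h x - transfer_op (T 0) ?h x - \<epsilon> * q x) = wn \<epsilon>"
      unfolding wn_def W1p_norm_eq[OF p0 w L] W1p_norm_eq[OF p0 w2 L] by simp
  qed
  have evd: "eventually (\<lambda>\<epsilon>. \<epsilon> \<in> {0<..<\<delta>2}) (at_right 0)" using d2 by (intro eventually_at_right_real) auto
  have wnlim: "((\<lambda>\<epsilon>. enn2real (wn \<epsilon>) / \<epsilon>) \<longlongrightarrow> 0) (at_right 0)"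
  proof -
    have "((\<lambda>\<epsilon>. enn2real (W1p_norm p (\<lambda>x. transfer_op (T \<epsilon>) ?h x - transfer_op (T 0) ?h x - \<epsilon> * q x) / ennreal \<epsilon>)) \<longlongrightarrow> 0) (at_right 0)"
      using q(2) by (intro tendsto_enn2real) auto
    then show ?thesis
    proof (rule Lim_transform_eventually)
      show "\<forall>\<^sub>F \<epsilon> in at_right 0. enn2real (W1p_norm p (\<lambda>x. transfer_op (T \<epsilon>) ?h x - transfer_op (T 0) ?h x - \<epsilon> * q x) / ennreal \<epsilon>) = enn2real (wn \<epsilon>) / \<epsilon>"
        using evd
      proof eventually_elim
        case (elim \<epsilon>)
        then have e: "\<epsilon> \<in> {0..<\<delta>}" "0 < \<epsilon>" using d2 by auto
        obtain rem' where r: "wn \<epsilon> = ennreal (nrm p (rem \<epsilon>) + nrm p rem')" using wn(1)[OF e(1)] by blast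
        define s where "s = nrm p (rem \<epsilon>) + nrm p rem'"
        have "wn \<epsilon> = ennreal s" "0 \<le> s" using r by (auto simp: s_def)
        then show ?case unfolding wn(2)[OF e(1)] using e(2) by (simp add: divide_ennreal)
      qed
    qed
  qed
  have rem_le: "nrm p (rem \<epsilon>) \<le> enn2real (wn \<epsilon>)" if e: "\<epsilon> \<in> {0..<\<delta>}" for \<epsilon>
  proof -
    obtain rem' where r: "wn \<epsilon> = ennreal (nrm p (rem \<epsilon>) + nrm p rem')" using wn(1)[OF e] by blast
    define s where "s = nrm p (rem \<epsilon>) + nrm p rem'"
    have "wn \<epsilon> = ennreal s" "0 \<le> s" "nrm p (rem \<epsilon>) \<le> s" using r by (auto simp: s_def)
    then show ?thesis by simp
  qed
  have remlim: "((\<lambda>\<epsilon>. nrm p (rem \<epsilon>) / \<epsilon>) \<longlongrightarrow> 0) (at_right 0)"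
  proof (rule tendsto_sandwich[OF _ _ tendsto_const wnlim])
    show "\<forall>\<^sub>F \<epsilon> in at_right 0. nrm p (rem \<epsilon>) / \<epsilon> \<le> enn2real (wn \<epsilon>) / \<epsilon>"
      using evd by eventually_elim (use rem_le d2 in \<open>auto intro!: divide_right_mono\<close>)
    show "\<forall>\<^sub>F \<epsilon> in at_right 0. 0 \<le> nrm p (rem \<epsilon>) / \<epsilon>" using evd by eventually_elim auto
  qed
  have rem_int: "(LINT x|mu. rem \<epsilon> x) = - \<epsilon> * (LINT x|mu. q x)" if e: "\<epsilon> \<in> {0..<\<delta>}" for \<epsilon>
  proof -
    interpret E: cusp_map c \<beta> p \<theta> m M "T \<epsilon>" "T1 \<epsilon>" "T2 \<epsilon>" "T3 \<epsilon>" "a \<epsilon>" by (rule cm[OF e])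
    have i: "integrable mu (Q \<epsilon> ?h)" "integrable mu (Q 0 ?h)" "(LINT x|mu. Q \<epsilon> ?h x) = (LINT x|mu. Q 0 ?h x)"
      using E.P_integrable[OF H(1)] Z.P_integrable[OF H(1)] by auto
    have i2: "integrable mu (\<lambda>x. \<epsilon> * q x)" "integrable mu (\<lambda>x. Q \<epsilon> ?h x - Q 0 ?h x)" using Di i(1,2) by auto
    show ?thesis unfolding rem_def Bochner_Integration.integral_diff[OF i2(2,1)] Bochner_Integration.integral_diff[OF i(1,2)]
      using i(3) by simp
  qed
  \<comment> \<open>Mass conservation turns the integral of the remainder into -\<epsilon> times
    that of \<open>q\<close>, while the remainder is o(\<epsilon>).\<close>
  have D0: "(LINT x|mu. q x) = 0"
  proof -
    have "((\<lambda>\<epsilon>::real. \<bar>LINT x|mu. q x\<bar>) \<longlongrightarrow> 0) (at_right 0)"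
    proof (rule tendsto_sandwich[OF _ _ tendsto_const])
      show "((\<lambda>\<epsilon>. 2 * (nrm p (rem \<epsilon>) / \<epsilon>)) \<longlongrightarrow> 0) (at_right 0)" using tendsto_mult[OF tendsto_const[of 2] remlim] by simp
      show "\<forall>\<^sub>F \<epsilon> in at_right 0. \<bar>LINT x|mu. q x\<bar> \<le> 2 * (nrm p (rem \<epsilon>) / \<epsilon>)"
        using evd
      proof eventually_elim
        case (elim \<epsilon>)
        then have e: "\<epsilon> \<in> {0..<\<delta>}" "0 < \<epsilon>" using d2 by auto
        obtain rem' where "has_weak_deriv (rem \<epsilon>) rem'" using wn(1)[OF e(1)] by blast
        then have L: "rem \<epsilon> \<in> Lp_space p" by (rule has_weak_deriv_Lp[OF p0])
        have "\<epsilon> * \<bar>LINT x|mu. q x\<bar> = \<bar>LINT x|mu. rem \<epsilon> x\<bar>" using rem_int[OF e(1)] e by (simp add: abs_mult)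
        also have "\<dots> \<le> 2 * nrm p (rem \<epsilon>)" using integral_abs_bound[of mu "rem \<epsilon>"] Lp_integrable(2)[OF pge1 L] by linarith
        finally show ?case using e by (simp add: field_simps)
      qed
    qed auto
    then show ?thesis using tendsto_const_iff[of "at_right (0::real)" "\<bar>LINT x|mu. q x\<bar>" 0] by simp
  qed
  define KC where "KC = C / (1 - r) * (K2 + 2 * BB)"
  \<comment> \<open>\<open>u\<close> may be any representative of the resolvent at \<open>q\<close>,
    since \<open>I_minus_P_inv\<close> is determined only almost everywhere.\<close>
  have key: "(\<lambda>x. cusp_map.hinv c (T \<epsilon>) (T1 \<epsilon>) x - ?h x - \<epsilon> * u x) \<in> Lp_space p \<and>
    nrm p (\<lambda>x. cusp_map.hinv c (T \<epsilon>) (T1 \<epsilon>) x - ?h x - \<epsilon> * u x)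
      \<le> \<epsilon> * nrm p (\<lambda>x. cusp_map.Res c (T \<epsilon>) (T1 \<epsilon>) q x - Z.Res q x) + KC * enn2real (wn \<epsilon>)"
    if e2: "\<epsilon> \<in> {0<..<\<delta>2}" and u: "u \<in> borel_measurable mu" "AE x in mu. u x = Z.Res q x" for \<epsilon> u
  proof -
    have e: "\<epsilon> \<in> {0..<\<delta>}" "\<epsilon> \<in> {0..<\<delta>2}" "0 < \<epsilon>" using e2 d2 by auto
    interpret E: cusp_map c \<beta> p \<theta> m M "T \<epsilon>" "T1 \<epsilon>" "T2 \<epsilon>" "T3 \<epsilon>" "a \<epsilon>" by (rule cm[OF e(1)])
    note gE = gap[OF e(2)]
    note HE = E.hinv_invariant[OF gE]
    obtain rem' where rem': "has_weak_deriv (rem \<epsilon>) rem'" "rem' \<in> Lp_space p" "wn \<epsilon> = ennreal (nrm p (rem \<epsilon>) + nrm p rem')"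
      using wn(1)[OF e(1)] by blast
    have rz: "(LINT x|mu. rem \<epsilon> x) = 0" using rem_int[OF e(1)] D0 by simp
    note RD = E.Res_props[OF gE q' D0] and RR = E.Res_props[OF gE rem'(1,2) rz] and RZ = Z.Res_props[OF g0 q' D0]
    have i: "integrable mu (E.Res q)" "integrable mu (E.Res (rem \<epsilon>))" using RD(1) RR(1) by (auto simp: has_weak_deriv_def)
    have L: "E.Res q \<in> Lp_space p" "E.Res (rem \<epsilon>) \<in> Lp_space p" "Z.Res q \<in> Lp_space p"
      using has_weak_deriv_Lp[OF p0] RD(1) RR(1) RZ(1) by auto
    \<comment> \<open>Both sides have mean 0 and solve the resolvent equation of the perturbed
      operator with the same right-hand side.\<close>
    have "AE x in mu. E.hinv x - ?h x = \<epsilon> * E.Res q x + E.Res (rem \<epsilon>) x"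
    proof (rule E.resolvent_unique[OF gE, where w = "\<lambda>x. Q \<epsilon> ?h x - Q 0 ?h x" and k = 0])
      show "integrable mu (\<lambda>x. E.hinv x - ?h x)" "(LINT x|mu. E.hinv x - ?h x) = 0" using HE H by auto
      show "AE x in mu. (E.hinv x - ?h x) - Q \<epsilon> (\<lambda>x. E.hinv x - ?h x) x = Q \<epsilon> ?h x - Q 0 ?h x"
        using HE(3) H(3) by eventually_elim (simp add: E.P_diff)
      show "integrable mu (\<lambda>x. \<epsilon> * E.Res q x + E.Res (rem \<epsilon>) x)" "(LINT x|mu. \<epsilon> * E.Res q x + E.Res (rem \<epsilon>) x) = 0"
        using i RD(5) RR(5) by auto
      show "AE x in mu. (\<epsilon> * E.Res q x + E.Res (rem \<epsilon>) x) - Q \<epsilon> (\<lambda>x. \<epsilon> * E.Res q x + E.Res (rem \<epsilon>) x) x = Q \<epsilon> ?h x - Q 0 ?h x"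
        using RD(7) RR(7)
      proof eventually_elim
        case (elim x)
        have "\<epsilon> * (E.Res q x - Q \<epsilon> (E.Res q) x) = \<epsilon> * q x" using elim by simp
        then show ?case using elim(2) by (simp add: E.P_add E.P_cmult rem_def algebra_simps)
      qed
    qed
    then have eq: "AE x in mu. E.hinv x - ?h x - \<epsilon> * u x = \<epsilon> * (E.Res q x - Z.Res q x) + E.Res (rem \<epsilon>) x"
      using u(2) by eventually_elim (simp add: algebra_simps)
    have dL: "(\<lambda>x. E.Res q x - Z.Res q x) \<in> Lp_space p" by (rule Lp_diff(1)[OF pge1 L(1,3)])
    note edL = Lp_cmult(1)[OF p0 dL, of \<epsilon>]
    have SL: "(\<lambda>x. \<epsilon> * (E.Res q x - Z.Res q x) + E.Res (rem \<epsilon>) x) \<in> Lp_space p" by (rule Lp_add(1)[OF pge1 edL L(2)])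
    have m: "(\<lambda>x. E.hinv x - ?h x - \<epsilon> * u x) \<in> borel_measurable mu" using HE(1) H(1) u(1) by auto
    have rr': "C / (1 - r) \<ge> 0" using rr by simp
    have "nrm p (E.Res (rem \<epsilon>)) \<le> C / (1 - r) * E.V rem'" by (rule RR(3))
    also have "\<dots> \<le> C / (1 - r) * ((K2 + 2 * BB) * nrm p rem')" by (intro mult_left_mono E.V_le rem' rr')
    also have "\<dots> = KC * nrm p rem'" by (simp add: KC_def)
    also have "\<dots> \<le> KC * enn2real (wn \<epsilon>)"
    proof (rule mult_left_mono)
      define s where "s = nrm p (rem \<epsilon>) + nrm p rem'"
      have "wn \<epsilon> = ennreal s" "0 \<le> s" "nrm p rem' \<le> s" using rem'(3) by (auto simp: s_def)
      then show "nrm p rem' \<le> enn2real (wn \<epsilon>)" by simp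
      show "0 \<le> KC" unfolding KC_def using rr' const_bounds by (intro mult_nonneg_nonneg[OF rr']) linarith
    qed
    finally have "nrm p (\<lambda>x. \<epsilon> * (E.Res q x - Z.Res q x) + E.Res (rem \<epsilon>) x) \<le> \<epsilon> * nrm p (\<lambda>x. E.Res q x - Z.Res q x) + KC * enn2real (wn \<epsilon>)"
      using Lp_add(2)[OF pge1 edL L(2)] Lp_cmult(2)[OF p0 dL, of \<epsilon>] e by simp
    then show ?thesis using Lp_cong[OF p0 SL m eq] by simp
  qed
  show thesis
  proof (rule that[OF q' D0])
    show "((\<lambda>\<epsilon>. nrm p (\<lambda>x. Q \<epsilon> ?h x - Q 0 ?h x - \<epsilon> * q x) / \<epsilon>) \<longlongrightarrow> 0) (at_right 0)" using remlim by (simp add: rem_def)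
    fix u assume u: "u \<in> borel_measurable mu" "AE x in mu. u x = Z.Res q x"
    let ?N = "\<lambda>\<epsilon>. nrm p (\<lambda>x. cusp_map.hinv c (T \<epsilon>) (T1 \<epsilon>) x - ?h x - \<epsilon> * u x)"
    have b: "((\<lambda>\<epsilon>. nrm p (\<lambda>x. cusp_map.Res c (T \<epsilon>) (T1 \<epsilon>) q x - Z.Res q x) + KC * (enn2real (wn \<epsilon>) / \<epsilon>)) \<longlongrightarrow> 0 + KC * 0) (at_right 0)"
      by (intro tendsto_intros Res_tendsto[OF q' D0 d2 gap] wnlim)
    have b': "((\<lambda>\<epsilon>. nrm p (\<lambda>x. cusp_map.Res c (T \<epsilon>) (T1 \<epsilon>) q x - Z.Res q x) + KC * (enn2real (wn \<epsilon>) / \<epsilon>)) \<longlongrightarrow> 0) (at_right 0)"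
      using b by simp
    have "((\<lambda>\<epsilon>. ?N \<epsilon> / \<epsilon>) \<longlongrightarrow> 0) (at_right 0)"
    proof (rule tendsto_sandwich[OF _ _ tendsto_const b'])
      show "\<forall>\<^sub>F \<epsilon> in at_right 0. 0 \<le> ?N \<epsilon> / \<epsilon>" using evd by eventually_elim auto
      show "\<forall>\<^sub>F \<epsilon> in at_right 0. ?N \<epsilon> / \<epsilon> \<le> nrm p (\<lambda>x. cusp_map.Res c (T \<epsilon>) (T1 \<epsilon>) q x - Z.Res q x) + KC * (enn2real (wn \<epsilon>) / \<epsilon>)"
        using evd
      proof eventually_elim
        case (elim \<epsilon>)
        then show ?case using key[OF elim u] by (simp add: field_simps)
      qed
    qed
    then have "((\<lambda>\<epsilon>. ennreal (?N \<epsilon> / \<epsilon>)) \<longlongrightarrow> ennreal 0) (at_right 0)" by (rule tendsto_ennrealI)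
    then have "((\<lambda>\<epsilon>. ennreal (?N \<epsilon> / \<epsilon>)) \<longlongrightarrow> 0) (at_right 0)" by simp
    then show "((\<lambda>\<epsilon>. Lp_norm p (\<lambda>x. cusp_map.hinv c (T \<epsilon>) (T1 \<epsilon>) x - ?h x - \<epsilon> * u x) / ennreal \<epsilon>) \<longlongrightarrow> 0) (at_right 0)"
    proof (rule Lim_transform_eventually)
      show "\<forall>\<^sub>F \<epsilon> in at_right 0. ennreal (?N \<epsilon> / \<epsilon>) = Lp_norm p (\<lambda>x. cusp_map.hinv c (T \<epsilon>) (T1 \<epsilon>) x - ?h x - \<epsilon> * u x) / ennreal \<epsilon>"
        using evd
      proof eventually_elim
        case (elim \<epsilon>)
        then have "0 < \<epsilon>" by auto
        then show ?case using key[OF elim u] by (simp add: Lp_norm_nrm divide_ennreal)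
      qed
    qed
  qed
qed

end

subsection \<open>Response of the transfer operator at a point\<close>

lemma MVT_convex:
  fixes f f' :: "real \<Rightarrow> real"
  assumes "convex I" "x \<in> I" "z \<in> I" and d: "\<And>x. x \<in> I \<Longrightarrow> (f has_real_derivative f' x) (at x)"
  obtains \<xi> where "\<xi> \<in> I" "\<bar>\<xi> - x\<bar> \<le> \<bar>z - x\<bar>" "f z - f x = f' \<xi> * (z - x)"
proof -
  have iv: "is_interval I" using assms(1) by (simp add: is_interval_convex_1)
  consider "x < z" | "z < x" | "x = z" by linarith
  then show thesis
  proof cases
    case 1
    have "\<exists>\<xi>. x < \<xi> \<and> \<xi> < z \<and> f z - f x = (z - x) * f' \<xi>"
    proof (rule MVT2[OF 1])
      fix y assume "x \<le> y" "y \<le> z"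
      then have "y \<in> I" using iv assms(2,3) unfolding is_interval_1 by blast
      then show "(f has_real_derivative f' y) (at y)" by (rule d)
    qed
    then obtain \<xi> where x: "x < \<xi>" "\<xi> < z" "f z - f x = (z - x) * f' \<xi>" by blast
    have "\<xi> \<in> I" using iv assms(2,3) x(1,2) unfolding is_interval_1 by (meson less_imp_le)
    then show thesis using x by (intro that[of \<xi>]) (auto simp: mult.commute)
  next
    case 2
    have "\<exists>\<xi>. z < \<xi> \<and> \<xi> < x \<and> f x - f z = (x - z) * f' \<xi>"
    proof (rule MVT2[OF 2])
      fix y assume "z \<le> y" "y \<le> x"
      then have "y \<in> I" using iv assms(2,3) unfolding is_interval_1 by blast
      then show "(f has_real_derivative f' y) (at y)" by (rule d)
    qed
    then obtain \<xi> where x: "z < \<xi>" "\<xi> < x" "f x - f z = (x - z) * f' \<xi>" by blast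
    have "\<xi> \<in> I" using iv assms(2,3) x(1,2) unfolding is_interval_1 by (meson less_imp_le)
    moreover have "f z - f x = f' \<xi> * (z - x)"
      using x(3) by (simp add: algebra_simps)
    ultimately show thesis using x by (intro that[of \<xi>]) auto
  next
    case 3
    then show thesis using assms by (intro that[of x]) auto
  qed
qed

text \<open>A Lipschitz bound near \<open>x0\<close>, uniform in the parameter, upgrades convergence
  at \<open>x0\<close> to convergence along points moving to \<open>x0\<close>.\<close>

lemma family_tendsto:
  fixes F F' :: "real \<Rightarrow> real \<Rightarrow> real"
  assumes I: "convex I" "x0 \<in> I"
    and d: "eventually (\<lambda>e. \<forall>x\<in>I. (F e has_real_derivative F' e x) (at x)) (at_right 0)"
    and L: "eventually (\<lambda>e. \<forall>x\<in>I. \<bar>x - x0\<bar> \<le> \<eta> \<longrightarrow> \<bar>F' e x\<bar> \<le> L) (at_right 0)" "0 < \<eta>"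
    and F: "((\<lambda>e. F e x0) \<longlongrightarrow> b) (at_right 0)"
    and Z: "eventually (\<lambda>e. Z e \<in> I) (at_right 0)" "(Z \<longlongrightarrow> x0) (at_right 0)"
  shows "((\<lambda>e. F e (Z e)) \<longlongrightarrow> b) (at_right 0)"
proof -
  have "((\<lambda>e. Z e - x0) \<longlongrightarrow> 0) (at_right 0)" using Z(2) by (simp add: LIM_zero)
  then have n: "((\<lambda>e. \<bar>Z e - x0\<bar>) \<longlongrightarrow> 0) (at_right 0)" by (rule tendsto_rabs_zero)
  have near: "eventually (\<lambda>e. \<bar>Z e - x0\<bar> < \<eta>) (at_right 0)" by (rule order_tendstoD(2)[OF n L(2)])
  have n': "((\<lambda>e. L * \<bar>Z e - x0\<bar>) \<longlongrightarrow> 0) (at_right 0)" by (rule tendsto_mult_right_zero[OF n])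
  have "((\<lambda>e. F e (Z e) - F e x0) \<longlongrightarrow> 0) (at_right 0)"
  proof (rule Lim_null_comparison[OF _ n'])
    show "\<forall>\<^sub>F e in at_right 0. norm (F e (Z e) - F e x0) \<le> L * \<bar>Z e - x0\<bar>"
      using d L(1) near Z(1)
    proof eventually_elim
      case (elim e)
      have "(F e has_real_derivative F' e x) (at x)" if "x \<in> I" for x using elim(1) that by blast
      from MVT_convex[OF I elim(4) this] obtain \<xi> where \<xi>: "\<xi> \<in> I" "\<bar>\<xi> - x0\<bar> \<le> \<bar>Z e - x0\<bar>" "F e (Z e) - F e x0 = F' e \<xi> * (Z e - x0)"
        by blast
      have "\<bar>\<xi> - x0\<bar> \<le> \<eta>" using \<xi>(2) elim(3) by linarith
      then have "\<bar>F' e \<xi>\<bar> \<le> L" using elim(2) \<xi>(1) by blast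
      then show ?case unfolding \<xi>(3) by (simp add: abs_mult mult_right_mono)
    qed
  qed
  from tendsto_add[OF this F] show ?thesis by simp
qed

text \<open>Nothing is assumed about the convergence of the derivatives: it is interpolated between the
  convergence of \<open>F\<close> and the bound on \<open>F''\<close>.\<close>

lemma family_deriv_tendsto:
  fixes F F' F'' :: "real \<Rightarrow> real \<Rightarrow> real"
  assumes I: "convex I" "open I" "x0 \<in> I" and \<delta>: "0 < \<delta>"
    and d: "\<And>e x. e \<in> {0..<\<delta>} \<Longrightarrow> x \<in> I \<Longrightarrow> (F e has_real_derivative F' e x) (at x)"
      "\<And>e x. e \<in> {0..<\<delta>} \<Longrightarrow> x \<in> I \<Longrightarrow> (F' e has_real_derivative F'' e x) (at x)"
    and L: "\<And>e x. e \<in> {0..<\<delta>} \<Longrightarrow> x \<in> I \<Longrightarrow> \<bar>x - x0\<bar> \<le> \<eta> \<Longrightarrow> \<bar>F'' e x\<bar> \<le> L" "0 < \<eta>"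
    and F: "\<And>x. x \<in> I \<Longrightarrow> ((\<lambda>e. F e x) \<longlongrightarrow> F 0 x) (at_right 0)"
  shows "((\<lambda>e. F' e x0) \<longlongrightarrow> F' 0 x0) (at_right 0)"
proof (rule tendstoI)
  fix t :: real assume t: "0 < t"
  have Lnn: "0 \<le> L" using L(1)[of 0 x0] \<delta> I L(2) by simp
  obtain r where r: "0 < r" "ball x0 r \<subseteq> I" using I(2,3) openE by blast
  \<comment> \<open>The step of the difference quotient: \<open>\<eta>\<close> keeps it where the
    bound holds, r/2 keeps it inside \<open>I\<close>, and the last term makes each of the two
    errors \<open>L * k\<close> at most t/4.\<close>
  define k where "k = min (min \<eta> (r / 2)) (t / (4 * (L + 1)))"
  have k: "0 < k" "k \<le> \<eta>" "k < r" using r(1) L(2) t Lnn by (auto simp: k_def)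
  have "k * (L + 1) \<le> t / (4 * (L + 1)) * (L + 1)" using Lnn by (intro mult_right_mono) (auto simp: k_def)
  moreover have "t / (4 * (L + 1)) * (L + 1) = t / 4"
  proof -
    have "t / (4 * u) * u = t / 4" if "0 < u" for u :: real using that by simp
    from this[of "L + 1"] Lnn show ?thesis by linarith
  qed
  ultimately have "k * (L + 1) \<le> t / 4" by metis
  then have kL: "L * k \<le> t / 4" using k by (simp add: algebra_simps)
  have xk: "x0 + k \<in> I" using r(2) k by (auto simp: subset_iff dist_real_def)
  define g where "g e = (F e (x0 + k) - F e x0) / k" for e
  have ge: "\<bar>g e - F' e x0\<bar> \<le> L * k" if e: "e \<in> {0..<\<delta>}" for e
  proof -
    obtain \<xi> where \<xi>: "\<xi> \<in> I" "\<bar>\<xi> - x0\<bar> \<le> \<bar>x0 + k - x0\<bar>" "F e (x0 + k) - F e x0 = F' e \<xi> * (x0 + k - x0)"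
      by (rule MVT_convex[OF I(1,3) xk d(1)[OF e]])
    obtain z where z: "z \<in> I" "\<bar>z - x0\<bar> \<le> \<bar>\<xi> - x0\<bar>" "F' e \<xi> - F' e x0 = F'' e z * (\<xi> - x0)"
      by (rule MVT_convex[OF I(1,3) \<xi>(1) d(2)[OF e]])
    have gx: "g e = F' e \<xi>" using \<xi>(3) k by (simp add: g_def)
    have zz: "\<bar>F'' e z\<bar> \<le> L" using L(1)[OF e z(1)] z(2) \<xi>(2) k by simp
    have "\<bar>g e - F' e x0\<bar> = \<bar>F'' e z\<bar> * \<bar>\<xi> - x0\<bar>" unfolding gx z(3) by (simp add: abs_mult)
    moreover have "\<bar>F'' e z\<bar> * \<bar>\<xi> - x0\<bar> \<le> L * k" using zz Lnn \<xi>(2) k by (intro mult_mono) auto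
    ultimately show ?thesis by linarith
  qed
  have "(g \<longlongrightarrow> g 0) (at_right 0)" unfolding g_def using k by (intro tendsto_intros F I xk) auto
  then have "eventually (\<lambda>e. dist (g e) (g 0) < t / 4) (at_right 0)" using t by (intro tendstoD) auto
  moreover have "eventually (\<lambda>e. e \<in> {0<..<\<delta>}) (at_right 0)" using \<delta> by (intro eventually_at_right_real) auto
  ultimately show "\<forall>\<^sub>F e in at_right 0. dist (F' e x0) (F' 0 x0) < t"
  proof eventually_elim
    case (elim e)
    have "\<bar>g e - F' e x0\<bar> \<le> L * k" "\<bar>g 0 - F' 0 x0\<bar> \<le> L * k" using ge[of e] ge[of 0] elim(2) \<delta> by auto
    then show ?case using elim(1) kL t unfolding dist_real_def by linarith
  qed
qed

text \<open>Substitute for joint differentiability in parameter and point: \<open>G\<close> is the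
  derivative at a mean value point, chosen for each parameter and squeezed towards
  \<open>x0\<close>.\<close>

lemma family_difference_quotient:
  fixes F F' :: "real \<Rightarrow> real \<Rightarrow> real"
  assumes I: "convex I" "x0 \<in> I"
    and d: "eventually (\<lambda>e. \<forall>x\<in>I. (F e has_real_derivative F' e x) (at x)) (at_right 0)"
    and Z: "eventually (\<lambda>e. Z e \<in> I) (at_right 0)" "(Z \<longlongrightarrow> x0) (at_right 0)"
    and F': "\<And>\<xi>. eventually (\<lambda>e. \<xi> e \<in> I) (at_right 0) \<Longrightarrow> (\<xi> \<longlongrightarrow> x0) (at_right 0) \<Longrightarrow> ((\<lambda>e. F' e (\<xi> e)) \<longlongrightarrow> b) (at_right 0)"
  obtains G where "eventually (\<lambda>e. F e (Z e) - F e x0 = G e * (Z e - x0)) (at_right 0)" "(G \<longlongrightarrow> b) (at_right 0)"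
proof -
  have "\<forall>e. \<exists>\<xi>. Z e \<in> I \<longrightarrow> (\<forall>x\<in>I. (F e has_real_derivative F' e x) (at x)) \<longrightarrow>
     \<xi> \<in> I \<and> \<bar>\<xi> - x0\<bar> \<le> \<bar>Z e - x0\<bar> \<and> F e (Z e) - F e x0 = F' e \<xi> * (Z e - x0)"
    using MVT_convex[OF I] by metis
  then obtain \<xi> where \<xi>: "\<And>e. Z e \<in> I \<Longrightarrow> \<forall>x\<in>I. (F e has_real_derivative F' e x) (at x) \<Longrightarrow>
     \<xi> e \<in> I \<and> \<bar>\<xi> e - x0\<bar> \<le> \<bar>Z e - x0\<bar> \<and> F e (Z e) - F e x0 = F' e (\<xi> e) * (Z e - x0)"
    by metis
  have ev: "eventually (\<lambda>e. \<xi> e \<in> I \<and> \<bar>\<xi> e - x0\<bar> \<le> \<bar>Z e - x0\<bar> \<and> F e (Z e) - F e x0 = F' e (\<xi> e) * (Z e - x0)) (at_right 0)"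
    using Z(1) d by eventually_elim (rule \<xi>)
  have "((\<lambda>e. Z e - x0) \<longlongrightarrow> 0) (at_right 0)" using Z(2) by (simp add: LIM_zero)
  then have n: "((\<lambda>e. \<bar>Z e - x0\<bar>) \<longlongrightarrow> 0) (at_right 0)" by (rule tendsto_rabs_zero)
  have "((\<lambda>e. \<xi> e - x0) \<longlongrightarrow> 0) (at_right 0)"
    by (rule Lim_null_comparison[OF _ n]) (use ev in eventually_elim, simp)
  then have "(\<xi> \<longlongrightarrow> x0) (at_right 0)" by (rule LIM_zero_cancel)
  then have "((\<lambda>e. F' e (\<xi> e)) \<longlongrightarrow> b) (at_right 0)"
    by (rule F'[rotated]) (use ev in eventually_elim, simp)
  then show thesis by (rule that[rotated]) (use ev in eventually_elim, simp)
qed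

text \<open>The increment splits into a change of the parameter at the fixed point \<open>x0\<close>
  and a change of the point at a fixed parameter.\<close>

lemma family_has_deriv:
  fixes F F' :: "real \<Rightarrow> real \<Rightarrow> real"
  assumes I: "convex I" "x0 \<in> I"
    and d: "eventually (\<lambda>e. \<forall>x\<in>I. (F e has_real_derivative F' e x) (at x)) (at_right 0)"
    and Z: "eventually (\<lambda>e. Z e \<in> I) (at_right 0)" "(Z has_real_derivative v) (at_right 0)" "Z 0 = x0"
    and F': "\<And>\<xi>. eventually (\<lambda>e. \<xi> e \<in> I) (at_right 0) \<Longrightarrow> (\<xi> \<longlongrightarrow> x0) (at_right 0) \<Longrightarrow> ((\<lambda>e. F' e (\<xi> e)) \<longlongrightarrow> b) (at_right 0)"
    and F: "((\<lambda>e. F e x0) has_real_derivative s) (at_right 0)"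
  shows "((\<lambda>e. F e (Z e)) has_real_derivative (s + b * v)) (at_right 0)"
proof -
  have "(Z \<longlongrightarrow> x0) (at_right 0)" using DERIV_continuous[OF Z(2)] Z(3) by (simp add: continuous_within)
  then obtain G where G: "eventually (\<lambda>e. F e (Z e) - F e x0 = G e * (Z e - x0)) (at_right 0)" "(G \<longlongrightarrow> b) (at_right 0)"
    by (rule family_difference_quotient[OF I d Z(1) _ F'])
  have "((\<lambda>e. (F e x0 - F 0 x0) / e + G e * ((Z e - Z 0) / e)) \<longlongrightarrow> s + b * v) (at_right 0)"
    using F Z(2) unfolding has_field_derivative_iff by (intro tendsto_intros G) simp_all
  then show ?thesis unfolding has_field_derivative_iff
  proof (rule Lim_transform_eventually)
    show "\<forall>\<^sub>F e in at_right 0. (F e x0 - F 0 x0) / e + G e * ((Z e - Z 0) / e) = (F e (Z e) - F 0 (Z 0)) / (e - 0)"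
      using G(1)
    proof eventually_elim
      case (elim e)
      have "F e (Z e) - F 0 (Z 0) = (F e x0 - F 0 x0) + G e * (Z e - Z 0)" using elim Z(3) by simp
      then show ?case by (simp add: add_divide_distrib)
    qed
  qed
qed

text \<open>Along the level curve the total increment is 0, so the same splitting can be solved for
  the velocity of the point.\<close>

lemma family_implicit_deriv:
  fixes F F' :: "real \<Rightarrow> real \<Rightarrow> real"
  assumes I: "convex I" "x0 \<in> I"
    and d: "eventually (\<lambda>e. \<forall>x\<in>I. (F e has_real_derivative F' e x) (at x)) (at_right 0)"
    and Z: "eventually (\<lambda>e. Z e \<in> I \<and> F e (Z e) = F 0 x0) (at_right 0)" "(Z \<longlongrightarrow> x0) (at_right 0)" "Z 0 = x0"
    and F': "\<And>\<xi>. eventually (\<lambda>e. \<xi> e \<in> I) (at_right 0) \<Longrightarrow> (\<xi> \<longlongrightarrow> x0) (at_right 0) \<Longrightarrow> ((\<lambda>e. F' e (\<xi> e)) \<longlongrightarrow> b) (at_right 0)"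
    and F: "((\<lambda>e. F e x0) has_real_derivative s) (at_right 0)" and b: "b \<noteq> 0"
  shows "(Z has_real_derivative (- s / b)) (at_right 0)"
proof -
  have "eventually (\<lambda>e. Z e \<in> I) (at_right 0)" using Z(1) by eventually_elim simp
  then obtain G where G: "eventually (\<lambda>e. F e (Z e) - F e x0 = G e * (Z e - x0)) (at_right 0)" "(G \<longlongrightarrow> b) (at_right 0)"
    by (rule family_difference_quotient[OF I d _ Z(2) F'])
  have "((\<lambda>e. (- ((F e x0 - F 0 x0) / e)) / G e) \<longlongrightarrow> - s / b) (at_right 0)"
    using F unfolding has_field_derivative_iff by (intro tendsto_intros G b) simp_all
  then show ?thesis unfolding has_field_derivative_iff
  proof (rule Lim_transform_eventually)
    show "\<forall>\<^sub>F e in at_right 0. (- ((F e x0 - F 0 x0) / e)) / G e = (Z e - Z 0) / (e - 0)"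
      using G(1) Z(1) tendsto_imp_eventually_ne[OF G(2) b]
    proof eventually_elim
      case (elim e)
      have "- (F e x0 - F 0 x0) = G e * (Z e - Z 0)" using elim Z(3) by simp
      then have "Z e - Z 0 = - (F e x0 - F 0 x0) / G e" using elim(3) by (simp add: field_simps)
      then show ?case by (simp add: mult.commute diff_divide_distrib)
    qed
  qed
qed

context cusp_params
begin

text \<open>\<open>\<sigma>\<close> is the sign of T' on the branch; it replaces the absolute value
  by a linear factor before differentiating.\<close>

definition branch :: "real set \<Rightarrow> real \<Rightarrow> bool" where
  "branch I \<sigma> \<longleftrightarrow> I = {0<..<c} \<and> \<sigma> = 1 \<or> I = {c<..<1} \<and> \<sigma> = -1"

lemma branchD: "branch I \<sigma> \<Longrightarrow> convex I" "branch I \<sigma> \<Longrightarrow> open I" "branch I \<sigma> \<Longrightarrow> I \<subseteq> {0<..<1} - {c}"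
  "branch I \<sigma> \<Longrightarrow> I \<subseteq> D"
  using c01 by (auto simp: branch_def D_def)

end

context cusp_map
begin

lemma branch_expanding:
  assumes b: "branch I \<sigma>" and x: "x \<in> I" "z \<in> I"
  shows "\<theta> * \<bar>x - z\<bar> \<le> \<bar>T x - T z\<bar>"
proof -
  have *: "\<theta> * \<bar>x - z\<bar> \<le> \<bar>T x - T z\<bar>" if "x \<in> I" "z \<in> I" "x \<le> z" for x z
  proof -
    from b consider "I = {0<..<c}" | "I = {c<..<1}" by (auto simp: branch_def)
    then have "\<theta> * (z - x) \<le> \<bar>T x - T z\<bar>"
    proof cases
      case 1 then show ?thesis using T_left[of x z] that by auto
    next
      case 2 then show ?thesis using T_right[of x z] that by auto
    qed
    then show ?thesis using that by simp
  qed
  show ?thesis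
  proof (cases "x \<le> z")
    case True then show ?thesis by (rule *[OF x])
  next
    case False
    then have "\<theta> * \<bar>z - x\<bar> \<le> \<bar>T z - T x\<bar>" by (intro * x) simp
    then show ?thesis by (simp only: abs_minus_commute)
  qed
qed

lemma branch_abs: "branch I \<sigma> \<Longrightarrow> x \<in> I \<Longrightarrow> \<bar>T1 x\<bar> = \<sigma> * T1 x"
  using T1_left[of x] T1_right[of x] by (auto simp: branch_def)

lemma P_two:
  assumes y: "0 < y" "y < a"
  obtains xL xR where "xL \<in> {0<..<c}" "xR \<in> {c<..<1}" "T xL = y" "T xR = y"
    "\<And>f. P f y = f xL / \<bar>T1 xL\<bar> + f xR / \<bar>T1 xR\<bar>"
proof -
  obtain xL where L: "0 < xL" "xL < c" "T xL = y" using preimage_left[of 0 y] y c01 T01 by auto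
  obtain xR where R: "c < xR" "xR < 1" "T xR = y" using preimage_right[of 1 y] y c01 T01 by auto
  have "x = xL \<or> x = xR" if "x \<in> {0<..<1} - {c}" "T x = y" for x
  proof (cases "x < c")
    case True
    then have "x = xL" using inj_onD[OF inj(1), of x xL] that L by auto
    then show ?thesis ..
  next
    case False
    then have "x = xR" using inj_onD[OF inj(2), of x xR] that R by auto
    then show ?thesis ..
  qed
  then have fib: "{x. x \<in> {0<..<1} - {c} \<and> T x = y} = {xL, xR}" using L R c01 by auto
  have "xL \<noteq> xR" using L R by auto
  then have "P f y = f xL / \<bar>T1 xL\<bar> + f xR / \<bar>T1 xR\<bar>" for f unfolding PF_def fib by simp
  then show thesis using L R by (intro that[of xL xR]) auto
qed

end

locale cusp_family_deriv = cusp_family +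
  fixes S S1 :: "real \<Rightarrow> real"
  assumes dT: "\<And>x. x \<in> D \<Longrightarrow> ((\<lambda>e. T e x) has_real_derivative S x) (at_right 0)"
    and dT1: "\<And>x. x \<in> D \<Longrightarrow> ((\<lambda>e. T1 e x) has_real_derivative S1 x) (at_right 0)"
begin

lemma T_tendsto: "x \<in> D \<Longrightarrow> ((\<lambda>e. T e x) \<longlongrightarrow> T 0 x) (at_right 0)"
  and T1_tendsto: "x \<in> D \<Longrightarrow> ((\<lambda>e. T1 e x) \<longlongrightarrow> T1 0 x) (at_right 0)"
  using DERIV_continuous[OF dT] DERIV_continuous[OF dT1] by (auto simp: continuous_within)

lemma ev_delta: "eventually (\<lambda>e. e \<in> {0..<\<delta>}) (at_right 0)"
proof -
  have "eventually (\<lambda>e. e \<in> {0<..<\<delta>}) (at_right 0)" using delta by (intro eventually_at_right_real) auto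
  then show ?thesis by eventually_elim simp
qed

text \<open>\<open>Z\<close> follows one preimage of a fixed value as the parameter moves. Its
  velocity is -S/T', and the quotient rule then produces the summand of A H' + B H that belongs to
  this preimage.\<close>

lemma branch_response:
  assumes b: "branch I \<sigma>" and x0: "x0 \<in> I"
    and Z: "eventually (\<lambda>e. Z e \<in> I \<and> T e (Z e) = T 0 x0) (at_right 0)" "Z 0 = x0"
    and H: "(H has_real_derivative H') (at x0)"
  shows "((\<lambda>e. H (Z e) / \<bar>T1 e (Z e)\<bar>) has_real_derivative
    (- (S x0 / T1 0 x0) * H' + (S x0 * T2 0 x0 / (T1 0 x0)\<^sup>2 - S1 x0 / T1 0 x0) * H x0) / \<bar>T1 0 x0\<bar>) (at_right 0)"
proof -
  note I = branchD[OF b]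
  have IE: "x \<in> D" "x \<in> {0<..<1} - {c}" if "x \<in> I" for x using I that by auto
  have x0D: "x0 \<in> D" using IE x0 by auto
  \<comment> \<open>Half the distance to the cusp: within it the bounds on T'' and T''' are finite
    and uniform in the parameter.\<close>
  define \<eta> where "\<eta> = \<bar>x0 - c\<bar> / 2"
  have \<eta>: "0 < \<eta>" using x0D by (auto simp: \<eta>_def D_def)
  have far: "\<eta> \<le> \<bar>x - c\<bar>" if "\<bar>x - x0\<bar> \<le> \<eta>" for x
  proof -
    have "\<bar>x0 - c\<bar> \<le> \<bar>x - c\<bar> + \<bar>x - x0\<bar>" by arith
    moreover have "u / 2 \<le> v" if "u \<le> v + w" "w \<le> u / 2" for u v w :: real using that by linarith
    ultimately show ?thesis using that unfolding \<eta>_def by blast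
  qed
  have dd: "(T e has_real_derivative T1 e x) (at x)" "(T1 e has_real_derivative T2 e x) (at x)"
     "(T2 e has_real_derivative T3 e x) (at x)" if "e \<in> {0..<\<delta>}" "x \<in> I" for e x
    using cusp_map.der_int[OF cm[OF that(1)] IE(2)[OF that(2)]] by auto
  have b2: "\<bar>T2 e x\<bar> \<le> M * \<eta> powr (\<beta> - 1)" if "e \<in> {0..<\<delta>}" "x \<in> I" "\<bar>x - x0\<bar> \<le> \<eta>" for e x
  proof -
    have "\<bar>T2 e x\<bar> \<le> M * \<bar>x - c\<bar> powr (\<beta> - 1)" using cusp_map.T2_upper[OF cm[OF that(1)] IE(1)[OF that(2)]] .
    also have "\<dots> \<le> M * \<eta> powr (\<beta> - 1)"
      using \<eta> far[OF that(3)] beta_half M0 by (intro mult_left_mono powr_mono2') auto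
    finally show ?thesis .
  qed
  have b3: "\<bar>T3 e x\<bar> \<le> M * \<eta> powr (\<beta> - 2)" if "e \<in> {0..<\<delta>}" "x \<in> I" "\<bar>x - x0\<bar> \<le> \<eta>" for e x
  proof -
    have "\<bar>T3 e x\<bar> \<le> M * \<bar>x - c\<bar> powr (\<beta> - 2)" using cusp_map.T3_upper[OF cm[OF that(1)] IE(1)[OF that(2)]] .
    also have "\<dots> \<le> M * \<eta> powr (\<beta> - 2)"
      using \<eta> far[OF that(3)] beta_half M0 by (intro mult_left_mono powr_mono2') auto
    finally show ?thesis .
  qed
  have ed: "eventually (\<lambda>e. \<forall>x\<in>I. (T e has_real_derivative T1 e x) (at x)) (at_right 0)"
      "eventually (\<lambda>e. \<forall>x\<in>I. (T1 e has_real_derivative T2 e x) (at x)) (at_right 0)"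
      "eventually (\<lambda>e. \<forall>x\<in>I. (T2 e has_real_derivative T3 e x) (at x)) (at_right 0)"
    and eb: "eventually (\<lambda>e. \<forall>x\<in>I. \<bar>x - x0\<bar> \<le> \<eta> \<longrightarrow> \<bar>T2 e x\<bar> \<le> M * \<eta> powr (\<beta> - 1)) (at_right 0)"
      "eventually (\<lambda>e. \<forall>x\<in>I. \<bar>x - x0\<bar> \<le> \<eta> \<longrightarrow> \<bar>T3 e x\<bar> \<le> M * \<eta> powr (\<beta> - 2)) (at_right 0)"
    by (rule eventually_mono[OF ev_delta], use dd b2 b3 in blast)+
  have T2x: "((\<lambda>e. T2 e x0) \<longlongrightarrow> T2 0 x0) (at_right 0)"
    by (rule family_deriv_tendsto[OF I(1,2) x0 delta dd(2,3) b3 \<eta>]) (use T1_tendsto IE in auto)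
  have T1z: "((\<lambda>e. T1 e (\<xi> e)) \<longlongrightarrow> T1 0 x0) (at_right 0)"
    if "eventually (\<lambda>e. \<xi> e \<in> I) (at_right 0)" "(\<xi> \<longlongrightarrow> x0) (at_right 0)" for \<xi>
    by (rule family_tendsto[OF I(1) x0 ed(2) eb(1) \<eta> T1_tendsto[OF x0D] that])
  have T2z: "((\<lambda>e. T2 e (\<xi> e)) \<longlongrightarrow> T2 0 x0) (at_right 0)"
    if "eventually (\<lambda>e. \<xi> e \<in> I) (at_right 0)" "(\<xi> \<longlongrightarrow> x0) (at_right 0)" for \<xi>
    by (rule family_tendsto[OF I(1) x0 ed(3) eb(2) \<eta> T2x that])
  have T10: "T1 0 x0 \<noteq> 0" by (rule Z.T1_pos(2)[OF x0D])
  have ZI: "eventually (\<lambda>e. Z e \<in> I) (at_right 0)" using Z(1) by eventually_elim simp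
  \<comment> \<open>The branch is expanding, so the preimage moves by no more than the value of the
    map at \<open>x0\<close> changes.\<close>
  have Zl: "(Z \<longlongrightarrow> x0) (at_right 0)"
  proof (rule LIM_zero_cancel, rule Lim_null_comparison)
    have "((\<lambda>e. T e x0 - T 0 x0) \<longlongrightarrow> 0) (at_right 0)" using T_tendsto[OF x0D] by (simp add: LIM_zero)
    then show "((\<lambda>e. \<bar>T e x0 - T 0 x0\<bar>) \<longlongrightarrow> 0) (at_right 0)" by (rule tendsto_rabs_zero)
    show "\<forall>\<^sub>F e in at_right 0. norm (Z e - x0) \<le> \<bar>T e x0 - T 0 x0\<bar>"
      using Z(1) ev_delta
    proof eventually_elim
      case (elim e)
      have "\<theta> * \<bar>Z e - x0\<bar> \<le> \<bar>T e (Z e) - T e x0\<bar>"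
        using cusp_map.branch_expanding[OF cm[OF elim(2)] b _ x0] elim(1) by blast
      moreover have "1 * \<bar>Z e - x0\<bar> \<le> \<theta> * \<bar>Z e - x0\<bar>" using theta by (intro mult_right_mono) auto
      ultimately show ?case using elim(1) by simp
    qed
  qed
  have Zd: "(Z has_real_derivative - S x0 / T1 0 x0) (at_right 0)"
    by (rule family_implicit_deriv[OF I(1) x0 ed(1) Z(1) Zl Z(2) T1z dT[OF x0D] T10])
  have T1d: "((\<lambda>e. T1 e (Z e)) has_real_derivative S1 x0 + T2 0 x0 * (- S x0 / T1 0 x0)) (at_right 0)"
    by (rule family_has_deriv[OF I(1) x0 ed(2) ZI Zd Z(2) T2z dT1[OF x0D]])
  have Hd: "((\<lambda>e. H (Z e)) has_real_derivative H' * (- S x0 / T1 0 x0)) (at_right 0)"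
    using H Zd unfolding Z(2)[symmetric] by (rule DERIV_chain2)
  have s: "\<sigma> \<noteq> 0" "\<sigma> * \<sigma> = 1" using b by (auto simp: branch_def)
  have "((\<lambda>e. H (Z e) / (\<sigma> * T1 e (Z e))) has_real_derivative
      ((H' * (- S x0 / T1 0 x0)) * (\<sigma> * T1 0 (Z 0)) - H (Z 0) * (\<sigma> * (S1 x0 + T2 0 x0 * (- S x0 / T1 0 x0)))) /
        ((\<sigma> * T1 0 (Z 0)) * (\<sigma> * T1 0 (Z 0)))) (at_right 0)"
    using s T10 Z(2) by (intro DERIV_divide Hd DERIV_cmult T1d) auto
  moreover have "((H' * (- S x0 / T1 0 x0)) * (\<sigma> * T1 0 (Z 0)) - H (Z 0) * (\<sigma> * (S1 x0 + T2 0 x0 * (- S x0 / T1 0 x0)))) /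
        ((\<sigma> * T1 0 (Z 0)) * (\<sigma> * T1 0 (Z 0))) =
     (- (S x0 / T1 0 x0) * H' + (S x0 * T2 0 x0 / (T1 0 x0)\<^sup>2 - S1 x0 / T1 0 x0) * H x0) / (\<sigma> * T1 0 x0)"
    unfolding Z(2) using s T10 by (simp add: field_simps power2_eq_square)
  ultimately have "((\<lambda>e. H (Z e) / (\<sigma> * T1 e (Z e))) has_real_derivative
     (- (S x0 / T1 0 x0) * H' + (S x0 * T2 0 x0 / (T1 0 x0)\<^sup>2 - S1 x0 / T1 0 x0) * H x0) / \<bar>T1 0 x0\<bar>) (at_right 0)"
    unfolding Z.branch_abs[OF b x0] by simp
  then show ?thesis unfolding has_field_derivative_iff
  proof (rule Lim_transform_eventually)
    show "\<forall>\<^sub>F e in at_right 0. (H (Z e) / (\<sigma> * T1 e (Z e)) - H (Z 0) / (\<sigma> * T1 0 (Z 0))) / (e - 0)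
       = (H (Z e) / \<bar>T1 e (Z e)\<bar> - H (Z 0) / \<bar>T1 0 (Z 0)\<bar>) / (e - 0)"
      using ZI ev_delta
    proof eventually_elim
      case (elim e)
      then show ?case using cusp_map.branch_abs[OF cm b, of e "Z e"] Z.branch_abs[OF b x0] Z(2) by simp
    qed
  qed
qed

text \<open>For small parameters the operator at \<open>y\<close> is a sum over two moving
  preimages, one on each branch, and each is handled by \<open>branch_response\<close>.\<close>

lemma pointwise_response:
  assumes y: "0 < y" "y < 1" and H: "\<And>x. x \<in> {0<..<1} \<Longrightarrow> (H has_real_derivative H' x) (at x)"
  shows "((\<lambda>\<epsilon>. (Q \<epsilon> H y - Q 0 H y) / \<epsilon>) \<longlongrightarrow>
     Q 0 (\<lambda>x. - (S x / T1 0 x) * H' x + (S x * T2 0 x / (T1 0 x)\<^sup>2 - S1 x / T1 0 x) * H x) y) (at_right 0)"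
proof -
  let ?W = "\<lambda>x. - (S x / T1 0 x) * H' x + (S x * T2 0 x / (T1 0 x)\<^sup>2 - S1 x / T1 0 x) * H x"
  let ?good = "\<lambda>e. e \<in> {0..<\<delta>} \<and> y < a e"
  have "\<forall>e. \<exists>xL xR. ?good e \<longrightarrow> xL \<in> {0<..<c} \<and> xR \<in> {c<..<1} \<and> T e xL = y \<and> T e xR = y \<and>
    (\<forall>f. Q e f y = f xL / \<bar>T1 e xL\<bar> + f xR / \<bar>T1 e xR\<bar>)"
  proof
    fix e show "\<exists>xL xR. ?good e \<longrightarrow> xL \<in> {0<..<c} \<and> xR \<in> {c<..<1} \<and> T e xL = y \<and> T e xR = y \<and>
      (\<forall>f. Q e f y = f xL / \<bar>T1 e xL\<bar> + f xR / \<bar>T1 e xR\<bar>)"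
    proof (cases "?good e")
      case True
      then interpret E: cusp_map c \<beta> p \<theta> m M "T e" "T1 e" "T2 e" "T3 e" "a e" by (intro cm) simp
      obtain xL xR where "xL \<in> {0<..<c}" "xR \<in> {c<..<1}" "T e xL = y" "T e xR = y"
        "\<And>f. Q e f y = f xL / \<bar>T1 e xL\<bar> + f xR / \<bar>T1 e xR\<bar>"
        using E.P_two[OF y(1)] True by blast
      then show ?thesis by blast
    qed blast
  qed
  then obtain XL XR where X: "\<And>e. ?good e \<Longrightarrow> XL e \<in> {0<..<c} \<and> XR e \<in> {c<..<1} \<and> T e (XL e) = y \<and> T e (XR e) = y \<and>
    (\<forall>f. Q e f y = f (XL e) / \<bar>T1 e (XL e)\<bar> + f (XR e) / \<bar>T1 e (XR e)\<bar>)" by metis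
  have g0: "?good 0" using delta a0 y by simp
  obtain x1 where x1: "0 < x1" "x1 < c" "y < T 0 x1" using Z.T_near_c_left[of y 0] a0 y c01 by auto
  have x1D: "x1 \<in> D" using x1 c01 by (simp add: D_def)
  have good: "eventually ?good (at_right 0)"
    using order_tendstoD(1)[OF T_tendsto[OF x1D] x1(3)] ev_delta
  proof eventually_elim
    case (elim e)
    then show ?case using cusp_map.T_less_a[OF cm[OF elim(2)] x1D] by simp
  qed
  have bL: "branch {0<..<c} 1" and bR: "branch {c<..<1} (-1)" by (auto simp: branch_def)
  note X0 = X[OF g0]
  have ZL: "eventually (\<lambda>e. XL e \<in> {0<..<c} \<and> T e (XL e) = T 0 (XL 0)) (at_right 0)"
    and ZR: "eventually (\<lambda>e. XR e \<in> {c<..<1} \<and> T e (XR e) = T 0 (XR 0)) (at_right 0)"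
    by (rule eventually_mono[OF good], use X X0 in simp)+
  have HL: "(H has_real_derivative H' (XL 0)) (at (XL 0))" and HR: "(H has_real_derivative H' (XR 0)) (at (XR 0))"
    using H X0 c01 by auto
  have "((\<lambda>e. H (XL e) / \<bar>T1 e (XL e)\<bar>) has_real_derivative ?W (XL 0) / \<bar>T1 0 (XL 0)\<bar>) (at_right 0)"
    by (rule branch_response[OF bL _ ZL refl HL]) (use X0 in blast)
  moreover have "((\<lambda>e. H (XR e) / \<bar>T1 e (XR e)\<bar>) has_real_derivative ?W (XR 0) / \<bar>T1 0 (XR 0)\<bar>) (at_right 0)"
    by (rule branch_response[OF bR _ ZR refl HR]) (use X0 in blast)
  ultimately have "((\<lambda>e. H (XL e) / \<bar>T1 e (XL e)\<bar> + H (XR e) / \<bar>T1 e (XR e)\<bar>) has_real_derivative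
      ?W (XL 0) / \<bar>T1 0 (XL 0)\<bar> + ?W (XR 0) / \<bar>T1 0 (XR 0)\<bar>) (at_right 0)"
    by (rule DERIV_add)
  moreover have "Q 0 ?W y = ?W (XL 0) / \<bar>T1 0 (XL 0)\<bar> + ?W (XR 0) / \<bar>T1 0 (XR 0)\<bar>" using X0 by blast
  ultimately have "((\<lambda>e. ((H (XL e) / \<bar>T1 e (XL e)\<bar> + H (XR e) / \<bar>T1 e (XR e)\<bar>) -
     (H (XL 0) / \<bar>T1 0 (XL 0)\<bar> + H (XR 0) / \<bar>T1 0 (XR 0)\<bar>)) / (e - 0)) \<longlongrightarrow> Q 0 ?W y) (at_right 0)"
    unfolding has_field_derivative_iff by simp
  then show ?thesis
  proof (rule Lim_transform_eventually)
    show "\<forall>\<^sub>F e in at_right 0. ((H (XL e) / \<bar>T1 e (XL e)\<bar> + H (XR e) / \<bar>T1 e (XR e)\<bar>) -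
     (H (XL 0) / \<bar>T1 0 (XL 0)\<bar> + H (XR 0) / \<bar>T1 0 (XR 0)\<bar>)) / (e - 0) = (Q e H y - Q 0 H y) / e"
      using good
    proof eventually_elim
      case (elim e)
      have "Q e H y = H (XL e) / \<bar>T1 e (XL e)\<bar> + H (XR e) / \<bar>T1 e (XR e)\<bar>" using X[OF elim] by blast
      moreover have "Q 0 H y = H (XL 0) / \<bar>T1 0 (XL 0)\<bar> + H (XR 0) / \<bar>T1 0 (XR 0)\<bar>" using X0 by blast
      ultimately show ?case by simp
    qed
  qed
qed

end

context cusp_family_deriv
begin

section \<open>Identification of the response almost everywhere\<close>

lemma null_sequence:
  obtains e where "\<And>n. e n \<in> {0<..<\<delta>}" "filterlim e (at_right 0) sequentially"
proof (rule that)
  let ?e = "\<lambda>n. \<delta> / real (n + 2)"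
  have "\<delta> * 1 < \<delta> * real (n + 2)" for n using delta by (intro mult_strict_left_mono) auto
  then show e: "?e n \<in> {0<..<\<delta>}" for n using delta by (simp add: pos_divide_less_eq)
  have "?e \<longlonglongrightarrow> 0" by real_asymp
  then show "filterlim ?e (at_right 0) sequentially"
    using e by (intro tendsto_imp_filterlim_at_right) auto
qed

lemma measurable_deriv_at_0:
  assumes m: "\<And>e. e \<in> {0..<\<delta>} \<Longrightarrow> F e \<in> borel_measurable mu"
    and d: "\<And>x. x \<in> D \<Longrightarrow> ((\<lambda>e. F e x) has_real_derivative s x) (at_right 0)"
  shows "s \<in> borel_measurable mu"
proof -
  obtain e where e: "\<And>n. e n \<in> {0<..<\<delta>}" and elim: "filterlim e (at_right 0) sequentially"
    by (rule null_sequence) blast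
  have lim: "(\<lambda>n. (F (e n) x - F 0 x) / e n) \<longlonglongrightarrow> s x" if "x \<in> D" for x
    using filterlim_compose[OF d[OF that, unfolded has_field_derivative_iff] elim] by simp
  have ind: "(\<lambda>x. if x = c then 0 else 1 :: real) \<in> borel_measurable mu" "(\<lambda>x. if x = c then s c else 0) \<in> borel_measurable mu"
    by (intro borel_measurable_mu; measurable)+
  have "(\<lambda>x. (if x = c then 0 else 1) * s x) \<in> borel_measurable mu"
  proof (rule borel_measurable_LIMSEQ_real)
    show "(\<lambda>n. (if x = c then 0 else 1) * ((F (e n) x - F 0 x) / e n)) \<longlonglongrightarrow> (if x = c then 0 else 1) * s x" if "x \<in> space mu" for x
      using lim[of x] that by (auto simp: D_def)
    show "(\<lambda>x. (if x = c then 0 else 1) * ((F (e n) x - F 0 x) / e n)) \<in> borel_measurable mu" for n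
      using m[of "e n"] m[of 0] e[of n] delta by (intro borel_measurable_times ind borel_measurable_divide borel_measurable_diff) auto
  qed
  from borel_measurable_add[OF this ind(2)] show ?thesis
    by (rule measurable_cong[THEN iffD1, rotated]) auto
qed

lemma S_measurable: "S \<in> borel_measurable mu" "S1 \<in> borel_measurable mu"
proof -
  show "S \<in> borel_measurable mu"
    by (rule measurable_deriv_at_0[OF _ dT]) (use cusp_map.cont_D(1)[OF cm] continuous_on_D_measurable in auto)
  show "S1 \<in> borel_measurable mu"
    by (rule measurable_deriv_at_0[OF _ dT1]) (use cusp_map.cont_D(2)[OF cm] continuous_on_D_measurable in auto)
qed

abbreviation "response h h' x \<equiv> - (S x / T1 0 x) * h' x + (S x * T2 0 x / (T1 0 x)\<^sup>2 - S1 x / T1 0 x) * h x"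

lemma response_measurable:
  assumes [measurable]: "h \<in> borel_measurable mu" "h' \<in> borel_measurable mu"
  shows "(\<lambda>x. response h h' x) \<in> borel_measurable mu"
proof -
  note [measurable] = S_measurable Z.meas_D
  show ?thesis by measurable
qed

text \<open>L^p convergence yields convergence almost everywhere along a sequence of parameters, and
  pointwise differentiation names the limit. Using one sequence keeps the exceptional null sets
  countable in number.\<close>

lemma response_AE:
  assumes h: "has_weak_deriv h h'" "has_weak_deriv h' h''" and q: "q \<in> Lp_space p"
    and lim: "((\<lambda>\<epsilon>. nrm p (\<lambda>x. Q \<epsilon> h x - Q 0 h x - \<epsilon> * q x) / \<epsilon>) \<longlongrightarrow> 0) (at_right 0)"
  shows "AE y in mu. q y = Q 0 (\<lambda>x. response h (weak_deriv h) x) y"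
proof -
  obtain k where k: "AE x in mu. h x = k + prim h' x" using h(1) unfolding has_weak_deriv_iff by blast
  obtain k' where k': "AE x in mu. h' x = k' + prim h'' x" using h(2) unfolding has_weak_deriv_iff by blast
  have hi: "integrable mu h'" "integrable mu h''" "integrable mu h" using h by (auto simp: has_weak_deriv_def)
  \<comment> \<open>The moving preimages require a derivative at every point, so \<open>h\<close> is
    replaced by its C^1 representative, built from the continuous version of h'.\<close>
  define H' where "H' x = k' + prim h'' x" for x
  have H'c: "continuous_on {0..1} H'" unfolding H'_def using hi by (intro continuous_intros continuous_on_prim)
  define G where "G x = integral {0..x} H'" for x
  have Gd: "(G has_real_derivative H' x) (at x within {0..1})" if "x \<in> {0..1}" for x
    unfolding G_def using integral_has_real_derivative[OF H'c that] .
  have Gd': "(G has_real_derivative H' x) (at x)" if "x \<in> {0<..<1}" for x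
    using Gd[of x] that at_within_interior[of x "{0..1::real}"] by auto
  have Gc: "continuous_on {0..1} G" using Gd by (rule DERIV_continuous_on)
  define H where "H x = k - G 0 + G x" for x
  have Hd: "(H has_real_derivative H' x) (at x)" if "x \<in> {0<..<1}" for x
    unfolding H_def by (rule DERIV_cong[OF DERIV_add[OF DERIV_const Gd'[OF that]]]) simp
  have H'm: "H' \<in> borel_measurable mu" using continuous_integrable_mu[OF H'c] by auto
  have pr: "prim h' x = prim H' x" for x
    using k' hi H'm by (intro prim_cong_AE) (auto simp: H'_def)
  have hH: "AE x in mu. h x = H x"
    using k AE_mu_in
  proof eventually_elim
    case (elim x)
    have "G x = G 0 + prim H' x"
      by (rule prim_eqI[OF continuous_integrable_mu[OF H'c] Gc, of "{}"]) (use Gd' elim(2) in auto)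
    then show ?case using elim(1) pr by (simp add: H_def)
  qed
  have wH: "AE x in mu. weak_deriv h x = H' x"
    using weak_deriv_AE(2)[OF h(1)] k' by eventually_elim (simp add: H'_def)
  obtain e where en: "\<And>n. e n \<in> {0<..<\<delta>}" and elim: "filterlim e (at_right 0) sequentially"
    by (rule null_sequence) blast
  have e: "e n \<in> {0..<\<delta>}" "0 < e n" for n using en[of n] by auto
  define u where "u n x = (Q (e n) h x - Q 0 h x - e n * q x) / e n" for n x
  have hL: "h \<in> Lp_space p" by (rule has_weak_deriv_Lp[OF p0 h(1)])
  have uL: "(\<lambda>x. Q (e n) h x - Q 0 h x - e n * q x) \<in> Lp_space p" for n
    by (intro Lp_diff[OF pge1] Lp_cmult[OF p0] q Z.P_Lp(1)[OF hL] cusp_map.P_Lp(1)[OF cm[OF e(1)] hL])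
  have ui: "integrable mu (u n)" for n
    unfolding u_def using Lp_integrable(1)[OF pge1 uL[of n]] by (rule integrable_divide)
  have un: "(LINT x|mu. norm (u n x)) \<le> 2 * (nrm p (\<lambda>x. Q (e n) h x - Q 0 h x - e n * q x) / e n)" for n
  proof -
    have "(LINT x|mu. norm (u n x)) = (LINT x|mu. \<bar>Q (e n) h x - Q 0 h x - e n * q x\<bar>) / e n"
      unfolding u_def using e(2)[of n] by (simp add: abs_divide)
    also have "\<dots> \<le> (2 * nrm p (\<lambda>x. Q (e n) h x - Q 0 h x - e n * q x)) / e n"
      using e(2)[of n] Lp_integrable(2)[OF pge1 uL[of n]] by (intro divide_right_mono) auto
    finally show ?thesis by simp
  qed
  have "(\<lambda>n. 2 * (nrm p (\<lambda>x. Q (e n) h x - Q 0 h x - e n * q x) / e n)) \<longlonglongrightarrow> 2 * 0"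
    using filterlim_compose[OF lim elim] by (intro tendsto_intros)
  then have b: "(\<lambda>n. 2 * (nrm p (\<lambda>x. Q (e n) h x - Q 0 h x - e n * q x) / e n)) \<longlonglongrightarrow> 0" by simp
  have "(\<lambda>n. LINT x|mu. norm (u n x)) \<longlonglongrightarrow> 0"
    by (rule tendsto_sandwich[OF _ _ tendsto_const b]) (use un in auto)
  then obtain r where r: "strict_mono r" "AE x in mu. (\<lambda>n. u (r n) x) \<longlonglongrightarrow> 0"
    using tendsto_L1_AE_subseq[where u = u, OF ui] by blast
  have QH: "AE y in mu. \<forall>n. Q (e n) h y = Q (e n) H y" unfolding AE_all_countable
    using cusp_map.P_cong_AE[OF cm[OF e(1)] hH] by blast
  have R: "AE x in mu. response h (weak_deriv h) x = response H H' x"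
    using hH wH by eventually_elim simp
  show ?thesis
    using r(2) QH Z.P_cong_AE[OF hH] Z.P_cong_AE[OF R] AE_D
  proof eventually_elim
    case (elim y)
    have "((\<lambda>\<epsilon>. (Q \<epsilon> H y - Q 0 H y) / \<epsilon>) \<longlongrightarrow> Q 0 (\<lambda>x. response H H' x) y) (at_right 0)"
      by (rule pointwise_response[OF _ _ Hd]) (use elim(5) in auto)
    then have "(\<lambda>n. (Q (e n) H y - Q 0 H y) / e n) \<longlonglongrightarrow> Q 0 (\<lambda>x. response H H' x) y"
      using \<open>filterlim e _ _\<close> by (rule filterlim_compose)
    from LIMSEQ_subseq_LIMSEQ[OF this r(1)]
    have 1: "(\<lambda>n. (Q (e (r n)) H y - Q 0 H y) / e (r n)) \<longlonglongrightarrow> Q 0 (\<lambda>x. response H H' x) y" by (simp add: o_def)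
    have "u (r n) y + q y = (Q (e (r n)) H y - Q 0 H y) / e (r n)" for n
    proof -
      have "(A - B - t * v) / t + v = (A - B) / t" if "0 < t" for A B t v :: real using that by (simp add: field_simps)
      then show ?thesis unfolding u_def using elim(2,3) e(2)[of "r n"] by simp
    qed
    then have "(\<lambda>n. (Q (e (r n)) H y - Q 0 H y) / e (r n)) \<longlonglongrightarrow> 0 + q y"
      using tendsto_add[OF elim(1) tendsto_const[of "q y"]] by simp
    then have "0 + q y = Q 0 (\<lambda>x. response H H' x) y" using 1 by (rule LIMSEQ_unique)
    then show ?case using elim(4) by simp
  qed
qed

end

subsection \<open>The linear response formula\<close>

lemma has_deriv_on_minus_point:
  fixes f :: "real \<Rightarrow> real"
  assumes "f differentiable_on {0..1} - {c}" "x \<in> {0..1} - {c}"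
  shows "(f has_real_derivative deriv_on ({0..1} - {c}) f x) (at x within {0..1})"
proof -
  have "f differentiable (at x within {0..1} - {c})" using assms by (simp add: differentiable_on_def)
  then have "(f has_real_derivative deriv_on ({0..1} - {c}) f x) (at x within {0..1} - {c})"
    unfolding vector_derivative_works deriv_on_def has_real_derivative_iff_has_vector_derivative .
  moreover have "at x within {0..1} - {c} = at x within {0..1}"
    by (rule at_within_nhd[of _ "- {c}"]) (use assms in auto)
  ultimately show ?thesis by simp
qed

theorem theorem1p1:
  fixes \<delta> p c \<beta> :: real
    and T :: "real \<Rightarrow> real \<Rightarrow> real"
    and a :: "real \<Rightarrow> real"
  assumes delta: "0 < \<delta>"
    and p: "1 < p"
    and c: "c \<in> {0<..<1}"
    and beta: "\<beta> \<in> {-1<..<(1 - 2 * p) / (2 * p)}"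
    and maps: "\<And>\<epsilon>. \<epsilon> \<in> {0..<\<delta>} \<Longrightarrow> T \<epsilon> \<in> {0..1} \<rightarrow> {0..1}"
    and nonsing: "\<And>\<epsilon>. \<epsilon> \<in> {0..<\<delta>} \<Longrightarrow> nonsingular (T \<epsilon>)"
    and deps: "\<And>\<epsilon> x. \<epsilon> \<in> {0..<\<delta>} \<Longrightarrow> x \<in> {0..1} - {c} \<Longrightarrow>
        (\<lambda>e. T e x) differentiable (at \<epsilon> within {0..<\<delta>}) \<and>
        (\<lambda>e. Dx c 1 (T e) x) differentiable (at \<epsilon> within {0..<\<delta>})"
    and A1: "\<And>\<epsilon>. \<epsilon> \<in> {0..<\<delta>} \<Longrightarrow> inj_on (T \<epsilon>) {0..<c} \<and> inj_on (T \<epsilon>) {c<..1}"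
    and A2: "\<And>\<epsilon>. \<epsilon> \<in> {0..<\<delta>} \<Longrightarrow>
        T \<epsilon> 0 = 0 \<and> T \<epsilon> 1 = 0 \<and> (T \<epsilon> \<longlongrightarrow> a \<epsilon>) (at c) \<and> a \<epsilon> \<in> {0..1}"
    and A3: "\<And>\<epsilon>. \<epsilon> \<in> {0..<\<delta>} \<Longrightarrow> Ck_on 3 ({0..1} - {c}) (T \<epsilon>)"
    and A4: "\<exists>\<theta>>1. \<forall>\<epsilon>\<in>{0..<\<delta>}. \<forall>x\<in>{0..1} - {c}. \<theta> \<le> \<bar>Dx c 1 (T \<epsilon>) x\<bar>"
    and A5: "topologically_mixing_on {0..a 0} (T 0)"
    and A6: "\<And>\<epsilon>. \<epsilon> \<in> {0..<\<delta>} \<Longrightarrow>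
        filterlim (Dx c 1 (T \<epsilon>)) at_top (at_left c) \<and>
        filterlim (Dx c 1 (T \<epsilon>)) at_bot (at_right c) \<and>
        (\<exists>C1. ((\<lambda>x. \<bar>Dx c 1 (T \<epsilon>) x\<bar> / \<bar>x - c\<bar> powr \<beta>) \<longlongrightarrow> C1) (at c))"
    and A7: "\<And>\<epsilon>. \<epsilon> \<in> {0..<\<delta>} \<Longrightarrow>
        (\<exists>C2. ((\<lambda>x. \<bar>Dx c 2 (T \<epsilon>) x\<bar> / \<bar>x - c\<bar> powr (\<beta> - 1)) \<longlongrightarrow> C2) (at c)) \<and>
        (\<exists>C3. ((\<lambda>x. \<bar>Dx c 3 (T \<epsilon>) x\<bar> / \<bar>x - c\<bar> powr (\<beta> - 2)) \<longlongrightarrow> C3) (at c))"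
    and A8_sup: "bdd_above
        ((\<lambda>(\<epsilon>, i, x). \<bar>Dx c (i + 1) (T \<epsilon>) x\<bar> / \<bar>x - c\<bar> powr (\<beta> - real i)) `
          ({0..<\<delta>} \<times> {0, 1, 2::nat} \<times> ({0..1} - {c})))"
    and A8_inf: "0 < (INF (\<epsilon>, x) \<in> {0..<\<delta>} \<times> ({0..1} - {c}).
        \<bar>Dx c 1 (T \<epsilon>) x\<bar> / \<bar>x - c\<bar> powr \<beta>)"
    and A9_norm: "((\<lambda>\<epsilon>. SUP f \<in> {f. W1p_norm p f \<le> 1}.
          Lp_norm (2 * p) (\<lambda>x. transfer_op (T 0) f x - transfer_op (T \<epsilon>) f x))
        \<longlongrightarrow> 0) (at_right 0)"
    and A9_deriv: "\<And>f. f \<in> sobolev_space 2 p \<Longrightarrow> \<exists>D \<in> sobolev_space 1 p.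
        ((\<lambda>\<epsilon>. W1p_norm p (\<lambda>x. transfer_op (T \<epsilon>) f x - transfer_op (T 0) f x - \<epsilon> * D x)
               / ennreal \<epsilon>) \<longlongrightarrow> 0) (at_right 0)"
  shows "\<exists>\<delta>\<^sub>2 h.
      0 < \<delta>\<^sub>2 \<and> \<delta>\<^sub>2 \<le> \<delta> \<and>
      (\<forall>\<epsilon>\<in>{0..<\<delta>\<^sub>2}. h \<epsilon> \<in> sobolev_space 2 p \<and> invariant_density (T \<epsilon>) (h \<epsilon>) \<and>
         (\<forall>g. invariant_density (T \<epsilon>) g \<longrightarrow> (AE x in mu. g x = h \<epsilon> x))) \<and>
      (\<exists>D \<in> Lp_space p.
         ((\<lambda>\<epsilon>. Lp_norm p (\<lambda>x. h \<epsilon> x - h 0 x - \<epsilon> * D x) / ennreal \<epsilon>) \<longlongrightarrow> 0) (at_right 0)) \<and>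
      I_minus_P_bij p (T 0) \<and>
      q_fun \<delta> c T (a 0) (h 0) \<in> W1p_mean_zero p \<and>
      ((\<lambda>\<epsilon>. Lp_norm p (\<lambda>x. h \<epsilon> x -
                (h 0 x + \<epsilon> * I_minus_P_inv p (T 0) (q_fun \<delta> c T (a 0) (h 0)) x))
             / ennreal \<epsilon>) \<longlongrightarrow> 0) (at_right 0)"
proof -
  obtain \<theta> where \<theta>: "1 < \<theta>" "\<And>\<epsilon> x. \<epsilon> \<in> {0..<\<delta>} \<Longrightarrow> x \<in> {0..1} - {c} \<Longrightarrow> \<theta> \<le> \<bar>Dx c 1 (T \<epsilon>) x\<bar>"
    using A4 by blast
  define m where "m = (INF (\<epsilon>, x) \<in> {0..<\<delta>} \<times> ({0..1} - {c}). \<bar>Dx c 1 (T \<epsilon>) x\<bar> / \<bar>x - c\<bar> powr \<beta>)"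
  have m: "0 < m" using A8_inf by (simp add: m_def)
  have low: "m * \<bar>x - c\<bar> powr \<beta> \<le> \<bar>Dx c 1 (T \<epsilon>) x\<bar>" if "\<epsilon> \<in> {0..<\<delta>}" "x \<in> {0..1} - {c}" for \<epsilon> x
  proof -
    have "m \<le> (\<lambda>(\<epsilon>, x). \<bar>Dx c 1 (T \<epsilon>) x\<bar> / \<bar>x - c\<bar> powr \<beta>) (\<epsilon>, x)"
      unfolding m_def by (rule cINF_lower) (use that in \<open>auto intro!: bdd_belowI[of _ 0]\<close>)
    then show ?thesis using that by (simp add: pos_le_divide_eq)
  qed
  obtain B where B: "\<And>v. v \<in> (\<lambda>(\<epsilon>, i, x). \<bar>Dx c (i + 1) (T \<epsilon>) x\<bar> / \<bar>x - c\<bar> powr (\<beta> - real i)) `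
          ({0..<\<delta>} \<times> {0, 1, 2::nat} \<times> ({0..1} - {c})) \<Longrightarrow> v \<le> B"
    using A8_sup unfolding bdd_above_def by blast
  \<comment> \<open>\<open>B\<close> is just some upper bound; the 1 secures positivity.\<close>
  define M where "M = max B 1"
  have M: "0 < M" by (simp add: M_def)
  have up: "\<bar>Dx c (i + 1) (T \<epsilon>) x\<bar> \<le> M * \<bar>x - c\<bar> powr (\<beta> - real i)"
    if "\<epsilon> \<in> {0..<\<delta>}" "x \<in> {0..1} - {c}" "i \<in> {0, 1, 2}" for \<epsilon> x i
  proof -
    have "(\<lambda>(\<epsilon>, i, x). \<bar>Dx c (i + 1) (T \<epsilon>) x\<bar> / \<bar>x - c\<bar> powr (\<beta> - real i)) (\<epsilon>, i, x) \<le> B"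
      by (rule B, rule imageI) (use that in blast)
    then have "\<bar>Dx c (i + 1) (T \<epsilon>) x\<bar> / \<bar>x - c\<bar> powr (\<beta> - real i) \<le> M" by (simp add: M_def)
    moreover have "0 < \<bar>x - c\<bar> powr (\<beta> - real i)" using that by simp
    ultimately show ?thesis by (simp only: pos_divide_le_eq)
  qed
  have params: "cusp_params c \<beta> p \<theta> m M"
    by unfold_locales (use c beta p \<theta>(1) m M in auto)
  then interpret cusp_params c \<beta> p \<theta> m M .
  have cm: "cusp_map c \<beta> p \<theta> m M (T \<epsilon>) (Dx c 1 (T \<epsilon>)) (Dx c 2 (T \<epsilon>)) (Dx c 3 (T \<epsilon>)) (a \<epsilon>)"
    if \<epsilon>: "\<epsilon> \<in> {0..<\<delta>}" for \<epsilon>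
  proof (intro cusp_map.intro[OF params] cusp_map_axioms.intro)
    have diff: "Dx c i (T \<epsilon>) differentiable_on {0..1} - {c}" if "i < 3" for i
      using A3[OF \<epsilon>] that unfolding Ck_on_def by blast
    have der: "(Dx c i (T \<epsilon>) has_real_derivative Dx c (Suc i) (T \<epsilon>) x) (at x within {0..1})" if "i < 3" "x \<in> D" for i x
      using has_deriv_on_minus_point[OF diff[OF that(1)], of x] that(2) by (simp add: D_def)
    fix x assume x: "x \<in> D"
    show "(T \<epsilon> has_real_derivative Dx c 1 (T \<epsilon>) x) (at x within {0..1})" using der[of 0 x] x by simp
    show "(Dx c 1 (T \<epsilon>) has_real_derivative Dx c 2 (T \<epsilon>) x) (at x within {0..1})"
      using der[of 1 x] x by (simp only: numeral_2_eq_2 One_nat_def)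
    show "(Dx c 2 (T \<epsilon>) has_real_derivative Dx c 3 (T \<epsilon>) x) (at x within {0..1})"
      using der[of 2 x] x by (simp only: numeral_2_eq_2 numeral_3_eq_3)
    have xD: "x \<in> {0..1} - {c}" using x by (simp add: D_def)
    show "\<theta> \<le> \<bar>Dx c 1 (T \<epsilon>) x\<bar>" by (rule \<theta>(2)[OF \<epsilon> xD])
    show "m * \<bar>x - c\<bar> powr \<beta> \<le> \<bar>Dx c 1 (T \<epsilon>) x\<bar>" by (rule low[OF \<epsilon> xD])
    show "\<bar>Dx c 1 (T \<epsilon>) x\<bar> \<le> M * \<bar>x - c\<bar> powr \<beta>" using up[OF \<epsilon> xD, of 0] by simp
    show "\<bar>Dx c 2 (T \<epsilon>) x\<bar> \<le> M * \<bar>x - c\<bar> powr (\<beta> - 1)"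
      using up[OF \<epsilon> xD, of 1] by (simp only: one_add_one of_nat_1 insert_iff simp_thms)
    show "\<bar>Dx c 3 (T \<epsilon>) x\<bar> \<le> M * \<bar>x - c\<bar> powr (\<beta> - 2)"
    proof -
      have "2 + 1 = (3::nat)" "real 2 = 2" by simp_all
      then show ?thesis using up[OF \<epsilon> xD, of 2] by (simp only: insert_iff simp_thms)
    qed
  next
    show "continuous_on D (Dx c 3 (T \<epsilon>))" using A3[OF \<epsilon>] by (simp add: Ck_on_def D_def)
  qed (use maps nonsing A1 A2 \<epsilon> in auto)
  have zero: "0 \<in> {0..<\<delta>}" using delta by simp
  have a0: "a 0 = 1"
    using cusp_map.mixing_imp_full[OF cm[OF zero] A5] A2[OF zero] by blast
  define S where "S = D_eps \<delta> T 0"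
  define S1 where "S1 = D_eps \<delta> (\<lambda>e. Dx c 1 (T e)) 0"
  \<comment> \<open>At \<epsilon> = 0 the derivative within [0, \<delta>) is the right derivative,
    so \<open>D_eps\<close> provides \<open>S\<close> and \<open>S1\<close>.\<close>
  have "at 0 within {0..<\<delta>} = at_right 0"
    by (rule at_within_nhd[of _ "{..<\<delta>}"]) (use delta in auto)
  then have dS: "((\<lambda>e. T e x) has_real_derivative S x) (at_right 0)"
    "((\<lambda>e. Dx c 1 (T e) x) has_real_derivative S1 x) (at_right 0)" if "x \<in> D" for x
    using deps[OF zero, of x] that
    unfolding S_def S1_def D_eps_def vector_derivative_works has_real_derivative_iff_has_vector_derivative
    by (simp_all add: D_def)
  interpret cusp_family_deriv c \<beta> p \<theta> m M \<delta> T "\<lambda>e. Dx c 1 (T e)" "\<lambda>e. Dx c 2 (T e)" "\<lambda>e. Dx c 3 (T e)" a S S1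
    by (intro cusp_family_deriv.intro cusp_family.intro cusp_family_axioms.intro cusp_family_deriv_axioms.intro
        params delta cm a0 A9_norm A9_deriv dS)
  obtain \<delta>2 C r where d2: "0 < \<delta>2" "\<delta>2 \<le> \<delta>"
    and gap: "\<And>\<epsilon>. \<epsilon> \<in> {0..<\<delta>2} \<Longrightarrow> cusp_map.gap c \<beta> p \<theta> m M (T \<epsilon>) (Dx c 1 (T \<epsilon>)) (Dx c 2 (T \<epsilon>)) C r"
  proof (rule uniform_gap)
    fix \<delta>2 C r
    assume *: "0 < \<delta>2" "\<delta>2 \<le> \<delta>"
      "\<And>\<epsilon>. \<epsilon> \<in> {0..<\<delta>2} \<Longrightarrow> cusp_map.gap c \<beta> p \<theta> m M (T \<epsilon>) (Dx c 1 (T \<epsilon>)) (Dx c 2 (T \<epsilon>)) C r"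
    show thesis by (rule that[OF *])
  qed
  have g0: "Z.gap C r" using gap[of 0] d2 by simp
  define h where "h \<epsilon> = cusp_map.hinv c (T \<epsilon>) (Dx c 1 (T \<epsilon>))" for \<epsilon>
  obtain q q' where q: "has_weak_deriv q q'" "q' \<in> Lp_space p" "(LINT x|mu. q x) = 0"
    "((\<lambda>\<epsilon>. nrm p (\<lambda>x. Q \<epsilon> (h 0) x - Q 0 (h 0) x - \<epsilon> * q x) / \<epsilon>) \<longlongrightarrow> 0) (at_right 0)"
    "\<And>u. u \<in> borel_measurable mu \<Longrightarrow> AE x in mu. u x = Z.Res q x \<Longrightarrow>
      ((\<lambda>\<epsilon>. Lp_norm p (\<lambda>x. h \<epsilon> x - h 0 x - \<epsilon> * u x) / ennreal \<epsilon>) \<longlongrightarrow> 0) (at_right 0)"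
  proof (rule expansion[OF d2 gap])
    fix q q'
    assume *: "has_weak_deriv q q'" "q' \<in> Lp_space p" "(LINT x|mu. q x) = 0"
      "((\<lambda>\<epsilon>. nrm p (\<lambda>x. Q \<epsilon> Z.hinv x - Q 0 Z.hinv x - \<epsilon> * q x) / \<epsilon>) \<longlongrightarrow> 0) (at_right 0)"
      "\<And>u. u \<in> borel_measurable mu \<Longrightarrow> AE x in mu. u x = Z.Res q x \<Longrightarrow>
        ((\<lambda>\<epsilon>. Lp_norm p (\<lambda>x. cusp_map.hinv c (T \<epsilon>) (Dx c 1 (T \<epsilon>)) x - Z.hinv x - \<epsilon> * u x) / ennreal \<epsilon>) \<longlongrightarrow> 0) (at_right 0)"
    show thesis by (rule that[unfolded h_def, OF *])
  qed
  have qL: "q \<in> Lp_space p" by (rule has_weak_deriv_Lp[OF p0 q(1)])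
  obtain h' h'' where h': "has_weak_deriv (h 0) h'" "has_weak_deriv h' h''"
    unfolding h_def by (rule Z.hinv_W2[OF g0])
  let ?F = "\<lambda>y. A_coeff \<delta> c T 0 y * weak_deriv (h 0) y + B_coeff \<delta> c T 0 y * h 0 y"
  let ?q = "q_fun \<delta> c T (a 0) (h 0)"
  have F: "?F = (\<lambda>x. response (h 0) (weak_deriv (h 0)) x)"
    unfolding A_coeff_def B_coeff_def S_def S1_def ..
  have Fm: "?F \<in> borel_measurable mu"
    unfolding F using h'(1) weak_deriv_AE(1)[OF h'(1)] by (intro response_measurable) (auto simp: has_weak_deriv_def)
  note tF = Z.transfer_op_P[OF Fm]
  \<comment> \<open>As a 0 = 1, the zero clause of \<open>q_fun\<close> affects only the point 1 of
    the interval; elsewhere \<open>transfer_op\<close> agrees almost everywhere with the sum over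
    preimages.\<close>
  have qq: "AE x in mu. ?q x = q x"
    using response_AE[OF h' qL q(4)] tF(1) AE_D
  proof eventually_elim
    case (elim x)
    then have "x \<in> {0..<a 0}" by (simp add: a0)
    then have "?q x = transfer_op (T 0) ?F x" unfolding q_fun_def by (rule if_P)
    also have "\<dots> = Q 0 ?F x" by (rule elim(2))
    also have "\<dots> = q x" unfolding F using elim(1) by simp
    finally show ?case .
  qed
  have qm: "?q \<in> borel_measurable mu"
  proof -
    have "(\<lambda>x. if x = 1 then 0 else 1 :: real) \<in> borel_measurable mu" by (intro borel_measurable_mu) measurable
    then have "(\<lambda>x. (if x = 1 then 0 else 1) * transfer_op (T 0) ?F x) \<in> borel_measurable mu"
      using tF(2) by (rule borel_measurable_times)
    then show ?thesis
      by (rule measurable_cong[THEN iffD1, rotated]) (auto simp: q_fun_def a0)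
  qed
  have qS: "?q \<in> W1p_mean_zero p"
    unfolding W1p_mean_zero_def
  proof (intro CollectI conjI)
    show "?q \<in> sobolev_space 1 p" by (rule sobolev1_cong[OF p0 sobolev1_I[OF p0 q(1,2)] qq qm])
    show "(LINT x|mu. ?q x) = 0"
      using integral_cong_AE[OF qm Lp_meas[OF qL] qq] q(3) by simp
  qed
  note inv = Z.I_minus_P_inv_Res[OF g0 q(1-3) qq]
  have RL: "Z.Res q \<in> Lp_space p" by (rule has_weak_deriv_Lp[OF p0 Z.Res_props(1)[OF g0 q(1-3)]])
  show ?thesis
  proof (intro exI[of _ \<delta>2] exI[of _ h] conjI ballI allI impI)
    show "0 < \<delta>2" "\<delta>2 \<le> \<delta>" by (rule d2)+
    fix \<epsilon> assume \<epsilon>: "\<epsilon> \<in> {0..<\<delta>2}"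
    then have e: "\<epsilon> \<in> {0..<\<delta>}" using d2 by auto
    show "h \<epsilon> \<in> sobolev_space 2 p" unfolding h_def by (rule cusp_map.hinv_sobolev[OF cm[OF e] gap[OF \<epsilon>]])
    show "invariant_density (T \<epsilon>) (h \<epsilon>)" unfolding h_def by (rule cusp_map.hinv_density(1)[OF cm[OF e] gap[OF \<epsilon>]])
    show "AE x in mu. g x = h \<epsilon> x" if "invariant_density (T \<epsilon>) g" for g
      unfolding h_def by (rule cusp_map.hinv_density(2)[OF cm[OF e] gap[OF \<epsilon>] that])
  next
    show "\<exists>D \<in> Lp_space p. ((\<lambda>\<epsilon>. Lp_norm p (\<lambda>x. h \<epsilon> x - h 0 x - \<epsilon> * D x) / ennreal \<epsilon>) \<longlongrightarrow> 0) (at_right 0)"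
      by (rule bexI[OF q(5) RL]) (use Lp_meas[OF RL] in auto)
    show "I_minus_P_bij p (T 0)" by (rule Z.I_minus_P_bijective[OF g0])
    show "?q \<in> W1p_mean_zero p" by (rule qS)
    show "((\<lambda>\<epsilon>. Lp_norm p (\<lambda>x. h \<epsilon> x - (h 0 x + \<epsilon> * I_minus_P_inv p (T 0) ?q x)) / ennreal \<epsilon>) \<longlongrightarrow> 0) (at_right 0)"
      using q(5)[OF inv(2,1)] by (simp only: diff_diff_eq)
  qed
qed

end
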